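(* Let $\mathbb{I}\subset\mathbb{CP}^2$ be a conic that is either regular or a union of two distinct lines. Let $\gamma\subset\mathbb{CP}^2$ be an irreducible complex algebraic curve different from a line and from $\mathbb{I}$. Suppose that all the singularities and inflection points (if any) of $\gamma$ lie in $\mathbb{I}$. Suppose that for every $C\in\gamma\cap\mathbb{I}$ the local branches $b$ of $\gamma$ at $C$ satisfy the following: Case 1): $C$ is a regular point of the conic $\mathbb{I}$. If $b$ is tangent to $\mathbb{I}$, then $b$ is quadratic: $p=2q$. If $b$ is transversal to $\mathbb{I}$, then $b$ is regular and quadratic: $q=1$, $p=2$. Case 2): $\mathbb{I}$ is a union of two distinct lines intersecting at $C$. If $b$ is transversal to both lines, then $b$ is subquadratic: $p\le 2q$. Then $\gamma$ is a conic.
   Context: A local branch of $\gamma$ at $C$ is an irreducible component of the germ $(\gamma,C)$. For a (non-linear) local branch $b$ at $C$, let $(z,w)$ be affine coordinates centered at $C$ such that the $z$-axis is tangent to $b$ (adapted coordinates). Then $b$ is holomorphically and bijectively parametrized by a small complex parameter $t$ as $t\mapsto(t^q,ct^p(1+o(1)))$ as $t\to0$, with $q,p\in\mathbb{N}$, $1\le q<p$, $c\ne0$; these are the exponents $p=p_b$, $q=q_b$ in the statement. The branch is regular iff $q=1$, quadratic iff $p=2q$, subquadratic iff $p\le2q$. *)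

theory Defs
  imports
    "HOL-Complex_Analysis.Complex_Analysis"
    "HOL-Computational_Algebra.Computational_Algebra"
    "HOL-Library.Landau_Symbols"
begin

section \<open>The complex projective plane\<close>

definition proportional :: "complex^3 \<Rightarrow> complex^3 \<Rightarrow> bool" where
  "proportional v w \<longleftrightarrow> v \<noteq> 0 \<and> w \<noteq> 0 \<and> (\<exists>c. w = c *s v)"

quotient_type cp2 = "complex^3" / partial: proportional
  morphisms hom_coords pt
proof (rule part_equivpI)
  have "proportional (1 :: complex^3) 1"
    unfolding proportional_def by (auto intro: exI[of _ 1])
  then show "\<exists>v. proportional v v" ..
  show "symp proportional"
  proof (rule sympI)
    fix v w :: "complex^3"
    assume *: "proportional v w"
    then obtain c where c: "w = c *s v" and nz: "v \<noteq> 0" "w \<noteq> 0"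
      by (auto simp: proportional_def)
    then have "c \<noteq> 0" by auto
    then have "v = inverse c *s w" by (simp add: c vector_smult_assoc)
    with nz show "proportional w v" unfolding proportional_def by blast
  qed
  show "transp proportional"
    by (rule transpI) (auto simp: proportional_def vector_smult_assoc)
qed

text \<open>The quotient topology. Only nonzero vectors represent points; \<open>pt 0\<close> is unspecified.\<close>

instantiation cp2 :: topological_space
begin

definition open_cp2 :: "cp2 set \<Rightarrow> bool" where
  "open_cp2 U \<longleftrightarrow> open {v. v \<noteq> 0 \<and> pt v \<in> U}"

instance
proof
  have "{v :: complex^3. v \<noteq> 0 \<and> pt v \<in> UNIV} = - {0}" by auto
  then show "open (UNIV :: cp2 set)"
    unfolding open_cp2_def by (simp add: open_Compl)
next
  fix S T :: "cp2 set"
  assume "open S" "open T"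
  moreover have "{v. v \<noteq> 0 \<and> pt v \<in> S \<inter> T} =
      {v. v \<noteq> 0 \<and> pt v \<in> S} \<inter> {v. v \<noteq> 0 \<and> pt v \<in> T}" by auto
  ultimately show "open (S \<inter> T)"
    unfolding open_cp2_def by (simp only: open_Int)
next
  fix K :: "cp2 set set"
  assume "\<forall>S\<in>K. open S"
  moreover have "{v. v \<noteq> 0 \<and> pt v \<in> \<Union>K} = (\<Union>S\<in>K. {v. v \<noteq> 0 \<and> pt v \<in> S})" by auto
  ultimately show "open (\<Union>K)"
    unfolding open_cp2_def by (simp only: open_UN)
qed

end


section \<open>Algebraic curves\<close>

text \<open>
  A polynomial in three variables is an element of \<open>\<complex>[x][y][z]\<close>, so the innermost
  coefficients belong to the first variable.
\<close>

type_synonym poly3 = "complex poly poly poly"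

definition eval3 :: "poly3 \<Rightarrow> complex^3 \<Rightarrow> complex" where
  "eval3 F v = poly (poly (poly F [:[:v $ 3:]:]) [:v $ 2:]) (v $ 1)"

definition homogeneous :: "nat \<Rightarrow> poly3 \<Rightarrow> bool" where
  "homogeneous d F \<longleftrightarrow>
     (\<forall>i j k. coeff (coeff (coeff F k) j) i \<noteq> 0 \<longrightarrow> i + j + k = d)"

definition zero_locus :: "poly3 \<Rightarrow> cp2 set" where
  "zero_locus F = {pt v | v. v \<noteq> 0 \<and> eval3 F v = 0}"

text \<open>
  A curve is a point set; its reduced (squarefree) equation is unique up to a constant factor,
  and its degree, singular points and tangent lines are read off that equation.
\<close>

definition curve_equation :: "cp2 set \<Rightarrow> poly3 \<Rightarrow> bool" where
  "curve_equation K F \<longleftrightarrow>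
     (\<exists>d. homogeneous d F) \<and> squarefree F \<and> \<not> is_unit F \<and> K = zero_locus F"

definition irreducible_curve :: "cp2 set \<Rightarrow> bool" where
  "irreducible_curve K \<longleftrightarrow> (\<exists>F. curve_equation K F \<and> irreducible F)"

definition projective_line :: "cp2 set \<Rightarrow> bool" where
  "projective_line K \<longleftrightarrow> (\<exists>F. curve_equation K F \<and> homogeneous 1 F)"

definition conic_curve :: "cp2 set \<Rightarrow> bool" where
  "conic_curve K \<longleftrightarrow> (\<exists>F. curve_equation K F \<and> homogeneous 2 F)"

definition singular_point :: "cp2 set \<Rightarrow> cp2 \<Rightarrow> bool" where
  "singular_point K C \<longleftrightarrow>
     (\<exists>F v. curve_equation K F \<and> v \<noteq> 0 \<and> C = pt v \<and> eval3 F v = 0 \<and>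
        (eval3 F has_derivative (\<lambda>_. 0)) (at v))"

definition regular_point :: "cp2 set \<Rightarrow> cp2 \<Rightarrow> bool" where
  "regular_point K C \<longleftrightarrow> C \<in> K \<and> \<not> singular_point K C"

definition regular_conic :: "cp2 set \<Rightarrow> bool" where
  "regular_conic K \<longleftrightarrow> conic_curve K \<and> (\<forall>C\<in>K. regular_point K C)"

definition curve_tangent :: "cp2 set \<Rightarrow> cp2 \<Rightarrow> cp2 set \<Rightarrow> bool" where
  "curve_tangent K C L \<longleftrightarrow>
     (\<exists>F v D. curve_equation K F \<and> v \<noteq> 0 \<and> C = pt v \<and> eval3 F v = 0 \<and>
        (eval3 F has_derivative D) (at v) \<and> D \<noteq> (\<lambda>_. 0) \<and>
        L = {pt u | u. u \<noteq> 0 \<and> D u = 0})"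

text \<open>
  An inflection point is a regular point at which the tangent line meets the curve with
  multiplicity at least 3; the tangent line is parametrized by \<open>t \<mapsto> v + t u\<close>.
\<close>

definition inflection_point :: "cp2 set \<Rightarrow> cp2 \<Rightarrow> bool" where
  "inflection_point K C \<longleftrightarrow>
     (\<exists>F L v u. curve_equation K F \<and> curve_tangent K C L \<and>
        v \<noteq> 0 \<and> C = pt v \<and> u \<noteq> 0 \<and> pt u \<in> L \<and> pt u \<noteq> C \<and>
        (\<lambda>t. eval3 F (v + t *s u)) \<in> O[at 0](\<lambda>t. t ^ 3))"


section \<open>Germs of analytic sets and local branches\<close>

text \<open>
  A function on an open subset of the plane is holomorphic iff its pullback to the cone of
  nonzero vectors is complex differentiable.
\<close>

definition holomorphic_cp2 :: "(cp2 \<Rightarrow> complex) \<Rightarrow> cp2 set \<Rightarrow> bool" where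
  "holomorphic_cp2 f U \<longleftrightarrow>
     (\<forall>v. v \<noteq> 0 \<and> pt v \<in> U \<longrightarrow>
        (\<exists>D. ((\<lambda>x. f (pt x)) has_derivative D) (at v) \<and> (\<forall>c x. D (c *s x) = c * D x)))"

text \<open>Germs at \<open>C\<close> are represented by sets, compared on a small neighbourhood of \<open>C\<close>.\<close>

definition germ_le :: "cp2 \<Rightarrow> cp2 set \<Rightarrow> cp2 set \<Rightarrow> bool" where
  "germ_le C A B \<longleftrightarrow> (\<forall>\<^sub>F X in nhds C. X \<in> A \<longrightarrow> X \<in> B)"

definition germ_eq :: "cp2 \<Rightarrow> cp2 set \<Rightarrow> cp2 set \<Rightarrow> bool" where
  "germ_eq C A B \<longleftrightarrow> (\<forall>\<^sub>F X in nhds C. X \<in> A \<longleftrightarrow> X \<in> B)"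

definition analytic_germ :: "cp2 \<Rightarrow> cp2 set \<Rightarrow> bool" where
  "analytic_germ C A \<longleftrightarrow>
     (\<exists>U fs. open U \<and> C \<in> U \<and> finite fs \<and> (\<forall>f\<in>fs. holomorphic_cp2 f U) \<and>
        A \<inter> U = {X \<in> U. \<forall>f\<in>fs. f X = 0})"

definition irreducible_germ :: "cp2 \<Rightarrow> cp2 set \<Rightarrow> bool" where
  "irreducible_germ C A \<longleftrightarrow> analytic_germ C A \<and> C \<in> A \<and>
     (\<forall>A1 A2. analytic_germ C A1 \<and> analytic_germ C A2 \<and> germ_eq C A (A1 \<union> A2) \<longrightarrow>
        germ_eq C A A1 \<or> germ_eq C A A2)"

text \<open>Irreducible components of a germ are its maximal irreducible analytic subgerms.\<close>

definition local_branch :: "cp2 set \<Rightarrow> cp2 \<Rightarrow> cp2 set \<Rightarrow> bool" where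
  "local_branch K C b \<longleftrightarrow> irreducible_germ C b \<and> germ_le C b K \<and>
     (\<forall>b'. irreducible_germ C b' \<and> germ_le C b b' \<and> germ_le C b' K \<longrightarrow> germ_eq C b' b)"

text \<open>
  The affine coordinate systems on the plane correspond to invertible matrices: the point with
  affine coordinates \<open>(z, w)\<close> has homogeneous coordinates \<open>M (1, z, w)\<close>.
\<close>

definition affine_pt :: "complex^3^3 \<Rightarrow> complex \<Rightarrow> complex \<Rightarrow> cp2" where
  "affine_pt M z w = pt (M *v vector [1, z, w])"

definition centered_coords :: "cp2 \<Rightarrow> complex^3^3 \<Rightarrow> bool" where
  "centered_coords C M \<longleftrightarrow> invertible M \<and> affine_pt M 0 0 = C"

text \<open>The \<open>z\<close>-axis is tangent to \<open>b\<close> iff \<open>w = o(z)\<close> along \<open>b\<close>.\<close>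

definition adapted_coords :: "cp2 \<Rightarrow> cp2 set \<Rightarrow> complex^3^3 \<Rightarrow> bool" where
  "adapted_coords C b M \<longleftrightarrow> centered_coords C M \<and>
     snd \<in> o[at (0, 0) within {(z, w). affine_pt M z w \<in> b}](fst)"

definition branch_tangent :: "cp2 \<Rightarrow> cp2 set \<Rightarrow> cp2 set \<Rightarrow> bool" where
  "branch_tangent C b L \<longleftrightarrow>
     projective_line L \<and> (\<exists>M. adapted_coords C b M \<and> (\<forall>z. affine_pt M z 0 \<in> L))"

definition tangent_to :: "cp2 \<Rightarrow> cp2 set \<Rightarrow> cp2 set \<Rightarrow> bool" where
  "tangent_to C b K \<longleftrightarrow> (\<exists>L. curve_tangent K C L \<and> branch_tangent C b L)"

definition transversal_to :: "cp2 \<Rightarrow> cp2 set \<Rightarrow> cp2 set \<Rightarrow> bool" where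
  "transversal_to C b K \<longleftrightarrow>
     (\<exists>L L'. curve_tangent K C L \<and> branch_tangent C b L' \<and> L \<noteq> L')"

text \<open>
  \<open>q\<close> and \<open>p\<close> are the exponents of \<open>b\<close>: in adapted coordinates, \<open>b\<close> is bijectively
  parametrized by \<open>t \<mapsto> (t^q, c t^p (1 + o(1)))\<close>.
\<close>

definition branch_exponents :: "cp2 \<Rightarrow> cp2 set \<Rightarrow> nat \<Rightarrow> nat \<Rightarrow> bool" where
  "branch_exponents C b q p \<longleftrightarrow> 1 \<le> q \<and> q < p \<and>
     (\<exists>M r g c. adapted_coords C b M \<and> 0 < r \<and> g holomorphic_on ball 0 r \<and>
        c \<noteq> 0 \<and> ((\<lambda>t. g t / t ^ p) \<longlongrightarrow> c) (at 0) \<and> g 0 = 0 \<and>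
        inj_on (\<lambda>t. (t ^ q, g t)) (ball 0 r) \<and>
        germ_eq C b ((\<lambda>t. affine_pt M (t ^ q) (g t)) ` ball 0 r))"

definition regular_branch :: "cp2 \<Rightarrow> cp2 set \<Rightarrow> bool" where
  "regular_branch C b \<longleftrightarrow> (\<exists>q p. branch_exponents C b q p \<and> q = 1)"

definition quadratic_branch :: "cp2 \<Rightarrow> cp2 set \<Rightarrow> bool" where
  "quadratic_branch C b \<longleftrightarrow> (\<exists>q p. branch_exponents C b q p \<and> p = 2 * q)"

definition subquadratic_branch :: "cp2 \<Rightarrow> cp2 set \<Rightarrow> bool" where
  "subquadratic_branch C b \<longleftrightarrow> (\<exists>q p. branch_exponents C b q p \<and> p \<le> 2 * q)"

end

theory Submission
  imports Defs "HOL-Computational_Algebra.Field_as_Ring"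
begin

text \<open>
  Let \<open>B\<close> be the bilinear form of the conic and lift the curve to a holomorphic curve \<open>\<phi>\<close> in
  \<open>\<complex>\<^sup>3\<close>. Rescaling \<open>\<phi>\<close> and changing the parameter so that \<open>det (\<phi>, \<phi>', \<phi>'')\<close> becomes constant and
  dividing out the remaining freedom, the fourth-order jet of \<open>\<phi>\<close> and \<open>B\<close> produce a function \<open>hval\<close>
  which depends only on the point of the curve. It is holomorphic at smooth points that are not
  inflection points, and the conditions on the exponents of the branches are exactly what keeps it
  bounded near the conic. Projecting to a line, the product over the sheets of \<open>hval - c\<close> is then a
  bounded entire function, hence constant, and a suitable \<open>c\<close> makes it vanish. So \<open>hval\<close> is constant on
  some sheet; this differential equation forces the sheet to satisfy a quadratic equation, and an
  irreducible equation of the curve divides that quadratic form.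
\<close>

text \<open>For a lift \<phi> with constant Wronskian, \<phi>''' = \<alpha> \<phi> + \<beta>
  \<phi>', and \<open>zjet\<close> is \<beta> B(\<phi>,\<phi>) + B(\<phi>',\<phi>') - 2
  B(\<phi>,\<phi>''), with derivative (\<beta>' - 2 \<alpha>) B(\<phi>,\<phi>). The factor \<beta>'
  - 2 \<alpha> is the classical projective invariant whose vanishing characterizes conics; in an
  affine chart this is Monge's equation (Y''^(-2/3))''' = 0. One count explains the exponents: on a
  branch t^3 times the Wronskian has order p + q, and \<open>hval\<close> is bounded if t^2 times
  \<open>zjet\<close> has order at least k with 3 k \<ge> 2 (p + q). Tangency with p = 2 q, or a
  node with p \<le> 2 q, gives k = 2 q; a branch at the node tangent to one of the lines gives k = p
  + q; a transversal regular quadratic branch has nonzero Wronskian. The hypotheses speak of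
  irreducible components of germs, so Puiseux parametrizations are constructed and their images
  shown to be such components. Monodromy permutes the sheets, hence the product over all of them;
  one constant sheet suffices, which avoids any appeal to connectedness of the curve.\<close>

no_notation fps_nth (infixl "$" 75)

subsection \<open>Polynomials in three variables\<close>

lemma vec3_eq_iff: "v = w \<longleftrightarrow> v $ 1 = w $ 1 \<and> v $ 2 = w $ 2 \<and> v $ 3 = w $ 3" for v w :: "'a^3"
  unfolding vec_eq_iff forall_3 ..

lemma poly_map_poly_0: "poly (map_poly f p) x = (\<Sum>i\<le>degree p. f (coeff p i) * x ^ i)"
  if "f 0 = 0" for f :: "'a::comm_semiring_1 \<Rightarrow> 'b::comm_semiring_1"
proof -
  have "poly (map_poly f p) x = (\<Sum>i\<le>degree p. coeff (map_poly f p) i * x ^ i)"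
  proof -
    have "degree (map_poly f p) \<le> degree p"
      by (rule degree_le) (simp add: coeff_map_poly that coeff_eq_0)
    then show ?thesis
      unfolding poly_altdef
      by (intro sum.mono_neutral_left) (auto simp: coeff_eq_0)
  qed
  then show ?thesis by (simp add: coeff_map_poly that)
qed

lemma map_poly_eq_0D:
  assumes "map_poly f p = 0" "f 0 = 0"
  shows "f (coeff p k) = 0"
  using coeff_map_poly[of f p k] assms by simp

lemma eval3_simps [simp]:
  "eval3 0 v = 0" "eval3 1 v = 1"
  "eval3 (F + G) v = eval3 F v + eval3 G v"
  "eval3 (F - G) v = eval3 F v - eval3 G v"
  "eval3 (- F) v = - eval3 F v"
  "eval3 (F * G) v = eval3 F v * eval3 G v"
  "eval3 (F ^ n) v = eval3 F v ^ n"
  "eval3 (sum f A) v = (\<Sum>x\<in>A. eval3 (f x) v)"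
  by (simp_all add: eval3_def poly_sum)

lemma poly_eq_0_if_infinite_roots:
  fixes p :: "'a::idom poly"
  assumes "infinite {x. poly p x = 0}"
  shows "p = 0"
  using assms poly_roots_finite by blast

text \<open>The resultant trick without resultants: a nonzero element of least degree in the ideal
  \<open>(F, G)\<close> must be constant, by pseudo-division.\<close>

lemma irreducible_ideal_const:
  fixes F G :: "'a::{factorial_ring_gcd,semiring_gcd_mult_normalize} poly"
  assumes F: "irreducible F" and ndvd: "\<not> F dvd G"
  obtains a b r where "a * F + b * G = [:r:]" "r \<noteq> 0"
proof -
  define I where "I = {a * F + b * G | a b. True}"
  have FI: "F \<in> I" unfolding I_def by (intro CollectI exI[of _ 1] exI[of _ 0]) simp
  have GI: "G \<in> I" unfolding I_def by (intro CollectI exI[of _ 0] exI[of _ 1]) simp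
  have diff: "c * x - q * y \<in> I" if xI: "x \<in> I" and yI: "y \<in> I" for x y c q
  proof -
    from xI yI obtain a b a' b' where "x = a * F + b * G" "y = a' * F + b' * G"
      unfolding I_def by blast
    then have "c * x - q * y = (c * a - q * a') * F + (c * b - q * b') * G"
      by (simp add: algebra_simps)
    then show ?thesis unfolding I_def by blast
  qed
  have F0: "F \<noteq> 0" using F by auto
  define m where "m = arg_min degree (\<lambda>x. x \<in> I \<and> x \<noteq> 0)"
  have mI: "m \<in> I" "m \<noteq> 0" and mmin: "\<And>x. x \<in> I \<Longrightarrow> x \<noteq> 0 \<Longrightarrow> degree m \<le> degree x"
    using arg_min_nat_lemma[of "\<lambda>x. x \<in> I \<and> x \<noteq> 0" F degree] FI F0
    unfolding m_def by auto
  have dvd: "\<exists>a. a \<noteq> 0 \<and> m dvd [:a:] * x" if "x \<in> I" for x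
  proof -
    obtain a q where aq: "a \<noteq> 0" "smult a x = m * q + pseudo_mod x m"
      and r: "pseudo_mod x m = 0 \<or> degree (pseudo_mod x m) < degree m"
      using pseudo_mod[OF mI(2), of x] by blast
    have "pseudo_mod x m = [:a:] * x - q * m" using aq(2) by (simp add: algebra_simps)
    then have "pseudo_mod x m \<in> I" using diff[OF \<open>x \<in> I\<close> mI(1)] by metis
    then have "pseudo_mod x m = 0" using r mmin by fastforce
    then have "[:a:] * x = m * q" using aq(2) by simp
    then show ?thesis using aq(1) by (metis dvd_triv_left)
  qed
  have prime: "prime_elem F" by (rule irreducible_imp_prime_elem[OF F])
  have "degree m = 0"
  proof (rule ccontr)
    assume dm: "degree m \<noteq> 0"
    have dF: "degree F \<noteq> 0" using mmin[OF FI F0] dm by linarith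
    obtain a where a: "a \<noteq> 0" "m dvd [:a:] * F" using dvd[OF FI] by blast
    then obtain q where q: "[:a:] * F = m * q" by blast
    \<comment> \<open>Up to constant factors both F and G are multiples of m. If F divides the
      cofactor q, then m divides the constant a; if F divides m, then F divides a constant multiple
      of G and hence a constant. Both contradict positive degrees.\<close>
    have "F dvd m * q" using q by (metis dvd_triv_right)
    then consider "F dvd m" | "F dvd q" using prime_elem_dvd_multD[OF prime] by metis
    then show False
    proof cases
      case 2
      then obtain k where "q = F * k" by blast
      then have "F * [:a:] = F * (m * k)" using q by (simp only: ac_simps)
      then have "[:a:] = m * k" using F0 by (simp only: mult_cancel_left) simp
      moreover from this have "k \<noteq> 0" "m \<noteq> 0" using a by auto
      ultimately show False using dm by (metis add_is_0 degree_mult_eq degree_pCons_0)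
    next
      case 1
      obtain c where c: "c \<noteq> 0" "m dvd [:c:] * G" using dvd[OF GI] by blast
      have "F dvd [:c:] * G" using 1 c dvd_trans by blast
      then have "F dvd [:c:]" using prime_elem_dvd_multD[OF prime] ndvd by metis
      then have "degree F \<le> degree [:c:]" using c by (intro dvd_imp_degree_le) auto
      then show False using dF by simp
    qed
  qed
  then obtain r where "m = [:r:]" by (metis degree_eq_zeroE)
  moreover obtain a b where "m = a * F + b * G" using mI(1) unfolding I_def by blast
  ultimately show ?thesis using mI(2) that[of a b r] by auto
qed

lemma eval3_const: "eval3 [:f:] v = poly (poly f [:v $ 2:]) (v $ 1)"
  by (simp add: eval3_def)

text \<open>The case x = 0 is left out so that r can be tested along the lines y = s x: infinitely
  many slopes s give infinitely many values y for each nonzero x.\<close>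

lemma poly2_eq_0:
  fixes r :: "complex poly poly"
  assumes "\<And>x. x \<noteq> 0 \<Longrightarrow> infinite {y. poly (poly r [:y:]) x = 0}"
  shows "r = 0"
proof -
  have "poly (coeff r j) x = 0" if "x \<noteq> 0" for x j
  proof -
    define p where "p = map_poly (\<lambda>c. poly c x) r"
    have "poly p y = poly (poly r [:y:]) x" for y
      by (simp add: p_def poly_map_poly_0 poly_altdef[of r] poly_sum poly_power)
    then have "p = 0" using assms[OF that] by (intro poly_eq_0_if_infinite_roots) simp
    then show ?thesis unfolding p_def by (rule map_poly_eq_0D) simp
  qed
  then have "{x. poly (coeff r j) x = 0} \<supseteq> UNIV - {0}" for j by auto
  moreover have "infinite (UNIV - {0::complex})" by (simp add: infinite_UNIV_char_0)
  ultimately have "infinite {x. poly (coeff r j) x = 0}" for j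
    using infinite_super by blast
  then have "coeff r j = 0" for j
    by (rule poly_eq_0_if_infinite_roots)
  then show ?thesis by (simp add: poly_eq_iff)
qed

lemma eval3_eq_0_imp:
  assumes "\<And>v. eval3 F v = 0"
  shows "F = 0"
proof -
  have "poly (poly (poly F [:[:z:]:]) [:y:]) x = 0" for x y z
    using assms[of "vector [x, y, z]"] by (simp add: eval3_def)
  then have p0: "poly F [:[:z:]:] = 0" for z
    by (intro poly2_eq_0) (simp add: infinite_UNIV_char_0)
  have "infinite {w. poly F w = 0}"
  proof
    assume "finite {w. poly F w = 0}"
    moreover have "range (\<lambda>z. [:[:z:]:]) \<subseteq> {w. poly F w = 0}" using p0 by auto
    ultimately have "finite (range (\<lambda>z::complex. [:[:z:]:]))" using finite_subset by blast
    then show False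
      by (simp add: finite_image_iff inj_on_def infinite_UNIV_char_0)
  qed
  then show ?thesis by (rule poly_eq_0_if_infinite_roots)
qed

lemma eval3_eq_imp: "(\<And>v. eval3 F v = eval3 G v) \<Longrightarrow> F = G"
  using eval3_eq_0_imp[of "F - G"] by simp

subsection \<open>Points\<close>

lemma proportional_iff: "proportional v w \<longleftrightarrow> v \<noteq> 0 \<and> w \<noteq> 0 \<and> (\<exists>c. c \<noteq> 0 \<and> w = c *s v)"
  unfolding proportional_def by auto

lemma pt_eq_iff: "v \<noteq> 0 \<Longrightarrow> w \<noteq> 0 \<Longrightarrow> pt v = pt w \<longleftrightarrow> (\<exists>c. c \<noteq> 0 \<and> w = c *s v)"
proof -
  assume v: "v \<noteq> 0" and w: "w \<noteq> 0"
  have r: "proportional u u" if "u \<noteq> 0" for u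
    using that by (auto simp: proportional_def intro!: exI[of _ 1])
  show ?thesis
    using Quotient_rel[OF Quotient_cp2, of v w] v w r[OF v] r[OF w] by (simp add: proportional_iff)
qed

lemma pt_scale: "v \<noteq> 0 \<Longrightarrow> c \<noteq> 0 \<Longrightarrow> pt (c *s v) = pt v"
  by (subst pt_eq_iff) (auto simp: vector_smult_assoc intro!: exI[of _ "inverse c"])

lemma cp2_cases: obtains v where "v \<noteq> 0" "X = pt v"
proof -
  have "pt (hom_coords X) = X" "proportional (hom_coords X) (hom_coords X)"
    using Quotient_abs_rep[OF Quotient_cp2] Quotient_rep_reflp[OF Quotient_cp2] by auto
  then show ?thesis using that[of "hom_coords X"] by (auto simp: proportional_def)
qed

text \<open>The case in which elimination degenerates. A polynomial that vanishes on a plane through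
  the third axis is divisible by the linear equation of that plane; an irreducible F is then
  associate to this equation, which divides G as well.\<close>

lemma dvd_if_common_zeros_aux:
  assumes F: "irreducible (F::poly3)" and xy: "(x, y) \<noteq> (0, 0)"
    and Fz: "\<And>c z. eval3 F (vector [c * x, c * y, z]) = 0"
    and Gz: "\<And>c z. eval3 G (vector [c * x, c * y, z]) = 0"
  shows "F dvd G"
proof -
  \<comment> \<open>The equation of the plane spanned by (x, y, 0) and the third axis: the first
    variable if x = 0, otherwise the second variable minus y / x times the first.\<close>
  define l where "l = (if x = 0 then [:[:0, 1:]:] else [:-[:0, y / x:], 1:])"
  have key: "[:l:] dvd K" if K: "\<And>c z. eval3 K (vector [c * x, c * y, z]) = 0" for K :: poly3
  proof -
    have c0: "poly (poly (coeff K k) [:c * y:]) (c * x) = 0" for k c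
    proof -
      define p where "p = map_poly (\<lambda>f. poly (poly f [:c * y:]) (c * x)) K"
      have "poly p z = eval3 K (vector [c * x, c * y, z])" for z
        by (simp add: p_def poly_map_poly_0 eval3_def poly_altdef[of K] poly_sum poly_power)
      then have "p = 0" using K by (intro poly_eq_0_if_infinite_roots) (simp add: infinite_UNIV_char_0)
      then show ?thesis unfolding p_def by (rule map_poly_eq_0D) simp
    qed
    have "l dvd coeff K k" for k
    proof (cases "x = 0")
      case True
      then have y: "y \<noteq> 0" using xy by auto
      have "poly (poly (coeff K k) [:s:]) 0 = 0" for s
        using c0[of k "s / y"] True y by simp
      moreover have "poly (map_poly (\<lambda>c. poly c 0) (coeff K k)) s = poly (poly (coeff K k) [:s:]) 0" for s
        by (simp add: poly_map_poly_0 poly_altdef[of "coeff K k"] poly_sum poly_power)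
      ultimately have "map_poly (\<lambda>c. poly c 0) (coeff K k) = 0"
        by (intro poly_eq_0_if_infinite_roots) (simp add: infinite_UNIV_char_0)
      then have "poly (coeff (coeff K k) j) 0 = 0" for j
        by (rule map_poly_eq_0D) simp
      then show ?thesis using True
        by (simp add: l_def const_poly_dvd_iff poly_eq_0_iff_dvd)
    next
      case False
      have "poly (poly (coeff K k) [:0, y / x:]) s = 0" for s
      proof -
        have "poly (poly (coeff K k) [:0, y / x:]) s = poly (poly (coeff K k) [:s / x * y:]) (s / x * x)"
          using False by (simp add: poly_altdef[of "coeff K k"] poly_sum poly_power)
        also have "\<dots> = 0" by (rule c0)
        finally show ?thesis .
      qed
      then have "poly (coeff K k) [:0, y / x:] = 0"
        by (intro poly_eq_0_if_infinite_roots) (simp add: infinite_UNIV_char_0)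
      then show ?thesis using False by (simp add: l_def poly_eq_0_iff_dvd)
    qed
    then show ?thesis by (simp add: const_poly_dvd_iff)
  qed
  have nu: "\<not> is_unit [:l:]"
  proof
    assume "is_unit [:l:]"
    then have l1: "l dvd 1" by (simp only: is_unit_const_poly_iff)
    then have "degree l \<le> degree (1::complex poly poly)" by (rule dvd_imp_degree_le) simp
    then have x: "x = 0" by (auto simp: l_def split: if_splits)
    then have "[:0, 1:] dvd (1::complex poly)" using l1 unfolding l_def by (simp only: if_P is_unit_const_poly_iff)
    then have "degree [:0, 1::complex:] \<le> degree (1::complex poly)" by (rule dvd_imp_degree_le) simp
    then show False by simp
  qed
  from key[OF Fz] obtain k where k: "F = [:l:] * k" by blast
  then have "is_unit k" using irreducibleD[OF F k] nu by simp
  then have "F dvd [:l:]" using k by (metis dvd_refl mult_unit_dvd_iff)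
  then show ?thesis using key[OF Gz] dvd_trans by blast
qed

text \<open>A weak form of Bezout's theorem. Unless F divides G, the ideal (F, G) contains a nonzero
  polynomial r in the first two variables. Infinitely many slopes among the common zeros would make
  r vanish identically; with finitely many slopes, one plane through the third axis contains
  infinitely many of the points, and F and G vanish on it. All multiples \<open>c *s v\<close> occur
  because G is an arbitrary polynomial, whose zeros need not come in whole lines.\<close>

lemma dvd_if_infinite_common_zeros:
  assumes F: "irreducible (F::poly3)" and inf: "infinite X"
    and z: "\<And>v c. v \<noteq> 0 \<Longrightarrow> pt v \<in> X \<Longrightarrow> c \<noteq> 0 \<Longrightarrow> eval3 F (c *s v) = 0 \<and> eval3 G (c *s v) = 0"
  shows "F dvd G"
proof (rule ccontr)
  assume ndvd: "\<not> F dvd G"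
  obtain a b r where ab: "a * F + b * G = [:r:]" and r: "r \<noteq> 0"
    using irreducible_ideal_const[OF F ndvd] by blast
  have r0: "poly (poly r [:c * v $ 2:]) (c * v $ 1) = 0" if "v \<noteq> 0" "pt v \<in> X" "c \<noteq> 0" for v :: "complex^3" and c
  proof -
    have "eval3 [:r:] (c *s v) = 0" unfolding ab[symmetric] using z[OF that] by simp
    then show ?thesis by (simp add: eval3_const)
  qed
  define V where "V = {v. v \<noteq> 0 \<and> pt v \<in> X \<and> v $ 1 \<noteq> 0}"
  define sl where "sl v = v $ 2 / v $ 1" for v :: "complex^3"
  have fin: "finite (sl ` V)"
  proof (rule ccontr)
    assume inf: "infinite (sl ` V)"
    have "r = 0"
    proof (rule poly2_eq_0)
      fix x :: complex assume x: "x \<noteq> 0"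
      have "(\<lambda>s. x * s) ` sl ` V \<subseteq> {y. poly (poly r [:y:]) x = 0}"
      proof (rule subsetI)
        fix y assume "y \<in> (\<lambda>s. x * s) ` sl ` V"
        then obtain v where y: "y = x * sl v" and "v \<in> V" by blast
        then show "y \<in> {y. poly (poly r [:y:]) x = 0}"
          using r0[of v "x / v $ 1"] x by (simp add: y V_def sl_def)
      qed
      moreover have "infinite ((\<lambda>s. x * s) ` sl ` V)"
        using inf x by (simp add: finite_image_iff inj_on_def)
      ultimately show "infinite {y. poly (poly r [:y:]) x = 0}" using infinite_super by blast
    qed
    then show False using r by simp
  qed
  \<comment> \<open>The possible directions in the first two coordinates: one for each slope and one
    for vectors with first coordinate 0. The direction 0 added below accounts for the point of the
    third axis.\<close>
  define D where "D = (\<lambda>s. vector [1, s, 0] :: complex^3) ` sl ` V \<union> {vector [0, 1, 0]}"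
  have "\<exists>d\<in>insert 0 D. \<exists>z. X0 = pt (d + z *s vector [0, 0, 1])" if X0: "X0 \<in> X" for X0
  proof -
    obtain v where v: "v \<noteq> 0" "X0 = pt v" by (rule cp2_cases)
    consider "v $ 1 \<noteq> 0" | "v $ 1 = 0" "v $ 2 \<noteq> 0" | "v $ 1 = 0" "v $ 2 = 0" by blast
    then show ?thesis
    proof cases
      case 1
      then have vV: "v \<in> V" using v X0 by (simp add: V_def)
      have "inverse (v $ 1) *s v = vector [1, sl v, 0] + (v $ 3 / v $ 1) *s vector [0, 0, 1]"
        using 1 by (simp add: vec3_eq_iff vector_3 sl_def divide_inverse mult.commute)
      then have "X0 = pt (vector [1, sl v, 0] + (v $ 3 / v $ 1) *s vector [0, 0, 1])"
        using pt_scale[OF v(1), of "inverse (v $ 1)"] 1 v by simp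
      then show ?thesis using vV by (auto simp: D_def)
    next
      case 2
      have "inverse (v $ 2) *s v = vector [0, 1, 0] + (v $ 3 / v $ 2) *s vector [0, 0, 1]"
        using 2 by (simp add: vec3_eq_iff vector_3 sl_def divide_inverse mult.commute)
      then have "X0 = pt (vector [0, 1, 0] + (v $ 3 / v $ 2) *s vector [0, 0, 1])"
        using pt_scale[OF v(1), of "inverse (v $ 2)"] 2 v by simp
      then show ?thesis by (auto simp: D_def)
    next
      case 3
      then have "v = 0 + v $ 3 *s vector [0, 0, 1]"
        by (simp add: vec3_eq_iff vector_3)
      then have "X0 = pt (0 + v $ 3 *s vector [0, 0, 1])" using v by simp
      then show ?thesis by blast
    qed
  qed
  then have sub: "X \<subseteq> (\<Union>d\<in>insert 0 D. {X0\<in>X. \<exists>z. X0 = pt (d + z *s vector [0, 0, 1])})" by blast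
  have finD: "finite (insert 0 D)" using fin by (simp add: D_def)
  obtain d where d: "d \<in> insert 0 D" and
    dinf: "infinite {X0\<in>X. \<exists>z. X0 = pt (d + z *s vector [0, 0, 1])}"
    using inf sub finD by (meson finite_UN_I finite_subset)
  have d0: "d \<noteq> 0"
  proof
    assume d: "d = 0"
    \<comment> \<open>\<open>pt 0\<close> is unspecified but still a single point, so the direction
      0 contributes at most two points.\<close>
    have "{X0\<in>X. \<exists>z. X0 = pt (d + z *s vector [0, 0, 1])} \<subseteq> {pt 0, pt (vector [0, 0, 1])}"
    proof
      fix X0 assume "X0 \<in> {X0\<in>X. \<exists>z. X0 = pt (d + z *s vector [0, 0, 1])}"
      then obtain z where z: "X0 = pt (z *s vector [0, 0, 1])" using d by auto
      have "vector [0, 0, 1] \<noteq> (0::complex^3)" by (simp add: vec3_eq_iff vector_3)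
      then show "X0 \<in> {pt 0, pt (vector [0, 0, 1])}"
        using z pt_scale[of "vector [0, 0, 1]" z] by (cases "z = 0") auto
    qed
    then show False using dinf by (meson finite.emptyI finite.insertI finite_subset)
  qed
  then have dD: "d \<in> D" using d by blast
  then have d3: "d $ 3 = 0" and d12: "(d $ 1, d $ 2) \<noteq> (0, 0)" by (auto simp: D_def vector_3)
  define Z where "Z = {z. pt (d + z *s vector [0, 0, 1]) \<in> X}"
  have Zinf: "infinite Z"
  proof
    assume "finite Z"
    moreover have "{X0\<in>X. \<exists>z. X0 = pt (d + z *s vector [0, 0, 1])} \<subseteq> (\<lambda>z. pt (d + z *s vector [0, 0, 1])) ` Z"
      by (auto simp: Z_def)
    ultimately show False using dinf finite_surj by blast
  qed
  have main: "eval3 K (vector [c * d $ 1, c * d $ 2, w]) = 0"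
    if K: "\<And>v c. v \<noteq> 0 \<Longrightarrow> pt v \<in> X \<Longrightarrow> c \<noteq> 0 \<Longrightarrow> eval3 K (c *s v) = 0" for K :: poly3 and c w
  proof -
    define p where "p c = map_poly (\<lambda>f. poly (poly f [:c * d $ 2:]) (c * d $ 1)) K" for c
    have p: "poly (p c) z = eval3 K (vector [c * d $ 1, c * d $ 2, z])" for z c
      by (simp add: p_def poly_map_poly_0 eval3_def poly_altdef[of K] poly_sum poly_power vector_3)
    have pc: "p c = 0" if "c \<noteq> 0" for c
    proof (rule poly_eq_0_if_infinite_roots)
      have "(\<lambda>z. c * z) ` Z \<subseteq> {z. poly (p c) z = 0}"
      proof (rule image_subsetI)
        fix z assume zZ: "z \<in> Z"
        have eq: "d + z *s vector [0, 0, 1] = vector [d $ 1, d $ 2, z]"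
          using d3 by (simp add: vec3_eq_iff vector_3)
        have "vector [d $ 1, d $ 2, z] \<noteq> (0::complex^3)"
          using d12 by (auto simp: vec3_eq_iff vector_3)
        then have "eval3 K (c *s vector [d $ 1, d $ 2, z]) = 0"
          using zZ eq that by (intro K) (auto simp: Z_def)
        moreover have "c *s vector [d $ 1, d $ 2, z] = (vector [c * d $ 1, c * d $ 2, c * z] :: complex^3)"
          by (simp add: vec3_eq_iff vector_3)
        ultimately show "c * z \<in> {z. poly (p c) z = 0}" by (simp add: p)
      qed
      moreover have "infinite ((\<lambda>z. c * z) ` Z)"
        using Zinf that by (simp add: finite_image_iff inj_on_def)
      ultimately show "infinite {z. poly (p c) z = 0}" using infinite_super by blast
    qed
    \<comment> \<open>Scaling says nothing for c = 0. As a polynomial in c the value vanishes at all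
      other c, hence also there.\<close>
    define q where "q = (\<Sum>k\<le>degree K. (\<Sum>j\<le>degree (coeff K k).
       smult (w ^ k) (pcompose (coeff (coeff K k) j) [:0, d $ 1:] * [:0, d $ 2:] ^ j)))"
    have q: "poly q c = eval3 K (vector [c * d $ 1, c * d $ 2, w])" for c
      unfolding q_def eval3_def poly_altdef[of K]
      by (simp add: poly_sum poly_power vector_3 poly_pcompose poly_altdef[of "coeff K _"] sum_distrib_left mult_ac)
    have "UNIV - {0} \<subseteq> {c. poly q c = 0}" using p pc q by auto (metis poly_0)
    moreover have "infinite (UNIV - {0::complex})" by (simp add: infinite_UNIV_char_0)
    ultimately have "infinite {c. poly q c = 0}" using infinite_super by blast
    then have "q = 0" by (rule poly_eq_0_if_infinite_roots)
    then show ?thesis using q by (metis poly_0)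
  qed
  have "F dvd G"
    by (rule dvd_if_common_zeros_aux[OF F d12]) (use main z in auto)
  then show False using ndvd by simp
qed

section \<open>Homogeneous forms and linear forms\<close>

lemma homogeneousD:
  assumes "homogeneous d F"
  shows "degree F \<le> d" "degree (coeff F k) \<le> d" "degree (coeff (coeff F k) j) \<le> d"
proof -
  have 1: "degree (coeff (coeff F k) j) \<le> d" for k j
    by (rule degree_le) (use assms in \<open>fastforce simp: homogeneous_def\<close>)
  have 2: "degree (coeff F k) \<le> d" for k
  proof (rule degree_le, intro allI impI)
    fix j assume "d < j"
    then have "coeff (coeff (coeff F k) j) i = 0" for i
      using assms by (fastforce simp: homogeneous_def)
    then show "coeff (coeff F k) j = 0" by (simp add: poly_eq_iff)
  qed
  show "degree F \<le> d"
  proof (rule degree_le, intro allI impI)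
    fix k assume "d < k"
    then have "coeff (coeff (coeff F k) j) i = 0" for i j
      using assms by (fastforce simp: homogeneous_def)
    then show "coeff F k = 0" by (simp add: poly_eq_iff)
  qed
  show "degree (coeff F k) \<le> d" "degree (coeff (coeff F k) j) \<le> d" by (fact 2, fact 1)
qed

lemma poly_sum_le:
  fixes p :: "'a::comm_semiring_1 poly"
  shows "degree p \<le> n \<Longrightarrow> poly p x = (\<Sum>i\<le>n. coeff p i * x ^ i)"
  unfolding poly_altdef by (intro sum.mono_neutral_left) (auto simp: coeff_eq_0)

lemma eval3_sum:
  assumes "homogeneous d F"
  shows "eval3 F v = (\<Sum>k\<le>d. \<Sum>j\<le>d. \<Sum>i\<le>d. coeff (coeff (coeff F k) j) i * (v$1) ^ i * (v$2) ^ j * (v$3) ^ k)"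
  unfolding eval3_def poly_sum_le[OF homogeneousD(1)[OF assms]] poly_sum poly_mult poly_power
    poly_sum_le[OF homogeneousD(2)[OF assms]] poly_sum_le[OF homogeneousD(3)[OF assms]]
    sum_distrib_right sum_distrib_left poly_pCons
  by (simp add: poly_sum poly_power sum_distrib_right sum_distrib_left)

lemma eval3_scale:
  assumes "homogeneous d F"
  shows "eval3 F (c *s v) = c ^ d * eval3 F v"
proof -
  have *: "coeff (coeff (coeff F k) j) i * (c * v$1) ^ i * (c * v$2) ^ j * (c * v$3) ^ k
    = c ^ d * (coeff (coeff (coeff F k) j) i * (v$1) ^ i * (v$2) ^ j * (v$3) ^ k)" for i j k
  proof (cases "coeff (coeff (coeff F k) j) i = 0")
    case False
    then have "d = i + j + k" using assms unfolding homogeneous_def by auto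
    then show ?thesis by (simp add: power_add power_mult_distrib)
  qed auto
  show ?thesis
    by (simp add: eval3_sum[OF assms] * sum_distrib_left)
qed

lemma homogeneous_mult:
  assumes "homogeneous m F" "homogeneous n G"
  shows "homogeneous (m + n) (F * G)"
  unfolding homogeneous_def
proof (intro allI impI)
  fix i j k assume "coeff (coeff (coeff (F * G) k) j) i \<noteq> 0"
  then have "(\<Sum>a\<le>k. \<Sum>b\<le>j. \<Sum>c\<le>i. coeff (coeff (coeff F a) b) c * coeff (coeff (coeff G (k-a)) (j-b)) (i-c)) \<noteq> 0"
    by (simp add: coeff_mult coeff_sum)
  then obtain a b c where "a \<le> k" "b \<le> j" "c \<le> i"
    "coeff (coeff (coeff F a) b) c \<noteq> 0" "coeff (coeff (coeff G (k-a)) (j-b)) (i-c) \<noteq> 0"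
    by (auto elim!: sum.not_neutral_contains_not_neutral)
  moreover have "c + b + a = m" "(i - c) + (j - b) + (k - a) = n"
    using assms calculation unfolding homogeneous_def by blast+
  ultimately show "i + j + k = m + n" by linarith
qed

lemma in_zero_locus:
  assumes "homogeneous d F" "v \<noteq> 0"
  shows "pt v \<in> zero_locus F \<longleftrightarrow> eval3 F v = 0"
proof
  assume "pt v \<in> zero_locus F"
  then obtain w where w: "pt v = pt w" "w \<noteq> 0" "eval3 F w = 0" unfolding zero_locus_def by blast
  then obtain c where "c \<noteq> 0" "w = c *s v" using pt_eq_iff[OF assms(2) w(2)] by blast
  then show "eval3 F v = 0" using w eval3_scale[OF assms(1), of c v] by simp
qed (use assms in \<open>auto simp: zero_locus_def\<close>)

definition lform :: "complex^3 \<Rightarrow> poly3" where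
  "lform n = [:[:[:0, n $ 1:], [:n $ 2:]:], [:[:n $ 3:]:]:]"

lemma eval3_lform: "eval3 (lform n) v = n $ 1 * v $ 1 + n $ 2 * v $ 2 + n $ 3 * v $ 3"
  by (simp add: eval3_def lform_def algebra_simps)

lemma coeff_lform:
  "coeff (coeff (coeff (lform n) k) j) i =
    (if i = 1 \<and> j = 0 \<and> k = 0 then n $ 1 else if i = 0 \<and> j = 1 \<and> k = 0 then n $ 2
     else if i = 0 \<and> j = 0 \<and> k = 1 then n $ 3 else 0)"
  by (cases k; cases "k - 1"; cases j; cases "j - 1"; cases i; cases "i - 1") (simp_all add: lform_def)

lemma homogeneous_lform: "homogeneous 1 (lform n)"
  unfolding homogeneous_def coeff_lform by simp

lemma lform_eq_0_iff: "lform n = 0 \<longleftrightarrow> n = 0"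
  by (auto simp: lform_def vec3_eq_iff)

lemma homogeneous_1_lform:
  assumes "homogeneous 1 F"
  obtains n where "F = lform n"
proof
  have c: "coeff (coeff (coeff F k) j) i = 0" if "i + j + k \<noteq> 1" for i j k
    using assms that unfolding homogeneous_def by blast
  show "F = lform (vector [coeff (coeff (coeff F 0) 0) 1, coeff (coeff (coeff F 0) 1) 0, coeff (coeff (coeff F 1) 0) 0])"
    (is "F = ?G")
  proof -
    have "coeff (coeff (coeff F k) j) i = coeff (coeff (coeff ?G k) j) i" for i j k
    proof (cases "i + j + k = 1")
      case True
      then consider "i = 1" "j = 0" "k = 0" | "i = 0" "j = 1" "k = 0" | "i = 0" "j = 0" "k = 1" by linarith
      then show ?thesis by cases (simp_all add: coeff_lform)
    next
      case False
      then have n: "\<not> (i = 1 \<and> j = 0 \<and> k = 0)" "\<not> (i = 0 \<and> j = 1 \<and> k = 0)" "\<not> (i = 0 \<and> j = 0 \<and> k = 1)"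
        by linarith+
      have "coeff (coeff (coeff (lform n) k) j) i = 0" for n
        unfolding coeff_lform if_not_P[OF n(1)] if_not_P[OF n(2)] if_not_P[OF n(3)] ..
      from this[of "vector [coeff (coeff (coeff F 0) 0) 1, coeff (coeff (coeff F 0) 1) 0, coeff (coeff (coeff F 1) 0) 0]"]
      show ?thesis using c[OF False] by (metis (no_types))
    qed
    then show ?thesis unfolding poly_eq_iff by blast
  qed
qed

text \<open>A factor of degree 0 divides the leading coefficient. That this is a unit excludes
  constant factors which are not units; these may exist because the coefficients form only an
  integral domain.\<close>

lemma irreducible_linear_unit:
  fixes p :: "'a::idom poly"
  assumes "degree p = 1" "lead_coeff p dvd 1"
  shows "irreducible p"
proof (rule irreducibleI)
  show p0: "p \<noteq> 0" using assms(1) by auto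
  show "\<not> p dvd 1"
  proof
    assume "p dvd 1"
    then have "degree p \<le> degree (1::'a poly)" by (rule dvd_imp_degree_le) simp
    then show False using assms(1) by simp
  qed
  have *: "a dvd 1" if ab: "p = a * b" and da: "degree a = 0" for a b
  proof -
    obtain c where c: "a = [:c:]" using da by (metis degree_eq_zeroE)
    have "lead_coeff p = c * lead_coeff b" using ab c by (simp add: lead_coeff_smult)
    then have "c dvd 1" using assms(2) by (metis dvd_mult_left)
    then show ?thesis by (simp add: c is_unit_const_poly_iff)
  qed
  fix a b assume ab: "p = a * b"
  then have "degree a + degree b = 1" using assms(1) p0 by (metis degree_mult_eq mult_eq_0_iff)
  then have "degree a = 0 \<or> degree b = 0" by linarith
  moreover have "p = b * a" using ab by (simp only: mult.commute)
  ultimately show "a dvd 1 \<or> b dvd 1" using *[OF ab] *[of b a] by blast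
qed

lemma irreducible_const_polyI:
  fixes c :: "'a::idom"
  assumes "irreducible c"
  shows "irreducible [:c:]"
proof (rule irreducibleI)
  show "[:c:] \<noteq> 0" using assms by auto
  show "\<not> [:c:] dvd 1" using irreducible_not_unit[OF assms] by (simp only: is_unit_const_poly_iff simp_thms)
  fix a b assume ab: "[:c:] = a * b"
  have "a \<noteq> 0" "b \<noteq> 0" using ab \<open>[:c:] \<noteq> 0\<close> by auto
  then have "degree a + degree b = degree (a * b)" by (simp add: degree_mult_eq)
  also have "\<dots> = 0" unfolding ab[symmetric] by simp
  finally have "degree a = 0" "degree b = 0" by simp_all
  obtain x where x: "a = [:x:]" by (rule degree_eq_zeroE[OF \<open>degree a = 0\<close>])
  obtain y where y: "b = [:y:]" by (rule degree_eq_zeroE[OF \<open>degree b = 0\<close>])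
  note xy = x y
  have "c = x * y" using ab xy by simp
  then have "x dvd 1 \<or> y dvd 1" using irreducibleD[OF assms] by blast
  then show "a dvd 1 \<or> b dvd 1" by (simp only: xy is_unit_const_poly_iff)
qed

lemma irreducible_lform:
  assumes "n \<noteq> 0"
  shows "irreducible (lform n)"
proof -
  have 1: "irreducible (lform n)" if "n $ 3 \<noteq> 0"
    unfolding lform_def using that
    by (intro irreducible_linear_unit) (simp_all add: is_unit_const_poly_iff dvd_field_iff)
  have 2: "irreducible (lform n)" if n3: "n $ 3 = 0" and n2: "n $ 2 \<noteq> 0"
  proof -
    have "irreducible [:[:0, n $ 1:], [:n $ 2:]:]"
      using n2 by (intro irreducible_linear_unit) (simp_all add: is_unit_const_poly_iff dvd_field_iff)
    from irreducible_const_polyI[OF this] show ?thesis by (simp add: lform_def n3)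
  qed
  have 3: "irreducible (lform n)" if n3: "n $ 3 = 0" and n2: "n $ 2 = 0" and n1: "n $ 1 \<noteq> 0"
  proof -
    have "irreducible [:0, n $ 1:]"
      using n1 by (intro irreducible_linear_unit) (simp_all add: is_unit_const_poly_iff dvd_field_iff)
    from irreducible_const_polyI[OF irreducible_const_polyI[OF this]] show ?thesis
      by (simp add: lform_def n3 n2)
  qed
  have "n $ 1 \<noteq> 0 \<or> n $ 2 \<noteq> 0 \<or> n $ 3 \<noteq> 0"
    using assms by (auto simp: vec3_eq_iff)
  then show ?thesis using 1 2 3 by blast
qed

subsection \<open>Roots of holomorphic families of polynomials\<close>

lemma isCont_tendsto_nhds: "isCont f a \<Longrightarrow> (f \<longlongrightarrow> f a) (nhds a)"
  by (simp add: isCont_def tendsto_at_iff_tendsto_nhds)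

text \<open>The product of the distances from w to the roots is
  \<open>norm (poly p w) / norm (lead_coeff p)\<close>, so they cannot all be at least
  \<epsilon>.\<close>

lemma root_near:
  fixes p :: "complex poly"
  assumes "p \<noteq> 0" "degree p = d" "\<epsilon> > 0" "norm (poly p w) < norm (lead_coeff p) * \<epsilon> ^ d"
  obtains r where "poly p r = 0" "dist w r < \<epsilon>"
proof -
  obtain R where R: "size R = degree p" "p = smult (lead_coeff p) (\<Prod>x\<in>#R. [:-x, 1:])"
    using alg_closed_imp_factorization[OF assms(1)] by blast
  have ev: "poly (\<Prod>x\<in>#R. [:-x, 1:]) w = (\<Prod>x\<in>#R. w - x)" for R
    by (induction R) (auto simp: algebra_simps)
  have "norm (\<Prod>x\<in>#R. w - x) \<ge> \<epsilon> ^ size R" if "\<forall>x\<in>#R. dist w x \<ge> \<epsilon>" for R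
    using that
  proof (induction R)
    case (add x R)
    then have "\<epsilon> * \<epsilon> ^ size R \<le> norm (w - x) * norm (\<Prod>x\<in>#R. w - x)"
      using assms(3) by (intro mult_mono) (auto simp: dist_norm)
    then show ?case by (simp add: norm_mult)
  qed auto
  moreover have "norm (\<Prod>x\<in>#R. w - x) < \<epsilon> ^ size R"
  proof -
    have "poly p w = lead_coeff p * (\<Prod>x\<in>#R. w - x)"
      using arg_cong[OF R(2), of "\<lambda>p. poly p w"] by (simp add: ev)
    then have "norm (lead_coeff p) * norm (\<Prod>x\<in>#R. w - x) < norm (lead_coeff p) * \<epsilon> ^ d"
      using assms(4) by (simp add: norm_mult)
    moreover have "norm (lead_coeff p) > 0" using assms(1) by simp
    ultimately show ?thesis using R(1) assms(2) mult_less_cancel_left_pos by metis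
  qed
  ultimately obtain x where x: "x \<in># R" "dist w x < \<epsilon>" by (metis not_le)
  have "poly (\<Prod>x\<in>#R. [:-x, 1:]) x = 0" unfolding poly_prod_mset using x(1) by (auto simp: image_iff)
  then have "poly p x = 0" using arg_cong[OF R(2), of "\<lambda>p. poly p x"] by simp
  then show ?thesis using that x by blast
qed

text \<open>The divided difference of p, written without division so that it is defined and
  continuous on the diagonal. The bound d is a parameter because it has to be the same for all
  members of a family of polynomials.\<close>

definition dquot :: "nat \<Rightarrow> complex poly \<Rightarrow> complex \<Rightarrow> complex \<Rightarrow> complex" where
  "dquot d p x y = (\<Sum>j\<le>d. coeff p j * (\<Sum>i<j. y ^ (j - Suc i) * x ^ i))"

lemma poly_diff_dquot:
  assumes "degree p \<le> d"
  shows "poly p x - poly p y = (x - y) * dquot d p x y"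
proof -
  have "poly p x = (\<Sum>j\<le>d. coeff p j * x ^ j)" for x
    unfolding poly_altdef using assms by (intro sum.mono_neutral_left) (auto simp: coeff_eq_0)
  then show ?thesis
    by (simp add: dquot_def sum_subtractf[symmetric] right_diff_distrib[symmetric] power_diff_sumr2 sum_distrib_left mult_ac)
qed

lemma dquot_refl:
  assumes "degree p \<le> d"
  shows "dquot d p x x = poly (pderiv p) x"
proof -
  have "((\<lambda>y. (poly p y - poly p x) / (y - x)) \<longlongrightarrow> poly (pderiv p) x) (at x)"
    using poly_DERIV[of p x] by (simp add: has_field_derivative_iff)
  moreover have "((\<lambda>y. dquot d p y x) \<longlongrightarrow> dquot d p x x) (at x)"
    unfolding dquot_def by (intro tendsto_intros)
  then have "((\<lambda>y. (poly p y - poly p x) / (y - x)) \<longlongrightarrow> dquot d p x x) (at x)"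
    by (rule Lim_transform_eventually) (auto simp: eventually_at_filter poly_diff_dquot[OF assms])
  ultimately show ?thesis using tendsto_unique[of "at x"] by (metis at_neq_bot)
qed

text \<open>The roots of \<open>P z\<close> will be the points of the curve over z. The leading
  coefficient is a nonzero constant and not 1, because projection from a point c off the curve
  produces the value of the form at c.\<close>

locale monic_family =
  fixes P :: "complex \<Rightarrow> complex poly" and D :: "complex set" and d :: nat and a :: complex
  assumes D: "open D" and deg: "\<And>z. z \<in> D \<Longrightarrow> degree (P z) = d" and lc: "\<And>z. z \<in> D \<Longrightarrow> lead_coeff (P z) = a"
    and a0: "a \<noteq> 0" and holo: "\<And>j. (\<lambda>z. coeff (P z) j) holomorphic_on D"
begin

lemma P_nz: "z \<in> D \<Longrightarrow> P z \<noteq> 0"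
  using lc a0 by force

lemma poly_P: "z \<in> D \<Longrightarrow> poly (P z) w = (\<Sum>j\<le>d. coeff (P z) j * w ^ j)"
  using deg[of z] by (simp add: poly_altdef)

lemma holo_poly: "(\<lambda>z. poly (P z) w) holomorphic_on D"
  by (subst holomorphic_cong[OF refl poly_P]) (auto intro!: holomorphic_intros holo)

lemma cont_dquot: "continuous_on (D \<times> UNIV) (\<lambda>(z, x, y). dquot d (P z) x y)"
proof -
  have "continuous_on (D \<times> UNIV) (\<lambda>q. coeff (P (fst q)) j)" for j
    by (rule continuous_on_compose2[OF holomorphic_on_imp_continuous_on[OF holo[of j]]]) (auto intro: continuous_intros)
  then show ?thesis unfolding dquot_def case_prod_unfold
    by (auto intro!: continuous_intros)
qed

text \<open>The implicit function theorem for roots. Near a simple root the divided difference is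
  bounded away from 0, which makes the root in a small disc unique; \<open>root_near\<close>
  provides one, and the increment of the root is explicit enough to be differentiated. The bound
  \<epsilon>0 lets the discs around different roots be kept disjoint.\<close>

lemma simple_root:
  assumes z0: "z0 \<in> D" and w0: "poly (P z0) w0 = 0" and dw0: "poly (pderiv (P z0)) w0 \<noteq> 0" and e0: "\<epsilon>0 > 0"
  obtains \<delta> \<epsilon> Y where "\<delta> > 0" "\<epsilon> > 0" "\<epsilon> \<le> \<epsilon>0" "ball z0 \<delta> \<subseteq> D" "Y holomorphic_on ball z0 \<delta>" "Y z0 = w0"
    "\<And>z. z \<in> ball z0 \<delta> \<Longrightarrow> Y z \<in> ball w0 \<epsilon> \<and> poly (P z) (Y z) = 0"
    "\<And>z w. z \<in> ball z0 \<delta> \<Longrightarrow> w \<in> ball w0 \<epsilon> \<Longrightarrow> poly (P z) w = 0 \<Longrightarrow> w = Y z"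
proof -
  let ?A = "\<lambda>q. dquot d (P (fst q)) (fst (snd q)) (snd (snd q))"
  have cA: "continuous_on (D \<times> UNIV) ?A" using cont_dquot by (simp add: case_prod_unfold)
  have oD: "open (D \<times> (UNIV :: (complex \<times> complex) set))" using D by (simp add: open_Times)
  define m where "m = norm (poly (pderiv (P z0)) w0) / 2"
  have m0: "m > 0" using dw0 by (simp add: m_def)
  have "isCont ?A (z0, w0, w0)" using cA oD z0 continuous_on_eq_continuous_at by blast
  then have "(?A \<longlongrightarrow> ?A (z0, w0, w0)) (nhds (z0, w0, w0))"
    by (rule isCont_tendsto_nhds)
  then have "\<forall>\<^sub>F q in nhds (z0, w0, w0). dist (?A q) (?A (z0, w0, w0)) < m" using m0 by (rule tendstoD)
  then have "\<forall>\<^sub>F q in nhds (z0, w0, w0). norm (?A q) \<ge> m"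
  proof eventually_elim
    case (elim q)
    have "?A (z0, w0, w0) = poly (pderiv (P z0)) w0" using dquot_refl[of "P z0" d w0] deg[OF z0] by simp
    then have "norm (?A (z0, w0, w0)) = 2 * m" by (simp add: m_def)
    moreover have "norm (?A (z0, w0, w0)) \<le> norm (?A q) + dist (?A q) (?A (z0, w0, w0))"
      unfolding dist_norm by norm
    ultimately show ?case using elim by linarith
  qed
  then obtain \<eta> where eta: "\<eta> > 0" and eA: "\<And>q. dist q (z0, w0, w0) < \<eta> \<Longrightarrow> norm (?A q) \<ge> m"
    unfolding eventually_nhds_metric by blast
  obtain \<rho> where rho: "\<rho> > 0" "ball z0 \<rho> \<subseteq> D" using D z0 open_contains_ball by blast
  define \<epsilon> where "\<epsilon> = min \<epsilon>0 (\<eta> / 3)"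
  have eps: "\<epsilon> > 0" "\<epsilon> \<le> \<epsilon>0" "\<epsilon> \<le> \<eta> / 3" using eta e0 by (auto simp: \<epsilon>_def)
  have A: "norm (dquot d (P z) x y) \<ge> m" if "dist z z0 < \<eta> / 3" "dist x w0 < \<epsilon>" "dist y w0 < \<epsilon>" for z x y
  proof -
    have "dist (z, x, y) (z0, w0, w0) \<le> dist z z0 + (dist x w0 + dist y w0)"
      unfolding dist_Pair_Pair
      by (rule order_trans[OF sqrt_sum_squares_le_sum]) (auto intro!: add_left_mono sqrt_sum_squares_le_sum)
    then show ?thesis using eA[of "(z, x, y)"] that eps by simp
  qed
  have "isCont (\<lambda>z. poly (P z) w0) z0"
    using holomorphic_on_imp_continuous_on[OF holo_poly] D z0 continuous_on_eq_continuous_at by blast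
  then have "((\<lambda>z. poly (P z) w0) \<longlongrightarrow> 0) (nhds z0)"
    using isCont_tendsto_nhds[of z0 "\<lambda>z. poly (P z) w0"] w0 by simp
  moreover have "norm a * \<epsilon> ^ d > 0" using a0 eps by simp
  ultimately have "\<forall>\<^sub>F z in nhds z0. dist (poly (P z) w0) 0 < norm a * \<epsilon> ^ d" by (rule tendstoD)
  then obtain \<delta>1 where d1: "\<delta>1 > 0" "\<And>z. dist z z0 < \<delta>1 \<Longrightarrow> norm (poly (P z) w0) < norm a * \<epsilon> ^ d"
    unfolding eventually_nhds_metric by auto
  define \<delta> where "\<delta> = min \<delta>1 (min \<rho> (\<eta> / 3))"
  have del: "\<delta> > 0" "\<delta> \<le> \<delta>1" "\<delta> \<le> \<rho>" "\<delta> \<le> \<eta> / 3" using d1 rho eta by (auto simp: \<delta>_def)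
  have sub: "ball z0 \<delta> \<subseteq> D" using rho del by auto
  have ex: "\<exists>w. w \<in> ball w0 \<epsilon> \<and> poly (P z) w = 0" if z: "z \<in> ball z0 \<delta>" for z
  proof -
    have zD: "z \<in> D" using z sub by auto
    have "norm (poly (P z) w0) < norm (lead_coeff (P z)) * \<epsilon> ^ d"
      using d1(2)[of z] z del lc[OF zD] by (simp add: dist_commute)
    from root_near[OF P_nz[OF zD] deg[OF zD] eps(1) this] show ?thesis by (metis mem_ball)
  qed
  have uni: "w = w'" if "z \<in> ball z0 \<delta>" "w \<in> ball w0 \<epsilon>" "w' \<in> ball w0 \<epsilon>" "poly (P z) w = 0" "poly (P z) w' = 0" for z w w'
  proof -
    have zD: "z \<in> D" using that sub by auto
    have "(w - w') * dquot d (P z) w w' = 0" using poly_diff_dquot[of "P z" d w w'] deg[OF zD] that by simp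
    moreover have "norm (dquot d (P z) w w') \<ge> m" using A[of z w w'] that del by (simp add: dist_commute)
    ultimately show ?thesis using m0 by auto
  qed
  define Y where "Y z = (SOME w. w \<in> ball w0 \<epsilon> \<and> poly (P z) w = 0)" for z
  have Y: "Y z \<in> ball w0 \<epsilon> \<and> poly (P z) (Y z) = 0" if "z \<in> ball z0 \<delta>" for z
    unfolding Y_def by (rule someI_ex[OF ex[OF that]])
  have "(Y has_field_derivative - (deriv (\<lambda>z. poly (P z) (Y z1)) z1) / dquot d (P z1) (Y z1) (Y z1)) (at z1)" if z1: "z1 \<in> ball z0 \<delta>" for z1
  proof -
    define g where "g z = poly (P z) (Y z1)" for z
    have g: "g holomorphic_on D" unfolding g_def by (rule holo_poly)
    have z1D: "z1 \<in> D" using sub z1 by auto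
    have evb: "\<forall>\<^sub>F z in nhds z1. z \<in> ball z0 \<delta>" using z1 by (intro eventually_nhds_in_open) auto
    \<comment> \<open>\<open>P z\<close> vanishes at \<open>Y z\<close>, and g vanishes at z1, so
      the increment of Y times the divided difference is minus the increment of g. The lower bound m
      gives the continuity of Y, and the limit of the divided difference then gives the
      derivative.\<close>
    have id: "Y z - Y z1 = - (g z - g z1) / dquot d (P z) (Y z) (Y z1) \<and> norm (dquot d (P z) (Y z) (Y z1)) \<ge> m" if z: "z \<in> ball z0 \<delta>" for z
    proof -
      have zD: "z \<in> D" using z sub by auto
      have Am: "norm (dquot d (P z) (Y z) (Y z1)) \<ge> m" using A[of z "Y z" "Y z1"] z z1 del Y[OF z] Y[OF z1] by (simp add: dist_commute)
      have "(Y z - Y z1) * dquot d (P z) (Y z) (Y z1) = - (g z - g z1)"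
        using poly_diff_dquot[of "P z" d "Y z" "Y z1"] deg[OF zD] Y[OF z] Y[OF z1] by (simp add: g_def)
      moreover have "dquot d (P z) (Y z) (Y z1) \<noteq> 0" using Am m0 by auto
      ultimately show ?thesis using Am by (simp add: field_simps)
    qed
    have gc: "(g \<longlongrightarrow> g z1) (nhds z1)"
    proof -
      have "isCont g z1" using holomorphic_on_imp_continuous_on[OF g] D z1D continuous_on_eq_continuous_at by blast
      then show ?thesis by (rule isCont_tendsto_nhds)
    qed
    have Yc: "(Y \<longlongrightarrow> Y z1) (nhds z1)"
    proof (rule Lim_null[THEN iffD2], rule Lim_null_comparison)
      show "\<forall>\<^sub>F z in nhds z1. norm (Y z - Y z1) \<le> norm (g z - g z1) / m"
        using evb
      proof eventually_elim
        case (elim z)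
        have i: "Y z - Y z1 = - (g z - g z1) / dquot d (P z) (Y z) (Y z1)" "norm (dquot d (P z) (Y z) (Y z1)) \<ge> m"
          using id[OF elim] by auto
        show ?case unfolding i(1) norm_divide norm_minus_cancel
          using i(2) m0 by (intro divide_left_mono) (auto intro!: mult_pos_pos)
      qed
      have "((\<lambda>z. norm (g z - g z1) / m) \<longlongrightarrow> norm (g z1 - g z1) / m) (nhds z1)"
        by (intro tendsto_intros gc) (use m0 in auto)
      then show "((\<lambda>z. norm (g z - g z1) / m) \<longlongrightarrow> 0) (nhds z1)" by simp
    qed
    have Ac: "((\<lambda>z. dquot d (P z) (Y z) (Y z1)) \<longlongrightarrow> dquot d (P z1) (Y z1) (Y z1)) (at z1)"
    proof -
      have "isCont ?A (z1, Y z1, Y z1)" using cA oD z1D continuous_on_eq_continuous_at by blast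
      moreover have "((\<lambda>z. (z, Y z, Y z1)) \<longlongrightarrow> (z1, Y z1, Y z1)) (at z1)"
        by (intro tendsto_intros tendsto_mono[OF _ Yc]) (simp add: at_within_def)
      ultimately show ?thesis using isCont_tendsto_compose[of _ ?A] by fastforce
    qed
    have A1: "dquot d (P z1) (Y z1) (Y z1) \<noteq> 0" using id[OF z1] m0 by auto
    have "(g has_field_derivative deriv g z1) (at z1)" using holomorphic_derivI[OF g D z1D] .
    then have "((\<lambda>z. (g z - g z1) / (z - z1)) \<longlongrightarrow> deriv g z1) (at z1)" by (simp add: has_field_derivative_iff)
    then have "((\<lambda>z. - ((g z - g z1) / (z - z1)) / dquot d (P z) (Y z) (Y z1)) \<longlongrightarrow> - deriv g z1 / dquot d (P z1) (Y z1) (Y z1)) (at z1)"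
      by (intro tendsto_intros Ac A1)
    then have "((\<lambda>z. (Y z - Y z1) / (z - z1)) \<longlongrightarrow> - deriv g z1 / dquot d (P z1) (Y z1) (Y z1)) (at z1)"
    proof (rule Lim_transform_eventually)
      show "\<forall>\<^sub>F z in at z1. - ((g z - g z1) / (z - z1)) / dquot d (P z) (Y z) (Y z1) = (Y z - Y z1) / (z - z1)"
        unfolding eventually_at_filter using evb
      proof eventually_elim
        case (elim z)
        have "Y z - Y z1 = - (g z - g z1) / dquot d (P z) (Y z) (Y z1)" using id[OF elim] by blast
        moreover have "- (N / h) / q = (- N / q) / h" for N h q :: complex
          by (simp add: divide_inverse mult_ac)
        ultimately show ?case by (simp only: simp_thms)
      qed
    qed
    then show ?thesis by (simp add: has_field_derivative_iff g_def[abs_def])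
  qed
  then have "Y field_differentiable (at z1)" if "z1 \<in> ball z0 \<delta>" for z1
    using that unfolding field_differentiable_def by blast
  then have "Y holomorphic_on ball z0 \<delta>"
    by (auto simp: holomorphic_on_def intro: field_differentiable_at_within)
  moreover have "Y z0 = w0" using uni[of z0 "Y z0" w0] Y[of z0] del eps w0 by simp
  ultimately show ?thesis using that[of \<delta> \<epsilon> Y] del eps sub Y uni by blast
qed

text \<open>Cauchy's bound: once \<open>norm w\<close> exceeds 1 + C, the leading term is larger
  than the sum of the others. On a compact set the coefficients are bounded, which makes C
  uniform.\<close>

lemma roots_bounded:
  assumes "compact K" "K \<subseteq> D"
  obtains M where "\<And>z w. z \<in> K \<Longrightarrow> poly (P z) w = 0 \<Longrightarrow> norm w \<le> M"
proof -
  have "\<exists>M. \<forall>z\<in>K. norm (coeff (P z) j) \<le> M" for j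
  proof -
    have "compact ((\<lambda>z. coeff (P z) j) ` K)"
      using holomorphic_on_imp_continuous_on[OF holo] assms continuous_on_subset by (blast intro: compact_continuous_image)
    then have "bounded ((\<lambda>z. coeff (P z) j) ` K)" by (rule compact_imp_bounded)
    then show ?thesis unfolding bounded_iff by auto
  qed
  then obtain M where M: "\<And>z j. z \<in> K \<Longrightarrow> norm (coeff (P z) j) \<le> M j" by metis
  define C where "C = (\<Sum>j<d. \<bar>M j\<bar>) / norm a"
  have C0: "C \<ge> 0" by (auto simp: C_def intro!: sum_nonneg divide_nonneg_nonneg)
  have "norm w \<le> 1 + C" if z: "z \<in> K" and w: "poly (P z) w = 0" for z w
  proof (rule ccontr)
    assume "\<not> norm w \<le> 1 + C"
    then have w1: "norm w > 1 + C" by simp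
    have zD: "z \<in> D" using z assms by auto
    have d0: "d > 0"
    proof (rule ccontr)
      assume "\<not> d > 0"
      then have "degree (P z) = 0" using deg[OF zD] by simp
      then obtain c where c: "P z = [:c:]" by (rule degree_eq_zeroE)
      then have "c = a" using lc[OF zD] by simp
      then show False using w a0 c by simp
    qed
    have cd: "coeff (P z) d = a" using lc[OF zD] deg[OF zD] by simp
    have "poly (P z) w = (\<Sum>j<d. coeff (P z) j * w ^ j) + a * w ^ d"
      unfolding poly_P[OF zD] lessThan_Suc_atMost[symmetric] by (simp add: cd)
    then have "(\<Sum>j<d. coeff (P z) j * w ^ j) = - (a * w ^ d)"
      using w by (simp add: eq_neg_iff_add_eq_0)
    then have "norm a * norm w ^ d = norm (\<Sum>j<d. coeff (P z) j * w ^ j)" by (simp add: norm_mult norm_power)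
    also have "\<dots> \<le> (\<Sum>j<d. \<bar>M j\<bar> * norm w ^ (d - 1))"
    proof (rule sum_norm_le)
      fix j assume j: "j \<in> {..<d}"
      have "norm w ^ j \<le> norm w ^ (d - 1)" using w1 C0 j by (intro power_increasing) auto
      moreover have "norm (coeff (P z) j) \<le> \<bar>M j\<bar>" using M[OF z, of j] by linarith
      ultimately show "norm (coeff (P z) j * w ^ j) \<le> \<bar>M j\<bar> * norm w ^ (d - 1)"
        unfolding norm_mult norm_power by (intro mult_mono) auto
    qed
    also have "\<dots> = norm a * C * norm w ^ (d - 1)" using a0 by (simp add: C_def sum_distrib_right)
    also have "\<dots> < norm a * norm w * norm w ^ (d - 1)"
      using a0 w1 C0 by (intro mult_strict_right_mono mult_strict_left_mono) (auto intro!: zero_less_power)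
    also have "\<dots> = norm a * norm w ^ d" using d0 by (cases d) auto
    finally show False by simp
  qed
  then show ?thesis by (rule that)
qed

end

locale simple_monic_family = monic_family +
  assumes simple: "\<And>z w. z \<in> D \<Longrightarrow> poly (P z) w = 0 \<Longrightarrow> poly (pderiv (P z)) w \<noteq> 0"
    and d0: "d > 0"
begin

definition RR :: "(complex \<times> complex) set" where
  "RR = {(z, w). z \<in> D \<and> poly (P z) w = 0}"

lemma finite_roots: "z \<in> D \<Longrightarrow> finite {w. poly (P z) w = 0}"
  using P_nz poly_roots_finite by blast

lemma card_roots: "z \<in> D \<Longrightarrow> card {w. poly (P z) w = 0} = d"
proof -
  assume z: "z \<in> D"
  have "rsquarefree (P z)" using simple[OF z] by (auto simp: rsquarefree_roots)
  then have "smult (lead_coeff (P z)) (\<Prod>w | poly (P z) w = 0. [:- w, 1:]) = P z"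
    by (rule complex_poly_decompose_rsquarefree)
  then have "degree (\<Prod>w | poly (P z) w = 0. [:- w, 1:]) = d"
    using deg[OF z] P_nz[OF z] by (metis degree_smult_eq leading_coeff_0_iff)
  moreover have "degree (\<Prod>w | poly (P z) w = 0. [:- w, 1:]) = (\<Sum>w | poly (P z) w = 0. degree [:- w, 1:])"
    by (rule degree_prod_eq_sum_degree) auto
  ultimately show ?thesis by simp
qed

text \<open>The implicit functions at the d roots over z0 have disjoint ranges and so give d
  different roots over every nearby z. There are no others, because each fibre has exactly d
  elements; the graphs of these functions are the sheets.\<close>

lemma covering: "covering_space RR fst D"
  unfolding covering_space_def
proof (intro conjI ballI)
  show "continuous_on RR fst" by (intro continuous_intros)
  show "fst ` RR = D"
  proof
    show "D \<subseteq> fst ` RR"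
    proof
      fix z assume z: "z \<in> D"
      have "{w. poly (P z) w = 0} \<noteq> {}" using card_roots[OF z] d0 by force
      then show "z \<in> fst ` RR" using z by (force simp: RR_def)
    qed
  qed (auto simp: RR_def)
  fix z0 assume z0: "z0 \<in> D"
  define R where "R = {w. poly (P z0) w = 0}"
  have fR: "finite R" and cR: "card R = d" using finite_roots card_roots z0 by (auto simp: R_def)
  have "\<exists>e>0. \<forall>w\<in>R. \<forall>w'\<in>R. w \<noteq> w' \<longrightarrow> e \<le> dist w w'"
  proof -
      define X where "X = (\<lambda>(w, w'). dist w w') ` {(w, w') \<in> R \<times> R. w \<noteq> w'}"
      have "finite {(w, w') \<in> R \<times> R. w \<noteq> w'}" using fR by (auto intro: finite_subset[of _ "R \<times> R"])
      \<comment> \<open>The element 1 keeps the minimum defined when there is a single root and thus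
        no distance between different roots.\<close>
      then have fX: "finite (insert 1 X)" unfolding X_def by (intro finite.insertI finite_imageI)
      have "\<forall>x\<in>insert 1 X. x > 0" by (auto simp: X_def)
      then have "Min (insert 1 X) > 0" using fX by (subst Min_gr_iff) auto
      moreover have "Min (insert 1 X) \<le> dist w w'" if "w \<in> R" "w' \<in> R" "w \<noteq> w'" for w w'
        using fX that by (intro Min_le) (auto simp: X_def)
      ultimately show ?thesis by blast
  qed
  then obtain e where e: "e > 0" "\<And>w w'. w \<in> R \<Longrightarrow> w' \<in> R \<Longrightarrow> w \<noteq> w' \<Longrightarrow> e \<le> dist w w'" by blast
  have "\<forall>w\<in>R. \<exists>\<delta> \<epsilon> Y. \<delta> > 0 \<and> \<epsilon> \<le> e / 2 \<and> Y holomorphic_on ball z0 \<delta> \<and>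
    (\<forall>z\<in>ball z0 \<delta>. Y z \<in> ball w \<epsilon> \<and> poly (P z) (Y z) = 0) \<and>
    (\<forall>z\<in>ball z0 \<delta>. \<forall>w'\<in>ball w \<epsilon>. poly (P z) w' = 0 \<longrightarrow> w' = Y z)"
  proof
    fix w assume w: "w \<in> R"
    then have pw: "poly (P z0) w = 0" by (simp add: R_def)
    have e2: "e / 2 > 0" using e by simp
    show "\<exists>\<delta> \<epsilon> Y. \<delta> > 0 \<and> \<epsilon> \<le> e / 2 \<and> Y holomorphic_on ball z0 \<delta> \<and>
      (\<forall>z\<in>ball z0 \<delta>. Y z \<in> ball w \<epsilon> \<and> poly (P z) (Y z) = 0) \<and>
      (\<forall>z\<in>ball z0 \<delta>. \<forall>w'\<in>ball w \<epsilon>. poly (P z) w' = 0 \<longrightarrow> w' = Y z)"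
      by (rule simple_root[OF z0 pw simple[OF z0 pw] e2]) blast
  qed
  then obtain \<delta> \<epsilon> Y where Y: "\<And>w. w \<in> R \<Longrightarrow> \<delta> w > 0 \<and> \<epsilon> w \<le> e / 2 \<and> Y w holomorphic_on ball z0 (\<delta> w) \<and>
    (\<forall>z\<in>ball z0 (\<delta> w). Y w z \<in> ball w (\<epsilon> w) \<and> poly (P z) (Y w z) = 0) \<and>
    (\<forall>z\<in>ball z0 (\<delta> w). \<forall>w'\<in>ball w (\<epsilon> w). poly (P z) w' = 0 \<longrightarrow> w' = Y w z)" by metis
  obtain \<rho> where rho: "\<rho> > 0" "ball z0 \<rho> \<subseteq> D" using D z0 open_contains_ball by blast
  define m where "m = Min (insert \<rho> (\<delta> ` R))"
  have m0: "m > 0" unfolding m_def using fR rho Y by (subst Min_gr_iff) auto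
  have mle: "m \<le> \<rho>" "\<And>w. w \<in> R \<Longrightarrow> m \<le> \<delta> w" unfolding m_def using fR by (auto intro: Min_le)
  define T where "T = ball z0 m"
  have TD: "T \<subseteq> D" using rho mle by (auto simp: T_def)
  have Td: "z \<in> ball z0 (\<delta> w)" if "z \<in> T" "w \<in> R" for z w using that mle(2)[of w] by (auto simp: T_def)
  define V where "V w = (\<lambda>z. (z, Y w z)) ` T" for w
  \<comment> \<open>The radii are at most half of the least distance between two roots over
    z0.\<close>
  have disj: "w = w'" if "w \<in> R" "w' \<in> R" "x \<in> ball w (\<epsilon> w)" "x \<in> ball w' (\<epsilon> w')" for w w' x
  proof (rule ccontr)
    assume "w \<noteq> w'"
    then have "e \<le> dist w w'" using e that by blast
    also have "\<dots> \<le> dist w x + dist x w'" by (rule dist_triangle)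
    also have "\<dots> < e / 2 + e / 2" using that Y[OF that(1)] Y[OF that(2)] by (intro add_strict_mono) (auto simp: dist_commute)
    finally show False by simp
  qed
  have roots: "{w. poly (P z) w = 0} = (\<lambda>w. Y w z) ` R" if z: "z \<in> T" for z
  proof -
    have zD: "z \<in> D" using z TD by auto
    have "inj_on (\<lambda>w. Y w z) R"
    proof (rule inj_onI)
      fix w w' assume w: "w \<in> R" "w' \<in> R" "Y w z = Y w' z"
      show "w = w'" using disj[OF w(1,2), of "Y w z"] Y[OF w(1)] Y[OF w(2)] Td[OF z w(1)] Td[OF z w(2)] w(3) by metis
    qed
    then have "card ((\<lambda>w. Y w z) ` R) = d" using cR by (simp add: card_image)
    moreover have "(\<lambda>w. Y w z) ` R \<subseteq> {w. poly (P z) w = 0}" using Y Td[OF z] by auto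
    ultimately show ?thesis using card_roots[OF zD] finite_roots[OF zD] card_subset_eq by metis
  qed
  show "\<exists>T. z0 \<in> T \<and> openin (top_of_set D) T \<and> (\<exists>v. \<Union> v = RR \<inter> fst -` T \<and>
          (\<forall>u\<in>v. openin (top_of_set RR) u) \<and> pairwise disjnt v \<and> (\<forall>u\<in>v. Ex (homeomorphism u T fst)))"
  proof (intro exI conjI)
    show "z0 \<in> T" using m0 by (simp add: T_def)
    show "openin (top_of_set D) T" using TD by (intro open_subset) (auto simp: T_def)
    show "\<Union> (V ` R) = RR \<inter> fst -` T"
    proof
      show "\<Union> (V ` R) \<subseteq> RR \<inter> fst -` T" using TD Y Td by (fastforce simp: V_def RR_def)
      show "RR \<inter> fst -` T \<subseteq> \<Union> (V ` R)"
      proof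
        fix x assume "x \<in> RR \<inter> fst -` T"
        then obtain z w where x: "x = (z, w)" "z \<in> T" "poly (P z) w = 0" by (auto simp: RR_def)
        then obtain w' where "w' \<in> R" "w = Y w' z" using roots[OF x(2)] by blast
        then show "x \<in> \<Union> (V ` R)" using x by (auto simp: V_def)
      qed
    qed
    show "\<forall>u\<in>V ` R. openin (top_of_set RR) u"
    proof
      fix u assume "u \<in> V ` R"
      then obtain w where w: "w \<in> R" "u = V w" by blast
      have "u = RR \<inter> (T \<times> ball w (\<epsilon> w))"
      proof
        show "u \<subseteq> RR \<inter> (T \<times> ball w (\<epsilon> w))" using w TD Y[OF w(1)] Td[OF _ w(1)] by (auto simp: V_def RR_def)
        show "RR \<inter> (T \<times> ball w (\<epsilon> w)) \<subseteq> u" using w Y[OF w(1)] Td[OF _ w(1)] by (auto simp: V_def RR_def)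
      qed
      then show "openin (top_of_set RR) u" by (auto simp: openin_open T_def intro!: exI[of _ "T \<times> ball w (\<epsilon> w)"] open_Times)
    qed
    show "pairwise disjnt (V ` R)"
    proof (rule pairwiseI)
      fix u u' assume "u \<in> V ` R" "u' \<in> V ` R" and ne: "u \<noteq> u'"
      then obtain w w' where w: "w \<in> R" "u = V w" "w' \<in> R" "u' = V w'" by blast
      show "disjnt u u'"
        unfolding disjnt_iff
      proof (intro allI notI)
        fix x assume "x \<in> u \<and> x \<in> u'"
        then obtain z where z: "z \<in> T" "Y w z = Y w' z" using w by (auto simp: V_def)
        then have "w = w'" using disj[OF w(1,3), of "Y w z"] Y[OF w(1)] Y[OF w(3)] Td[OF z(1) w(1)] Td[OF z(1) w(3)] by metis
        then show False using ne w by simp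
      qed
    qed
    show "\<forall>u\<in>V ` R. Ex (homeomorphism u T fst)"
    proof
      fix u assume "u \<in> V ` R"
      then obtain w where w: "w \<in> R" "u = V w" by blast
      have "continuous_on T (Y w)"
        using holomorphic_on_imp_continuous_on Y[OF w(1)] Td[OF _ w(1)] continuous_on_subset by (metis subsetI)
      then have "homeomorphism u T fst (\<lambda>z. (z, Y w z))"
        unfolding homeomorphism_def w V_def by (auto simp: image_image intro!: continuous_intros)
      then show "Ex (homeomorphism u T fst)" by blast
    qed
  qed
qed

text \<open>Lifting along a covering yields only continuity; near each point a continuous root has
  to coincide with the holomorphic implicit function.\<close>

lemma continuous_root_holomorphic:
  assumes y: "continuous_on D y" and r: "\<And>z. z \<in> D \<Longrightarrow> poly (P z) (y z) = 0"
  shows "y holomorphic_on D"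
proof -
  have "y field_differentiable at z0" if z0: "z0 \<in> D" for z0
  proof -
    obtain \<delta> \<epsilon> Y where Y: "\<delta> > 0" "\<epsilon> > 0" "ball z0 \<delta> \<subseteq> D" "Y holomorphic_on ball z0 \<delta>"
      "\<And>z w. z \<in> ball z0 \<delta> \<Longrightarrow> w \<in> ball (y z0) \<epsilon> \<Longrightarrow> poly (P z) w = 0 \<Longrightarrow> w = Y z"
      using simple_root[OF z0 r[OF z0] simple[OF z0 r[OF z0]], of 1] by (metis zero_less_one)
    have "isCont y z0" using y z0 D continuous_on_eq_continuous_at by blast
    then have "\<forall>\<^sub>F z in nhds z0. y z \<in> ball (y z0) \<epsilon>"
      using isCont_tendsto_nhds[of z0 y] Y(2) by (intro topological_tendstoD[where l = "y z0"]) auto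
    moreover have "\<forall>\<^sub>F z in nhds z0. z \<in> ball z0 \<delta>" using Y by (intro eventually_nhds_in_open) auto
    ultimately have "\<forall>\<^sub>F z in nhds z0. Y z = y z"
    proof eventually_elim
      case (elim z)
      then show ?case using Y(3) Y(5)[of z "y z"] r[of z] by auto
    qed
    moreover have "Y field_differentiable at z0" using Y by (meson centre_in_ball holomorphic_on_imp_differentiable_at open_ball)
    ultimately show ?thesis unfolding field_differentiable_def using DERIV_cong_ev[of z0 z0 Y y] by blast
  qed
  then show ?thesis by (auto simp: holomorphic_on_def intro: field_differentiable_at_within)
qed

text \<open>The sheet is a lift of the identity map along the covering. It exists because a convex
  open set is simply connected and locally path connected.\<close>

lemma global_sheet:
  assumes cv: "convex D" and z0: "z0 \<in> D" and w0: "poly (P z0) w0 = 0"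
  obtains y where "y holomorphic_on D" "y z0 = w0" "\<And>z. z \<in> D \<Longrightarrow> poly (P z) (y z) = 0"
proof -
  have "simply_connected D" "locally path_connected D"
    using cv D by (auto intro: convex_imp_simply_connected open_imp_locally_path_connected)
  then obtain g where g: "continuous_on D g" "g \<in> D \<rightarrow> RR" "g z0 = (z0, w0)" "\<And>z. z \<in> D \<Longrightarrow> fst (g z) = z"
    using covering_space_lift_strong[OF covering, of "(z0, w0)" z0 D "\<lambda>z. z"] z0 w0
    by (auto simp: RR_def continuous_on_id)
  define y where "y z = snd (g z)" for z
  have yc: "continuous_on D y" unfolding y_def using g(1) by (intro continuous_intros)
  have r: "poly (P z) (y z) = 0" if z: "z \<in> D" for z
  proof -
    have "g z \<in> RR" using g(2) z by blast
    then show ?thesis using g(4)[OF z] by (auto simp: RR_def y_def case_prod_unfold)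
  qed
  show ?thesis
  proof (rule that[of y])
    show "y holomorphic_on D" by (rule continuous_root_holomorphic[OF yc r])
    show "y z0 = w0" by (simp add: y_def g(3))
  qed (rule r)
qed

lemma sheet_unique:
  assumes cv: "convex D" and y: "y holomorphic_on D" "\<And>z. z \<in> D \<Longrightarrow> poly (P z) (y z) = 0"
    and y': "y' holomorphic_on D" "\<And>z. z \<in> D \<Longrightarrow> poly (P z) (y' z) = 0"
    and z0: "z0 \<in> D" "y z0 = y' z0" and z: "z \<in> D"
  shows "y z = y' z"
proof -
  have c: "continuous_on D y" "continuous_on D y'" using y y' holomorphic_on_imp_continuous_on by auto
  have "(\<lambda>z. (z, y z)) z = (\<lambda>z. (z, y' z)) z"
    by (rule covering_space_lift_unique[OF covering, of "\<lambda>z. (z, y z)" z0 "\<lambda>z. (z, y' z)" D "\<lambda>z. z" z])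
      (use assms c in \<open>auto simp: RR_def intro!: continuous_intros convex_connected\<close>)
  then show ?thesis by simp
qed

end

section \<open>Periodic functions on a half-plane and Puiseux parametrizations\<close>

lemma periodic_int:
  fixes u :: "complex \<Rightarrow> 'a"
  assumes per: "\<And>\<zeta>. Re \<zeta> < b \<Longrightarrow> u (\<zeta> + 2 * of_real pi * \<i> * of_nat n) = u \<zeta>" and "Re \<zeta> < b"
  shows "u (\<zeta> + 2 * of_real pi * \<i> * of_nat n * of_int k) = u \<zeta>"
proof -
  have nat: "u (\<zeta> + 2 * of_real pi * \<i> * of_nat n * of_nat k) = u \<zeta>" if "Re \<zeta> < b" for \<zeta> k
  proof (induction k)
    case (Suc k)
    have "u (\<zeta> + 2 * of_real pi * \<i> * of_nat n * of_nat k + 2 * of_real pi * \<i> * of_nat n) = u (\<zeta> + 2 * of_real pi * \<i> * of_nat n * of_nat k)"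
      using that by (intro per) simp
    then show ?case using Suc by (simp add: algebra_simps)
  qed simp
  show ?thesis
  proof (cases "k \<ge> 0")
    case True
    then show ?thesis using nat[OF assms(2), of "nat k"] by simp
  next
    case False
    have "u (\<zeta> + 2 * of_real pi * \<i> * of_nat n * of_int k + 2 * of_real pi * \<i> * of_nat n * of_nat (nat (-k))) = u (\<zeta> + 2 * of_real pi * \<i> * of_nat n * of_int k)"
      using assms(2) by (intro nat) simp
    then show ?thesis using False by simp
  qed
qed

text \<open>The map \<zeta> \<mapsto> exp (\<zeta> / n) sends the half-plane onto a punctured disc
  and identifies points that differ by multiples of 2 pi i n. Periodicity makes u a function on that
  disc, and boundedness removes the singularity at its centre.\<close>

lemma descend_periodic:
  fixes u :: "complex \<Rightarrow> complex"
  assumes rho: "\<rho> > 0" and n: "n \<ge> 1" and u: "u holomorphic_on {\<zeta>. Re \<zeta> < ln \<rho>}"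
    and per: "\<And>\<zeta>. Re \<zeta> < ln \<rho> \<Longrightarrow> u (\<zeta> + 2 * of_real pi * \<i> * of_nat n) = u \<zeta>"
    and bd: "\<And>\<zeta>. Re \<zeta> < ln \<rho> \<Longrightarrow> norm (u \<zeta>) \<le> M"
  obtains g where "g holomorphic_on ball 0 (root n \<rho>)" "\<And>\<zeta>. Re \<zeta> < ln \<rho> \<Longrightarrow> g (exp (\<zeta> / of_nat n)) = u \<zeta>"
proof -
  define r where "r = root n \<rho>"
  have r: "r > 0" "r ^ n = \<rho>" using rho n by (auto simp: r_def)
  have lnr: "ln \<rho> = of_nat n * ln r" using r ln_realpow[of r n] by simp
  have n0: "of_nat n \<noteq> (0::complex)" "real n > 0" using n by auto
  define g where "g s = u (of_nat n * Ln s)" for s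
  have gl: "g s = u (of_nat n * l)" if "exp l = s" "norm s < r" for s l
  proof -
    have s0: "s \<noteq> 0" using that by auto
    have "exp l = exp (Ln s)" using that s0 by simp
    then obtain k :: int where k: "l = Ln s + of_int (2 * k) * pi * \<i>" unfolding exp_eq by blast
    have "Re (Ln s) < ln r" using that s0 r by simp
    then have R: "Re (of_nat n * Ln s) < ln \<rho>" using n0(2) by (simp add: lnr)
    have "of_nat n * l = of_nat n * Ln s + 2 * of_real pi * \<i> * of_nat n * of_int k" by (simp add: k algebra_simps)
    then show ?thesis unfolding g_def using periodic_int[of "ln \<rho>" u n, OF per R, of k] by simp
  qed
  have ud: "u field_differentiable at \<zeta>" if "Re \<zeta> < ln \<rho>" for \<zeta>
    using u that by (intro holomorphic_on_imp_differentiable_at[OF u]) (auto intro: open_halfspace_Re_lt)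
  have "g field_differentiable at s0" if s0: "s0 \<noteq> 0" "norm s0 < r" for s0
  proof -
    have R: "Re (of_nat n * Ln s0) < ln \<rho>" using s0 r n0(2) by (simp add: lnr)
    obtain u' where u': "(u has_field_derivative u') (at (of_nat n * Ln s0))" using ud[OF R] unfolding field_differentiable_def by blast
    \<comment> \<open>A logarithm, up to the factor n, that is holomorphic near s0 even if s0 lies
      on the cut of \<open>Ln\<close>; by \<open>gl\<close> the value of g does not depend on the
      logarithm used.\<close>
    define L where "L s = of_nat n * (Ln s0 + Ln (s / s0))" for s
    have "(L has_field_derivative of_nat n * (1 / s0)) (at s0)"
      unfolding L_def using s0 by (auto intro!: derivative_eq_intros simp: field_simps)
    moreover have "(u has_field_derivative u') (at (L s0))" using u' s0 by (simp add: L_def)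
    ultimately have d: "((\<lambda>s. u (L s)) has_field_derivative u' * (of_nat n * (1 / s0))) (at s0)"
      by (rule DERIV_chain2[rotated])
    have "\<forall>\<^sub>F s in nhds s0. s \<in> ball 0 r - {0}" using s0 by (intro eventually_nhds_in_open) auto
    then have "\<forall>\<^sub>F s in nhds s0. u (L s) = g s"
    proof eventually_elim
      case (elim s)
      have "exp (Ln s0 + Ln (s / s0)) = s" using elim s0 by (simp add: exp_add)
      then show ?case using gl[of "Ln s0 + Ln (s / s0)" s] elim by (simp add: L_def)
    qed
    then have "(g has_field_derivative u' * (of_nat n * (1 / s0))) (at s0)"
      using d DERIV_cong_ev[of s0 s0 "\<lambda>s. u (L s)" g] by blast
    then show ?thesis unfolding field_differentiable_def by blast
  qed
  then have gh: "g holomorphic_on ball 0 r - {0}"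
    by (auto simp: holomorphic_on_def intro: field_differentiable_at_within)
  have gb: "norm (g s) \<le> M" if "s \<noteq> 0" "norm s < r" for s
  proof -
    have "Re (of_nat n * Ln s) < ln \<rho>" using that r n0(2) by (simp add: lnr)
    then show ?thesis using bd by (simp add: g_def)
  qed
  have "g \<in> O[at 0](\<lambda>_. 1)"
  proof (rule landau_o.bigI[where c = "max M 1"])
    have "\<forall>\<^sub>F s in at 0. s \<in> ball 0 r - {0}" using r by (intro eventually_at_in_open) auto
    then show "\<forall>\<^sub>F s in at 0. norm (g s) \<le> max M 1 * norm (1::complex)"
    proof eventually_elim
      case (elim s)
      then show ?case using gb[of s] by auto
    qed
  qed auto
  then obtain h where h: "h holomorphic_on ball 0 r" "\<forall>s\<in>ball 0 r - {0}. h s = g s"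
    using holomorphic_on_extend[OF gh] r by auto
  show ?thesis
  proof (rule that[of h])
    show "h holomorphic_on ball 0 (root n \<rho>)" using h(1) by (simp add: r_def)
    fix \<zeta> :: complex assume z: "Re \<zeta> < ln \<rho>"
    have nr: "norm (exp (\<zeta> / of_nat n)) < r"
    proof -
      have "Re \<zeta> / n < ln r" using z n0 by (simp add: lnr field_simps)
      then have "exp (Re \<zeta> / n) < r" using r by (metis exp_less_mono exp_ln)
      then show ?thesis by (simp add: norm_exp_eq_Re)
    qed
    have "h (exp (\<zeta> / of_nat n)) = g (exp (\<zeta> / of_nat n))" using h(2) nr by auto
    also have "\<dots> = u \<zeta>" using gl[OF refl nr] n0 by simp
    finally show "h (exp (\<zeta> / of_nat n)) = u \<zeta>" .
  qed
qed

lemma coeff_linear_factor_mult: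
  "coeff ([:- c, 1:] * p) j = (case j of 0 \<Rightarrow> 0 | Suc i \<Rightarrow> coeff p i) - (c::'a::comm_ring_1) * coeff p j"
  by (cases j) (simp_all add: mult_pCons_left)

lemma holomorphic_coeff_prod:
  fixes n :: nat
  assumes "\<And>k. k < n \<Longrightarrow> y k holomorphic_on S"
  shows "(\<lambda>z. coeff (\<Prod>k<n. [:- y k z, 1:]) j) holomorphic_on S"
  using assms
proof (induction n arbitrary: j)
  case (Suc n)
  then show ?case
    unfolding prod.lessThan_Suc mult.commute[of "prod _ _"] coeff_linear_factor_mult
    by (cases j) (auto intro!: holomorphic_intros)
qed auto

text \<open>Boundedness is what later allows symmetric functions of the sheets, holomorphic on a
  punctured disc, to be extended over its centre.\<close>

lemma bounded_coeff_prod: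
  fixes n :: nat and y :: "nat \<Rightarrow> 'b \<Rightarrow> complex"
  assumes "\<And>k z. k < n \<Longrightarrow> z \<in> S \<Longrightarrow> norm (y k z) \<le> M"
  shows "\<exists>M'. \<forall>z\<in>S. norm (coeff (\<Prod>k<n. [:- y k z, 1:]) j) \<le> M'"
  using assms
proof (induction n arbitrary: j)
  case 0
  show ?case by (intro exI[of _ 1]) (auto simp: coeff_1)
next
  case (Suc n)
  obtain M1 where M1: "\<And>z. z \<in> S \<Longrightarrow> norm (coeff (\<Prod>k<n. [:- y k z, 1:]) j) \<le> M1" using Suc by fastforce
  obtain M2 where M2: "\<And>z. z \<in> S \<Longrightarrow> norm (coeff (\<Prod>k<n. [:- y k z, 1:]) (j - 1)) \<le> M2" using Suc by fastforce
  have "norm (coeff (\<Prod>k<Suc n. [:- y k z, 1:]) j) \<le> \<bar>M2\<bar> + \<bar>M\<bar> * \<bar>M1\<bar>" if z: "z \<in> S" for z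
  proof -
    let ?p = "\<Prod>k<n. [:- y k z, 1:]"
    have "norm (coeff (\<Prod>k<Suc n. [:- y k z, 1:]) j) \<le> norm (case j of 0 \<Rightarrow> 0 | Suc i \<Rightarrow> coeff ?p i) + norm (y n z * coeff ?p j)"
      unfolding prod.lessThan_Suc mult.commute[of "prod _ _"] coeff_linear_factor_mult by (rule norm_triangle_ineq4)
    moreover have "norm (case j of 0 \<Rightarrow> 0 | Suc i \<Rightarrow> coeff ?p i) \<le> \<bar>M2\<bar>" using M2[OF z] by (cases j) auto
    moreover have "norm (y n z * coeff ?p j) \<le> \<bar>M\<bar> * \<bar>M1\<bar>"
    proof -
      have "norm (y n z) \<le> \<bar>M\<bar>" using Suc.prems[of n z] z by fastforce
      moreover have "norm (coeff ?p j) \<le> \<bar>M1\<bar>" using M1[OF z] by linarith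
      ultimately show ?thesis unfolding norm_mult by (intro mult_mono) auto
    qed
    ultimately show ?thesis by linarith
  qed
  then show ?case by blast
qed

text \<open>A Puiseux branch z = s ^ e, w = g s. The radius of the parameter disc is such that s ^ e
  sweeps out exactly the disc of radius \<rho>. The functions A are the coefficients of a polynomial
  in w that cuts out the image; they are what makes the image an analytic germ.\<close>

definition pbranch :: "real \<Rightarrow> nat \<Rightarrow> (complex \<Rightarrow> complex) \<Rightarrow> (nat \<Rightarrow> complex \<Rightarrow> complex) \<Rightarrow> bool" where
  "pbranch \<rho> e g A \<longleftrightarrow> e \<ge> 1 \<and> g holomorphic_on ball 0 (root e \<rho>) \<and>
     inj_on (\<lambda>s. (s ^ e, g s)) (ball 0 (root e \<rho>)) \<and> (\<forall>j. A j holomorphic_on ball 0 \<rho>) \<and>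
     (\<forall>z\<in>ball 0 \<rho>. \<forall>w. (\<Sum>j\<le>e. A j z * w ^ j) = 0 \<longleftrightarrow> (\<exists>s\<in>ball 0 (root e \<rho>). z = s ^ e \<and> w = g s))"

locale puiseux = monic_family +
  fixes \<rho> :: real
  assumes rho: "\<rho> > 0" "cball 0 \<rho> \<subseteq> D" and d0: "d > 0"
    and simple: "\<And>z w. z \<in> ball 0 \<rho> - {0} \<Longrightarrow> poly (P z) w = 0 \<Longrightarrow> poly (pderiv (P z)) w \<noteq> 0"
begin

text \<open>The half-plane is the universal covering of the punctured disc by \<open>exp\<close>. It
  is convex and roots do not collide over it, so every root extends to a global sheet; monodromy
  returns as translation by 2 pi i.\<close>

definition H where "H = {\<zeta>. Re \<zeta> < ln \<rho>}"

lemma H_exp: "\<zeta> \<in> H \<longleftrightarrow> exp \<zeta> \<in> ball 0 \<rho>"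
proof -
  have "Re \<zeta> < ln \<rho> \<longleftrightarrow> exp (Re \<zeta>) < \<rho>" using rho(1) by (metis exp_less_cancel_iff exp_ln)
  then show ?thesis by (simp add: H_def norm_exp_eq_Re)
qed

lemma H_open: "open H" and H_convex: "convex H"
  unfolding H_def by (rule open_halfspace_Re_lt, rule convex_halfspace_Re_lt)

lemma H_shift: "\<zeta> + 2 * of_real pi * \<i> * of_int k \<in> H \<longleftrightarrow> \<zeta> \<in> H"
  by (simp add: H_def)

lemma exp_shift: "exp (\<zeta> + 2 * of_real pi * \<i> * of_int k) = exp \<zeta>"
  using exp_eq[of "\<zeta> + 2 * of_real pi * \<i> * of_int k" \<zeta>] by (auto simp: algebra_simps intro!: exI[of _ k])

sublocale Q: simple_monic_family "\<lambda>\<zeta>. P (exp \<zeta>)" H d a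
proof
  have D': "exp \<zeta> \<in> D" if "\<zeta> \<in> H" for \<zeta> using that rho(2) by (auto simp: H_exp)
  show "open H" by (rule H_open)
  show "degree (P (exp \<zeta>)) = d" "lead_coeff (P (exp \<zeta>)) = a" if "\<zeta> \<in> H" for \<zeta> using deg lc D'[OF that] by auto
  show "a \<noteq> 0" by (rule a0)
  show "(\<lambda>\<zeta>. coeff (P (exp \<zeta>)) j) holomorphic_on H" for j
    using holomorphic_on_compose_gen[OF _ holo[of j], of exp H] D' by (auto simp: o_def intro: holomorphic_intros)
  show "poly (pderiv (P (exp \<zeta>))) w \<noteq> 0" if "\<zeta> \<in> H" "poly (P (exp \<zeta>)) w = 0" for \<zeta> w
    using simple[of "exp \<zeta>" w] that by (auto simp: H_exp)
  show "d > 0" by (rule d0)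
qed

definition sheet :: "(complex \<Rightarrow> complex) \<Rightarrow> bool" where
  "sheet y \<longleftrightarrow> y holomorphic_on H \<and> (\<forall>\<zeta>\<in>H. poly (P (exp \<zeta>)) (y \<zeta>) = 0)"

lemma sheet_shift: "sheet y \<Longrightarrow> sheet (\<lambda>\<zeta>. y (\<zeta> + 2 * of_real pi * \<i> * of_int k))"
  unfolding sheet_def
proof safe
  assume y: "y holomorphic_on H" "\<forall>\<zeta>\<in>H. poly (P (exp \<zeta>)) (y \<zeta>) = 0"
  have "(y \<circ> (\<lambda>\<zeta>. \<zeta> + 2 * of_real pi * \<i> * of_int k)) holomorphic_on H"
    by (rule holomorphic_on_compose_gen[OF _ y(1)]) (auto simp: H_shift intro!: holomorphic_intros)
  then show "(\<lambda>\<zeta>. y (\<zeta> + 2 * of_real pi * \<i> * of_int k)) holomorphic_on H" by (simp add: o_def)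
  show "poly (P (exp \<zeta>)) (y (\<zeta> + 2 * of_real pi * \<i> * of_int k)) = 0" if "\<zeta> \<in> H" for \<zeta>
    using y(2) that H_shift exp_shift by metis
qed

lemma sheet_eq: "sheet y \<Longrightarrow> sheet y' \<Longrightarrow> \<zeta>0 \<in> H \<Longrightarrow> y \<zeta>0 = y' \<zeta>0 \<Longrightarrow> \<zeta> \<in> H \<Longrightarrow> y \<zeta> = y' \<zeta>"
  unfolding sheet_def using Q.sheet_unique[OF H_convex, of y y' \<zeta>0 \<zeta>] by blast

lemma sheet_ex:
  assumes "\<zeta>0 \<in> H" "poly (P (exp \<zeta>0)) w0 = 0" obtains y where "sheet y" "y \<zeta>0 = w0"
  using Q.global_sheet[OF H_convex assms] unfolding sheet_def by metis

lemma sheet_period_if_eq: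
  assumes y: "sheet y" and z: "\<zeta>0 \<in> H" "y (\<zeta>0 + 2 * of_real pi * \<i> * of_int k) = y \<zeta>0" and h: "\<zeta> \<in> H"
  shows "y (\<zeta> + 2 * of_real pi * \<i> * of_int k) = y \<zeta>"
  using sheet_eq[OF sheet_shift[OF y] y z(1) z(2) h] by simp

text \<open>The translates of a sheet take values in the finite set of roots over one point, so two
  of them agree there; sheets that agree at one point agree everywhere.\<close>

lemma sheet_period:
  assumes y: "sheet y"
  obtains n :: nat where "n \<ge> 1" "\<And>\<zeta>. \<zeta> \<in> H \<Longrightarrow> y (\<zeta> + 2 * of_real pi * \<i> * of_nat n) = y \<zeta>"
proof -
  define \<zeta>0 :: complex where "\<zeta>0 = of_real (ln \<rho> - 1)"
  have z0: "\<zeta>0 \<in> H" by (simp add: \<zeta>0_def H_def)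
  define f where "f k = y (\<zeta>0 + 2 * of_real pi * \<i> * of_int (int k))" for k :: nat
  have "range f \<subseteq> {w. poly (P (exp \<zeta>0)) w = 0}"
    using sheet_shift[OF y] z0 unfolding sheet_def f_def by blast
  then have "finite (range f)" using Q.finite_roots[OF z0] finite_subset by blast
  then have "\<not> inj f" using finite_imageD infinite_UNIV_nat by blast
  then obtain j k where jk: "j < k" "f j = f k" unfolding inj_def by (metis linorder_neqE_nat)
  define \<zeta>1 where "\<zeta>1 = \<zeta>0 + 2 * of_real pi * \<i> * of_int (int j)"
  have z1: "\<zeta>1 \<in> H" using z0 H_shift unfolding \<zeta>1_def by blast
  have kj: "\<zeta>1 + 2 * of_real pi * \<i> * of_int (int (k - j)) = \<zeta>0 + 2 * of_real pi * \<i> * of_int (int k)"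
    using jk(1) by (simp add: \<zeta>1_def of_nat_diff algebra_simps)
  have "y (\<zeta>1 + 2 * of_real pi * \<i> * of_int (int (k - j))) = y \<zeta>1"
    unfolding kj using jk(2) unfolding f_def \<zeta>1_def by (rule sym)
  then have "y (\<zeta> + 2 * of_real pi * \<i> * of_int (int (k - j))) = y \<zeta>" if "\<zeta> \<in> H" for \<zeta>
    using sheet_period_if_eq[OF y z1 _ that] by blast
  then show ?thesis using jk(1) that[of "k - j"] by simp
qed

lemma sheet_bounded: "\<exists>M. \<forall>y \<zeta>. sheet y \<longrightarrow> \<zeta> \<in> H \<longrightarrow> norm (y \<zeta>) \<le> M"
proof -
  obtain M where M: "\<And>z w. z \<in> cball 0 \<rho> \<Longrightarrow> poly (P z) w = 0 \<Longrightarrow> norm w \<le> M"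
    using roots_bounded[of "cball 0 \<rho>"] rho(2) by auto
  have "norm (y \<zeta>) \<le> M" if "sheet y" "\<zeta> \<in> H" for y \<zeta>
    using M[of "exp \<zeta>" "y \<zeta>"] that H_exp[of \<zeta>] unfolding sheet_def by auto
  then show ?thesis by blast
qed

lemma descend:
  assumes n: "n \<ge> 1" and u: "u holomorphic_on H"
    and per: "\<And>\<zeta>. \<zeta> \<in> H \<Longrightarrow> u (\<zeta> + 2 * of_real pi * \<i> * of_nat n) = u \<zeta>"
    and bd: "\<And>\<zeta>. \<zeta> \<in> H \<Longrightarrow> norm (u \<zeta>) \<le> M"
  shows "\<exists>g. g holomorphic_on ball 0 (root n \<rho>) \<and> (\<forall>\<zeta>\<in>H. g (exp (\<zeta> / of_nat n)) = u \<zeta>)"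
proof (rule descend_periodic[OF rho(1) n, of u M])
  show "u holomorphic_on {\<zeta>. Re \<zeta> < ln \<rho>}" using u by (simp add: H_def)
  show "u (\<zeta> + 2 * of_real pi * \<i> * of_nat n) = u \<zeta>" if "Re \<zeta> < ln \<rho>" for \<zeta>
    using per[of \<zeta>] that by (simp add: H_def)
  show "norm (u \<zeta>) \<le> M" if "Re \<zeta> < ln \<rho>" for \<zeta> using bd[of \<zeta>] that by (simp add: H_def)
  fix g assume "g holomorphic_on ball 0 (root n \<rho>)" "\<And>\<zeta>. Re \<zeta> < ln \<rho> \<Longrightarrow> g (exp (\<zeta> / of_nat n)) = u \<zeta>"
  then show ?thesis by (auto simp: H_def)
qed

text \<open>For the least period e, the sheet as a function of s = exp (\<zeta> / e) separates
  points with the same s ^ e, since otherwise a shorter period would exist. The product of w - y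
  over the e translates of y is unchanged by one full turn, so its coefficients descend to functions
  of z itself and yield A.\<close>

lemma sheet_branch:
  assumes y: "sheet y"
  obtains e g A where "pbranch \<rho> e g A"
    "\<And>z w. z \<noteq> 0 \<Longrightarrow> (\<exists>s\<in>ball 0 (root e \<rho>). z = s ^ e \<and> w = g s) \<longleftrightarrow> (\<exists>\<zeta>\<in>H. exp \<zeta> = z \<and> w = y \<zeta>)"
proof -
  define e where "e = (LEAST n::nat. n \<ge> 1 \<and> (\<forall>\<zeta>\<in>H. y (\<zeta> + 2 * of_real pi * \<i> * of_nat n) = y \<zeta>))"
  have "\<exists>n::nat. n \<ge> 1 \<and> (\<forall>\<zeta>\<in>H. y (\<zeta> + 2 * of_real pi * \<i> * of_nat n) = y \<zeta>)" using sheet_period[OF y] by metis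
  from LeastI_ex[OF this] have e1: "e \<ge> 1" and per: "\<And>\<zeta>. \<zeta> \<in> H \<Longrightarrow> y (\<zeta> + 2 * of_real pi * \<i> * of_nat e) = y \<zeta>"
    unfolding e_def[symmetric] by auto
  have emin: "e \<le> n" if "n \<ge> 1" "\<And>\<zeta>. \<zeta> \<in> H \<Longrightarrow> y (\<zeta> + 2 * of_real pi * \<i> * of_nat n) = y \<zeta>" for n
    unfolding e_def by (rule Least_le) (use that in auto)
  define r where "r = root e \<rho>"
  have r: "r > 0" "r ^ e = \<rho>" using rho e1 by (auto simp: r_def)
  have e0: "of_nat e \<noteq> (0::complex)" using e1 by auto
  obtain M where M: "\<And>y \<zeta>. sheet y \<Longrightarrow> \<zeta> \<in> H \<Longrightarrow> norm (y \<zeta>) \<le> M" using sheet_bounded by blast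
  have yh: "y holomorphic_on H" using y by (simp add: sheet_def)
  have H': "(Re \<zeta> < ln \<rho>) \<longleftrightarrow> \<zeta> \<in> H" for \<zeta> by (simp add: H_def)
  obtain g where gh: "g holomorphic_on ball 0 r" and g: "\<And>\<zeta>. \<zeta> \<in> H \<Longrightarrow> g (exp (\<zeta> / of_nat e)) = y \<zeta>"
    using descend[OF e1 yh per M[OF y]] unfolding r_def by blast
  have pint: "y (\<zeta> + 2 * of_real pi * \<i> * of_nat e * of_int k) = y \<zeta>" if "\<zeta> \<in> H" for \<zeta> k
    using periodic_int[of "ln \<rho>" y e \<zeta> k] per that unfolding H' by blast
  have pmod: "y (\<zeta> + 2 * of_real pi * \<i> * of_int k) = y (\<zeta> + 2 * of_real pi * \<i> * of_nat (nat (k mod int e)))" if "\<zeta> \<in> H" for \<zeta> k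
  proof -
    define m where "m = nat (k mod int e)"
    have m: "k = int m + int e * (k div int e)" using e1 by (simp add: m_def)
    have "of_int k = (of_nat m + of_nat e * of_int (k div int e) :: complex)"
      by (subst m) simp
    then have eq: "\<zeta> + 2 * of_real pi * \<i> * of_int k = (\<zeta> + 2 * of_real pi * \<i> * of_int (int m)) + 2 * of_real pi * \<i> * of_nat e * of_int (k div int e)"
      by (simp add: algebra_simps)
    have mem: "\<zeta> + 2 * of_real pi * \<i> * of_int (int m) \<in> H" using that H_shift by blast
    show ?thesis unfolding eq m_def[symmetric] using pint[OF mem] by simp
  qed
  have S: "\<exists>\<zeta>\<in>H. s = exp (\<zeta> / of_nat e) \<and> s ^ e = exp \<zeta>" if "s \<in> ball 0 r" "s \<noteq> 0" for s
  proof -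
    have "norm (s ^ e) < \<rho>" using that r power_strict_mono[of "norm s" r e] e1 by (simp add: norm_power)
    moreover have se: "exp (of_nat e * Ln s) = s ^ e" using that by (simp add: exp_of_nat_mult)
    ultimately have "of_nat e * Ln s \<in> H" by (simp add: H_exp)
    then show ?thesis using that se e0 by (intro bexI[of _ "of_nat e * Ln s"]) auto
  qed
  have S': "exp (\<zeta> / of_nat e) \<in> ball 0 r" "exp (\<zeta> / of_nat e) ^ e = exp \<zeta>" if "\<zeta> \<in> H" for \<zeta>
  proof -
    show ee: "exp (\<zeta> / of_nat e) ^ e = exp \<zeta>" using e0 by (simp add: exp_of_nat_mult[symmetric])
    have "norm (exp (\<zeta> / of_nat e)) ^ e = norm (exp \<zeta>)" unfolding norm_power[symmetric] ee ..
    also have "\<dots> < r ^ e" using that r(2) unfolding H_exp by (simp only: mem_ball_0)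
    finally have "norm (exp (\<zeta> / of_nat e)) ^ e < r ^ e" .
    then show "exp (\<zeta> / of_nat e) \<in> ball 0 r" using r power_less_imp_less_base[of _ e r] by auto
  qed
  have img: "(\<exists>s\<in>ball 0 r. z = s ^ e \<and> w = g s) \<longleftrightarrow> (\<exists>\<zeta>\<in>H. exp \<zeta> = z \<and> w = y \<zeta>)" if z: "z \<noteq> 0" for z w
  proof
    assume "\<exists>s\<in>ball 0 r. z = s ^ e \<and> w = g s"
    then obtain s where s: "s \<in> ball 0 r" "z = s ^ e" "w = g s" by blast
    then have "s \<noteq> 0" using z e1 by auto
    then show "\<exists>\<zeta>\<in>H. exp \<zeta> = z \<and> w = y \<zeta>" using S[OF s(1)] s g by auto
  next
    assume "\<exists>\<zeta>\<in>H. exp \<zeta> = z \<and> w = y \<zeta>"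
    then show "\<exists>s\<in>ball 0 r. z = s ^ e \<and> w = g s" using S' g by metis
  qed
  have inj: "inj_on (\<lambda>s. (s ^ e, g s)) (ball 0 r)"
  proof (rule inj_onI)
    fix s s' assume s: "s \<in> ball 0 r" "s' \<in> ball 0 r" "(s ^ e, g s) = (s' ^ e, g s')"
    show "s = s'"
    proof (cases "s = 0 \<or> s' = 0")
      case True
      then show ?thesis using s(3) e1 by (auto simp: power_0_left)
    next
      case False
      obtain \<zeta> where \<zeta>: "\<zeta> \<in> H" "s = exp (\<zeta> / of_nat e)" "s ^ e = exp \<zeta>" using S[OF s(1)] False by blast
      obtain \<zeta>' where \<zeta>': "\<zeta>' \<in> H" "s' = exp (\<zeta>' / of_nat e)" "s' ^ e = exp \<zeta>'" using S[OF s(2)] False by blast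
      have "exp \<zeta> = exp \<zeta>'" using s(3) \<zeta> \<zeta>' by simp
      then obtain k :: int where k: "\<zeta> = \<zeta>' + of_int (2 * k) * pi * \<i>" unfolding exp_eq by blast
      then have k': "\<zeta> = \<zeta>' + 2 * of_real pi * \<i> * of_int k" by (simp add: algebra_simps)
      have "y \<zeta> = y \<zeta>'" using s(3) \<zeta> \<zeta>' g by auto
      then have pk: "y (x + 2 * of_real pi * \<i> * of_int k) = y x" if "x \<in> H" for x
        using sheet_period_if_eq[OF y \<zeta>'(1) _ that] k' by simp
      have pk2: "y (x + 2 * of_real pi * \<i> * of_nat (nat (k mod int e))) = y x" if "x \<in> H" for x
        using pk[OF that] pmod[OF that, of k] by argo
      \<comment> \<open>Equal values over the same z make the sheet invariant under k turns, hence
        under k modulo e turns; minimality of e leaves only the residue 0.\<close>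
      have "\<not> nat (k mod int e) \<ge> 1"
      proof
        assume ge: "nat (k mod int e) \<ge> 1"
        have "e \<le> nat (k mod int e)" by (rule emin[OF ge pk2])
        moreover have "nat (k mod int e) < e" using e1 pos_mod_bound[of "int e" k] by linarith
        ultimately show False by simp
      qed
      then have "k mod int e = 0" using pos_mod_sign[of "int e" k] e1 by linarith
      then obtain j where "k = int e * j" by (metis mod_0_imp_dvd dvdE)
      then have "\<zeta> / of_nat e = \<zeta>' / of_nat e + 2 * of_real pi * \<i> * of_int j" using k' e0 by (simp add: field_simps)
      then show ?thesis using \<zeta> \<zeta>' exp_shift by simp
    qed
  qed
  define Cz where "Cz \<zeta> = (\<Prod>k<e. [:- y (\<zeta> + 2 * of_real pi * \<i> * of_int (int k)), 1:])" for \<zeta>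
  have Czh: "(\<lambda>\<zeta>. coeff (Cz \<zeta>) j) holomorphic_on H" for j
    unfolding Cz_def by (rule holomorphic_coeff_prod) (rule conjunct1[OF sheet_shift[OF y, unfolded sheet_def]])
  have Czb: "\<exists>M'. \<forall>\<zeta>\<in>H. norm (coeff (Cz \<zeta>) j) \<le> M'" for j
    unfolding Cz_def by (rule bounded_coeff_prod[where M=M]) (rule M[OF sheet_shift[OF y]])
  \<comment> \<open>One turn shifts the index of every factor by one, and the new last factor, of
    index e, equals the lost factor of index 0.\<close>
  have Czp: "Cz (\<zeta> + 2 * of_real pi * \<i> * of_nat 1) = Cz \<zeta>" if "\<zeta> \<in> H" for \<zeta>
  proof -
    define f where "f k = [:- y (\<zeta> + 2 * of_real pi * \<i> * of_int (int k)), 1:]" for k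
    have "f 0 = f e" using per[OF that] by (simp add: f_def)
    have "f 0 * (\<Prod>k<e. f (Suc k)) = (\<Prod>k<Suc e. f k)" by (rule prod.lessThan_Suc_shift[symmetric])
    also have "\<dots> = f 0 * (\<Prod>k<e. f k)" using \<open>f 0 = f e\<close> by (simp add: mult.commute)
    finally have fe: "f 0 * (\<Prod>k<e. f (Suc k)) = f 0 * (\<Prod>k<e. f k)" .
    have "f 0 \<noteq> 0" by (simp add: f_def)
    then have "(\<Prod>k<e. f (Suc k)) = (\<Prod>k<e. f k)" using mult_left_cancel[of "f 0"] fe by blast
    moreover have "Cz (\<zeta> + 2 * of_real pi * \<i> * of_nat 1) = (\<Prod>k<e. f (Suc k))"
      unfolding Cz_def f_def by (intro prod.cong) (auto simp: algebra_simps)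
    moreover have "Cz \<zeta> = (\<Prod>k<e. f k)" by (simp add: Cz_def f_def)
    ultimately show ?thesis by simp
  qed
  have "\<exists>A. A holomorphic_on ball 0 \<rho> \<and> (\<forall>\<zeta>\<in>H. A (exp \<zeta>) = coeff (Cz \<zeta>) j)" for j
  proof -
    obtain M' where M': "\<And>\<zeta>. \<zeta> \<in> H \<Longrightarrow> norm (coeff (Cz \<zeta>) j) \<le> M'" using Czb[of j] by blast
    have "1 \<le> (1::nat)" by simp
    have "\<exists>g. g holomorphic_on ball 0 (root 1 \<rho>) \<and> (\<forall>\<zeta>\<in>H. g (exp (\<zeta> / of_nat 1)) = coeff (Cz \<zeta>) j)"
      by (rule descend[OF \<open>1 \<le> 1\<close> Czh _ M']) (simp only: Czp)
    then show ?thesis by simp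
  qed
  then obtain A where A: "\<And>j. A j holomorphic_on ball 0 \<rho>" "\<And>j \<zeta>. \<zeta> \<in> H \<Longrightarrow> A j (exp \<zeta>) = coeff (Cz \<zeta>) j" by metis
  have degC: "degree (Cz \<zeta>) = e" for \<zeta>
    unfolding Cz_def by (subst degree_prod_eq_sum_degree) auto
  have AC: "(\<Sum>j\<le>e. A j (exp \<zeta>) * w ^ j) = (\<Prod>k<e. w - y (\<zeta> + 2 * of_real pi * \<i> * of_int (int k)))" if "\<zeta> \<in> H" for \<zeta> w
  proof -
    have "(\<Sum>j\<le>e. A j (exp \<zeta>) * w ^ j) = poly (Cz \<zeta>) w" by (simp add: poly_altdef degC A(2)[OF that])
    then show ?thesis by (simp add: Cz_def poly_prod)
  qed
  have zero: "(\<Sum>j\<le>e. A j z * w ^ j) = 0 \<longleftrightarrow> (\<exists>s\<in>ball 0 r. z = s ^ e \<and> w = g s)" if z: "z \<in> ball 0 \<rho>" for z w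
  proof (cases "z = 0")
    case False
    have lz: "Ln z \<in> H" using z False by (simp add: H_exp)
    have "(\<Sum>j\<le>e. A j z * w ^ j) = 0 \<longleftrightarrow> (\<exists>k<e. w = y (Ln z + 2 * of_real pi * \<i> * of_int (int k)))"
      using AC[OF lz, of w] False by auto
    also have "\<dots> \<longleftrightarrow> (\<exists>\<zeta>\<in>H. exp \<zeta> = z \<and> w = y \<zeta>)"
    proof
      assume "\<exists>k<e. w = y (Ln z + 2 * of_real pi * \<i> * of_int (int k))"
      then obtain k where k: "w = y (Ln z + 2 * of_real pi * \<i> * of_int (int k))" by blast
      show "\<exists>\<zeta>\<in>H. exp \<zeta> = z \<and> w = y \<zeta>"
        by (rule bexI[of _ "Ln z + 2 * of_real pi * \<i> * of_int (int k)"]) (use k lz False exp_shift[of "Ln z" "int k"] H_shift[of "Ln z" "int k"] in auto)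
    next
      assume "\<exists>\<zeta>\<in>H. exp \<zeta> = z \<and> w = y \<zeta>"
      then obtain \<zeta> where \<zeta>: "exp \<zeta> = z" "w = y \<zeta>" by blast
      then have "exp \<zeta> = exp (Ln z)" using False by simp
      then obtain k :: int where "\<zeta> = Ln z + of_int (2 * k) * pi * \<i>" unfolding exp_eq by blast
      then have "\<zeta> = Ln z + 2 * of_real pi * \<i> * of_int k" by (simp add: algebra_simps)
      then have "w = y (Ln z + 2 * of_real pi * \<i> * of_int (int (nat (k mod int e))))" using pmod[OF lz, of k] \<zeta> by simp
      moreover have "nat (k mod int e) < e" using e1 pos_mod_bound[of "int e" k] pos_mod_sign[of "int e" k] by linarith
      ultimately show "\<exists>k<e. w = y (Ln z + 2 * of_real pi * \<i> * of_int (int k))" by blast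
    qed
    finally show ?thesis using img[OF False] by simp
  next
    case True
    \<comment> \<open>No point of the half-plane lies over z = 0. The factorization is therefore
      rewritten with the e-th roots of unity and passed to the limit s = 0, where all factors become
      w - g 0.\<close>
    define \<omega> where "\<omega> k = exp (2 * of_real pi * \<i> * of_int (int k) / of_nat e)" for k :: nat
    have n\<omega>: "norm (\<omega> k) = 1" for k by (simp add: \<omega>_def norm_exp_eq_Re)
    have eq: "(\<Sum>j\<le>e. A j (s ^ e) * w ^ j) = (\<Prod>k<e. w - g (s * \<omega> k))" if s: "s \<in> ball 0 r" "s \<noteq> 0" for s
    proof -
      obtain \<zeta> where \<zeta>: "\<zeta> \<in> H" "s = exp (\<zeta> / of_nat e)" "s ^ e = exp \<zeta>" using S[OF s] by blast
      have "g (s * \<omega> k) = y (\<zeta> + 2 * of_real pi * \<i> * of_int (int k))" for k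
      proof -
        have "s * \<omega> k = exp ((\<zeta> + 2 * of_real pi * \<i> * of_int (int k)) / of_nat e)"
          by (simp add: \<zeta>(2) \<omega>_def exp_add[symmetric] add_divide_distrib)
        then show ?thesis using g[of "\<zeta> + 2 * of_real pi * \<i> * of_int (int k)"] H_shift[of \<zeta> "int k"] \<zeta>(1) by simp
      qed
      then show ?thesis using AC[OF \<zeta>(1)] \<zeta>(3) by simp
    qed
    have gc: "isCont g 0"
      by (rule continuous_on_interior[OF holomorphic_on_imp_continuous_on[OF gh]]) (use r in simp)
    have Ac: "isCont (A j) 0" for j
      by (rule continuous_on_interior[OF holomorphic_on_imp_continuous_on[OF A(1)]]) (use rho in simp)
    have A0: "isCont (\<lambda>s. A j (s ^ e)) 0" for j
    proof -
      have "isCont (\<lambda>s::complex. s ^ e) 0" by (intro continuous_intros)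
      moreover have "(0::complex) ^ e = 0" using e1 by (simp add: zero_power)
      then have "isCont (A j) ((0::complex) ^ e)" using Ac[of j] by (simp only:)
      ultimately show ?thesis by (rule isCont_o2)
    qed
    have g0: "isCont (\<lambda>s. g (s * \<omega> k)) 0" for k
    proof -
      have "isCont (\<lambda>s::complex. s * \<omega> k) 0" by (intro continuous_intros)
      moreover have "isCont g (0 * \<omega> k)" using gc by (simp only: mult_zero_left)
      ultimately show ?thesis by (rule isCont_o2)
    qed
    have "((\<lambda>s. \<Sum>j\<le>e. A j (s ^ e) * w ^ j) \<longlongrightarrow> (\<Sum>j\<le>e. A j (0 ^ e) * w ^ j)) (at 0)"
      using A0 by (intro tendsto_intros) (auto simp: isCont_def)
    moreover have "((\<lambda>s. \<Prod>k<e. w - g (s * \<omega> k)) \<longlongrightarrow> (\<Prod>k<e. w - g (0 * \<omega> k))) (at 0)"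
      using g0 by (intro tendsto_intros) (auto simp: isCont_def)
    moreover have "\<forall>\<^sub>F s in at 0. s \<in> ball 0 r - {0}" using r by (intro eventually_at_in_open) auto
    then have "\<forall>\<^sub>F s in at 0. (\<Sum>j\<le>e. A j (s ^ e) * w ^ j) = (\<Prod>k<e. w - g (s * \<omega> k))"
      by eventually_elim (use eq in auto)
    note ev = this
    ultimately have t1: "((\<lambda>s. \<Prod>k<e. w - g (s * \<omega> k)) \<longlongrightarrow> (\<Sum>j\<le>e. A j (0 ^ e) * w ^ j)) (at 0)"
      and t2: "((\<lambda>s. \<Prod>k<e. w - g (s * \<omega> k)) \<longlongrightarrow> (\<Prod>k<e. w - g (0 * \<omega> k))) (at 0)"
      using Lim_transform_eventually[OF _ ev] by blast+
    have "(\<Sum>j\<le>e. A j (0 ^ e) * w ^ j) = (\<Prod>k<e. w - g (0 * \<omega> k))"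
      by (rule tendsto_unique[OF at_neq_bot t1 t2])
    then have "(\<Sum>j\<le>e. A j z * w ^ j) = (w - g 0) ^ e" using True e1 by (simp add: power_0_left)
    then have "(\<Sum>j\<le>e. A j z * w ^ j) = 0 \<longleftrightarrow> w = g 0" using e1 by auto
    also have "\<dots> \<longleftrightarrow> (\<exists>s\<in>ball 0 r. z = s ^ e \<and> w = g s)" using True e1 r by force
    finally show ?thesis .
  qed
  have "pbranch \<rho> e g A" unfolding pbranch_def using e1 gh inj A(1) zero by (simp add: r_def)
  then show ?thesis by (rule that) (use img in \<open>simp add: r_def\<close>)
qed

text \<open>There is one branch for each root over a base point, so the same image may occur several
  times. The last clause says that branches sharing a point outside the centre have the same image
  outside the centre: the corresponding sheets differ by a number of full turns. It is what
  separates irreducible components later.\<close>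

theorem puiseux_branches:
  obtains \<B> where "finite \<B>" "\<And>e g A. (e, g, A) \<in> \<B> \<Longrightarrow> pbranch \<rho> e g A"
    "\<And>z w. z \<in> ball 0 \<rho> - {0} \<Longrightarrow> poly (P z) w = 0 \<longleftrightarrow> (\<exists>(e, g, A)\<in>\<B>. \<exists>s\<in>ball 0 (root e \<rho>). z = s ^ e \<and> w = g s)"
    "\<And>e g A e' g' A' s s' z w. (e, g, A) \<in> \<B> \<Longrightarrow> (e', g', A') \<in> \<B> \<Longrightarrow> s \<in> ball 0 (root e \<rho>) \<Longrightarrow> s' \<in> ball 0 (root e' \<rho>) \<Longrightarrow>
      s ^ e = s' ^ e' \<Longrightarrow> g s = g' s' \<Longrightarrow> s \<noteq> 0 \<Longrightarrow> z \<noteq> 0 \<Longrightarrow>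
      (\<exists>s\<in>ball 0 (root e \<rho>). z = s ^ e \<and> w = g s) \<longleftrightarrow> (\<exists>s\<in>ball 0 (root e' \<rho>). z = s ^ e' \<and> w = g' s)"
proof -
  define \<zeta>0 :: complex where "\<zeta>0 = of_real (ln \<rho> - 1)"
  have z0: "\<zeta>0 \<in> H" by (simp add: \<zeta>0_def H_def)
  define R where "R = {w. poly (P (exp \<zeta>0)) w = 0}"
  have fR: "finite R" using Q.finite_roots[OF z0] by (simp add: R_def)
  have "\<exists>y. sheet y \<and> y \<zeta>0 = w" if "w \<in> R" for w using sheet_ex[OF z0, of w] that unfolding R_def by blast
  then obtain Y where Y: "\<And>w. w \<in> R \<Longrightarrow> sheet (Y w) \<and> Y w \<zeta>0 = w" by metis
  define Pr where "Pr v b \<longleftrightarrow> pbranch \<rho> (fst b) (fst (snd b)) (snd (snd b)) \<and> (\<forall>z w. z \<noteq> 0 \<longrightarrow>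
     (\<exists>s\<in>ball 0 (root (fst b) \<rho>). z = s ^ fst b \<and> w = fst (snd b) s) = (\<exists>\<zeta>\<in>H. exp \<zeta> = z \<and> w = Y v \<zeta>))" for v b
  have "\<forall>v\<in>R. \<exists>b. Pr v b"
  proof
    fix v assume that: "v \<in> R"
    show "\<exists>b. Pr v b"
    proof -
    have "sheet (Y v)" using Y that by blast
    then show ?thesis
    proof (rule sheet_branch)
      fix e g A assume 1: "pbranch \<rho> e g A" and 2: "\<And>z w. z \<noteq> 0 \<Longrightarrow>
        (\<exists>s\<in>ball 0 (root e \<rho>). z = s ^ e \<and> w = g s) \<longleftrightarrow> (\<exists>\<zeta>\<in>H. exp \<zeta> = z \<and> w = Y v \<zeta>)"
      show ?thesis using 1 2 unfolding Pr_def by (intro exI[of _ "(e, g, A)"]) simp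
    qed
    qed
  qed
  from bchoice[OF this] obtain b where b0: "\<forall>v\<in>R. Pr v (b v)" by blast
  have b: "pbranch \<rho> (fst (b v)) (fst (snd (b v))) (snd (snd (b v)))"
    "\<And>z w. z \<noteq> 0 \<Longrightarrow> (\<exists>s\<in>ball 0 (root (fst (b v)) \<rho>). z = s ^ fst (b v) \<and> w = fst (snd (b v)) s) = (\<exists>\<zeta>\<in>H. exp \<zeta> = z \<and> w = Y v \<zeta>)"
    if "v \<in> R" for v
    using b0 that unfolding Pr_def by blast+
  have b2: "(\<exists>s\<in>ball 0 (root e \<rho>). z = s ^ e \<and> w = g s) = (\<exists>\<zeta>\<in>H. exp \<zeta> = z \<and> w = Y v \<zeta>)" if "v \<in> R" "b v = (e, g, A)" "z \<noteq> 0" for v e g A z w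
    using b(2)[OF that(1,3), of w] that(2) by simp
  show ?thesis
  proof (rule that[of "b ` R"])
    show "finite (b ` R)" using fR by simp
    show "pbranch \<rho> e g A" if mem: "(e, g, A) \<in> b ` R" for e g A
    proof -
      obtain v where v: "v \<in> R" "b v = (e, g, A)" using mem by (elim imageE) simp
      then show ?thesis using b(1)[OF v(1)] by simp
    qed
    show "poly (P z) w = 0 \<longleftrightarrow> (\<exists>(e, g, A)\<in>b ` R. \<exists>s\<in>ball 0 (root e \<rho>). z = s ^ e \<and> w = g s)" if z: "z \<in> ball 0 \<rho> - {0}" for z w
    proof
      assume w: "poly (P z) w = 0"
      have lz: "Ln z \<in> H" using z by (simp add: H_exp)
      obtain y where y: "sheet y" "y (Ln z) = w" using sheet_ex[OF lz, of w] w z by auto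
      have v: "y \<zeta>0 \<in> R" using y(1) z0 by (simp add: sheet_def R_def)
      have "Y (y \<zeta>0) (Ln z) = y (Ln z)" using sheet_eq[of "Y (y \<zeta>0)" y \<zeta>0 "Ln z"] Y[OF v] y(1) z0 lz by auto
      then have "\<exists>\<zeta>\<in>H. exp \<zeta> = z \<and> w = Y (y \<zeta>0) \<zeta>" using lz y(2) z by (intro bexI[of _ "Ln z"]) auto
      then have "\<exists>s\<in>ball 0 (root (fst (b (y \<zeta>0))) \<rho>). z = s ^ fst (b (y \<zeta>0)) \<and> w = fst (snd (b (y \<zeta>0))) s"
        using b(2)[OF v] z by simp
      then show "\<exists>(e, g, A)\<in>b ` R. \<exists>s\<in>ball 0 (root e \<rho>). z = s ^ e \<and> w = g s"
        using v by (intro bexI[of _ "b (y \<zeta>0)"]) (auto simp: case_prod_unfold)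
    next
      assume "\<exists>(e, g, A)\<in>b ` R. \<exists>s\<in>ball 0 (root e \<rho>). z = s ^ e \<and> w = g s"
      then obtain v where v: "v \<in> R" "\<exists>s\<in>ball 0 (root (fst (b v)) \<rho>). z = s ^ fst (b v) \<and> w = fst (snd (b v)) s"
        by (auto simp: case_prod_unfold)
      then obtain \<zeta> where "\<zeta> \<in> H" "exp \<zeta> = z" "w = Y v \<zeta>" using b(2)[OF v(1), of z w] z by auto
      then show "poly (P z) w = 0" using Y[OF v(1)] by (auto simp: sheet_def)
    qed
    fix e g A e' g' A' s s' z w
    assume m: "(e, g, A) \<in> b ` R" "(e', g', A') \<in> b ` R" and s: "s \<in> ball 0 (root e \<rho>)" "s' \<in> ball 0 (root e' \<rho>)"
      "s ^ e = s' ^ e'" "g s = g' s'" "s \<noteq> (0::complex)" and z: "z \<noteq> (0::complex)"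
    obtain v where v1: "v \<in> R" "b v = (e, g, A)" using m(1) by (elim imageE) simp
    obtain v' where v2: "v' \<in> R" "b v' = (e', g', A')" using m(2) by (elim imageE) simp
    note v = v1 v2
    have se: "s ^ e \<noteq> 0" using s(5) by simp
    obtain \<zeta> where \<zeta>: "\<zeta> \<in> H" "exp \<zeta> = s ^ e" "g s = Y v \<zeta>" using b2[OF v(1,2) se, of "g s"] s(1) by blast
    obtain \<zeta>' where \<zeta>': "\<zeta>' \<in> H" "exp \<zeta>' = s ^ e" "g s = Y v' \<zeta>'" using b2[OF v(3,4) se, of "g s"] s(2,3,4) by blast
    have "exp \<zeta> = exp \<zeta>'" using \<zeta>(2) \<zeta>'(2) by simp
    then obtain k :: int where "\<zeta> = \<zeta>' + of_int (2 * k) * pi * \<i>" unfolding exp_eq by blast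
    then have k: "\<zeta> = \<zeta>' + 2 * of_real pi * \<i> * of_int k" by (simp add: algebra_simps)
    have Ys: "sheet (Y v)" "sheet (Y v')" using Y v by auto
    have eq: "Y v (x + 2 * of_real pi * \<i> * of_int k) = Y v' x" if "x \<in> H" for x
      using sheet_eq[OF sheet_shift[OF Ys(1)] Ys(2) \<zeta>'(1) _ that, of k] \<zeta>(3) \<zeta>'(3) k by simp
    have "(\<exists>\<zeta>\<in>H. exp \<zeta> = z \<and> w = Y v \<zeta>) = (\<exists>\<zeta>\<in>H. exp \<zeta> = z \<and> w = Y v' \<zeta>)"
    proof
      assume "\<exists>\<zeta>\<in>H. exp \<zeta> = z \<and> w = Y v \<zeta>"
      then obtain x where x: "x \<in> H" "exp x = z" "w = Y v x" by blast
      define x' where "x' = x + 2 * of_real pi * \<i> * of_int (-k)"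
      have "x' \<in> H" "exp x' = z" using x H_shift[of x "-k"] exp_shift[of x "-k"] by (auto simp: x'_def)
      moreover have "x' + 2 * of_real pi * \<i> * of_int k = x" by (simp add: x'_def algebra_simps)
      ultimately show "\<exists>\<zeta>\<in>H. exp \<zeta> = z \<and> w = Y v' \<zeta>" using eq[of x'] x(3) by (intro bexI[of _ x']) auto
    next
      assume "\<exists>\<zeta>\<in>H. exp \<zeta> = z \<and> w = Y v' \<zeta>"
      then obtain x where x: "x \<in> H" "exp x = z" "w = Y v' x" by blast
      then show "\<exists>\<zeta>\<in>H. exp \<zeta> = z \<and> w = Y v \<zeta>"
        using eq[OF x(1)] H_shift[of x k] exp_shift[of x k] by (intro bexI[of _ "x + 2 * of_real pi * \<i> * of_int k"]) auto
    qed
    then show "(\<exists>s\<in>ball 0 (root e \<rho>). z = s ^ e \<and> w = g s) \<longleftrightarrow> (\<exists>s\<in>ball 0 (root e' \<rho>). z = s ^ e' \<and> w = g' s)"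
      using b2[OF v(1,2) z] b2[OF v(3,4) z] by simp
  qed
qed

end

subsection \<open>The projective invariant of a curve relative to a quadratic form\<close>

text \<open>
  \<open>Field_as_Ring\<close> makes \<open>complex\<close> a Euclidean ring, so these rules apply to its division, where they loop
  with \<open>field_simps\<close>.
\<close>

declare
  div_mult_mult1_if [simp del]
  dvd_div_mult_self [simp del]
  dvd_mult_div_cancel [simp del]
  div_mult_self1 [simp del]
  div_mult_self2 [simp del]
  div_mult_self3 [simp del]
  div_mult_self4 [simp del]
  div_add_self1 [simp del]
  div_add_self2 [simp del]

definition det3 :: "complex^3 \<Rightarrow> complex^3 \<Rightarrow> complex^3 \<Rightarrow> complex" where
  "det3 a b c = a$1 * (b$2 * c$3 - b$3 * c$2) - a$2 * (b$1 * c$3 - b$3 * c$1) + a$3 * (b$1 * c$2 - b$2 * c$1)"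

lemma det3_linear [simp]:
  "det3 (a + a') b c = det3 a b c + det3 a' b c"
  "det3 a (b + b') c = det3 a b c + det3 a b' c"
  "det3 a b (c + c') = det3 a b c + det3 a b c'"
  "det3 (r *s a) b c = r * det3 a b c"
  "det3 a (r *s b) c = r * det3 a b c"
  "det3 a b (r *s c) = r * det3 a b c"
  "det3 a a c = 0" "det3 a b a = 0" "det3 a b b = 0"
  "det3 0 b c = 0" "det3 a 0 c = 0" "det3 a b 0 = 0"
  by (simp_all add: det3_def algebra_simps)

lemma det3_swap: "det3 a c b = - det3 a b c" "det3 b a c = - det3 a b c"
  by (simp_all add: det3_def algebra_simps)

definition vhd :: "(complex \<Rightarrow> complex^3) \<Rightarrow> complex^3 \<Rightarrow> complex \<Rightarrow> bool" where
  "vhd f f' t \<longleftrightarrow> (\<forall>i. ((\<lambda>s. f s $ i) has_field_derivative f' $ i) (at t))"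

definition vD :: "(complex \<Rightarrow> complex^3) \<Rightarrow> complex \<Rightarrow> complex^3" where
  "vD f t = (\<chi> i. deriv (\<lambda>s. f s $ i) t)"

definition vholo :: "(complex \<Rightarrow> complex^3) \<Rightarrow> complex set \<Rightarrow> bool" where
  "vholo f U \<longleftrightarrow> (\<forall>i. (\<lambda>s. f s $ i) holomorphic_on U)"

lemma vhd_vD: "vhd f f' t \<Longrightarrow> vD f t = f'"
  unfolding vhd_def vD_def vec_eq_iff by (simp add: DERIV_imp_deriv)

lemma vholo_vhd: "vholo f U \<Longrightarrow> open U \<Longrightarrow> t \<in> U \<Longrightarrow> vhd f (vD f t) t"
  unfolding vholo_def vhd_def vD_def by (auto intro: holomorphic_derivI)

lemma vholo_vD: "vholo f U \<Longrightarrow> open U \<Longrightarrow> vholo (vD f) U"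
  unfolding vholo_def vD_def by (auto intro: holomorphic_deriv)

lemma vD_cong:
  assumes "open U" "\<And>s. s \<in> U \<Longrightarrow> f s = g s" "t \<in> U"
  shows "vD f t = vD g t"
proof -
  have "eventually (\<lambda>s. f s $ i = g s $ i) (nhds t)" for i
    using eventually_nhds_in_open[OF assms(1,3)] by eventually_elim (simp add: assms(2))
  then show ?thesis unfolding vD_def vec_eq_iff by (auto intro: deriv_cong_ev)
qed

lemma vhd_add: "vhd f f' t \<Longrightarrow> vhd g g' t \<Longrightarrow> vhd (\<lambda>s. f s + g s) (f' + g') t"
  unfolding vhd_def by (auto intro!: derivative_eq_intros)

lemma vhd_scale: "(l has_field_derivative l') (at t) \<Longrightarrow> vhd f f' t \<Longrightarrow>
    vhd (\<lambda>s. l s *s f s) (l' *s f t + l t *s f') t"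
  unfolding vhd_def by (auto intro!: derivative_eq_intros)

lemma vhd_compose: "(x has_field_derivative x') (at t) \<Longrightarrow> vhd f f' (x t) \<Longrightarrow> vhd (\<lambda>s. f (x s)) (x' *s f') t"
  unfolding vhd_def
  by (auto intro: DERIV_chain2 simp: mult.commute[of x'])

lemma vD_eqI:
  assumes "open U" "t \<in> U" "\<And>s. s \<in> U \<Longrightarrow> f s = g s" "vhd g g' t" "g' = h"
  shows "vD f t = h"
  using vD_cong[OF assms(1,3,2)] vhd_vD[OF assms(4)] assms(5) by simp

text \<open>The Leibniz rule combined with the formula of Faa di Bruno up to fourth order, for a
  simultaneous change of the lift by the factor l and of the parameter by x.\<close>

lemma vD_scale_compose:
  assumes U: "open U" and V: "open V" and f: "vholo f V" and x: "x holomorphic_on U" and xV: "x ` U \<subseteq> V"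
    and l: "l holomorphic_on U" and eq: "\<And>t. t \<in> U \<Longrightarrow> g t = l t *s f (x t)" and t: "t \<in> U"
  defines "l1 \<equiv> deriv l" and "l2 \<equiv> (deriv ^^ 2) l" and "l3 \<equiv> (deriv ^^ 3) l" and "l4 \<equiv> (deriv ^^ 4) l"
    and "x1 \<equiv> deriv x" and "x2 \<equiv> (deriv ^^ 2) x" and "x3 \<equiv> (deriv ^^ 3) x" and "x4 \<equiv> (deriv ^^ 4) x"
    and "f1 \<equiv> vD f" and "f2 \<equiv> vD (vD f)" and "f3 \<equiv> vD (vD (vD f))" and "f4 \<equiv> vD (vD (vD (vD f)))"
  shows "vD g t = l1 t *s f (x t) + (l t * x1 t) *s f1 (x t)"
    and "vD (vD g) t = l2 t *s f (x t) + (2 * l1 t * x1 t + l t * x2 t) *s f1 (x t) + (l t * x1 t ^ 2) *s f2 (x t)"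
    and "vD (vD (vD g)) t = l3 t *s f (x t) + (3 * l2 t * x1 t + 3 * l1 t * x2 t + l t * x3 t) *s f1 (x t)
       + (3 * l1 t * x1 t ^ 2 + 3 * l t * x1 t * x2 t) *s f2 (x t) + (l t * x1 t ^ 3) *s f3 (x t)"
    and "vD (vD (vD (vD g))) t = l4 t *s f (x t) + (4 * l3 t * x1 t + 6 * l2 t * x2 t + 4 * l1 t * x3 t + l t * x4 t) *s f1 (x t)
       + (6 * l2 t * x1 t ^ 2 + 12 * l1 t * x1 t * x2 t + l t * (3 * x2 t ^ 2 + 4 * x1 t * x3 t)) *s f2 (x t)
       + (4 * l1 t * x1 t ^ 3 + 6 * l t * x1 t ^ 2 * x2 t) *s f3 (x t) + (l t * x1 t ^ 4) *s f4 (x t)"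
proof -
  have dl: "((deriv ^^ n) l has_field_derivative (deriv ^^ Suc n) l t) (at t)" if "t \<in> U" for n t
    using holomorphic_derivI[OF holomorphic_higher_deriv[OF l U] U that, of n] by simp
  have dx: "((deriv ^^ n) x has_field_derivative (deriv ^^ Suc n) x t) (at t)" if "t \<in> U" for n t
    using holomorphic_derivI[OF holomorphic_higher_deriv[OF x U] U that, of n] by simp
  note dl' = dl[of _ 0, simplified] dl[of _ 1, simplified] dl[of _ 2, simplified] dl[of _ 3, simplified]
  note dx' = dx[of _ 0, simplified] dx[of _ 1, simplified] dx[of _ 2, simplified] dx[of _ 3, simplified]
  have L: "(l has_field_derivative l1 t) (at t)" "(l1 has_field_derivative l2 t) (at t)"
      "(l2 has_field_derivative l3 t) (at t)" "(l3 has_field_derivative l4 t) (at t)" if "t \<in> U" for t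
    using dl[OF that, of 0] dl[OF that, of 1] dl[OF that, of 2] dl[OF that, of 3]
    by (simp_all add: l1_def l2_def l3_def l4_def eval_nat_numeral)
  have X: "(x has_field_derivative x1 t) (at t)" "(x1 has_field_derivative x2 t) (at t)"
      "(x2 has_field_derivative x3 t) (at t)" "(x3 has_field_derivative x4 t) (at t)" if "t \<in> U" for t
    using dx[OF that, of 0] dx[OF that, of 1] dx[OF that, of 2] dx[OF that, of 3]
    by (simp_all add: x1_def x2_def x3_def x4_def eval_nat_numeral)
  have h: "vholo f V" "vholo f1 V" "vholo f2 V" "vholo f3 V"
    using f V by (auto simp: f1_def f2_def f3_def intro!: vholo_vD)
  have F: "vhd (\<lambda>s. f (x s)) (x1 t *s f1 (x t)) t" "vhd (\<lambda>s. f1 (x s)) (x1 t *s f2 (x t)) t"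
    "vhd (\<lambda>s. f2 (x s)) (x1 t *s f3 (x t)) t" "vhd (\<lambda>s. f3 (x s)) (x1 t *s f4 (x t)) t" if "t \<in> U" for t
    using vholo_vhd[OF h(1) V, of "x t"] vholo_vhd[OF h(2) V, of "x t"] vholo_vhd[OF h(3) V, of "x t"] vholo_vhd[OF h(4) V, of "x t"]
      xV that by (auto simp: f1_def f2_def f3_def f4_def intro!: vhd_compose X)
  have 1: "vD g t = l1 t *s f (x t) + (l t * x1 t) *s f1 (x t)" if "t \<in> U" for t
    by (rule vD_eqI[OF U that eq vhd_scale[OF L(1)[OF that] F(1)[OF that]]]) (simp_all add: vec_eq_iff algebra_simps)
  have "((\<lambda>t. l t * x1 t) has_field_derivative (l1 t * x1 t + l t * x2 t)) (at t)" if "t \<in> U" for t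
    using that by (auto intro!: derivative_eq_intros L X)
  note s2 = vhd_add[OF vhd_scale[OF L(2) F(1)] vhd_scale[OF this F(2)]]
  have 2: "vD (vD g) t = l2 t *s f (x t) + (2 * l1 t * x1 t + l t * x2 t) *s f1 (x t) + (l t * x1 t ^ 2) *s f2 (x t)" if "t \<in> U" for t
    by (rule vD_eqI[OF U that 1 s2[OF that that that that]]) (simp_all add: vec_eq_iff algebra_simps power2_eq_square)
  have a: "((\<lambda>t. 2 * l1 t * x1 t + l t * x2 t) has_field_derivative (2 * l2 t * x1 t + 2 * l1 t * x2 t + (l1 t * x2 t + l t * x3 t))) (at t)" if "t \<in> U" for t
    using that by (auto intro!: derivative_eq_intros L X simp: algebra_simps)
  have b: "((\<lambda>t. l t * x1 t ^ 2) has_field_derivative (l1 t * x1 t ^ 2 + l t * (2 * x1 t * x2 t))) (at t)" if "t \<in> U" for t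
    using that by (auto intro!: derivative_eq_intros L X simp: algebra_simps)
  note s3 = vhd_add[OF vhd_add[OF vhd_scale[OF L(3) F(1)] vhd_scale[OF a F(2)]] vhd_scale[OF b F(3)]]
  have 3: "vD (vD (vD g)) t = l3 t *s f (x t) + (3 * l2 t * x1 t + 3 * l1 t * x2 t + l t * x3 t) *s f1 (x t)
       + (3 * l1 t * x1 t ^ 2 + 3 * l t * x1 t * x2 t) *s f2 (x t) + (l t * x1 t ^ 3) *s f3 (x t)" if "t \<in> U" for t
    by (rule vD_eqI[OF U that 2 s3[OF that that that that that that]]) (simp_all add: vec_eq_iff algebra_simps power2_eq_square power3_eq_cube)
  have a: "((\<lambda>t. 3 * l2 t * x1 t + 3 * l1 t * x2 t + l t * x3 t) has_field_derivative
     (3 * l3 t * x1 t + 3 * l2 t * x2 t + (3 * l2 t * x2 t + 3 * l1 t * x3 t) + (l1 t * x3 t + l t * x4 t))) (at t)" if "t \<in> U" for t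
    using that by (auto intro!: derivative_eq_intros L X simp: algebra_simps)
  have b: "((\<lambda>t. 3 * l1 t * x1 t ^ 2 + 3 * l t * x1 t * x2 t) has_field_derivative
     (3 * l2 t * x1 t ^ 2 + 6 * l1 t * x1 t * x2 t + (3 * l1 t * x1 t * x2 t + 3 * l t * x2 t ^ 2 + 3 * l t * x1 t * x3 t))) (at t)" if "t \<in> U" for t
    using that by (auto intro!: derivative_eq_intros L X simp: algebra_simps power2_eq_square)
  have c: "((\<lambda>t. l t * x1 t ^ 3) has_field_derivative (l1 t * x1 t ^ 3 + l t * (3 * x1 t ^ 2 * x2 t))) (at t)" if "t \<in> U" for t
    using that by (auto intro!: derivative_eq_intros L X simp: algebra_simps)
  note s4 = vhd_add[OF vhd_add[OF vhd_add[OF vhd_scale[OF L(4) F(1)] vhd_scale[OF a F(2)]] vhd_scale[OF b F(3)]] vhd_scale[OF c F(4)]]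
  show "vD (vD (vD (vD g))) t = l4 t *s f (x t) + (4 * l3 t * x1 t + 6 * l2 t * x2 t + 4 * l1 t * x3 t + l t * x4 t) *s f1 (x t)
       + (6 * l2 t * x1 t ^ 2 + 12 * l1 t * x1 t * x2 t + l t * (3 * x2 t ^ 2 + 4 * x1 t * x3 t)) *s f2 (x t)
       + (4 * l1 t * x1 t ^ 3 + 6 * l t * x1 t ^ 2 * x2 t) *s f3 (x t) + (l t * x1 t ^ 4) *s f4 (x t)"
    by (rule vD_eqI[OF U t 3 s4[OF t t t t t t t t]]) (simp_all add: vec_eq_iff algebra_simps eval_nat_numeral)
  show "vD g t = l1 t *s f (x t) + (l t * x1 t) *s f1 (x t)" by (rule 1[OF t])
  show "vD (vD g) t = l2 t *s f (x t) + (2 * l1 t * x1 t + l t * x2 t) *s f1 (x t) + (l t * x1 t ^ 2) *s f2 (x t)" by (rule 2[OF t])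
  show "vD (vD (vD g)) t = l3 t *s f (x t) + (3 * l2 t * x1 t + 3 * l1 t * x2 t + l t * x3 t) *s f1 (x t)
       + (3 * l1 t * x1 t ^ 2 + 3 * l t * x1 t * x2 t) *s f2 (x t) + (l t * x1 t ^ 3) *s f3 (x t)" by (rule 3[OF t])
qed

locale symform =
  fixes B :: "complex^3 \<Rightarrow> complex^3 \<Rightarrow> complex"
  assumes B_add: "B (u + v) w = B u w + B v w"
    and B_scale: "B (c *s u) w = c * B u w"
    and B_sym: "B u v = B v u"
begin

lemma B_add': "B w (u + v) = B w u + B w v"
  using B_add B_sym by metis

lemma B_scale': "B w (c *s u) = c * B w u"
  using B_scale B_sym by metis

lemmas B_simps = B_add B_scale B_add' B_scale'

lemma B_zero [simp]: "B 0 w = 0" "B w 0 = 0"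
  using B_scale[of 0 0 w] B_scale'[of w 0 0] by auto

text \<open>\<open>zjet\<close> is a projective invariant of the pair (curve, quadric), of weight two: \<open>zjet^3 / W^2\<close>,
  with \<open>W\<close> the Wronskian, depends neither on the parameter of the curve nor on its lift.\<close>

definition zjet :: "complex^3 \<Rightarrow> complex^3 \<Rightarrow> complex^3 \<Rightarrow> complex^3 \<Rightarrow> complex^3 \<Rightarrow> complex" where
  "zjet a b c d e = B a a * (5 * det3 a b d ^ 2 - 3 * det3 a b c * (4 * det3 a c d + det3 a b e)) / (9 * det3 a b c ^ 2)
     + 2 * det3 a b d * B a b / (3 * det3 a b c) + B b b - 2 * B a c"

definition hjet :: "complex^3 \<Rightarrow> complex^3 \<Rightarrow> complex^3 \<Rightarrow> complex^3 \<Rightarrow> complex^3 \<Rightarrow> complex" where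
  "hjet a b c d e = zjet a b c d e ^ 3 / det3 a b c ^ 2"

text \<open>The arguments on the left have the shape produced by \<open>vD_scale_compose\<close>,
  with independent numbers in place of the derivatives of l and x. The combination of determinants
  in \<open>zjet\<close> is the one in which the derivatives of l and the higher derivatives of x
  cancel.\<close>

lemma zjet_reparam:
  assumes "det3 a b c \<noteq> 0" "l \<noteq> 0" "x1 \<noteq> 0"
  shows "zjet (l *s a) (l1 *s a + (l * x1) *s b) (l2 *s a + (2 * l1 * x1 + l * x2) *s b + (l * x1 ^ 2) *s c)
     (l3 *s a + (3 * l2 * x1 + 3 * l1 * x2 + l * x3) *s b + (3 * l1 * x1 ^ 2 + 3 * l * x1 * x2) *s c + (l * x1 ^ 3) *s d)
     (l4 *s a + (4 * l3 * x1 + 6 * l2 * x2 + 4 * l1 * x3 + l * x4) *s b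
       + (6 * l2 * x1 ^ 2 + 12 * l1 * x1 * x2 + l * (3 * x2 ^ 2 + 4 * x1 * x3)) *s c
       + (4 * l1 * x1 ^ 3 + 6 * l * x1 ^ 2 * x2) *s d + (l * x1 ^ 4) *s e) = l ^ 2 * x1 ^ 2 * zjet a b c d e"
    (is "zjet ?a ?b ?c ?d ?e = _")
proof -
  \<comment> \<open>\<open>zjet\<close> sees the jet only through these four determinants and four
    values of B, so the claim becomes an identity of rational functions in them.\<close>
  define W where "W = det3 a b c"
  define W1 where "W1 = det3 a b d"
  define D13 where "D13 = det3 a c d"
  define D04 where "D04 = det3 a b e"
  have W0: "W \<noteq> 0" using assms by (simp add: W_def)
  have w: "det3 ?a ?b ?c = l^3 * x1^3 * W"
    by (simp add: W_def algebra_simps eval_nat_numeral)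
  have w1: "det3 ?a ?b ?d = l^2 * x1 * ((3 * l1 * x1 ^ 2 + 3 * l * x1 * x2) * W + l * x1^3 * W1)"
    by (simp add: W_def W1_def algebra_simps eval_nat_numeral)
  have d04: "det3 ?a ?b ?e = l^2 * x1 * ((6 * l2 * x1 ^ 2 + 12 * l1 * x1 * x2 + l * (3 * x2 ^ 2 + 4 * x1 * x3)) * W
      + (4 * l1 * x1 ^ 3 + 6 * l * x1 ^ 2 * x2) * W1 + l * x1^4 * D04)"
    by (simp add: W_def W1_def D04_def algebra_simps eval_nat_numeral)
  have d13: "det3 ?a ?c ?d = l * ((2 * l1 * x1 + l * x2) * (3 * l1 * x1 ^ 2 + 3 * l * x1 * x2) * W
      + (2 * l1 * x1 + l * x2) * (l * x1^3) * W1 - l * x1^2 * (3 * l2 * x1 + 3 * l1 * x2 + l * x3) * W + l * x1^2 * (l * x1^3) * D13)"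
    by (simp add: W_def W1_def D13_def det3_swap(1)[of a b c] algebra_simps eval_nat_numeral)
  show ?thesis
    unfolding zjet_def w w1 d04 d13 W_def[symmetric] W1_def[symmetric] D13_def[symmetric] D04_def[symmetric]
    using W0 assms(2,3)
    apply (simp add: B_simps B_sym[of b a] B_sym[of c a] divide_simps)
    apply algebra
    done
qed

end

lemma vD_lin:
  assumes "open U" "z holomorphic_on U" "g holomorphic_on U" "t \<in> U"
  shows "vD (\<lambda>t. A + z t *s B + g t *s C) t = deriv z t *s B + deriv g t *s C"
  by (rule vhd_vD) (use assms in \<open>auto simp: vhd_def intro!: derivative_eq_intros holomorphic_derivI\<close>)

lemma vD_lin_higher:
  fixes A B C :: "complex^3"
  assumes U: "open U" "z holomorphic_on U" "g holomorphic_on U" and t: "t \<in> U"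
  defines "f \<equiv> \<lambda>t. A + z t *s B + g t *s C"
  shows "vD f t = deriv z t *s B + deriv g t *s C"
    "vD (vD f) t = (deriv ^^ 2) z t *s B + (deriv ^^ 2) g t *s C"
    "vD (vD (vD f)) t = (deriv ^^ 3) z t *s B + (deriv ^^ 3) g t *s C"
    "vD (vD (vD (vD f))) t = (deriv ^^ 4) z t *s B + (deriv ^^ 4) g t *s C"
proof -
  have h: "(deriv ^^ n) z holomorphic_on U" "(deriv ^^ n) g holomorphic_on U" for n
    using U by (auto intro: holomorphic_higher_deriv)
  have s: "vD (\<lambda>t. (deriv ^^ n) z t *s B + (deriv ^^ n) g t *s C) t = (deriv ^^ Suc n) z t *s B + (deriv ^^ Suc n) g t *s C"
    if "t \<in> U" for n t
    using vD_lin[OF U(1) h(1) h(2) that, of 0 n B n C] by simp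
  have 1: "vD f t = (deriv ^^ 1) z t *s B + (deriv ^^ 1) g t *s C" if "t \<in> U" for t
    unfolding f_def using vD_lin[OF U that, of A B C] by simp
  have 2: "vD (vD f) t = (deriv ^^ 2) z t *s B + (deriv ^^ 2) g t *s C" if "t \<in> U" for t
    using vD_cong[OF U(1) 1 that] s[OF that, of 1] by (simp add: eval_nat_numeral)
  have 3: "vD (vD (vD f)) t = (deriv ^^ 3) z t *s B + (deriv ^^ 3) g t *s C" if "t \<in> U" for t
    using vD_cong[OF U(1) 2 that] s[OF that, of 2] by (simp add: eval_nat_numeral)
  have 4: "vD (vD (vD (vD f))) t = (deriv ^^ 4) z t *s B + (deriv ^^ 4) g t *s C" if "t \<in> U" for t
    using vD_cong[OF U(1) 3 that] s[OF that, of 3] by (simp add: eval_nat_numeral)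
  show "vD f t = deriv z t *s B + deriv g t *s C" using 1[OF t] by simp
  show "vD (vD f) t = (deriv ^^ 2) z t *s B + (deriv ^^ 2) g t *s C" by (rule 2[OF t])
  show "vD (vD (vD f)) t = (deriv ^^ 3) z t *s B + (deriv ^^ 3) g t *s C" by (rule 3[OF t])
  show "vD (vD (vD (vD f))) t = (deriv ^^ 4) z t *s B + (deriv ^^ 4) g t *s C" by (rule 4[OF t])
qed

lemma vholo_lin:
  "z holomorphic_on U \<Longrightarrow> g holomorphic_on U \<Longrightarrow> vholo (\<lambda>t. A + z t *s B + g t *s C) U"
  unfolding vholo_def by (auto intro!: holomorphic_intros)

definition wr :: "(complex \<Rightarrow> complex^3) \<Rightarrow> complex \<Rightarrow> complex" where
  "wr f t = det3 (f t) (vD f t) (vD (vD f) t)"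

lemma holomorphic_det3:
  "vholo f U \<Longrightarrow> vholo g U \<Longrightarrow> vholo h U \<Longrightarrow> (\<lambda>t. det3 (f t) (g t) (h t)) holomorphic_on U"
  unfolding vholo_def det3_def by (auto intro!: holomorphic_intros)

lemma holomorphic_wr: "vholo f U \<Longrightarrow> open U \<Longrightarrow> wr f holomorphic_on U"
  unfolding wr_def by (intro holomorphic_det3 vholo_vD)

lemma wr_lin:
  assumes U: "open U" "z holomorphic_on U" "g holomorphic_on U" and t: "t \<in> U"
  shows "wr (\<lambda>t. A + z t *s B + g t *s C) t =
    (deriv z t * (deriv ^^ 2) g t - (deriv ^^ 2) z t * deriv g t) * det3 A B C"
  unfolding wr_def vD_lin_higher[OF assms]
  by (simp add: det3_swap(1)[of A B C] det3_swap(1)[of B B C] algebra_simps) (simp add: det3_def algebra_simps)?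

lemma wr_scale_compose:
  assumes U: "open U" and V: "open V" and f: "vholo f V" and x: "x holomorphic_on U" and xV: "x ` U \<subseteq> V"
    and l: "l holomorphic_on U" and eq: "\<And>t. t \<in> U \<Longrightarrow> g t = l t *s f (x t)" and t: "t \<in> U"
  shows "wr g t = (l t * deriv x t) ^ 3 * wr f (x t)"
  apply (simp only: wr_def vD_scale_compose(1-2)[where f=f and x=x and l=l and g=g, OF assms] eq[OF t])
  by (simp add: power_mult_distrib eval_nat_numeral algebra_simps)

context symform
begin

definition hval :: "(complex \<Rightarrow> complex^3) \<Rightarrow> complex \<Rightarrow> complex" where
  "hval f t = hjet (f t) (vD f t) (vD (vD f) t) (vD (vD (vD f)) t) (vD (vD (vD (vD f))) t)"

text \<open>A nonzero Wronskian of g forces both l and the derivative of x to be nonzero at t, so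
  that their common sixth power can be cancelled. This makes \<open>hval\<close> a quantity attached
  to points of the curve and not to lifts.\<close>

lemma hval_scale_compose:
  assumes U: "open U" and V: "open V" and f: "vholo f V" and x: "x holomorphic_on U" and xV: "x ` U \<subseteq> V"
    and l: "l holomorphic_on U" and eq: "\<And>t. t \<in> U \<Longrightarrow> g t = l t *s f (x t)" and t: "t \<in> U"
    and w: "wr g t \<noteq> 0"
  shows "hval g t = hval f (x t)" "wr f (x t) \<noteq> 0"
proof -
  have w': "wr g t = (l t * deriv x t) ^ 3 * wr f (x t)"
    by (rule wr_scale_compose[where f=f and x=x and l=l and g=g, OF U V f x xV l eq t])
  then have nz: "l t \<noteq> 0" "deriv x t \<noteq> 0" "wr f (x t) \<noteq> 0" using w by auto
  show "wr f (x t) \<noteq> 0" by fact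
  note D = vD_scale_compose[where f=f and x=x and l=l and g=g, OF U V f x xV l eq t]
  have "zjet (g t) (vD g t) (vD (vD g) t) (vD (vD (vD g)) t) (vD (vD (vD (vD g))) t)
    = l t ^ 2 * deriv x t ^ 2 * zjet (f (x t)) (vD f (x t)) (vD (vD f) (x t)) (vD (vD (vD f)) (x t)) (vD (vD (vD (vD f))) (x t))"
    apply (simp only: D eq[OF t]) by (rule zjet_reparam) (use nz in \<open>auto simp: wr_def\<close>)
  moreover have "(l t ^ 2 * deriv x t ^ 2 * z) ^ 3 = (l t * deriv x t) ^ 6 * z ^ 3" for z
    by (simp add: power_mult_distrib power_mult[symmetric])
  moreover have "((l t * deriv x t) ^ 3 * z) ^ 2 = (l t * deriv x t) ^ 6 * z ^ 2" for z
    by (simp add: power_mult_distrib power_mult[symmetric])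
  moreover have "(l t * deriv x t) ^ 6 \<noteq> 0" using nz by simp
  ultimately show "hval g t = hval f (x t)"
    unfolding hval_def hjet_def wr_def[symmetric] w' by (simp only: mult_divide_mult_cancel_left not_False_eq_True)
qed

lemma B_sum_left: "B (\<Sum>i\<in>A. f i) w = (\<Sum>i\<in>A. B (f i) w)"
  by (induction A rule: infinite_finite_induct) (auto simp: B_add)

text \<open>Bilinearity expresses B through nine constants; this is how values of B along
  holomorphic lifts are seen to be holomorphic.\<close>

lemma B_expand: "B u v = (\<Sum>i\<in>UNIV. \<Sum>j\<in>UNIV. u $ i * v $ j * B (axis i 1) (axis j 1))"
proof -
  have "B u v = (\<Sum>i\<in>UNIV. u $ i * B (axis i 1) v)" for u v
    using B_sum_left[of "\<lambda>i. u $ i *s axis i 1" UNIV v] basis_expansion[of u] by (simp add: B_scale)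
  from this[of u v] this[of v "axis _ 1"] show ?thesis
    by (simp add: B_sym[of "axis _ 1" v] B_sym[of "axis _ 1" "axis _ 1"] sum_distrib_left mult.assoc)
qed

lemma holomorphic_B:
  "vholo f U \<Longrightarrow> vholo g U \<Longrightarrow> (\<lambda>t. B (f t) (g t)) holomorphic_on U"
  by (subst B_expand) (auto simp: vholo_def intro!: holomorphic_intros)

lemma holomorphic_hval:
  assumes "vholo f U" "open U" "\<And>t. t \<in> U \<Longrightarrow> wr f t \<noteq> 0"
  shows "hval f holomorphic_on U"
  unfolding hval_def hjet_def zjet_def
  using assms by (auto intro!: holomorphic_intros holomorphic_B holomorphic_det3 vholo_vD simp: wr_def)

lemma hval_bounded_if_wr_nonzero:
  assumes f: "vholo f U" and U: "open U" "t0 \<in> U" and w: "wr f t0 \<noteq> 0"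
  obtains K where "\<forall>\<^sub>F t in nhds t0. wr f t \<noteq> 0 \<and> norm (hval f t) \<le> K"
proof -
  have "isCont (wr f) t0"
    using holomorphic_on_imp_continuous_on[OF holomorphic_wr[OF f U(1)]] U continuous_on_eq_continuous_at by blast
  then have "\<forall>\<^sub>F t in nhds t0. wr f t \<in> - {0}"
    using w by (intro topological_tendstoD[where l="wr f t0"]) (auto simp: isCont_def filterlim_at tendsto_at_iff_tendsto_nhds)
  then obtain V where V: "open V" "t0 \<in> V" "\<And>t. t \<in> V \<Longrightarrow> wr f t \<noteq> 0"
    unfolding eventually_nhds by auto
  define S where "S = U \<inter> V"
  have S: "open S" "t0 \<in> S" using U V by (auto simp: S_def)
  have "vholo f S" using f unfolding vholo_def S_def by (auto intro: holomorphic_on_subset)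
  then have "hval f holomorphic_on S" using S V by (intro holomorphic_hval) (auto simp: S_def)
  then have "isCont (hval f) t0"
    using holomorphic_on_imp_continuous_on S continuous_on_eq_continuous_at by blast
  then have "(hval f \<longlongrightarrow> hval f t0) (nhds t0)"
    by (simp add: isCont_def tendsto_at_iff_tendsto_nhds)
  then have "\<forall>\<^sub>F t in nhds t0. dist (hval f t) (hval f t0) < 1" by (rule tendstoD) simp
  moreover have "\<forall>\<^sub>F t in nhds t0. t \<in> S" using S by (rule eventually_nhds_in_open)
  ultimately have "\<forall>\<^sub>F t in nhds t0. wr f t \<noteq> 0 \<and> norm (hval f t) \<le> norm (hval f t0) + 1"
  proof eventually_elim
    case (elim t)
    have "norm (hval f t) \<le> norm (hval f t0) + norm (hval f t - hval f t0)" by norm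
    then show ?case using elim V by (auto simp: S_def dist_norm)
  qed
  then show ?thesis by (rule that)
qed

end

text \<open>With the Euler operator \<theta> = t d/dt one has t^(k+1) f^(k+1) = (\<theta> - k) (t^k
  f^(k)), and \<theta> turns t^n G into t^n (n G + t G'). The recursion computes the holomorphic
  factor that remains after t^n has been split off.\<close>

primrec euler_coeff :: "nat \<Rightarrow> nat \<Rightarrow> (complex \<Rightarrow> complex) \<Rightarrow> complex \<Rightarrow> complex" where
  "euler_coeff n 0 G = G"
| "euler_coeff n (Suc k) G = (\<lambda>t. (of_nat n - of_nat k) * euler_coeff n k G t + t * deriv (euler_coeff n k G) t)"

lemma holomorphic_euler_coeff:
  "G holomorphic_on U \<Longrightarrow> open U \<Longrightarrow> euler_coeff n k G holomorphic_on U"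
  by (induction k) (auto intro!: holomorphic_intros holomorphic_deriv)

lemma higher_deriv_euler_coeff:
  assumes U: "open U" and f: "f holomorphic_on U" and G: "G holomorphic_on U"
    and eq: "\<And>t. t \<in> U \<Longrightarrow> f t = t ^ n * G t"
  shows "t \<in> U \<Longrightarrow> t ^ k * (deriv ^^ k) f t = t ^ n * euler_coeff n k G t"
proof (induction k arbitrary: t)
  case (Suc k)
  let ?f = "(deriv ^^ k) f" and ?G = "euler_coeff n k G"
  have h: "?f holomorphic_on U" "?G holomorphic_on U"
    using U f G by (auto intro: holomorphic_higher_deriv holomorphic_euler_coeff)
  have "((\<lambda>t. t ^ k * ?f t) has_field_derivative (of_nat k * t ^ (k - 1) * ?f t + t ^ k * deriv ?f t)) (at t)"
    using holomorphic_derivI[OF h(1) U Suc.prems] by (auto intro!: derivative_eq_intros)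
  moreover have "((\<lambda>t. t ^ n * ?G t) has_field_derivative (of_nat n * t ^ (n - 1) * ?G t + t ^ n * deriv ?G t)) (at t)"
    using holomorphic_derivI[OF h(2) U Suc.prems] by (auto intro!: derivative_eq_intros)
  then have "((\<lambda>t. t ^ k * ?f t) has_field_derivative (of_nat n * t ^ (n - 1) * ?G t + t ^ n * deriv ?G t)) (at t)"
    by (rule has_field_derivative_transform_within_open[OF _ U Suc.prems]) (simp add: Suc.IH)
  ultimately have "of_nat k * t ^ (k - 1) * ?f t + t ^ k * deriv ?f t = of_nat n * t ^ (n - 1) * ?G t + t ^ n * deriv ?G t"
    by (rule DERIV_unique)
  then have "t * (of_nat k * t ^ (k - 1) * ?f t) + t * (t ^ k * deriv ?f t) = t * (of_nat n * t ^ (n - 1) * ?G t) + t * (t ^ n * deriv ?G t)"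
    by (simp only: distrib_left[symmetric])
  moreover have "t * (of_nat k * t ^ (k - 1) * ?f t) = of_nat k * (t ^ k * ?f t)" by (cases k) auto
  moreover have "t * (of_nat n * t ^ (n - 1) * ?G t) = of_nat n * (t ^ n * ?G t)" by (cases n) auto
  ultimately have "of_nat k * (t ^ k * ?f t) + t * (t ^ k * deriv ?f t) = of_nat n * (t ^ n * ?G t) + t * (t ^ n * deriv ?G t)"
    by (simp only:)
  then have "of_nat k * (t ^ n * ?G t) + t * (t ^ k * deriv ?f t) = of_nat n * (t ^ n * ?G t) + t * (t ^ n * deriv ?G t)"
    by (simp only: Suc.IH[OF Suc.prems])
  then show ?case by (simp add: algebra_simps)
qed (simp add: eq)

lemma third_deriv_zero_imp_quadratic:
  fixes f :: "complex \<Rightarrow> complex"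
  assumes S: "convex S" "open S"
    and f: "\<And>t. t \<in> S \<Longrightarrow> (f has_field_derivative f1 t) (at t)"
    and f1: "\<And>t. t \<in> S \<Longrightarrow> (f1 has_field_derivative f2 t) (at t)"
    and f2: "\<And>t. t \<in> S \<Longrightarrow> (f2 has_field_derivative 0) (at t)"
  obtains \<alpha> \<beta> \<gamma> where "\<And>t. t \<in> S \<Longrightarrow> f t = \<alpha> + \<beta> * t + \<gamma> * t ^ 2"
    "\<And>t. t \<in> S \<Longrightarrow> f2 t = 2 * \<gamma>"
proof -
  have cst: "\<exists>c. \<forall>t\<in>S. h t = c" if "\<And>t. t \<in> S \<Longrightarrow> (h has_field_derivative 0) (at t)" for h :: "complex \<Rightarrow> complex"
    using has_field_derivative_zero_constant[OF S(1), of h] that by (metis has_field_derivative_at_within)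
  obtain c where c: "\<And>t. t \<in> S \<Longrightarrow> f2 t = c" using cst[OF f2] by blast
  have "((\<lambda>t. f1 t - c * t) has_field_derivative 0) (at t)" if "t \<in> S" for t
    using f1[OF that] c[OF that] by (auto intro!: derivative_eq_intros)
  from cst[OF this] obtain b where b: "\<And>t. t \<in> S \<Longrightarrow> f1 t - c * t = b" by blast
  have "((\<lambda>t. f t - b * t - c / 2 * t ^ 2) has_field_derivative 0) (at t)" if "t \<in> S" for t
    using f[OF that] b[OF that] by (auto intro!: derivative_eq_intros simp: algebra_simps)
  from cst[OF this] obtain a where a: "\<And>t. t \<in> S \<Longrightarrow> f t - b * t - c / 2 * t ^ 2 = a" by blast
  show ?thesis
  proof (rule that[of a b "c / 2"])
    show "f t = a + b * t + c / 2 * t ^ 2" if "t \<in> S" for t using a[OF that] by (simp add: algebra_simps)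
    show "f2 t = 2 * (c / 2)" if "t \<in> S" for t using c[OF that] by simp
  qed
qed

context symform
begin

text \<open>With l = Y''^(-1/3) the invariant becomes h ^ 3 / \<delta> ^ 2, where h' is
  B(\<phi>,\<phi>) times half the third derivative of l ^ 2. Constancy therefore means Monge's
  equation for conics. If r3, r5 and r6 all vanished, the relation would involve t alone and say
  nothing about Y.\<close>

lemma conic_if_hval_constant:
  fixes A E C :: "complex^3"
  assumes S: "convex S" "open S" "S \<noteq> {}" and Y: "Y holomorphic_on S"
    and Y2: "\<And>t. t \<in> S \<Longrightarrow> (deriv ^^ 2) Y t \<noteq> 0"
    and det: "det3 A E C \<noteq> 0"
    and \<phi>: "\<phi> = (\<lambda>t. A + t *s E + Y t *s C)"
    and Q: "\<And>t. t \<in> S \<Longrightarrow> B (\<phi> t) (\<phi> t) \<noteq> 0"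
    and const: "\<And>t. t \<in> S \<Longrightarrow> hval \<phi> t = c"
  obtains r1 r2 r3 r4 r5 r6 where "(r3, r5, r6) \<noteq> (0, 0, 0)"
    "\<And>t. t \<in> S \<Longrightarrow> r1 + r2 * t + r3 * Y t + r4 * t ^ 2 + r5 * t * Y t + r6 * Y t ^ 2 = 0"
proof -
  have "contractible S" using S(1) by (rule convex_imp_contractible)
  then obtain g where g: "g holomorphic_on S" "\<And>t. t \<in> S \<Longrightarrow> (deriv ^^ 2) Y t = exp (g t)"
    using contractible_imp_holomorphic_log[OF holomorphic_higher_deriv[OF Y S(2), of 2] _] Y2 by metis
  \<comment> \<open>A holomorphic cube root of 1 / Y''; it exists because Y'' has a holomorphic
    logarithm on the contractible set S.\<close>
  define l where "l t = exp (- g t / 3)" for t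
  have lh: "l holomorphic_on S" unfolding l_def using g(1) by (auto intro!: holomorphic_intros)
  have l0: "l t \<noteq> 0" for t by (simp add: l_def)
  have lY: "(deriv ^^ 2) Y t = 1 / l t ^ 3" if "t \<in> S" for t
    using g(2)[OF that] by (simp add: l_def exp_of_nat_mult[symmetric] exp_minus field_simps)
  define l1 where "l1 = deriv l"
  define l2 where "l2 = deriv l1"
  define l3 where "l3 = deriv l2"
  have hs: "l1 holomorphic_on S" "l2 holomorphic_on S" "l3 holomorphic_on S"
    unfolding l1_def l2_def l3_def using lh S(2) by (auto intro!: holomorphic_deriv)
  have L: "(l has_field_derivative l1 t) (at t)" "(l1 has_field_derivative l2 t) (at t)" "(l2 has_field_derivative l3 t) (at t)"
    if "t \<in> S" for t
    using that S(2) lh hs unfolding l1_def l2_def l3_def by (auto intro: holomorphic_derivI)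
  have Yn: "((deriv ^^ n) Y has_field_derivative (deriv ^^ Suc n) Y t) (at t)" if "t \<in> S" for n t
    using holomorphic_derivI[OF holomorphic_higher_deriv[OF Y S(2)] S(2) that, of n] by simp
  have Y3: "(deriv ^^ 3) Y t = - 3 * l1 t / l t ^ 4" if t: "t \<in> S" for t
  proof -
    have "((\<lambda>t. 1 / l t ^ 3) has_field_derivative - 3 * l1 t / l t ^ 4) (at t)"
      using t l0 by (auto intro!: derivative_eq_intros L simp: field_simps eval_nat_numeral)
    then have "((deriv ^^ 2) Y has_field_derivative - 3 * l1 t / l t ^ 4) (at t)"
      by (rule has_field_derivative_transform_within_open[OF _ S(2) t]) (simp add: lY)
    then have "deriv ((deriv ^^ 2) Y) t = - 3 * l1 t / l t ^ 4" by (rule DERIV_imp_deriv)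
    then show ?thesis by (simp add: eval_nat_numeral)
  qed
  have Y4: "(deriv ^^ 4) Y t = 12 * l1 t ^ 2 / l t ^ 5 - 3 * l2 t / l t ^ 4" if t: "t \<in> S" for t
  proof -
    have "((\<lambda>t. - 3 * l1 t / l t ^ 4) has_field_derivative 12 * l1 t ^ 2 / l t ^ 5 - 3 * l2 t / l t ^ 4) (at t)"
      using t l0 by (auto intro!: derivative_eq_intros L simp: field_simps eval_nat_numeral)
    then have "((deriv ^^ 3) Y has_field_derivative 12 * l1 t ^ 2 / l t ^ 5 - 3 * l2 t / l t ^ 4) (at t)"
      by (rule has_field_derivative_transform_within_open[OF _ S(2) t]) (simp add: Y3)
    then have "deriv ((deriv ^^ 3) Y) t = 12 * l1 t ^ 2 / l t ^ 5 - 3 * l2 t / l t ^ 4" by (rule DERIV_imp_deriv)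
    then show ?thesis by (simp add: eval_nat_numeral)
  qed
  define Y1 where "Y1 = deriv Y"
  have Yd: "(Y has_field_derivative Y1 t) (at t)" "(Y1 has_field_derivative 1 / l t ^ 3) (at t)" if "t \<in> S" for t
    using Yn[OF that, of 0] Yn[OF that, of 1] lY[OF that] by (simp_all add: Y1_def eval_nat_numeral)
  define q where "q t = B (\<phi> t) (\<phi> t)" for t
  define p where "p t = B (\<phi> t) (E + Y1 t *s C)" for t
  define r where "r t = B (E + Y1 t *s C) (E + Y1 t *s C)" for t
  define s where "s t = B (\<phi> t) C" for t
  define s1 where "s1 t = B (E + Y1 t *s C) C" for t
  have dq: "(q has_field_derivative 2 * p t) (at t)" if "t \<in> S" for t
    unfolding q_def p_def \<phi> using Yd[OF that]
    by (auto simp: B_simps B_sym[of E A] B_sym[of C A] B_sym[of C E] algebra_simps intro!: derivative_eq_intros)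
  have dp: "(p has_field_derivative r t + s t / l t ^ 3) (at t)" if "t \<in> S" for t
    unfolding p_def r_def s_def \<phi> using Yd[OF that]
    by (auto simp: B_simps B_sym[of E A] B_sym[of C A] B_sym[of C E] algebra_simps add_divide_distrib intro!: derivative_eq_intros)
  have dr: "(r has_field_derivative 2 * s1 t / l t ^ 3) (at t)" if "t \<in> S" for t
    unfolding r_def s1_def \<phi> using Yd[OF that]
    by (auto simp: B_simps B_sym[of E A] B_sym[of C A] B_sym[of C E] algebra_simps add_divide_distrib intro!: derivative_eq_intros)
  have ds: "(s has_field_derivative s1 t) (at t)" if "t \<in> S" for t
    unfolding s_def s1_def \<phi> using Yd[OF that]
    by (auto simp: B_simps B_sym[of E A] B_sym[of C A] B_sym[of C E] algebra_simps intro!: derivative_eq_intros)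
  \<comment> \<open>\<open>zjet\<close> of \<phi> in the parameter t, multiplied by l ^ 2.\<close>
  define h where "h t = q t * (l t * l2 t + l1 t ^ 2) - 2 * l t * l1 t * p t + l t ^ 2 * r t - 2 * s t / l t" for t
  define \<delta> where "\<delta> = det3 A E C"
  have hh: "h t ^ 3 = c * \<delta> ^ 2" if t: "t \<in> S" for t
  proof -
    have idh: "(\<lambda>t. t) holomorphic_on S" by (auto intro: holomorphic_intros)
    have d1: "deriv (\<lambda>t. t) t = (1::complex)" "(deriv ^^ 2) (\<lambda>t. t) t = (0::complex)"
        "(deriv ^^ 3) (\<lambda>t. t) t = (0::complex)" "(deriv ^^ 4) (\<lambda>t. t) t = (0::complex)" for t
      by (simp_all add: eval_nat_numeral)
    note D = vD_lin_higher[OF S(2) idh Y t, of A E C, folded \<phi>, unfolded d1]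
    have jets: "vD \<phi> t = E + Y1 t *s C" "vD (vD \<phi>) t = (1 / l t ^ 3) *s C"
      "vD (vD (vD \<phi>)) t = (- 3 * l1 t / l t ^ 4) *s C" "vD (vD (vD (vD \<phi>))) t = (12 * l1 t ^ 2 / l t ^ 5 - 3 * l2 t / l t ^ 4) *s C"
      using D lY[OF t] Y3[OF t] Y4[OF t] by (simp_all add: Y1_def)
    have dets: "det3 (\<phi> t) (E + Y1 t *s C) (x *s C) = x * \<delta>" "det3 (\<phi> t) (x *s C) (y *s C) = 0" for x y
      by (simp_all add: \<phi> \<delta>_def det3_swap(1)[of A C E])
    have "zjet (\<phi> t) (vD \<phi> t) (vD (vD \<phi>) t) (vD (vD (vD \<phi>)) t) (vD (vD (vD (vD \<phi>))) t) = h t / l t ^ 2"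
      unfolding jets zjet_def dets using det l0[of t]
      by (simp add: B_scale' q_def[symmetric] p_def[symmetric] r_def[symmetric] s_def[symmetric] h_def \<delta>_def[symmetric] field_simps eval_nat_numeral)
    then have "hval \<phi> t = (h t / l t ^ 2) ^ 3 / (1 / l t ^ 3 * \<delta>) ^ 2"
      unfolding hval_def hjet_def jets(1,2) dets by (simp add: jets)
    also have "\<dots> = h t ^ 3 / \<delta> ^ 2" using l0[of t] det by (simp add: field_simps \<delta>_def)
    finally show ?thesis using const[OF t] det by (simp add: field_simps \<delta>_def)
  qed
  have dh: "(h has_field_derivative q t * (3 * l1 t * l2 t + l t * l3 t)) (at t)" if t: "t \<in> S" for t
    unfolding h_def[abs_def] using l0[of t] t
    by (auto intro!: derivative_eq_intros L[OF t] dq[OF t] dp[OF t] dr[OF t] ds[OF t] simp: field_simps eval_nat_numeral)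
  have key: "3 * l1 t * l2 t + l t * l3 t = 0" if t: "t \<in> S" for t
  proof -
    have "((\<lambda>t. h t ^ 3) has_field_derivative 3 * h t ^ 2 * (q t * (3 * l1 t * l2 t + l t * l3 t))) (at t)"
      by (auto intro!: derivative_eq_intros dh[OF t])
    moreover have "((\<lambda>t. h t ^ 3) has_field_derivative 0) (at t)"
      by (rule has_field_derivative_transform_within_open[OF DERIV_const[of "c * \<delta> ^ 2"] S(2) t]) (simp add: hh)
    ultimately have "3 * h t ^ 2 * (q t * (3 * l1 t * l2 t + l t * l3 t)) = 0" by (rule DERIV_unique)
    \<comment> \<open>The derivative of h ^ 3 gives no information where h vanishes. But one zero
      makes the constant 0, so h vanishes on all of S and its own derivative can be used
      instead.\<close>
    then consider "h t = 0" | "q t * (3 * l1 t * l2 t + l t * l3 t) = 0" by auto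
    then show ?thesis
    proof cases
      case 1
      then have z: "c * \<delta> ^ 2 = 0" using hh[OF t] by simp
      have "h u = 0" if "u \<in> S" for u
      proof -
        have "h u ^ 3 = 0" using hh[OF that] z by (simp only:)
        then show ?thesis by simp
      qed
      then have "(h has_field_derivative 0) (at t)"
        by (intro has_field_derivative_transform_within_open[OF DERIV_const[of 0] S(2) t]) simp
      then have "q t * (3 * l1 t * l2 t + l t * l3 t) = 0" using dh[OF t] DERIV_unique by blast
      then show ?thesis using Q[OF t] by (simp add: q_def)
    next
      case 2
      then show ?thesis using Q[OF t] by (simp add: q_def)
    qed
  qed
  have cst: "\<exists>c. \<forall>t\<in>S. h t = c" if "\<And>t. t \<in> S \<Longrightarrow> (h has_field_derivative 0) (at t)" for h :: "complex \<Rightarrow> complex"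
    using has_field_derivative_zero_constant[OF S(1), of h] that by (metis has_field_derivative_at_within)
  \<comment> \<open>Multiplied by l ^ 2, the vanishing expression is also the derivative of l ^ 3
    l''. Hence l'' = k / l ^ 3 = k Y'' with a constant k.\<close>
  have "((\<lambda>t. l t ^ 3 * l2 t) has_field_derivative l t ^ 2 * (3 * l1 t * l2 t + l t * l3 t)) (at t)" if t: "t \<in> S" for t
    by (auto intro!: derivative_eq_intros L[OF t] simp: algebra_simps eval_nat_numeral)
  then have "((\<lambda>t. l t ^ 3 * l2 t) has_field_derivative 0) (at t)" if t: "t \<in> S" for t
    using key[OF t] t by fastforce
  from cst[OF this] obtain k where k: "\<And>t. t \<in> S \<Longrightarrow> l t ^ 3 * l2 t = k" by blast
  have l2k: "l2 t = k / l t ^ 3" if "t \<in> S" for t using k[OF that] l0[of t] by (simp add: field_simps)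
  have m1: "((\<lambda>t. l t ^ 2) has_field_derivative 2 * l t * l1 t) (at t)" if t: "t \<in> S" for t
    by (auto intro!: derivative_eq_intros L[OF t])
  have m2: "((\<lambda>t. 2 * l t * l1 t) has_field_derivative 2 * (l1 t ^ 2 + l t * l2 t)) (at t)" if t: "t \<in> S" for t
    by (auto intro!: derivative_eq_intros L[OF t] simp: algebra_simps eval_nat_numeral)
  have m3: "((\<lambda>t. 2 * (l1 t ^ 2 + l t * l2 t)) has_field_derivative 0) (at t)" if t: "t \<in> S" for t
  proof -
    have "((\<lambda>t. 2 * (l1 t ^ 2 + l t * l2 t)) has_field_derivative 2 * (3 * l1 t * l2 t + l t * l3 t)) (at t)"
      by (auto intro!: derivative_eq_intros L[OF t] simp: algebra_simps eval_nat_numeral)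
    then show ?thesis using key[OF t] by simp
  qed
  obtain \<alpha> \<beta> \<gamma> where quad: "\<And>t. t \<in> S \<Longrightarrow> l t ^ 2 = \<alpha> + \<beta> * t + \<gamma> * t ^ 2"
    using third_deriv_zero_imp_quadratic[OF S(1,2) m1 m2 m3] by metis
  \<comment> \<open>If k is nonzero, then l - k Y is affine in t, and squaring l = k Y + a t + b
    turns the quadratic formula for l ^ 2 into a relation for Y. If k = 0, then l itself is affine
    and l Y has vanishing third derivative.\<close>
  show ?thesis
  proof (cases "k = 0")
    case False
    have 1: "((\<lambda>t. l t - k * Y t) has_field_derivative l1 t - k * Y1 t) (at t)" if t: "t \<in> S" for t
      by (auto intro!: derivative_eq_intros L[OF t] Yd[OF t])
    have 2: "((\<lambda>t. l1 t - k * Y1 t) has_field_derivative 0) (at t)" if t: "t \<in> S" for t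
      using l2k[OF t] by (auto intro!: derivative_eq_intros L[OF t] Yd[OF t])
    obtain a where a: "\<And>t. t \<in> S \<Longrightarrow> l1 t - k * Y1 t = a" using cst[OF 2] by blast
    have "((\<lambda>t. l t - k * Y t - a * t) has_field_derivative 0) (at t)" if t: "t \<in> S" for t
      using a[OF t] by (auto intro!: derivative_eq_intros L[OF t] Yd[OF t])
    from cst[OF this] obtain b where b: "\<And>t. t \<in> S \<Longrightarrow> l t - k * Y t - a * t = b" by blast
    show ?thesis
    proof (rule that[of "2 * k * b" "2 * k * a" "k ^ 2" "b ^ 2 - \<alpha>" "2 * a * b - \<beta>" "a ^ 2 - \<gamma>"])
      show "(2 * k * b, 2 * k * a, k ^ 2) \<noteq> (0, 0, 0)" using False by simp
      show "b\<^sup>2 - \<alpha> + (2 * a * b - \<beta>) * t + 2 * k * b * Y t + (a\<^sup>2 - \<gamma>) * t\<^sup>2 + 2 * k * a * t * Y t + k\<^sup>2 * (Y t)\<^sup>2 = 0" if "t \<in> S" for t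
      proof -
        have "l t = k * Y t + a * t + b" using b[OF that] by (simp add: algebra_simps)
        then show ?thesis using quad[OF that] by (simp add: algebra_simps power2_eq_square)
      qed
    qed
  next
    case True
    then have l20: "l2 t = 0" if "t \<in> S" for t using l2k[OF that] by simp
    have "(l1 has_field_derivative 0) (at t)" if t: "t \<in> S" for t using L(2)[OF t] l20[OF t] by simp
    from cst[OF this] obtain a where a: "\<And>t. t \<in> S \<Longrightarrow> l1 t = a" by blast
    have "((\<lambda>t. l t - a * t) has_field_derivative 0) (at t)" if t: "t \<in> S" for t
      using a[OF t] by (auto intro!: derivative_eq_intros L[OF t])
    from cst[OF this] obtain b where b: "\<And>t. t \<in> S \<Longrightarrow> l t - a * t = b" by blast
    have lt: "l t = a * t + b" if "t \<in> S" for t using b[OF that] by (simp add: algebra_simps)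
    have n1: "((\<lambda>t. l t * Y t) has_field_derivative a * Y t + l t * Y1 t) (at t)" if t: "t \<in> S" for t
      using a[OF t] by (auto intro!: derivative_eq_intros L[OF t] Yd[OF t])
    have n2: "((\<lambda>t. a * Y t + l t * Y1 t) has_field_derivative 2 * a * Y1 t + 1 / l t ^ 2) (at t)" if t: "t \<in> S" for t
      using a[OF t] l0[of t] by (auto intro!: derivative_eq_intros L[OF t] Yd[OF t] simp: field_simps eval_nat_numeral)
    have n3: "((\<lambda>t. 2 * a * Y1 t + 1 / l t ^ 2) has_field_derivative 0) (at t)" if t: "t \<in> S" for t
      using a[OF t] l0[of t] by (auto intro!: derivative_eq_intros L[OF t] Yd[OF t] simp: field_simps eval_nat_numeral)
    obtain \<alpha>' \<beta>' \<gamma>' where quad': "\<And>t. t \<in> S \<Longrightarrow> l t * Y t = \<alpha>' + \<beta>' * t + \<gamma>' * t ^ 2"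
      using third_deriv_zero_imp_quadratic[OF S(1,2) n1 n2 n3] by metis
    show ?thesis
    proof (rule that[of b a 0 "- \<alpha>'" "- \<beta>'" "- \<gamma>'"])
      obtain t where "t \<in> S" using S(3) by blast
      then show "(b, a, 0) \<noteq> (0, 0, 0)" using lt l0[of t] by auto
      show "- \<alpha>' + - \<beta>' * t + b * Y t + - \<gamma>' * t\<^sup>2 + a * t * Y t + 0 * (Y t)\<^sup>2 = 0" if "t \<in> S" for t
        using quad'[OF that] unfolding lt[OF that] by (simp add: algebra_simps)
    qed
  qed
qed

text \<open>Multiplying the j-th derivative by t ^ j is the effect of a linear change of parameter
  with factor t. On a branch this replaces derivatives by expressions with explicit powers of
  t.\<close>

lemma zjet_scale:
  assumes "det3 a b c \<noteq> 0" "t \<noteq> 0"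
  shows "zjet a (t *s b) (t ^ 2 *s c) (t ^ 3 *s d) (t ^ 4 *s e) = t ^ 2 * zjet a b c d e"
  using assms by (simp add: zjet_def B_simps divide_simps) (simp add: algebra_simps eval_nat_numeral)

text \<open>Along the branch t ^ 3 times the Wronskian is t ^ (p + q) times a unit, and t ^ 2 times
  \<open>zjet\<close> is divisible by t ^ k as soon as all values of B on the jet are. So
  \<open>hval\<close> is t ^ (3 k - 2 (p + q)) times a function continuous at 0. The values B A C, B
  E E, B E C and B C C come with the powers p, 2 q, p + q and 2 p; each has to vanish or have power
  at least k.\<close>

lemma hval_bounded_on_branch:
  fixes A E C :: "complex^3"
  assumes r: "r > 0" and g: "g holomorphic_on ball 0 r" and lim: "((\<lambda>t. g t / t ^ p) \<longlongrightarrow> c) (at 0)" and c: "c \<noteq> 0"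
    and g0: "g 0 = 0"
    and qp: "1 \<le> q" "q < p" and det: "det3 A E C \<noteq> 0"
    and B0: "B A A = 0" "B A E = 0" and k: "k \<le> p + q" "2 * (p + q) \<le> 3 * k" "B A C = 0 \<or> k \<le> p" "B E E = 0 \<or> k \<le> 2 * q"
  defines "\<psi> \<equiv> (\<lambda>t. A + (t ^ q) *s E + g t *s C)"
  obtains K where "\<forall>\<^sub>F t in at 0. wr \<psi> t \<noteq> 0 \<and> norm (hval \<psi> t) \<le> K"
proof -
  define U where "U = ball (0::complex) r"
  have U: "open U" "0 \<in> U" using r by (auto simp: U_def)
  define G where "G t = (if t = 0 then c else g t / t ^ p)" for t
  have Gh: "G holomorphic_on U" unfolding G_def
    by (rule removable_singularity) (use g lim in \<open>auto simp: U_def intro!: holomorphic_intros elim: holomorphic_on_subset\<close>)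
  have gG: "g t = t ^ p * G t" for t using g0 qp by (simp add: G_def)
  define Gk where "Gk k = euler_coeff p k G" for k
  define Zk where "Zk k = euler_coeff q k (\<lambda>_. 1)" for k
  have zh: "(\<lambda>t. t ^ q) holomorphic_on U" by (auto intro: holomorphic_intros)
  have gh: "g holomorphic_on U" using g by (simp add: U_def)
  have hG: "Gk k holomorphic_on U" "Zk k holomorphic_on U" for k
    unfolding Gk_def Zk_def using Gh U by (auto intro!: holomorphic_euler_coeff)
  have gk: "t ^ k * (deriv ^^ k) g t = t ^ p * Gk k t" if "t \<in> U" for k t
    unfolding Gk_def by (rule higher_deriv_euler_coeff[OF U(1) gh Gh]) (use gG that in auto)
  have zk: "t ^ k * (deriv ^^ k) (\<lambda>t. t ^ q) t = t ^ q * Zk k t" if "t \<in> U" for k t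
    unfolding Zk_def by (rule higher_deriv_euler_coeff[OF U(1) zh]) (use that in auto)
  define \<delta> where "\<delta> = det3 A E C"
  define w where "w i j t = Zk i t * Gk j t - Zk j t * Gk i t" for i j t
  define V where "V k t = (t ^ q * Zk k t) *s E + (t ^ p * Gk k t) *s C" for k t
  have hw: "w i j holomorphic_on U" for i j unfolding w_def using hG by (auto intro!: holomorphic_intros)
  \<comment> \<open>The value at 0 of the unit in the Wronskian is c p q (p - q), up to the factor
    \<delta>; it is nonzero because the exponents differ.\<close>
  have w120: "w 1 2 0 \<noteq> 0"
  proof -
    have "w 1 2 0 = c * of_nat q * of_nat p * (of_nat p - of_nat q)"
      by (simp add: w_def Zk_def Gk_def G_def eval_nat_numeral algebra_simps)
    then show ?thesis using c qp by simp
  qed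
  define a where "a t = A + (t ^ q) *s E + (t ^ p * G t) *s C" for t
  have jets: "\<psi> t = a t" "t *s vD \<psi> t = V 1 t" "t^2 *s vD (vD \<psi>) t = V 2 t" "t^3 *s vD (vD (vD \<psi>)) t = V 3 t"
     "t^4 *s vD (vD (vD (vD \<psi>))) t = V 4 t" if t: "t \<in> U" for t
  proof -
    note D = vD_lin_higher[OF U(1) zh gh t, of A E C, folded \<psi>_def]
    have e: "t ^ k *s ((deriv ^^ k) (\<lambda>t. t ^ q) t *s E + (deriv ^^ k) g t *s C) = V k t" for k
      by (simp add: V_def zk[OF t, symmetric] gk[OF t, symmetric] vector_add_ldistrib vector_smult_assoc)
    show "\<psi> t = a t" by (simp add: \<psi>_def a_def gG)
    show "t *s vD \<psi> t = V 1 t" using e[of 1] D by simp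
    show "t^2 *s vD (vD \<psi>) t = V 2 t" "t^3 *s vD (vD (vD \<psi>)) t = V 3 t"
     "t^4 *s vD (vD (vD (vD \<psi>))) t = V 4 t" using e D by simp_all
  qed
  have dets: "det3 (a t) (V i t) (V j t) = t ^ (p + q) * (\<delta> * w i j t)" for i j t
    by (simp add: a_def V_def w_def \<delta>_def det3_swap(1)[of A C E] det3_def algebra_simps power_add)
  \<comment> \<open>Exponents are natural numbers, so the quotients by t ^ k need care: p - k and 2
    q - k are used only when the corresponding value of B is nonzero, and then they are true
    differences.\<close>
  define s1 where "s1 t = (if B A C = 0 then 0 else t ^ (p - k) * B A C)" for t
  define s2 where "s2 t = (if B E E = 0 then 0 else t ^ (2 * q - k) * B E E)" for t
  define s3 where "s3 t = t ^ (p + q - k) * B E C" for t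
  define s4 where "s4 t = t ^ (2 * p - k) * B C C" for t
  have e: "t ^ n = t ^ k * t ^ (n - k)" if "k \<le> n" for n and t :: complex
    using that by (simp add: power_add[symmetric])
  have s: "t ^ p * B A C = t ^ k * s1 t" "t ^ (2 * q) * B E E = t ^ k * s2 t" "t ^ (p + q) * B E C = t ^ k * s3 t"
     "t ^ (2 * p) * B C C = t ^ k * s4 t" for t
    using e[of p] e[of "2 * q"] e[of "p + q"] e[of "2 * p"] k qp
    by (auto simp: s1_def s2_def s3_def s4_def)
  have hs: "s1 holomorphic_on U" "s2 holomorphic_on U" "s3 holomorphic_on U" "s4 holomorphic_on U"
    unfolding s1_def s2_def s3_def s4_def by (cases "B A C = 0"; cases "B E E = 0"; auto intro!: holomorphic_intros)+
  \<comment> \<open>B divided by t ^ k, on vectors with coordinates x, t ^ q y and t ^ p z. Products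
    belonging to B A A and B A E are absent because these values vanish.\<close>
  define \<beta> where "\<beta> x y z x' y' z' t = (x * z' + x' * z) * s1 t + y * y' * s2 t + (y * z' + y' * z) * s3 t + z * z' * s4 t"
    for x y z x' y' z' t :: complex
  have pw: "x ^ (2 * n) = x ^ n * x ^ n" "x ^ (n * 2) = x ^ n * x ^ n" for x :: complex and n
    by (simp_all add: mult_2 mult_2_right power_add)
  have BB: "B (x *s A + (t ^ q * y) *s E + (t ^ p * z) *s C) (x' *s A + (t ^ q * y') *s E + (t ^ p * z') *s C) = t ^ k * \<beta> x y z x' y' z' t" for x y z x' y' z' t
  proof -
    have "B (x *s A + (t ^ q * y) *s E + (t ^ p * z) *s C) (x' *s A + (t ^ q * y') *s E + (t ^ p * z') *s C) =
      (x * z' + x' * z) * (t ^ p * B A C) + y * y' * (t ^ (2 * q) * B E E) + (y * z' + y' * z) * (t ^ (p + q) * B E C) + z * z' * (t ^ (2 * p) * B C C)"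
      by (simp add: B_simps B0 B_sym[of E A] B_sym[of C A] B_sym[of C E] power_add pw algebra_simps)
    then show ?thesis unfolding s \<beta>_def by (simp add: algebra_simps)
  qed
  define \<Theta> where "\<Theta> t = \<beta> 1 1 (G t) 1 1 (G t) t * (5 * w 1 3 t ^ 2 - 3 * w 1 2 t * (4 * w 2 3 t + w 1 4 t)) / (9 * w 1 2 t ^ 2)
     + 2 * w 1 3 t * \<beta> 1 1 (G t) 0 (Zk 1 t) (Gk 1 t) t / (3 * w 1 2 t) + \<beta> 0 (Zk 1 t) (Gk 1 t) 0 (Zk 1 t) (Gk 1 t) t
     - 2 * \<beta> 1 1 (G t) 0 (Zk 2 t) (Gk 2 t) t" for t
  have B1: "B (a t) (a t) = t ^ k * \<beta> 1 1 (G t) 1 1 (G t) t" "B (a t) (V i t) = t ^ k * \<beta> 1 1 (G t) 0 (Zk i t) (Gk i t) t"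
    "B (V i t) (V i t) = t ^ k * \<beta> 0 (Zk i t) (Gk i t) 0 (Zk i t) (Gk i t) t" for i t
    using BB[where x=1 and x'=1 and y=1 and y'=1 and z="G t" and z'="G t" and t=t] BB[where x=1 and x'=0 and y=1 and z="G t" and y'="Zk i t" and z'="Gk i t" and t=t]
      BB[where x=0 and x'=0 and y="Zk i t" and z="Gk i t" and y'="Zk i t" and z'="Gk i t" and t=t]
    by (simp_all add: a_def V_def)
  define F where "F t = t ^ (3 * k - 2 * (p + q)) * \<Theta> t ^ 3 / (\<delta> * w 1 2 t) ^ 2" for t
  have \<delta>0: "\<delta> \<noteq> 0" using det by (simp add: \<delta>_def)
  have hF: "wr \<psi> t \<noteq> 0 \<and> hval \<psi> t = F t" if t: "t \<in> U" "t \<noteq> 0" "w 1 2 t \<noteq> 0" for t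
  proof -
    have wr': "t ^ 3 * wr \<psi> t = t ^ (p + q) * (\<delta> * w 1 2 t)"
    proof -
      have "t ^ 3 * wr \<psi> t = det3 (\<psi> t) (t *s vD \<psi> t) (t^2 *s vD (vD \<psi>) t)" by (simp add: wr_def eval_nat_numeral)
      then show ?thesis unfolding jets[OF t(1)] dets .
    qed
    then have wr0: "wr \<psi> t \<noteq> 0" using t \<delta>0 by auto
    have "zjet (a t) (V 1 t) (V 2 t) (V 3 t) (V 4 t) = t ^ 2 * zjet (\<psi> t) (vD \<psi> t) (vD (vD \<psi>) t) (vD (vD (vD \<psi>)) t) (vD (vD (vD (vD \<psi>))) t)"
      using zjet_scale[of "\<psi> t" "vD \<psi> t" "vD (vD \<psi>) t" t "vD (vD (vD \<psi>)) t" "vD (vD (vD (vD \<psi>))) t"] wr0 t(2) jets[OF t(1)]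
      by (simp add: wr_def)
    moreover have "zjet (a t) (V 1 t) (V 2 t) (V 3 t) (V 4 t) = t ^ k * \<Theta> t"
      unfolding zjet_def dets B1 \<Theta>_def using t \<delta>0 by (simp add: divide_simps power_mult_distrib) (simp add: algebra_simps power2_eq_square)?
    ultimately have z: "t ^ 2 * zjet (\<psi> t) (vD \<psi> t) (vD (vD \<psi>) t) (vD (vD (vD \<psi>)) t) (vD (vD (vD (vD \<psi>))) t) = t ^ k * \<Theta> t" by simp
    have "hval \<psi> t = (t ^ 2 * zjet (\<psi> t) (vD \<psi> t) (vD (vD \<psi>) t) (vD (vD (vD \<psi>)) t) (vD (vD (vD (vD \<psi>))) t)) ^ 3 / (t ^ 3 * wr \<psi> t) ^ 2"
      using t(2) by (simp add: hval_def hjet_def wr_def power_mult_distrib power_mult[symmetric])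
    also have "\<dots> = (t ^ k * \<Theta> t) ^ 3 / (t ^ (p + q) * (\<delta> * w 1 2 t)) ^ 2" unfolding z wr' ..
    also have "\<dots> = F t"
    proof -
      have "t ^ (3 * k) = t ^ (2 * (p + q)) * t ^ (3 * k - 2 * (p + q))" using k(2) by (simp add: power_add[symmetric])
      then show ?thesis using t(2)
        by (simp add: F_def power_mult_distrib power_mult[symmetric] mult.commute[of _ 3] mult.commute[of _ 2] divide_simps)
    qed
    finally show ?thesis using wr0 by simp
  qed
  have cont: "isCont f 0" if "f holomorphic_on U" for f
    using holomorphic_on_imp_continuous_on[OF that] U continuous_on_eq_continuous_at by blast
  have "isCont F 0"
    unfolding F_def \<Theta>_def \<beta>_def using w120 \<delta>0
    by (intro continuous_intros cont hs hw hG Gh) auto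
  then have "\<forall>\<^sub>F t in at 0. dist (F t) (F 0) < 1" by (intro tendstoD) (auto simp: isCont_def)
  moreover have "\<forall>\<^sub>F t in at 0. w 1 2 t \<noteq> 0"
    using cont[OF hw[of 1 2]] w120 by (intro tendsto_imp_eventually_ne) (auto simp: isCont_def)
  moreover have "\<forall>\<^sub>F t in at 0. t \<in> U - {0}" using U by (intro eventually_at_in_open)
  ultimately have "\<forall>\<^sub>F t in at 0. wr \<psi> t \<noteq> 0 \<and> norm (hval \<psi> t) \<le> norm (F 0) + 1"
  proof eventually_elim
    case (elim t)
    have "norm (F t) \<le> norm (F 0) + norm (F t - F 0)" by norm
    then show ?case using elim hF[of t] by (auto simp: dist_norm)
  qed
  then show ?thesis by (rule that)
qed

end

declare
  div_mult_mult1_if [simp]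
  dvd_div_mult_self [simp]
  dvd_mult_div_cancel [simp]
  div_mult_self1 [simp]
  div_mult_self2 [simp]
  div_mult_self3 [simp]
  div_mult_self4 [simp]
  div_add_self1 [simp]
  div_add_self2 [simp]

subsection \<open>Charts\<close>

abbreviation aff :: "complex^3^3 \<Rightarrow> complex \<Rightarrow> complex \<Rightarrow> complex^3" where
  "aff M z w \<equiv> M *v vector [1, z, w]"

lemma matrix_vector_3: "M *v x = x $ 1 *s column 1 M + x $ 2 *s column 2 M + x $ 3 *s column 3 (M::complex^3^3)"
  by (simp add: vec_eq_iff matrix_vector_mult_def column_def sum_3 mult.commute)

lemma aff_columns: "aff M z w = column 1 M + z *s column 2 M + w *s column 3 M"
  by (subst matrix_vector_3) (simp add: vector_3)

definition cols :: "complex^3 \<Rightarrow> complex^3 \<Rightarrow> complex^3 \<Rightarrow> complex^3^3" where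
  "cols a b c = transpose (vector [a, b, c])"

lemma column_cols [simp]: "column 1 (cols a b c) = a" "column 2 (cols a b c) = b" "column 3 (cols a b c) = c"
  by (simp_all add: cols_def column_def transpose_def vec_eq_iff vector_3)

lemma det_columns: "det M = det3 (column 1 M) (column 2 M) (column 3 M)" for M :: "complex^3^3"
  by (simp add: det_3 det3_def column_def algebra_simps)

lemma invertible_columns: "invertible M \<longleftrightarrow> det3 (column 1 M) (column 2 M) (column 3 M) \<noteq> 0" for M :: "complex^3^3"
  by (simp add: invertible_det_nz det_columns)

lemma inv_mult:
  fixes M :: "complex^3^3" assumes "invertible M"
  shows "matrix_inv M *v (M *v x) = x" "M *v (matrix_inv M *v x) = x"
proof -
  have "M ** matrix_inv M = mat 1 \<and> matrix_inv M ** M = mat 1"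
    using assms unfolding invertible_def matrix_inv_def by (rule someI_ex)
  then show "matrix_inv M *v (M *v x) = x" "M *v (matrix_inv M *v x) = x"
    by (simp_all add: matrix_vector_mul_assoc)
qed

lemma aff_nz: "invertible M \<Longrightarrow> aff M z w \<noteq> 0"
proof
  assume M: "invertible M" and "aff M z w = 0"
  then have "vector [1, z, w] = (0 :: complex^3)" using inv_mult(1)[OF M, of "vector [1, z, w]"] by simp
  then show False by (simp add: vec3_eq_iff vector_3)
qed

lemma affine_pt_inj:
  assumes M: "invertible M" and eq: "affine_pt M z w = affine_pt M z' w'"
  shows "z = z' \<and> w = w'"
proof -
  obtain c where c: "aff M z' w' = c *s aff M z w"
    using eq aff_nz[OF M] pt_eq_iff unfolding affine_pt_def by metis
  have "vector [1, z', w'] = matrix_inv M *v (c *s aff M z w)"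
    using inv_mult(1)[OF M, of "vector [1, z', w']"] c by simp
  also have "\<dots> = c *s vector [1, z, w]"
    using inv_mult(1)[OF M, of "vector [1, z, w]"] by (simp add: matrix_vector_mult_scaleR vector_scalar_commute)
  finally show ?thesis by (simp add: vec3_eq_iff vector_3)
qed

lemma continuous_on_smult: "continuous_on S (\<lambda>u::complex^3. c *s u)"
  unfolding vector_scalar_mult_def by (intro continuous_intros)

text \<open>\<open>pt\<close> is an open map: the vectors proportional to an element of an open set
  V form the union of the rescalings of V without 0.\<close>

lemma eventually_nhds_pt:
  assumes v: "v \<noteq> 0"
  shows "eventually P (nhds (pt v)) \<longleftrightarrow> eventually (\<lambda>u. P (pt u)) (nhds v)"
proof
  assume "eventually P (nhds (pt v))"
  then obtain S where S: "open S" "pt v \<in> S" "\<And>x. x \<in> S \<Longrightarrow> P x" unfolding eventually_nhds by blast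
  have "open {u. u \<noteq> 0 \<and> pt u \<in> S}" using S(1) by (simp add: open_cp2_def)
  then show "eventually (\<lambda>u. P (pt u)) (nhds v)"
    unfolding eventually_nhds using v S by (intro exI[of _ "{u. u \<noteq> 0 \<and> pt u \<in> S}"]) auto
next
  assume "eventually (\<lambda>u. P (pt u)) (nhds v)"
  then obtain V where V: "open V" "v \<in> V" "\<And>u. u \<in> V \<Longrightarrow> P (pt u)" unfolding eventually_nhds by blast
  define S where "S = pt ` (V - {0})"
  have eq: "{u. u \<noteq> 0 \<and> pt u \<in> S} = (\<Union>c\<in>-{0}. (\<lambda>u. c *s u) -` (V - {0}))"
  proof (intro equalityI subsetI)
    fix u assume "u \<in> {u. u \<noteq> 0 \<and> pt u \<in> S}"
    then obtain x where x: "u \<noteq> 0" "pt u = pt x" "x \<in> V" "x \<noteq> 0" by (auto simp: S_def)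
    then obtain c where "c \<noteq> 0" "x = c *s u" using pt_eq_iff by blast
    then show "u \<in> (\<Union>c\<in>-{0}. (\<lambda>u. c *s u) -` (V - {0}))" using x by auto
  next
    fix u assume "u \<in> (\<Union>c\<in>-{0}. (\<lambda>u. c *s u) -` (V - {0}))"
    then obtain c where c: "c \<noteq> 0" "c *s u \<in> V" "c *s u \<noteq> 0" by auto
    then have "u \<noteq> 0" by auto
    then have "pt u = pt (c *s u)" using pt_scale c by metis
    then show "u \<in> {u. u \<noteq> 0 \<and> pt u \<in> S}" using c \<open>u \<noteq> 0\<close> by (auto simp: S_def)
  qed
  have "open ((\<lambda>u. c *s u) -` (V - {0}))" for c
    using V(1) by (intro open_vimage continuous_on_smult) auto
  then have "open {u. u \<noteq> 0 \<and> pt u \<in> S}" unfolding eq by blast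
  then have "open S" by (simp add: open_cp2_def)
  then show "eventually P (nhds (pt v))"
    unfolding eventually_nhds using v V by (intro exI[of _ S]) (auto simp: S_def)
qed

lemma tendsto_aff: "((\<lambda>p. aff M (fst p) (snd p)) \<longlongrightarrow> aff M z w) (nhds (z, w))"
  unfolding aff_columns
proof (rule vec_tendstoI)
  fix i
  have "isCont (\<lambda>p. (column 1 M + fst p *s column 2 M + snd p *s column 3 M) $ i) (z, w)"
    by (auto intro!: continuous_intros)
  from isCont_tendsto_nhds[OF this]
  show "((\<lambda>p. (column 1 M + fst p *s column 2 M + snd p *s column 3 M) $ i) \<longlongrightarrow>
      (column 1 M + z *s column 2 M + w *s column 3 M) $ i) (nhds (z, w))" by simp
qed

text \<open>An affine chart is continuous with continuous local inverse, namely the ratios of the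
  coordinates \<xi> of a vector in the basis given by M. All local statements can thus be moved into
  coordinates.\<close>

lemma eventually_nhds_chart:
  assumes M: "invertible M"
  shows "eventually P (nhds (affine_pt M z0 w0)) \<longleftrightarrow> eventually (\<lambda>p. P (affine_pt M (fst p) (snd p))) (nhds (z0, w0))"
proof -
  let ?v = "aff M z0 w0"
  have v0: "?v \<noteq> 0" by (rule aff_nz[OF M])
  have "eventually P (nhds (affine_pt M z0 w0)) \<longleftrightarrow> eventually (\<lambda>u. P (pt u)) (nhds ?v)"
    unfolding affine_pt_def by (rule eventually_nhds_pt[OF v0])
  also have "\<dots> \<longleftrightarrow> eventually (\<lambda>p. P (affine_pt M (fst p) (snd p))) (nhds (z0, w0))"
  proof
    assume "eventually (\<lambda>u. P (pt u)) (nhds ?v)"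
    then show "eventually (\<lambda>p. P (affine_pt M (fst p) (snd p))) (nhds (z0, w0))"
      unfolding affine_pt_def using tendsto_aff[of M z0 w0] by (rule eventually_compose_filterlim)
  next
    assume ev: "eventually (\<lambda>p. P (affine_pt M (fst p) (snd p))) (nhds (z0, w0))"
    define \<xi> where "\<xi> u = matrix_inv M *v u" for u
    have \<xi>v: "\<xi> ?v = vector [1, z0, w0]" unfolding \<xi>_def by (rule inv_mult(1)[OF M])
    have t: "((\<lambda>u. \<xi> u $ i) \<longlongrightarrow> \<xi> ?v $ i) (nhds ?v)" for i
      by (rule isCont_tendsto_nhds) (auto simp: \<xi>_def matrix_vector_mult_def intro!: continuous_intros)
    have t1: "((\<lambda>u. \<xi> u $ 1) \<longlongrightarrow> 1) (nhds ?v)" "((\<lambda>u. \<xi> u $ 2) \<longlongrightarrow> z0) (nhds ?v)" "((\<lambda>u. \<xi> u $ 3) \<longlongrightarrow> w0) (nhds ?v)"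
      using t[of 1] t[of 2] t[of 3] by (simp_all add: \<xi>v vector_3)
    have "((\<lambda>u. (\<xi> u $ 2 / \<xi> u $ 1, \<xi> u $ 3 / \<xi> u $ 1)) \<longlongrightarrow> (z0 / 1, w0 / 1)) (nhds ?v)"
      by (intro tendsto_intros t1) auto
    then have "((\<lambda>u. (\<xi> u $ 2 / \<xi> u $ 1, \<xi> u $ 3 / \<xi> u $ 1)) \<longlongrightarrow> (z0, w0)) (nhds ?v)" by simp
    from eventually_compose_filterlim[OF ev this]
    have 1: "eventually (\<lambda>u. P (affine_pt M (\<xi> u $ 2 / \<xi> u $ 1) (\<xi> u $ 3 / \<xi> u $ 1))) (nhds ?v)" by simp
    have 2: "eventually (\<lambda>u. \<xi> u $ 1 \<noteq> 0) (nhds ?v)" using t1(1) by (rule tendsto_imp_eventually_ne) simp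
    have 3: "eventually (\<lambda>u. u \<noteq> 0) (nhds ?v)" using v0 by (rule t1_space_nhds)
    from 1 2 3 show "eventually (\<lambda>u. P (pt u)) (nhds ?v)"
    proof eventually_elim
      case (elim u)
      have "\<xi> u = \<xi> u $ 1 *s vector [1, \<xi> u $ 2 / \<xi> u $ 1, \<xi> u $ 3 / \<xi> u $ 1]"
        using elim by (simp add: vec3_eq_iff vector_3)
      then have "M *v \<xi> u = \<xi> u $ 1 *s aff M (\<xi> u $ 2 / \<xi> u $ 1) (\<xi> u $ 3 / \<xi> u $ 1)"
        by (metis vector_scalar_commute)
      then have "u = \<xi> u $ 1 *s aff M (\<xi> u $ 2 / \<xi> u $ 1) (\<xi> u $ 3 / \<xi> u $ 1)"
        using inv_mult(2)[OF M, of u] by (simp add: \<xi>_def)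
      then have "pt u = affine_pt M (\<xi> u $ 2 / \<xi> u $ 1) (\<xi> u $ 3 / \<xi> u $ 1)"
        unfolding affine_pt_def using pt_scale[OF aff_nz[OF M], of "\<xi> u $ 1"] elim by metis
      then show ?case using elim by simp
    qed
  qed
  finally show ?thesis .
qed

text \<open>Compactness of the projective plane in the form in which it is used: the plane is the
  image of the compact unit sphere, so a property that holds near every point and passes to finite
  unions holds globally.\<close>

lemma eventually_nhds_cp2_sphere:
  assumes "\<And>X :: cp2. \<exists>U. open U \<and> X \<in> U \<and> Q U"
    and Q: "\<And>\<U>. finite \<U> \<Longrightarrow> (\<And>U. U \<in> \<U> \<Longrightarrow> Q U) \<Longrightarrow> Q (\<Union> \<U>)"
    and mono: "\<And>U V. Q V \<Longrightarrow> U \<subseteq> V \<Longrightarrow> Q U"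
  shows "Q UNIV"
proof -
  obtain U where U: "\<And>X. open (U X)" "\<And>X. X \<in> U X" "\<And>X. Q (U X)" using assms(1) by metis
  define V where "V X = {v. v \<noteq> 0 \<and> pt v \<in> U X}" for X
  have "open (V X)" for X using U(1)[of X] by (simp add: open_cp2_def V_def)
  moreover have "sphere (0::complex^3) 1 \<subseteq> (\<Union>X. V X)"
  proof
    fix x :: "complex^3" assume "x \<in> sphere 0 1"
    then have "x \<noteq> 0" by auto
    then have "x \<in> V (pt x)" using U(2)[of "pt x"] by (simp add: V_def)
    then show "x \<in> (\<Union>X. V X)" by blast
  qed
  ultimately obtain D where D: "finite D" "sphere (0::complex^3) 1 \<subseteq> (\<Union>X\<in>D. V X)"
    using compactE_image[OF compact_sphere, of UNIV V] by (metis UNIV_I)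
  have "X \<in> \<Union> (U ` D)" for X
  proof -
    obtain v where v: "v \<noteq> 0" "X = pt v" by (rule cp2_cases)
    define u where "u = of_real (1 / norm v) *s v"
    have "u = (1 / norm v) *\<^sub>R v"
      by (subst vec_eq_iff, intro allI, simp only: u_def vector_smult_component vector_scaleR_component) (simp add: scaleR_conv_of_real)
    then have "norm u = 1" using v by simp
    then obtain Y where "Y \<in> D" "u \<in> V Y" using D(2) by auto
    moreover have "pt u = X" unfolding u_def v(2) using v(1) by (intro pt_scale) auto
    ultimately show ?thesis by (auto simp: V_def)
  qed
  then have "\<Union> (U ` D) = UNIV" by blast
  moreover have "Q (\<Union> (U ` D))" using D(1) U(3) by (intro Q) auto
  ultimately show ?thesis by simp
qed

subsection \<open>Complex differentiable functions on the cone\<close>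

definition cdiff :: "(complex^3 \<Rightarrow> complex) \<Rightarrow> complex^3 \<Rightarrow> bool" where
  "cdiff f v \<longleftrightarrow> (\<exists>D. (f has_derivative D) (at v) \<and> (\<forall>c x. D (c *s x) = c * D x))"

lemma cdiff_const: "cdiff (\<lambda>_. c) v"
  unfolding cdiff_def by (intro exI[of _ "\<lambda>_. 0"]) auto

lemma cdiff_add: "cdiff f v \<Longrightarrow> cdiff g v \<Longrightarrow> cdiff (\<lambda>x. f x + g x) v"
  unfolding cdiff_def
proof safe
  fix D E assume D: "(f has_derivative D) (at v)" "\<forall>c x. D (c *s x) = c * D x" and E: "(g has_derivative E) (at v)" "\<forall>c x. E (c *s x) = c * E x"
  show "\<exists>D. ((\<lambda>x. f x + g x) has_derivative D) (at v) \<and> (\<forall>c x. D (c *s x) = c * D x)"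
    using has_derivative_add[OF D(1) E(1)] D(2) E(2) by (intro exI[of _ "\<lambda>h. D h + E h"]) (auto simp: algebra_simps)
qed

lemma cdiff_mult: "cdiff f v \<Longrightarrow> cdiff g v \<Longrightarrow> cdiff (\<lambda>x. f x * g x) v"
  unfolding cdiff_def
proof safe
  fix D E assume D: "(f has_derivative D) (at v)" "\<forall>c x. D (c *s x) = c * D x" and E: "(g has_derivative E) (at v)" "\<forall>c x. E (c *s x) = c * E x"
  show "\<exists>D. ((\<lambda>x. f x * g x) has_derivative D) (at v) \<and> (\<forall>c x. D (c *s x) = c * D x)"
    using has_derivative_mult[OF D(1) E(1)] D(2) E(2) by (intro exI[of _ "\<lambda>h. f v * E h + D h * g v"]) (auto simp: algebra_simps)
qed

lemma cdiff_sum: "finite A \<Longrightarrow> (\<And>i. i \<in> A \<Longrightarrow> cdiff (f i) v) \<Longrightarrow> cdiff (\<lambda>x. \<Sum>i\<in>A. f i x) v"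
  by (induction A rule: finite_induct) (auto intro: cdiff_const cdiff_add)

lemma cdiff_power: "cdiff f v \<Longrightarrow> cdiff (\<lambda>x. f x ^ n) v"
  by (induction n) (auto intro: cdiff_const cdiff_mult)

lemma cdiff_compose:
  assumes "cdiff f v" "h field_differentiable at (f v)"
  shows "cdiff (\<lambda>x. h (f x)) v"
proof -
  obtain D where D: "(f has_derivative D) (at v)" "\<And>c x. D (c *s x) = c * D x" using assms(1) unfolding cdiff_def by blast
  obtain h' where h': "(h has_field_derivative h') (at (f v))" using assms(2) unfolding field_differentiable_def by blast
  have "((\<lambda>x. h (f x)) has_derivative (\<lambda>x. h' * D x)) (at v)"
    using has_derivative_compose[OF D(1), of h "(*) h'"] h' by (simp add: has_field_derivative_def)
  then show ?thesis unfolding cdiff_def using D(2) by (intro exI[of _ "\<lambda>x. h' * D x"]) auto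
qed

lemma cdiff_divide: "cdiff f v \<Longrightarrow> cdiff g v \<Longrightarrow> g v \<noteq> 0 \<Longrightarrow> cdiff (\<lambda>x. f x / g x) v"
  unfolding divide_inverse
  by (intro cdiff_mult cdiff_compose[of g v inverse]) (auto intro: field_differentiable_inverse field_differentiable_ident)

lemma cdiff_component: "cdiff (\<lambda>v. v $ i) v"
  unfolding cdiff_def by (intro exI[of _ "\<lambda>v. v $ i"]) (auto intro!: bounded_linear.has_derivative[OF bounded_linear_vec_nth] has_derivative_ident)

lemma cdiff_matrix: "cdiff (\<lambda>v. (N *v v) $ i) v"
  unfolding matrix_vector_mult_def by (auto intro!: cdiff_sum cdiff_mult cdiff_const cdiff_component)

lemma cdiff_cong:
  assumes "cdiff f v" "open S" "v \<in> S" "\<And>x. x \<in> S \<Longrightarrow> f x = g x"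
  shows "cdiff g v"
  using assms has_derivative_transform_within_open[of f _ v UNIV S g] unfolding cdiff_def by blast

lemma vhd_has_derivative:
  assumes "vhd f f' t"
  shows "(f has_derivative (\<lambda>h. h *s f')) (at t)"
proof -
  have "((\<lambda>x. f x $ i) has_derivative (\<lambda>h. h * f' $ i)) (at t)" for i
    using assms unfolding vhd_def has_field_derivative_def by (simp add: mult_commute_abs)
  then have "((\<lambda>x. f x $ i \<bullet> b) has_derivative (\<lambda>h. (h * f' $ i) \<bullet> b)) (at t)" for i b
    by (rule bounded_linear.has_derivative[OF bounded_linear_inner_left])
  then show ?thesis
    by (subst has_derivative_componentwise_within) (auto simp: Basis_vec_def inner_axis)
qed

lemma cdiff_vhd:
  assumes "cdiff f (\<phi> t)" "vhd \<phi> \<phi>' t"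
  shows "(\<lambda>s. f (\<phi> s)) field_differentiable at t"
proof -
  obtain D where D: "(f has_derivative D) (at (\<phi> t))" "\<And>c x. D (c *s x) = c * D x" using assms(1) unfolding cdiff_def by blast
  have "((\<lambda>s. f (\<phi> s)) has_derivative (\<lambda>h. D (h *s \<phi>'))) (at t)"
    by (rule has_derivative_compose[OF vhd_has_derivative[OF assms(2)] D(1)])
  then have "((\<lambda>s. f (\<phi> s)) has_field_derivative D \<phi>') (at t)"
    unfolding has_field_derivative_def D(2) by (simp add: mult_commute_abs)
  then show ?thesis unfolding field_differentiable_def by blast
qed

lemma holomorphic_cp2_cdiff: "holomorphic_cp2 f U \<longleftrightarrow> (\<forall>v. v \<noteq> 0 \<and> pt v \<in> U \<longrightarrow> cdiff (\<lambda>x. f (pt x)) v)"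
  unfolding holomorphic_cp2_def cdiff_def ..

lemma holomorphic_cp2_curve:
  assumes f: "holomorphic_cp2 f U" and \<phi>: "vholo \<phi> S" "open S" and "\<And>t. t \<in> S \<Longrightarrow> \<phi> t \<noteq> 0 \<and> pt (\<phi> t) \<in> U"
  shows "(\<lambda>t. f (pt (\<phi> t))) holomorphic_on S"
proof -
  have "(\<lambda>t. f (pt (\<phi> t))) field_differentiable at t" if "t \<in> S" for t
    using f assms(4)[OF that] vholo_vhd[OF \<phi> that] unfolding holomorphic_cp2_cdiff by (intro cdiff_vhd[where f = "\<lambda>x. f (pt x)"]) auto
  then show ?thesis by (auto simp: holomorphic_on_def intro: field_differentiable_at_within)
qed

lemma holomorphic_cp2_subset: "holomorphic_cp2 f U \<Longrightarrow> V \<subseteq> U \<Longrightarrow> holomorphic_cp2 f V"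
  unfolding holomorphic_cp2_def by blast

lemma holomorphic_cp2_mult: "holomorphic_cp2 f U \<Longrightarrow> holomorphic_cp2 g U \<Longrightarrow> holomorphic_cp2 (\<lambda>x. f x * g x) U"
  unfolding holomorphic_cp2_cdiff by (auto intro: cdiff_mult)

subsection \<open>Germs\<close>

lemma analytic_germ_Int:
  assumes "analytic_germ C A" "analytic_germ C A'"
  shows "analytic_germ C (A \<inter> A')"
proof -
  obtain U fs where 1: "open U" "C \<in> U" "finite fs" "\<forall>f\<in>fs. holomorphic_cp2 f U" "A \<inter> U = {X \<in> U. \<forall>f\<in>fs. f X = 0}"
    using assms(1) unfolding analytic_germ_def by blast
  obtain U' fs' where 2: "open U'" "C \<in> U'" "finite fs'" "\<forall>f\<in>fs'. holomorphic_cp2 f U'" "A' \<inter> U' = {X \<in> U'. \<forall>f\<in>fs'. f X = 0}"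
    using assms(2) unfolding analytic_germ_def by blast
  have "A \<inter> A' \<inter> (U \<inter> U') = {X \<in> U \<inter> U'. \<forall>f\<in>fs \<union> fs'. f X = 0}" using 1(5) 2(5) by blast
  moreover have "\<forall>f\<in>fs \<union> fs'. holomorphic_cp2 f (U \<inter> U')" using 1(4) 2(4) by (auto intro: holomorphic_cp2_subset)
  ultimately show ?thesis unfolding analytic_germ_def using 1 2
    by (intro exI[of _ "U \<inter> U'"] exI[of _ "fs \<union> fs'"]) (auto intro: open_Int)
qed

lemma analytic_germ_Un:
  assumes "analytic_germ C A" "analytic_germ C A'"
  shows "analytic_germ C (A \<union> A')"
proof -
  obtain U fs where 1: "open U" "C \<in> U" "finite fs" "\<forall>f\<in>fs. holomorphic_cp2 f U" "A \<inter> U = {X \<in> U. \<forall>f\<in>fs. f X = 0}"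
    using assms(1) unfolding analytic_germ_def by blast
  obtain U' fs' where 2: "open U'" "C \<in> U'" "finite fs'" "\<forall>f\<in>fs'. holomorphic_cp2 f U'" "A' \<inter> U' = {X \<in> U'. \<forall>f\<in>fs'. f X = 0}"
    using assms(2) unfolding analytic_germ_def by blast
  define F where "F = (\<lambda>(f, g). (\<lambda>X. f X * g X)) ` (fs \<times> fs')"
  have "X \<in> A \<union> A' \<longleftrightarrow> (\<forall>f\<in>F. f X = 0)" if X: "X \<in> U \<inter> U'" for X
  proof -
    have "X \<in> A \<longleftrightarrow> (\<forall>f\<in>fs. f X = 0)" "X \<in> A' \<longleftrightarrow> (\<forall>f\<in>fs'. f X = 0)" using 1(5) 2(5) X by blast+
    then show ?thesis by (auto simp: F_def)
  qed
  then have "(A \<union> A') \<inter> (U \<inter> U') = {X \<in> U \<inter> U'. \<forall>f\<in>F. f X = 0}" by blast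
  moreover have "\<forall>f\<in>F. holomorphic_cp2 f (U \<inter> U')"
    unfolding F_def using 1(4) 2(4) by (auto intro!: holomorphic_cp2_mult intro: holomorphic_cp2_subset)
  moreover have "finite F" using 1 2 by (simp add: F_def)
  ultimately show ?thesis unfolding analytic_germ_def using 1 2
    by (intro exI[of _ "U \<inter> U'"] exI[of _ F]) (auto intro: open_Int)
qed

lemma analytic_germ_empty: "analytic_germ C {}"
  unfolding analytic_germ_def
  by (intro exI[of _ UNIV] exI[of _ "{\<lambda>_. 1}"]) (auto simp: holomorphic_cp2_cdiff intro: cdiff_const)

lemma analytic_germ_finite_Union:
  "finite I \<Longrightarrow> (\<And>i. i \<in> I \<Longrightarrow> analytic_germ C (A i)) \<Longrightarrow> analytic_germ C (\<Union>i\<in>I. A i)"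
  by (induction I rule: finite_induct) (auto intro: analytic_germ_empty analytic_germ_Un)

text \<open>Irreducibility speaks of decompositions of b itself, so the covering germs are first
  intersected with b.\<close>

lemma irreducible_germ_finite_Union:
  assumes b: "irreducible_germ C b" and "finite I" and "\<And>i. i \<in> I \<Longrightarrow> analytic_germ C (A i)"
    and "germ_le C b (\<Union>i\<in>I. A i)"
  shows "\<exists>i\<in>I. germ_le C b (A i)"
  using assms(2-)
proof (induction I rule: finite_induct)
  case empty
  have "\<forall>\<^sub>F X in nhds C. X \<notin> b" using empty(2) by (simp add: germ_le_def)
  then have "C \<notin> b" by (rule eventually_nhds_x_imp_x)
  then show ?case using b by (simp add: irreducible_germ_def)
next
  case (insert i I)
  have ab: "analytic_germ C b" using b by (simp add: irreducible_germ_def)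
  have "germ_eq C b ((b \<inter> A i) \<union> (b \<inter> (\<Union>i\<in>I. A i)))"
    using insert.prems(2) unfolding germ_le_def germ_eq_def by eventually_elim auto
  moreover have "analytic_germ C (b \<inter> A i)" "analytic_germ C (b \<inter> (\<Union>i\<in>I. A i))"
    using insert ab by (auto intro!: analytic_germ_Int analytic_germ_finite_Union)
  ultimately have "germ_eq C b (b \<inter> A i) \<or> germ_eq C b (b \<inter> (\<Union>i\<in>I. A i))"
    using b unfolding irreducible_germ_def by blast
  then show ?case
  proof
    assume "germ_eq C b (b \<inter> A i)"
    then have "germ_le C b (A i)" unfolding germ_eq_def germ_le_def by eventually_elim auto
    then show ?case by blast
  next
    assume "germ_eq C b (b \<inter> (\<Union>i\<in>I. A i))"
    then have "germ_le C b (\<Union>i\<in>I. A i)" unfolding germ_eq_def germ_le_def by eventually_elim auto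
    then show ?case using insert by auto
  qed
qed

lemma germ_le_trans:
  assumes "germ_le C A B" "germ_le C B D"
  shows "germ_le C A D"
  using assms unfolding germ_le_def by eventually_elim auto

lemma germ_eq_iff_le: "germ_eq C A B \<longleftrightarrow> germ_le C A B \<and> germ_le C B A"
  unfolding germ_eq_def germ_le_def eventually_conj_iff[symmetric] by (rule arg_cong[of _ _ "\<lambda>P. eventually P (nhds C)"]) blast

abbreviation pimg :: "complex^3^3 \<Rightarrow> nat \<Rightarrow> (complex \<Rightarrow> complex) \<Rightarrow> real \<Rightarrow> cp2 set" where
  "pimg M e g r \<equiv> (\<lambda>s. affine_pt M (s ^ e) (g s)) ` ball 0 r"

text \<open>Points of b close to the centre come from small parameters, because their first affine
  coordinate s ^ e controls the size of s. A property of nearby points of b is therefore one of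
  small s.\<close>

lemma eventually_param:
  assumes M: "invertible M" and e: "e \<ge> 1" and r: "r > 0" and g: "isCont g 0" "g 0 = 0"
    and b: "germ_eq (affine_pt M 0 0) b (pimg M e g r)"
  shows "(\<forall>\<^sub>F X in nhds (affine_pt M 0 0). X \<in> b \<longrightarrow> Q X) \<longleftrightarrow> (\<forall>\<^sub>F s in nhds 0. Q (affine_pt M (s ^ e) (g s)))"
proof -
  let ?C = "affine_pt M 0 0"
  have "(\<forall>\<^sub>F X in nhds ?C. X \<in> b \<longrightarrow> Q X) \<longleftrightarrow> (\<forall>\<^sub>F X in nhds ?C. X \<in> pimg M e g r \<longrightarrow> Q X)"
  proof
    assume "\<forall>\<^sub>F X in nhds ?C. X \<in> b \<longrightarrow> Q X"
    with b show "\<forall>\<^sub>F X in nhds ?C. X \<in> pimg M e g r \<longrightarrow> Q X" unfolding germ_eq_def by eventually_elim blast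
  next
    assume "\<forall>\<^sub>F X in nhds ?C. X \<in> pimg M e g r \<longrightarrow> Q X"
    with b show "\<forall>\<^sub>F X in nhds ?C. X \<in> b \<longrightarrow> Q X" unfolding germ_eq_def by eventually_elim blast
  qed
  also have "\<dots> \<longleftrightarrow> (\<forall>\<^sub>F p in nhds (0, 0). affine_pt M (fst p) (snd p) \<in> pimg M e g r \<longrightarrow> Q (affine_pt M (fst p) (snd p)))"
    by (rule eventually_nhds_chart[OF M])
  also have "\<dots> \<longleftrightarrow> (\<forall>\<^sub>F s in nhds 0. Q (affine_pt M (s ^ e) (g s)))"
  proof
    assume ev: "\<forall>\<^sub>F p in nhds (0, 0). affine_pt M (fst p) (snd p) \<in> pimg M e g r \<longrightarrow> Q (affine_pt M (fst p) (snd p))"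
    have "isCont (\<lambda>s::complex. s ^ e) 0" by (intro continuous_intros)
    then have "((\<lambda>s. (s ^ e, g s)) \<longlongrightarrow> (0 ^ e, g 0)) (nhds 0)"
      by (intro tendsto_Pair isCont_tendsto_nhds g(1))
    moreover have "(0::complex) ^ e = 0" using e by (simp add: zero_power)
    ultimately have "((\<lambda>s. (s ^ e, g s)) \<longlongrightarrow> (0, 0)) (nhds 0)" by (simp only: g(2))
    from eventually_compose_filterlim[OF ev this]
    have "\<forall>\<^sub>F s in nhds 0. affine_pt M (s ^ e) (g s) \<in> pimg M e g r \<longrightarrow> Q (affine_pt M (s ^ e) (g s))" by simp
    moreover have "\<forall>\<^sub>F s in nhds 0. s \<in> ball (0::complex) r" using r by (intro eventually_nhds_in_open) auto
    ultimately show "\<forall>\<^sub>F s in nhds 0. Q (affine_pt M (s ^ e) (g s))" by eventually_elim blast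
  next
    assume "\<forall>\<^sub>F s in nhds 0. Q (affine_pt M (s ^ e) (g s))"
    then obtain \<delta> where \<delta>: "\<delta> > 0" "\<And>s. norm s < \<delta> \<Longrightarrow> Q (affine_pt M (s ^ e) (g s))"
      unfolding eventually_nhds_metric by auto
    have "\<forall>\<^sub>F p in nhds (0, 0). p \<in> ball (0::complex) (\<delta> ^ e) \<times> (UNIV :: complex set)"
      using \<delta>(1) by (intro eventually_nhds_in_open) (auto intro: open_Times)
    then show "\<forall>\<^sub>F p in nhds (0, 0). affine_pt M (fst p) (snd p) \<in> pimg M e g r \<longrightarrow> Q (affine_pt M (fst p) (snd p))"
    proof eventually_elim
      case (elim p)
      show ?case
      proof
        assume "affine_pt M (fst p) (snd p) \<in> pimg M e g r"
        then obtain s where s: "affine_pt M (fst p) (snd p) = affine_pt M (s ^ e) (g s)" by blast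
        then have "fst p = s ^ e" using affine_pt_inj[OF M] by blast
        then have "norm s ^ e < \<delta> ^ e" using elim by (auto simp: norm_power mem_Times_iff)
        then have "norm s < \<delta>" using \<delta>(1) power_less_imp_less_base[of "norm s" e \<delta>] by auto
        then show "Q (affine_pt M (fst p) (snd p))" using \<delta>(2) s by simp
      qed
    qed
  qed
  finally show ?thesis .
qed

lemma pt_hom_coords: "pt (hom_coords X) = X" "hom_coords X \<noteq> 0"
  using Quotient_abs_rep[OF Quotient_cp2] Quotient_rep_reflp[OF Quotient_cp2] by (auto simp: proportional_def)

text \<open>Over the disc of radius \<rho> the image is the zero set of a single function, the
  polynomial with coefficients A in the affine coordinates. On the cone it is a function of ratios
  of homogeneous coordinates.\<close>

lemma pbranch_analytic:
  assumes M: "invertible M" and rho: "\<rho> > 0" and p: "pbranch \<rho> e g A" and g0: "g 0 = 0"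
  shows "analytic_germ (affine_pt M 0 0) (pimg M e g (root e \<rho>))"
proof -
  define \<xi> where "\<xi> v = matrix_inv M *v v" for v
  have \<xi>s: "\<xi> (c *s v) = c *s \<xi> v" for c v unfolding \<xi>_def by (simp add: vector_scalar_commute)
  have \<xi>a: "\<xi> (aff M z w) = vector [1, z, w]" for z w unfolding \<xi>_def by (rule inv_mult(1)[OF M])
  \<comment> \<open>The inequality places z in the disc of radius \<rho>; written without division
    it also excludes vectors whose first coordinate is 0.\<close>
  define cond where "cond v \<longleftrightarrow> norm (\<xi> v $ 2) < \<rho> * norm (\<xi> v $ 1)" for v
  define ex where "ex v = (\<Sum>j\<le>e. A j (\<xi> v $ 2 / \<xi> v $ 1) * (\<xi> v $ 3 / \<xi> v $ 1) ^ j)" for v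
  have conds: "cond (c *s v) \<longleftrightarrow> cond v" "ex (c *s v) = ex v" if "c \<noteq> 0" for c v
    using that by (simp_all add: cond_def ex_def \<xi>s norm_mult mult.left_commute)
  define U where "U = {X. cond (hom_coords X)}"
  \<comment> \<open>A value at a projective point is read off at the representative
    \<open>hom_coords\<close>; by \<open>conds\<close> any other representative gives the same
    value.\<close>
  define f where "f X = ex (hom_coords X)" for X
  have pv: "pt v \<in> U \<longleftrightarrow> cond v" "f (pt v) = ex v" if v: "v \<noteq> 0" for v
  proof -
    obtain c where "c \<noteq> 0" "hom_coords (pt v) = c *s v" using pt_hom_coords[of "pt v"] pt_eq_iff[OF v, of "hom_coords (pt v)"] by auto
    then show "pt v \<in> U \<longleftrightarrow> cond v" "f (pt v) = ex v" using conds by (simp_all add: U_def f_def)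
  qed
  have c\<xi>: "continuous_on UNIV (\<lambda>v. \<xi> v $ i)" for i
    unfolding \<xi>_def matrix_vector_mult_def by (simp, intro continuous_intros)
  have "open {v. v \<noteq> 0 \<and> pt v \<in> U}"
  proof -
    have "{v. v \<noteq> 0 \<and> pt v \<in> U} = - {0} \<inter> {v. norm (\<xi> v $ 2) < \<rho> * norm (\<xi> v $ 1)}"
      using pv by (auto simp: cond_def)
    moreover have "open {v. norm (\<xi> v $ 2) < \<rho> * norm (\<xi> v $ 1)}"
      by (intro open_Collect_less continuous_intros c\<xi>)
    ultimately show ?thesis by auto
  qed
  then have oU: "open U" by (simp add: open_cp2_def)
  have CU: "affine_pt M z w \<in> U \<longleftrightarrow> norm z < \<rho>" for z w
    unfolding affine_pt_def pv(1)[OF aff_nz[OF M]] cond_def \<xi>a by (simp add: vector_3)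
  have hol: "holomorphic_cp2 f U"
    unfolding holomorphic_cp2_cdiff
  proof (intro allI impI)
    fix v assume v: "v \<noteq> 0 \<and> pt v \<in> U"
    then have c: "norm (\<xi> v $ 2) < \<rho> * norm (\<xi> v $ 1)" using pv(1)[of v] by (simp add: cond_def)
    then have x1: "\<xi> v $ 1 \<noteq> 0" using rho by auto
    have "norm (\<xi> v $ 2 / \<xi> v $ 1) < \<rho>" using c x1 by (simp add: norm_divide divide_less_eq)
    then have A: "A j field_differentiable at (\<xi> v $ 2 / \<xi> v $ 1)" for j
      using p unfolding pbranch_def by (intro holomorphic_on_imp_differentiable_at[of "A j" "ball 0 \<rho>"]) auto
    have "cdiff ex v"
      unfolding ex_def[abs_def] \<xi>_def
      by (intro cdiff_sum cdiff_mult cdiff_power cdiff_compose[where h="A _"] cdiff_divide cdiff_matrix) (use x1 A in \<open>auto simp: \<xi>_def\<close>)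
    then show "cdiff (\<lambda>x. f (pt x)) v"
      by (rule cdiff_cong[where S = "- {0}"]) (use v pv in auto)
  qed
  have eq: "X \<in> pimg M e g (root e \<rho>) \<longleftrightarrow> f X = 0" if X: "X \<in> U" for X
  proof -
    obtain v where v: "v \<noteq> 0" "X = pt v" by (rule cp2_cases)
    have c: "norm (\<xi> v $ 2) < \<rho> * norm (\<xi> v $ 1)" using pv(1)[OF v(1)] X v by (simp add: cond_def)
    then have x1: "\<xi> v $ 1 \<noteq> 0" using rho by auto
    define z where "z = \<xi> v $ 2 / \<xi> v $ 1"
    define w where "w = \<xi> v $ 3 / \<xi> v $ 1"
    have "\<xi> v = \<xi> v $ 1 *s vector [1, z, w]" using x1 by (simp add: vec3_eq_iff vector_3 z_def w_def)
    then have "M *v \<xi> v = \<xi> v $ 1 *s aff M z w" by (metis vector_scalar_commute)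
    then have "v = \<xi> v $ 1 *s aff M z w" using inv_mult(2)[OF M, of v] by (simp add: \<xi>_def)
    then have Xa: "X = affine_pt M z w" unfolding v(2) affine_pt_def using pt_scale[OF aff_nz[OF M] x1] by metis
    then have z: "norm z < \<rho>" using X CU by simp
    have "f X = (\<Sum>j\<le>e. A j z * w ^ j)" using pv(2)[OF v(1)] v(2) by (simp add: ex_def z_def w_def)
    then have "f X = 0 \<longleftrightarrow> (\<exists>s\<in>ball 0 (root e \<rho>). z = s ^ e \<and> w = g s)" using p z unfolding pbranch_def by auto
    also have "\<dots> \<longleftrightarrow> X \<in> pimg M e g (root e \<rho>)" unfolding Xa using affine_pt_inj[OF M] by blast
    finally show ?thesis by blast
  qed
  show ?thesis unfolding analytic_germ_def
    using oU CU[of 0 0] rho hol eq by (intro exI[of _ U] exI[of _ "{f}"]) auto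
qed

lemma holomorphic_zero_dichotomy:
  assumes h: "h holomorphic_on ball 0 \<delta>" and d: "\<delta> > 0"
  shows "(\<forall>s\<in>ball 0 \<delta>. h s = 0) \<or> (\<forall>\<^sub>F s in at 0. h s \<noteq> 0)"
proof (rule disjCI)
  assume nz: "\<not> (\<forall>\<^sub>F s in at 0. h s \<noteq> 0)"
  show "\<forall>s\<in>ball 0 \<delta>. h s = 0"
  proof (rule ccontr)
    assume "\<not> (\<forall>s\<in>ball 0 \<delta>. h s = 0)"
    then obtain \<beta> where \<beta>: "\<beta> \<in> ball 0 \<delta>" "h \<beta> \<noteq> 0" by blast
    have "\<forall>\<^sub>F s in at 0. h s \<noteq> 0"
    proof (cases "h 0 = 0")
      case True
      have z0: "0 \<in> ball (0::complex) \<delta>" using d by simp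
      show ?thesis
      proof (rule isolated_zeros[OF h open_ball connected_ball z0 True \<beta>])
        fix r assume r: "0 < r" "ball 0 r \<subseteq> ball 0 \<delta>" "\<And>z. z \<in> ball 0 r - {0} \<Longrightarrow> h z \<noteq> 0"
        have "\<forall>\<^sub>F s in at 0. s \<in> ball 0 r - {0}" using r(1) by (intro eventually_at_in_open) auto
        then show ?thesis by eventually_elim (rule r(3))
      qed
    next
      case False
      have "isCont h 0" by (rule continuous_on_interior[OF holomorphic_on_imp_continuous_on[OF h]]) (use d in simp)
      then show ?thesis using False by (intro tendsto_imp_eventually_ne) (auto simp: isCont_def)
    qed
    then show False using nz by blast
  qed
qed

text \<open>Pulled back to the parameter, the equations of an analytic germ are holomorphic in s:
  either all of them vanish near 0, or one of them has no zeros in a punctured neighbourhood. Two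
  germs of the second kind cannot cover the image.\<close>

lemma param_irreducible:
  assumes M: "invertible M" and e: "e \<ge> 1" and r: "r > 0" and g: "g holomorphic_on ball 0 r" "g 0 = 0"
    and an: "analytic_germ (affine_pt M 0 0) (pimg M e g r)"
  shows "irreducible_germ (affine_pt M 0 0) (pimg M e g r)"
  unfolding irreducible_germ_def
proof (intro conjI an allI impI)
  let ?C = "affine_pt M 0 0"
  let ?b = "pimg M e g r"
  let ?p = "\<lambda>s. affine_pt M (s ^ e) (g s)"
  have z: "(0::complex) ^ e = 0" using e by (simp add: zero_power)
  have "?C = ?p 0" by (simp only: z g(2))
  then show "?C \<in> ?b" using r by (intro image_eqI[of _ _ 0]) auto
  have gc: "isCont g 0" by (rule continuous_on_interior[OF holomorphic_on_imp_continuous_on[OF g(1)]]) (use r in simp)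
  have bb: "germ_eq ?C ?b ?b" by (simp add: germ_eq_def)
  note par = eventually_param[OF M e r gc g(2) bb]
  fix A1 A2 assume as: "analytic_germ ?C A1 \<and> analytic_germ ?C A2 \<and> germ_eq ?C ?b (A1 \<union> A2)"
  have half: "(\<forall>\<^sub>F s in nhds 0. ?p s \<in> A) \<or> (\<exists>f. (\<forall>\<^sub>F s in at 0. f s \<noteq> (0::complex)) \<and> (\<forall>\<^sub>F s in nhds 0. ?p s \<in> A \<longrightarrow> f s = 0))"
    if A: "analytic_germ ?C A" for A
  proof -
    obtain U fs where U: "open U" "?C \<in> U" "finite fs" "\<forall>f\<in>fs. holomorphic_cp2 f U" "A \<inter> U = {X \<in> U. \<forall>f\<in>fs. f X = 0}"
      using A unfolding analytic_germ_def by blast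
    have "\<forall>\<^sub>F X in nhds ?C. X \<in> ?b \<longrightarrow> X \<in> U" using eventually_nhds_in_open[OF U(1,2)] by eventually_elim simp
    then have "\<forall>\<^sub>F s in nhds 0. ?p s \<in> U" unfolding par .
    then obtain \<delta>0 where \<delta>0: "\<delta>0 > 0" "\<And>s. norm s < \<delta>0 \<Longrightarrow> ?p s \<in> U" unfolding eventually_nhds_metric by auto
    define \<delta> where "\<delta> = min \<delta>0 r"
    have \<delta>: "\<delta> > 0" using \<delta>0 r by (simp add: \<delta>_def)
    have inU: "?p s \<in> U" if "s \<in> ball 0 \<delta>" for s using that \<delta>0(2)[of s] by (simp add: \<delta>_def)
    have vh: "vholo (\<lambda>s. aff M (s ^ e) (g s)) (ball 0 \<delta>)"
      unfolding aff_columns by (rule vholo_lin) (auto intro!: holomorphic_intros holomorphic_on_subset[OF g(1)] simp: \<delta>_def)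
    have hf: "(\<lambda>s. f (?p s)) holomorphic_on ball 0 \<delta>" if "f \<in> fs" for f
      unfolding affine_pt_def by (rule holomorphic_cp2_curve[OF _ vh]) (use U(4) that aff_nz[OF M] inU in \<open>auto simp: affine_pt_def\<close>)
    have evb: "\<forall>\<^sub>F s in nhds 0. s \<in> ball 0 \<delta>" using \<delta> by (intro eventually_nhds_in_open) auto
    show ?thesis
    proof (cases "\<forall>f\<in>fs. \<forall>s\<in>ball 0 \<delta>. f (?p s) = 0")
      case True
      from evb have "\<forall>\<^sub>F s in nhds 0. ?p s \<in> A"
      proof eventually_elim
        case (elim s)
        then have "?p s \<in> A \<inter> U" unfolding U(5) using True inU[OF elim] by blast
        then show ?case by blast
      qed
      then show ?thesis by blast
    next
      case False
      then obtain f where f: "f \<in> fs" "\<not> (\<forall>s\<in>ball 0 \<delta>. f (?p s) = 0)" by blast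
      have "\<forall>\<^sub>F s in at 0. f (?p s) \<noteq> 0" using holomorphic_zero_dichotomy[OF hf[OF f(1)] \<delta>] f(2) by blast
      moreover from evb have "\<forall>\<^sub>F s in nhds 0. ?p s \<in> A \<longrightarrow> f (?p s) = 0"
      proof eventually_elim
        case (elim s)
        have "?p s \<in> A \<Longrightarrow> ?p s \<in> A \<inter> U" using inU[OF elim] by blast
        then show ?case unfolding U(5) using f(1) by blast
      qed
      ultimately show ?thesis by (intro disjI2 exI[of _ "\<lambda>s. f (?p s)"]) blast
    qed
  qed
  have "\<forall>\<^sub>F X in nhds ?C. X \<in> ?b \<longrightarrow> X \<in> A1 \<union> A2" using as unfolding germ_eq_def by (elim conjE) (erule eventually_mono, blast)
  then have cov: "\<forall>\<^sub>F s in nhds 0. ?p s \<in> A1 \<union> A2" unfolding par .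
  have "(\<forall>\<^sub>F s in nhds 0. ?p s \<in> A1) \<or> (\<forall>\<^sub>F s in nhds 0. ?p s \<in> A2)"
  proof (rule ccontr)
    assume n: "\<not> ?thesis"
    obtain f1 where f1: "\<forall>\<^sub>F s in at 0. f1 s \<noteq> (0::complex)" "\<forall>\<^sub>F s in nhds 0. ?p s \<in> A1 \<longrightarrow> f1 s = 0" using half[of A1] as n by blast
    obtain f2 where f2: "\<forall>\<^sub>F s in at 0. f2 s \<noteq> (0::complex)" "\<forall>\<^sub>F s in nhds 0. ?p s \<in> A2 \<longrightarrow> f2 s = 0" using half[of A2] as n by blast
    have toat: "\<forall>\<^sub>F s in at (0::complex). P s" if "\<forall>\<^sub>F s in nhds 0. P s" for P
      using that unfolding eventually_at_filter by eventually_elim simp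
    have "\<forall>\<^sub>F s in at (0::complex). False"
      using f1(1) f2(1) toat[OF f1(2)] toat[OF f2(2)] toat[OF cov] by eventually_elim blast
    then show False by simp
  qed
  moreover have fin: "germ_eq ?C ?b A" if "\<forall>\<^sub>F s in nhds 0. ?p s \<in> A" "A \<subseteq> A1 \<union> A2" for A
  proof -
    have "\<forall>\<^sub>F X in nhds ?C. X \<in> ?b \<longrightarrow> X \<in> A" unfolding par by (rule that(1))
    moreover have "\<forall>\<^sub>F X in nhds ?C. X \<in> ?b \<longleftrightarrow> X \<in> A1 \<union> A2" using as by (simp add: germ_eq_def)
    ultimately show ?thesis unfolding germ_eq_def by eventually_elim (use that(2) in blast)
  qed
  ultimately show "germ_eq ?C ?b A1 \<or> germ_eq ?C ?b A2" by blast
qed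

text \<open>The point is maximality. An irreducible germ inside K that contains the branch lies in
  the image of a single branch, by irreducibility and finiteness. The given branch then lies in that
  image as well and shares with it points outside the centre, so \<open>disj\<close> makes both
  images equal.\<close>

lemma pbranch_local_branch:
  assumes M: "invertible M" and rho: "\<rho> > 0" and fin: "finite \<B>"
    and pb: "\<And>e g A. (e, g, A) \<in> \<B> \<Longrightarrow> pbranch \<rho> e g A \<and> g 0 = 0"
    and cover: "\<forall>\<^sub>F X in nhds (affine_pt M 0 0). X \<in> K \<longleftrightarrow> (\<exists>(e, g, A)\<in>\<B>. X \<in> pimg M e g (root e \<rho>))"
    and disj: "\<And>e g A e' g' A' s s' z w. (e, g, A) \<in> \<B> \<Longrightarrow> (e', g', A') \<in> \<B> \<Longrightarrow> s \<in> ball 0 (root e \<rho>) \<Longrightarrow> s' \<in> ball 0 (root e' \<rho>) \<Longrightarrow>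
      s ^ e = s' ^ e' \<Longrightarrow> g s = g' s' \<Longrightarrow> s \<noteq> 0 \<Longrightarrow> z \<noteq> 0 \<Longrightarrow>
      (\<exists>s\<in>ball 0 (root e \<rho>). z = s ^ e \<and> w = g s) \<longleftrightarrow> (\<exists>s\<in>ball 0 (root e' \<rho>). z = s ^ e' \<and> w = g' s)"
    and mem: "(e, g, A) \<in> \<B>"
  shows "local_branch K (affine_pt M 0 0) (pimg M e g (root e \<rho>))"
proof -
  let ?C = "affine_pt M 0 0"
  have r: "root e \<rho> > 0" if "(e, g, A) \<in> \<B>" for e g A using pb[OF that] rho by (auto simp: pbranch_def)
  have irr: "irreducible_germ ?C (pimg M e g (root e \<rho>))" if m: "(e, g, A) \<in> \<B>" for e g A
    using pb[OF m] pbranch_analytic[OF M rho, of e g A] by (intro param_irreducible[OF M _ r[OF m]]) (auto simp: pbranch_def)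
  have le: "germ_le ?C (pimg M e g (root e \<rho>)) K"
    using cover unfolding germ_le_def by eventually_elim (use mem in blast)
  have max: "germ_eq ?C b' (pimg M e g (root e \<rho>))"
    if b': "irreducible_germ ?C b'" "germ_le ?C (pimg M e g (root e \<rho>)) b'" "germ_le ?C b' K" for b'
  proof -
    define img where "img = (\<lambda>(e, g, A :: nat \<Rightarrow> complex \<Rightarrow> complex). pimg M e g (root e \<rho>))"
    have "germ_le ?C b' (\<Union>i\<in>\<B>. img i)"
      using b'(3) cover unfolding germ_le_def by eventually_elim (auto simp: img_def)
    moreover have "analytic_germ ?C (img i)" if "i \<in> \<B>" for i
      using irr that by (auto simp: img_def irreducible_germ_def split: prod.splits)
    ultimately obtain i where i: "i \<in> \<B>" "germ_le ?C b' (img i)"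
      using irreducible_germ_finite_Union[OF b'(1) fin] by blast
    obtain e' g' A' where ie: "i = (e', g', A')" by (cases i) auto
    have m': "(e', g', A') \<in> \<B>" using i ie by simp
    have li: "germ_le ?C b' (pimg M e' g' (root e' \<rho>))" using i ie by (simp add: img_def)
    have e1: "e \<ge> 1" "e' \<ge> 1" and g0: "g 0 = 0" "g' 0 = 0" using pb[OF mem] pb[OF m'] by (auto simp: pbranch_def)
    have gh: "g holomorphic_on ball 0 (root e \<rho>)" using pb[OF mem] by (simp add: pbranch_def)
    have gc: "isCont g 0" by (rule continuous_on_interior[OF holomorphic_on_imp_continuous_on[OF gh]]) (use r[OF mem] in simp)
    have bb: "germ_eq ?C (pimg M e g (root e \<rho>)) (pimg M e g (root e \<rho>))" by (simp add: germ_eq_def)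
    have "germ_le ?C (pimg M e g (root e \<rho>)) (pimg M e' g' (root e' \<rho>))" by (rule germ_le_trans[OF b'(2) li])
    then have ev: "\<forall>\<^sub>F s in nhds 0. affine_pt M (s ^ e) (g s) \<in> pimg M e' g' (root e' \<rho>)"
      unfolding germ_le_def eventually_param[OF M e1(1) r[OF mem] gc g0(1) bb] .
    have "\<forall>\<^sub>F s in nhds 0. s \<in> ball (0::complex) (root e \<rho>)" using r[OF mem] by (intro eventually_nhds_in_open) auto
    with ev have "\<forall>\<^sub>F s in nhds 0. affine_pt M (s ^ e) (g s) \<in> pimg M e' g' (root e' \<rho>) \<and> s \<in> ball 0 (root e \<rho>)" by eventually_elim simp
    then obtain \<delta> where \<delta>: "\<delta> > 0" "\<And>s. norm s < \<delta> \<Longrightarrow> affine_pt M (s ^ e) (g s) \<in> pimg M e' g' (root e' \<rho>) \<and> s \<in> ball 0 (root e \<rho>)"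
      unfolding eventually_nhds_metric by auto
    define s :: complex where "s = of_real (\<delta> / 2)"
    have s: "s \<noteq> 0" "norm s < \<delta>" using \<delta>(1) by (auto simp: s_def)
    then obtain s' where s': "s' \<in> ball 0 (root e' \<rho>)" "affine_pt M (s ^ e) (g s) = affine_pt M (s' ^ e') (g' s')" and sb: "s \<in> ball 0 (root e \<rho>)" using \<delta>(2)[OF s(2)] by blast
    have eqs: "s ^ e = s' ^ e'" "g s = g' s'" using affine_pt_inj[OF M s'(2)] by auto
    have same: "(\<exists>s\<in>ball 0 (root e \<rho>). z = s ^ e \<and> w = g s) \<longleftrightarrow> (\<exists>s\<in>ball 0 (root e' \<rho>). z = s ^ e' \<and> w = g' s)" for z w
    proof (cases "z = 0")
      case False
      then show ?thesis using disj[OF mem m' sb s'(1) eqs s(1)] by blast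
    next
      case True
      have "(\<exists>s\<in>ball 0 (root e \<rho>). z = s ^ e \<and> w = g s) \<longleftrightarrow> w = 0" if "e \<ge> 1" "g 0 = 0" "root e \<rho> > 0" for e and g :: "complex \<Rightarrow> complex"
        using that True by (auto intro!: bexI[of _ 0])
      then show ?thesis using e1 g0 r[OF mem] r[OF m'] by simp
    qed
    have "pimg M e g (root e \<rho>) = pimg M e' g' (root e' \<rho>)"
    proof -
      have "pimg M e g r = {X. \<exists>z w. X = affine_pt M z w \<and> (\<exists>s\<in>ball 0 r. z = s ^ e \<and> w = g s)}" for e g r by blast
      then show ?thesis using same by simp
    qed
    then show ?thesis using li b'(2) unfolding germ_eq_iff_le by simp
  qed
  show ?thesis unfolding local_branch_def using irr[OF mem] le max by blast
qed

subsection \<open>Restriction of a form to lines\<close>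

text \<open>Here m and n are bounds and not degrees, since the top coefficients of a restricted form
  may vanish for special lines.\<close>

lemma coeff_mult_top:
  fixes p q :: "'a::comm_semiring_1 poly"
  assumes "degree p \<le> m" "degree q \<le> n"
  shows "coeff (p * q) (m + n) = coeff p m * coeff q n"
proof -
  have "coeff (p * q) (m + n) = (\<Sum>i\<le>m + n. coeff p i * coeff q (m + n - i))" by (rule coeff_mult)
  also have "\<dots> = (\<Sum>i\<in>{m}. coeff p i * coeff q (m + n - i))"
  proof (rule sum.mono_neutral_right)
    show "\<forall>i\<in>{..m + n} - {m}. coeff p i * coeff q (m + n - i) = 0"
    proof
      fix i assume "i \<in> {..m + n} - {m}"
      then consider "i > m" | "m + n - i > n" by force
      then show "coeff p i * coeff q (m + n - i) = 0" using assms by cases (auto simp: coeff_eq_0)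
    qed
  qed auto
  finally show ?thesis by simp
qed

lemma coeff_linear_pow: "degree ([:a, b:] ^ n) \<le> n \<and> coeff ([:a, b:] ^ n) n = (b::'a::comm_semiring_1) ^ n"
proof (induction n)
  case (Suc n)
  have d: "degree [:a, b:] \<le> 1" by simp
  have "degree ([:a, b:] * [:a, b:] ^ n) \<le> 1 + n" using degree_mult_le[of "[:a, b:]" "[:a, b:] ^ n"] d Suc by linarith
  moreover have "coeff ([:a, b:] * [:a, b:] ^ n) (1 + n) = b * b ^ n" using coeff_mult_top[OF d conjunct1[OF Suc]] Suc by simp
  ultimately show ?case by simp
qed auto

text \<open>The polynomial t \<mapsto> F (v + t u), expanded by monomials so that its coefficients
  are visibly polynomial in v and u.\<close>

definition lp :: "nat \<Rightarrow> poly3 \<Rightarrow> complex^3 \<Rightarrow> complex^3 \<Rightarrow> complex poly" where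
  "lp d F v u = (\<Sum>k\<le>d. \<Sum>j\<le>d. \<Sum>i\<le>d. smult (coeff (coeff (coeff F k) j) i)
     ([:v $ 1, u $ 1:] ^ i * [:v $ 2, u $ 2:] ^ j * [:v $ 3, u $ 3:] ^ k))"

lemma poly_lp:
  assumes "homogeneous d F"
  shows "poly (lp d F v u) t = eval3 F (v + t *s u)"
  unfolding lp_def eval3_sum[OF assms] by (simp add: poly_sum poly_power mult.assoc)

lemma coeff_lp_deg:
  assumes F: "homogeneous d F"
  shows "degree (lp d F v u) \<le> d" "coeff (lp d F v u) d = eval3 F u"
proof -
  have *: "degree ([:v $ 1, u $ 1:] ^ i * [:v $ 2, u $ 2:] ^ j * [:v $ 3, u $ 3:] ^ k) \<le> i + j + k \<and>
      coeff ([:v $ 1, u $ 1:] ^ i * [:v $ 2, u $ 2:] ^ j * [:v $ 3, u $ 3:] ^ k) (i + j + k) = u $ 1 ^ i * u $ 2 ^ j * u $ 3 ^ k" for i j k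
  proof -
    note a = coeff_linear_pow[of "v $ 1" "u $ 1" i] and b = coeff_linear_pow[of "v $ 2" "u $ 2" j] and c = coeff_linear_pow[of "v $ 3" "u $ 3" k]
    have ab: "degree ([:v $ 1, u $ 1:] ^ i * [:v $ 2, u $ 2:] ^ j) \<le> i + j"
      using degree_mult_le[of "[:v $ 1, u $ 1:] ^ i" "[:v $ 2, u $ 2:] ^ j"] a b by linarith
    have "degree ([:v $ 1, u $ 1:] ^ i * [:v $ 2, u $ 2:] ^ j * [:v $ 3, u $ 3:] ^ k) \<le> i + j + k"
      using degree_mult_le[of "[:v $ 1, u $ 1:] ^ i * [:v $ 2, u $ 2:] ^ j" "[:v $ 3, u $ 3:] ^ k"] ab c by linarith
    then show ?thesis
      using coeff_mult_top[OF ab conjunct1[OF c]] coeff_mult_top[OF conjunct1[OF a] conjunct1[OF b]] a b c by simp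
  qed
  have z: "coeff (coeff (coeff F k) j) i = 0 \<or> i + j + k = d" for i j k using F unfolding homogeneous_def by blast
  show "degree (lp d F v u) \<le> d" unfolding lp_def
  proof (intro degree_sum_le)
    fix k j i
    show "degree (smult (coeff (coeff (coeff F k) j) i) ([:v $ 1, u $ 1:] ^ i * [:v $ 2, u $ 2:] ^ j * [:v $ 3, u $ 3:] ^ k)) \<le> d"
    proof (cases "coeff (coeff (coeff F k) j) i = 0")
      case False
      then have "i + j + k = d" using z[of k j i] by blast
      then show ?thesis using conjunct1[OF *[of i j k]] order_trans[OF degree_smult_le] by blast
    qed simp
  qed auto
  have cc: "coeff (smult (coeff (coeff (coeff F k) j) i) ([:v $ 1, u $ 1:] ^ i * [:v $ 2, u $ 2:] ^ j * [:v $ 3, u $ 3:] ^ k)) d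
     = coeff (coeff (coeff F k) j) i * u $ 1 ^ i * u $ 2 ^ j * u $ 3 ^ k" for k j i
    using z[of k j i] *[of i j k] by (auto simp: mult.assoc)
  show "coeff (lp d F v u) d = eval3 F u"
    unfolding lp_def eval3_sum[OF F] coeff_sum by (intro sum.cong refl cc)
qed

lemma holomorphic_coeff_mult:
  assumes "\<And>j. (\<lambda>z. coeff (P z) j) holomorphic_on S" "\<And>j. (\<lambda>z. coeff (Q z) j) holomorphic_on S"
  shows "(\<lambda>z. coeff (P z * Q z) j) holomorphic_on S"
  unfolding coeff_mult using assms by (intro holomorphic_intros)

lemma holomorphic_coeff_power:
  assumes "\<And>j. (\<lambda>z. coeff (P z) j) holomorphic_on S"
  shows "(\<lambda>z. coeff (P z ^ n) j) holomorphic_on S"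
proof (induction n arbitrary: j)
  case (Suc n)
  show ?case unfolding power_Suc by (rule holomorphic_coeff_mult[OF assms Suc])
qed auto

lemma holomorphic_coeff_linear:
  assumes "f holomorphic_on S" "g holomorphic_on S"
  shows "(\<lambda>z. coeff [:f z, g z:] j) holomorphic_on S"
proof -
  consider "j = 0" | "j = 1" | "j = Suc (Suc (j - 2))" by linarith
  then show ?thesis
  proof cases
    case 3
    then have "(\<lambda>z. coeff [:f z, g z:] j) = (\<lambda>_. 0)" by (metis coeff_pCons_Suc coeff_0)
    then show ?thesis by simp
  qed (use assms in simp_all)
qed

lemma holomorphic_coeff_lp:
  assumes v: "\<And>i. (\<lambda>z. v z $ i) holomorphic_on S" and u: "\<And>i. (\<lambda>z. u z $ i) holomorphic_on S"
  shows "(\<lambda>z. coeff (lp d F (v z) (u z)) j) holomorphic_on S"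
  unfolding lp_def coeff_sum coeff_smult
  by (intro holomorphic_intros holomorphic_coeff_mult holomorphic_coeff_power holomorphic_coeff_linear v u)

lemma lp_scale:
  assumes F: "homogeneous d F"
  shows "coeff (lp d F v (s *s u)) j = s ^ j * coeff (lp d F v u) j"
proof -
  have "poly (lp d F v (s *s u)) t = poly (pcompose (lp d F v u) [:0, s:]) t" for t
    by (simp add: poly_lp[OF F] poly_pcompose vector_smult_assoc)
  then have "lp d F v (s *s u) = pcompose (lp d F v u) [:0, s:]" by (simp add: poly_eq_poly_eq_iff[symmetric] fun_eq_iff)
  then show ?thesis by (simp add: coeff_pcompose_linear mult.commute)
qed

lemma eval3_lp_sum:
  assumes F: "homogeneous d F"
  shows "eval3 F (v + u) = (\<Sum>j\<le>d. coeff (lp d F v u) j)"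
  using poly_lp[OF F, of v u 1] poly_sum_le[OF coeff_lp_deg(1)[OF F], of v u 1] by simp

text \<open>Serves to turn expressions such as coefficients of \<open>lp\<close> back into elements
  of \<open>poly3\<close>, where divisibility by F makes sense.\<close>

definition polyfun :: "(complex^3 \<Rightarrow> complex) \<Rightarrow> bool" where
  "polyfun f \<longleftrightarrow> (\<exists>G::poly3. \<forall>v. eval3 G v = f v)"

lemma polyfun_const: "polyfun (\<lambda>_. c)"
  unfolding polyfun_def by (intro exI[of _ "[:[:[:c:]:]:]"]) (simp add: eval3_def)

lemma polyfun_component: "polyfun (\<lambda>v. v $ i)"
proof -
  have "eval3 (lform (axis i 1)) v = v $ i" for v
    using exhaust_3[of i] by (auto simp: eval3_lform axis_def)
  then show ?thesis unfolding polyfun_def by blast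
qed

lemma polyfun_add: "polyfun f \<Longrightarrow> polyfun g \<Longrightarrow> polyfun (\<lambda>v. f v + g v)"
  unfolding polyfun_def using eval3_simps(3) by metis

lemma polyfun_mult: "polyfun f \<Longrightarrow> polyfun g \<Longrightarrow> polyfun (\<lambda>v. f v * g v)"
  unfolding polyfun_def using eval3_simps(6) by metis

lemma polyfun_sum: "(\<And>i. i \<in> A \<Longrightarrow> polyfun (f i)) \<Longrightarrow> polyfun (\<lambda>v. \<Sum>i\<in>A. f i v)"
  by (induction A rule: infinite_finite_induct) (auto intro: polyfun_const polyfun_add)

lemma polyfun_coeff_power:
  assumes "\<And>j. polyfun (\<lambda>v. coeff (P v) j)"
  shows "polyfun (\<lambda>v. coeff (P v ^ n) j)"
proof (induction n arbitrary: j)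
  case 0
  then show ?case by (simp add: polyfun_const)
next
  case (Suc n)
  show ?case unfolding power_Suc coeff_mult by (intro polyfun_sum polyfun_mult assms Suc)
qed

lemma polyfun_coeff_linear: "polyfun f \<Longrightarrow> polyfun (\<lambda>v. coeff [:f v, c:] j)"
proof -
  assume f: "polyfun f"
  consider "j = 0" | "j = 1" | "j = Suc (Suc (j - 2))" by linarith
  then show ?thesis
  proof cases
    case 3
    then have "(\<lambda>v. coeff [:f v, c:] j) = (\<lambda>_. 0)" by (metis coeff_pCons_Suc coeff_0)
    then show ?thesis by (simp add: polyfun_const)
  qed (use f in \<open>simp_all add: polyfun_const\<close>)
qed

lemma polyfun_coeff_lp: "polyfun (\<lambda>v. coeff (lp d F v u) j)"
  unfolding lp_def coeff_sum coeff_smult coeff_mult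
  by (intro polyfun_sum polyfun_mult polyfun_const polyfun_coeff_power polyfun_coeff_linear polyfun_component)

subsection \<open>Irreducible forms\<close>

lemma continuous_on_eval3: "continuous_on S (eval3 K)"
proof -
  have "eval3 K = (\<lambda>v. \<Sum>i\<le>degree K. (\<Sum>j\<le>degree (coeff K i). poly (coeff (coeff K i) j) (v $ 1) * v $ 2 ^ j) * v $ 3 ^ i)"
    by (rule ext) (simp add: eval3_def poly_altdef[of K] poly_sum poly_power poly_altdef[of "coeff K _"])
  then show ?thesis by (simp, intro continuous_intros)
qed

lemma continuous_on_smult_left: "continuous_on S (\<lambda>l. l *s (v::complex^3))"
  unfolding vector_scalar_mult_def by (intro continuous_intros)

lemma isCont_eval3_smult: "isCont (\<lambda>l. eval3 K (l *s v)) l0"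
  using continuous_on_compose2[OF continuous_on_eval3[of UNIV K] continuous_on_smult_left[of UNIV v]]
  by (auto simp: continuous_on_eq_continuous_at[OF open_UNIV])

text \<open>For G = F K and F (v) nonzero, l ^ (d - m) K (l v) is constant in l and tends to 0 with
  l, so G (v) = 0. G is described by the scaling of its values, because this is what is known about
  polynomials obtained through \<open>polyfun\<close>.\<close>

lemma dvd_lower_degree:
  assumes F: "homogeneous d F" and G: "\<And>l v. l \<noteq> 0 \<Longrightarrow> eval3 G (l *s v) = l ^ m * eval3 G v" and md: "m < d"
    and dvd: "F dvd G"
  shows "G = 0"
proof (rule eval3_eq_0_imp, rule ccontr)
  fix v assume Gv: "eval3 G v \<noteq> 0"
  obtain K where K: "G = F * K" using dvd by blast
  then have Fv: "eval3 F v \<noteq> 0" using Gv by auto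
  have "isCont (\<lambda>l. l ^ (d - m) * eval3 K (l *s v)) 0"
    by (intro continuous_intros isCont_eval3_smult)
  then have t: "((\<lambda>l. l ^ (d - m) * eval3 K (l *s v)) \<longlongrightarrow> 0) (at 0)"
    using md by (simp add: isCont_def zero_power)
  have "l ^ (d - m) * eval3 K (l *s v) = eval3 G v / eval3 F v" if l: "l \<noteq> 0" for l
  proof -
    have "l ^ m * eval3 G v = l ^ d * eval3 F v * eval3 K (l *s v)"
      unfolding G[OF l, symmetric] by (simp add: K eval3_scale[OF F])
    also have "l ^ d = l ^ m * l ^ (d - m)" using md by (simp add: power_add[symmetric])
    finally have "l ^ m * eval3 G v = l ^ m * (eval3 F v * (l ^ (d - m) * eval3 K (l *s v)))" by (simp only: mult_ac)
    then have "eval3 G v = eval3 F v * (l ^ (d - m) * eval3 K (l *s v))" using l by (simp only: mult_cancel_left power_not_zero) simp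
    then show ?thesis using Fv by simp
  qed
  then have "\<forall>\<^sub>F l in at 0. l ^ (d - m) * eval3 K (l *s v) = eval3 G v / eval3 F v"
    by (simp add: eventually_at_filter)
  then have "((\<lambda>l::complex. eval3 G v / eval3 F v) \<longlongrightarrow> 0) (at 0)" using t tendsto_cong by fastforce
  then have "eval3 G v / eval3 F v = 0" using tendsto_unique[OF at_neq_bot tendsto_const] by metis
  then show False using Gv Fv by simp
qed

lemma finite_common_zeros:
  assumes "irreducible F" "homogeneous d F" and G: "\<And>l v. l \<noteq> 0 \<Longrightarrow> eval3 G (l *s v) = l ^ m * eval3 G v"
    and n: "\<not> F dvd G"
  shows "finite {pt v | v. v \<noteq> 0 \<and> eval3 F v = 0 \<and> eval3 G v = 0}" (is "finite ?X")
proof (rule ccontr)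
  assume inf: "infinite ?X"
  have "F dvd G"
  proof (rule dvd_if_infinite_common_zeros[OF assms(1) inf])
    fix v c assume v: "v \<noteq> 0" "pt v \<in> ?X" "c \<noteq> (0::complex)"
    then obtain u where u: "u \<noteq> 0" "pt v = pt u" "eval3 F u = 0" "eval3 G u = 0" by blast
    then obtain l where l: "l \<noteq> 0" "v = l *s u" using pt_eq_iff[OF u(1) v(1)] by metis
    then have "c *s v = (c * l) *s u" "c * l \<noteq> 0" using v by (simp_all add: vector_smult_assoc)
    then show "eval3 F (c *s v) = 0 \<and> eval3 G (c *s v) = 0" using u G eval3_scale[OF assms(2)] by simp
  qed
  then show False using n by simp
qed

subsection \<open>Local branches of algebraic curves\<close>

lemma poly_pderiv_lp:
  assumes F: "homogeneous d F"
  shows "poly (pderiv (lp d F v c)) w = coeff (lp d F (v + w *s c) c) 1"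
proof -
  have "lp d F (v + w *s c) c = pcompose (lp d F v c) [:w, 1:]"
  proof -
    have "poly (lp d F (v + w *s c) c) t = poly (pcompose (lp d F v c) [:w, 1:]) t" for t
    proof -
      have eq: "v + w *s c + t *s c = v + (w + t) *s c" by (simp add: vec_eq_iff algebra_simps)
      show ?thesis unfolding poly_pcompose poly_lp[OF F] eq by simp
    qed
    then show ?thesis by (simp add: poly_eq_poly_eq_iff[symmetric] fun_eq_iff)
  qed
  then have "pderiv (lp d F (v + w *s c) c) = pcompose (pderiv (lp d F v c)) [:w, 1:]"
    by (simp add: pderiv_pcompose pderiv_pCons)
  then have "poly (pderiv (lp d F (v + w *s c) c)) 0 = poly (pderiv (lp d F v c)) w" by (simp add: poly_pcompose)
  moreover have "poly (pderiv q) 0 = coeff q 1" for q :: "complex poly" by (simp add: poly_0_coeff_0 coeff_pderiv)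
  ultimately show ?thesis by simp
qed

lemma affine_pt_zero_locus:
  assumes "homogeneous d F" "invertible M"
  shows "affine_pt M z w \<in> zero_locus F \<longleftrightarrow> poly (lp d F (column 1 M + z *s column 2 M) (column 3 M)) w = 0"
  using in_zero_locus[OF assms(1) aff_nz[OF assms(2), of z w]] by (simp add: affine_pt_def poly_lp[OF assms(1)] aff_columns)

text \<open>A multiple root is a common zero of F and its derivative G in the direction of the
  projection centre, whose values scale with degree d - 1. If F divided G, then G would be 0 and F
  constant along that direction, although the coefficient of t ^ d is the nonzero value of F at the
  centre.\<close>

lemma finite_multiple_roots:
  fixes M :: "complex^3^3"
  assumes F: "irreducible F" "homogeneous d F" "d \<ge> 1" and M: "invertible M" and c: "eval3 F (column 3 M) \<noteq> 0"
  shows "finite {z. \<exists>w. poly (lp d F (column 1 M + z *s column 2 M) (column 3 M)) w = 0 \<and>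
    poly (pderiv (lp d F (column 1 M + z *s column 2 M) (column 3 M))) w = 0}" (is "finite ?S")
proof -
  let ?c = "column 3 M"
  obtain G :: poly3 where G: "\<And>v. eval3 G v = coeff (lp d F v ?c) 1"
    using polyfun_coeff_lp[of d F ?c 1] unfolding polyfun_def by blast
  have Gs: "eval3 G (l *s v) = l ^ (d - 1) * eval3 G v" if l: "l \<noteq> 0" for l v
  proof -
    have "poly (lp d F (l *s v) ?c) t = poly (smult (l ^ d) (pcompose (lp d F v ?c) [:0, 1 / l:])) t" for t
    proof -
      have eq: "l *s v + t *s ?c = l *s (v + (t / l) *s ?c)" using l by (simp add: vec_eq_iff algebra_simps)
      show ?thesis unfolding poly_smult poly_pcompose poly_lp[OF F(2)] eq eval3_scale[OF F(2)] by simp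
    qed
    then have "lp d F (l *s v) ?c = smult (l ^ d) (pcompose (lp d F v ?c) [:0, 1 / l:])" by (simp add: poly_eq_poly_eq_iff[symmetric] fun_eq_iff)
    then have "coeff (lp d F (l *s v) ?c) 1 = l ^ d * (1 / l) * coeff (lp d F v ?c) 1" by (simp add: coeff_pcompose_linear)
    moreover have "l ^ d * (1 / l) = l ^ (d - 1)" using l F(3) by (cases d) auto
    ultimately show ?thesis unfolding G by (simp only:)
  qed
  have nd: "\<not> F dvd G"
  proof
    assume "F dvd G"
    then have "G = 0" using dvd_lower_degree[OF F(2) Gs, of] F(3) by simp
    then have "poly (pderiv (lp d F 0 ?c)) w = 0" for w unfolding poly_pderiv_lp[OF F(2)] G[symmetric] by simp
    then have "pderiv (lp d F 0 ?c) = 0" by (simp add: poly_eq_poly_eq_iff[symmetric] fun_eq_iff)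
    then have "degree (lp d F 0 ?c) = 0" by (simp add: pderiv_eq_0_iff)
    moreover have "coeff (lp d F 0 ?c) d \<noteq> 0" using coeff_lp_deg(2)[OF F(2)] c by simp
    ultimately show False using F(3) le_degree by fastforce
  qed
  have fX: "finite {pt v | v. v \<noteq> 0 \<and> eval3 F v = 0 \<and> eval3 G v = 0}" (is "finite ?X")
    by (rule finite_common_zeros[OF F(1,2) Gs nd])
  \<comment> \<open>The finite set known so far consists of points; z is recovered from a point as
    its unique first affine coordinate.\<close>
  have "?S \<subseteq> (\<lambda>X. THE z. \<exists>w. X = affine_pt M z w) ` ?X"
  proof
    fix z assume "z \<in> ?S"
    then obtain w where w: "poly (lp d F (column 1 M + z *s column 2 M) ?c) w = 0"
      "poly (pderiv (lp d F (column 1 M + z *s column 2 M) ?c)) w = 0" by blast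
    then have "eval3 F (aff M z w) = 0" "eval3 G (aff M z w) = 0"
      unfolding poly_pderiv_lp[OF F(2)] G[symmetric] poly_lp[OF F(2)] aff_columns by auto
    then have mem: "affine_pt M z w \<in> ?X" unfolding affine_pt_def using aff_nz[OF M] by blast
    have the: "(THE z'. \<exists>w'. affine_pt M z w = affine_pt M z' w') = z"
      using affine_pt_inj[OF M] by (intro the_equality) blast+
    show "z \<in> (\<lambda>X. THE z. \<exists>w. X = affine_pt M z w) ` ?X"
      by (rule image_eqI[of _ _ "affine_pt M z w"], rule sym[OF the], rule mem)
  qed
  then show ?thesis using fX finite_surj by blast
qed

lemma monic_family_lp:
  assumes F: "homogeneous d F" and c: "eval3 F c \<noteq> 0"
  shows "monic_family (\<lambda>z. lp d F (v + z *s b) c) UNIV d (eval3 F c)"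
proof
  show deg: "degree (lp d F (v + z *s b) c) = d" for z
    using coeff_lp_deg[OF F, of "v + z *s b" c] c le_degree[of "lp d F (v + z *s b) c" d] by simp
  show "lead_coeff (lp d F (v + z *s b) c) = eval3 F c" for z
    unfolding deg by (rule coeff_lp_deg(2)[OF F])
  show "(\<lambda>z. coeff (lp d F (v + z *s b) c) j) holomorphic_on UNIV" for j
    by (rule holomorphic_coeff_lp) (auto intro!: holomorphic_intros)
qed (use c in auto)

lemma isCont_coeff_lp:
  "isCont (\<lambda>z. coeff (lp d F v (u + z *s b)) j) z0"
proof -
  have "(\<lambda>z. coeff (lp d F v (u + z *s b)) j) holomorphic_on UNIV"
    by (rule holomorphic_coeff_lp) (auto intro!: holomorphic_intros)
  then show ?thesis using holomorphic_on_imp_continuous_on continuous_on_interior by fastforce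
qed

text \<open>The number \<mu> is the multiplicity of F at v, and the second property keeps c off the
  tangent cone there, so that no branch through v is tangent to the fibres of the projection from c.
  The first keeps c off the curve. A direction u1 with the second property acquires the first by a
  small perturbation.\<close>

lemma good_direction:
  assumes F: "homogeneous d F" and u0: "eval3 F u0 \<noteq> 0"
  obtains c \<mu> where "eval3 F c \<noteq> 0" "coeff (lp d F v c) \<mu> \<noteq> 0" "\<And>u j. j < \<mu> \<Longrightarrow> coeff (lp d F v u) j = 0"
proof -
  define \<mu> where "\<mu> = (LEAST j. \<exists>u. coeff (lp d F v u) j \<noteq> 0)"
  have "\<exists>j u. coeff (lp d F v u) j \<noteq> 0" using coeff_lp_deg(2)[OF F, of v u0] u0 by metis
  then have "\<exists>u. coeff (lp d F v u) \<mu> \<noteq> 0" unfolding \<mu>_def by (rule LeastI_ex)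
  then obtain u1 where u1: "coeff (lp d F v u1) \<mu> \<noteq> 0" by blast
  have min: "coeff (lp d F v u) j = 0" if "j < \<mu>" for u j
    using not_less_Least[of j "\<lambda>j. \<exists>u. coeff (lp d F v u) j \<noteq> 0"] that unfolding \<mu>_def by blast
  have "isCont (\<lambda>s. coeff (lp d F v (u1 + s *s u0)) \<mu>) 0" by (rule isCont_coeff_lp)
  then have "((\<lambda>s. coeff (lp d F v (u1 + s *s u0)) \<mu>) \<longlongrightarrow> coeff (lp d F v u1) \<mu>) (at 0)" by (simp add: isCont_def)
  then have 1: "\<forall>\<^sub>F s in at 0. coeff (lp d F v (u1 + s *s u0)) \<mu> \<noteq> 0" using u1 by (rule tendsto_imp_eventually_ne)
  have "lp d F u1 u0 \<noteq> 0" using coeff_lp_deg(2)[OF F, of u1 u0] u0 by auto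
  then have "finite {s. poly (lp d F u1 u0) s = 0}" by (rule poly_roots_finite)
  then have "open (- ({s. poly (lp d F u1 u0) s = 0} - {0}))" by (intro open_Compl finite_imp_closed) auto
  then have "\<forall>\<^sub>F s in nhds 0. s \<in> - ({s. poly (lp d F u1 u0) s = 0} - {0})" by (rule eventually_nhds_in_open) simp
  then have "\<forall>\<^sub>F s in at 0. s \<notin> {s. poly (lp d F u1 u0) s = 0} - {0}"
    unfolding eventually_at_filter by eventually_elim blast
  moreover have "\<forall>\<^sub>F s in at (0::complex). s \<noteq> 0" by (simp add: eventually_at_filter)
  ultimately have "\<forall>\<^sub>F s in at 0. eval3 F (u1 + s *s u0) \<noteq> 0 \<and> coeff (lp d F v (u1 + s *s u0)) \<mu> \<noteq> 0"
    using 1 by eventually_elim (auto simp: poly_lp[OF F])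
  from eventually_happens'[OF at_neq_bot this]
  obtain s where "eval3 F (u1 + s *s u0) \<noteq> 0" "coeff (lp d F v (u1 + s *s u0)) \<mu> \<noteq> 0" by blast
  then show ?thesis using min by (rule that)
qed

lemma det3_complement:
  assumes v: "v \<noteq> 0" and c: "\<And>l. c \<noteq> l *s v"
  obtains b where "det3 v b c \<noteq> 0"
proof (rule ccontr)
  assume "\<not> thesis"
  then have z: "det3 v b c = 0" for b using that by blast
  have e: "v $ 3 * c $ 2 = v $ 2 * c $ 3" "v $ 1 * c $ 3 = v $ 3 * c $ 1" "v $ 2 * c $ 1 = v $ 1 * c $ 2"
    using z[of "vector [1, 0, 0]"] z[of "vector [0, 1, 0]"] z[of "vector [0, 0, 1]"] by (simp_all add: det3_def vector_3)
  consider "v $ 1 \<noteq> 0" | "v $ 2 \<noteq> 0" | "v $ 3 \<noteq> 0" using v by (auto simp: vec3_eq_iff)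
  then show False
  proof cases
    case 1
    then have "c = (c $ 1 / v $ 1) *s v" using e by (simp add: vec3_eq_iff field_simps)
    then show False using c by blast
  next
    case 2
    then have "c = (c $ 2 / v $ 2) *s v" using e by (simp add: vec3_eq_iff field_simps)
    then show False using c by blast
  next
    case 3
    then have "c = (c $ 3 / v $ 3) *s v" using e by (simp add: vec3_eq_iff field_simps)
    then show False using c by blast
  qed
qed

text \<open>Because c lies off the tangent cone, F (v + w (c + \<rho> b)) = w ^ \<mu> Kf (\<rho>, w)
  with Kf (0, 0) nonzero. Hence no zero with w nonzero has both w and \<rho> = z / w small, which
  bounds w by a multiple of z near the centre.\<close>

lemma small_root_estimate:
  assumes F: "homogeneous d F" and min: "\<And>u j. j < \<mu> \<Longrightarrow> coeff (lp d F v u) j = 0" and c: "coeff (lp d F v c) \<mu> \<noteq> 0"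
  obtains \<eta> where "\<eta> > 0" "\<And>z w. norm w < \<eta> \<Longrightarrow> eval3 F (v + z *s b + w *s c) = 0 \<Longrightarrow> \<eta> * norm w \<le> norm z"
proof -
  define Kf where "Kf p = (\<Sum>j\<in>{\<mu>..d}. snd p ^ (j - \<mu>) * coeff (lp d F v (c + fst p *s b)) j)" for p :: "complex \<times> complex"
  have \<mu>d: "\<mu> \<le> d" using c coeff_lp_deg(1)[OF F, of v c] le_degree[of "lp d F v c" \<mu>] by linarith
  have "isCont (\<lambda>p :: complex \<times> complex. coeff (lp d F v (c + fst p *s b)) j) (0, 0)" for j
  proof -
    have "isCont (\<lambda>p :: complex \<times> complex. fst p) (0, 0)" by (intro continuous_intros)
    then show ?thesis by (rule isCont_o2) (rule isCont_coeff_lp)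
  qed
  then have "isCont Kf (0, 0)" unfolding Kf_def by (intro continuous_intros)
  then have t: "(Kf \<longlongrightarrow> Kf (0, 0)) (nhds (0, 0))" by (rule isCont_tendsto_nhds)
  have "Kf (0, 0) = (\<Sum>j\<in>{\<mu>..d}. if j = \<mu> then coeff (lp d F v c) j else 0)"
    unfolding Kf_def by (intro sum.cong) (auto simp: zero_power)
  also have "\<dots> = coeff (lp d F v c) \<mu>" using \<mu>d by simp
  finally have "Kf (0, 0) \<noteq> 0" using c by simp
  then have "\<forall>\<^sub>F p in nhds (0, 0). Kf p \<noteq> 0" using t tendsto_imp_eventually_ne by blast
  then obtain \<delta> where \<delta>: "\<delta> > 0" "\<And>p. dist p (0, 0) < \<delta> \<Longrightarrow> Kf p \<noteq> 0" unfolding eventually_nhds_metric by blast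
  show ?thesis
  proof (rule that[of "\<delta> / 2"])
    show "\<delta> / 2 > 0" using \<delta> by simp
    fix z w assume w: "norm w < \<delta> / 2" and root: "eval3 F (v + z *s b + w *s c) = 0"
    show "\<delta> / 2 * norm w \<le> norm z"
    proof (rule ccontr)
      assume n: "\<not> \<delta> / 2 * norm w \<le> norm z"
      then have w0: "w \<noteq> 0" using \<delta> by auto
      define \<rho> where "\<rho> = z / w"
      have "norm \<rho> < \<delta> / 2" using n w0 by (simp add: \<rho>_def norm_divide divide_less_eq)
      have "dist (\<rho>, w) (0, 0) \<le> norm \<rho> + norm w" unfolding dist_Pair_Pair dist_0_norm by (simp add: sqrt_sum_squares_le_sum)
      also have "\<dots> < \<delta>" using \<open>norm \<rho> < \<delta> / 2\<close> w by simp
      finally have K0: "Kf (\<rho>, w) \<noteq> 0" by (rule \<delta>(2))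
      have eq: "v + z *s b + w *s c = v + w *s (c + \<rho> *s b)"
        using w0 by (simp add: \<rho>_def vec_eq_iff algebra_simps)
      have "0 = (\<Sum>j\<le>d. w ^ j * coeff (lp d F v (c + \<rho> *s b)) j)"
        using root unfolding eq eval3_lp_sum[OF F] lp_scale[OF F] by (rule sym)
      also have "\<dots> = (\<Sum>j\<in>{\<mu>..d}. w ^ j * coeff (lp d F v (c + \<rho> *s b)) j)"
        using min by (intro sum.mono_neutral_right) auto
      also have "\<dots> = w ^ \<mu> * Kf (\<rho>, w)"
        unfolding Kf_def sum_distrib_left by (intro sum.cong) (auto simp: power_add[symmetric] mult.assoc[symmetric])
      finally show False using K0 w0 by simp
    qed
  qed
qed

text \<open>The witnesses behind \<open>branch_exponents\<close> made explicit, with the centre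
  fixed as the vector v and not only as a point, so that values of B at it can be compared.\<close>

definition bparam :: "complex^3 \<Rightarrow> cp2 set \<Rightarrow> complex^3^3 \<Rightarrow> nat \<Rightarrow> nat \<Rightarrow> (complex \<Rightarrow> complex) \<Rightarrow> real \<Rightarrow> bool" where
  "bparam v b M q p g r \<longleftrightarrow> invertible M \<and> column 1 M = v \<and> 1 \<le> q \<and> q < p \<and> r > 0 \<and> g holomorphic_on ball 0 r \<and> g 0 = 0 \<and>
     (\<exists>c. c \<noteq> 0 \<and> ((\<lambda>t. g t / t ^ p) \<longlongrightarrow> c) (at 0)) \<and> germ_eq (pt v) b (pimg M q g r) \<and> adapted_coords (pt v) b M"

lemma affine_pt_0: "affine_pt M 0 0 = pt (column 1 M)"
  by (simp add: affine_pt_def aff_columns)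

text \<open>By the estimate g / s ^ e is bounded and extends to a holomorphic h, whose value
  \<kappa> at 0 is the slope of the tangent. A shear by \<kappa> makes the first axis tangent, and
  the order of h - \<kappa> at 0 is p - e. It is finite, since a curve that is irreducible of degree
  at least 2 has no branch inside a line.\<close>

lemma bparam_of_pbranch:
  assumes F: "irreducible F" "homogeneous d F" "d \<ge> 2" and M0: "invertible M0"
    and e: "e \<ge> 1" and r: "r > 0" and g: "g holomorphic_on ball 0 r" "g 0 = 0"
    and on: "\<And>s. s \<in> ball 0 r \<Longrightarrow> eval3 F (aff M0 (s ^ e) (g s)) = 0"
    and est: "\<eta> > 0" "\<And>s. s \<in> ball 0 r \<Longrightarrow> norm (g s) < \<eta> \<Longrightarrow> \<eta> * norm (g s) \<le> norm (s ^ e)"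
  obtains M p g' where "bparam (column 1 M0) (pimg M0 e g r) M e p g' r"
proof -
  have ballnz: "\<forall>\<^sub>F s in at 0. s \<in> ball 0 r - {0}" using r by (intro eventually_at_in_open) auto
  have gc: "isCont g 0" by (rule continuous_on_interior[OF holomorphic_on_imp_continuous_on[OF g(1)]]) (use r in simp)
  then have gt: "(g \<longlongrightarrow> 0) (at 0)" using g(2) by (simp add: isCont_def)
  have "\<forall>\<^sub>F s in at 0. norm (g s) < \<eta>" using tendstoD[OF gt est(1)] by simp
  with ballnz have "\<forall>\<^sub>F s in at 0. norm (g s / s ^ e) \<le> (1 / \<eta>) * norm (1::complex)"
  proof eventually_elim
    case (elim s)
    then have "\<eta> * norm (g s) \<le> norm (s ^ e)" using est(2)[of s] by auto
    then have "norm (g s) \<le> 1 / \<eta> * norm (s ^ e)" using est(1) by (simp add: field_simps)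
    then show ?case using elim by (simp add: norm_divide divide_le_eq)
  qed
  then have O: "(\<lambda>s. g s / s ^ e) \<in> O[at 0](\<lambda>_. 1)" using est(1) by (intro landau_o.bigI[where c = "1 / \<eta>"]) auto
  have "(\<lambda>s. g s / s ^ e) holomorphic_on ball 0 r - {0}"
    using g(1) by (auto intro!: holomorphic_intros elim: holomorphic_on_subset)
  then obtain h where h: "h holomorphic_on ball 0 r" "\<forall>s\<in>ball 0 r - {0}. h s = g s / s ^ e"
    using holomorphic_on_extend[of "\<lambda>s. g s / s ^ e" "ball 0 r" 0] O r by auto
  have gh: "g s = s ^ e * h s" if "s \<in> ball 0 r" for s
    using h(2) that g(2) e by (cases "s = 0") (auto simp: zero_power)
  define \<kappa> where "\<kappa> = h 0"
  define a where "a = column 1 M0"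
  define b where "b = column 2 M0"
  define c where "c = column 3 M0"
  define b' where "b' = b + \<kappa> *s c"
  define M where "M = cols a b' c"
  have det: "det3 a b c \<noteq> 0" using M0 by (simp add: invertible_columns a_def b_def c_def)
  have det': "det3 a b' c \<noteq> 0" using det by (simp add: b'_def)
  have Mi: "invertible M" using det' by (simp add: invertible_columns M_def)
  define g' where "g' s = g s - \<kappa> * s ^ e" for s
  have g'h: "g' s = s ^ e * (h s - \<kappa>)" if "s \<in> ball 0 r" for s using gh[OF that] by (simp add: g'_def algebra_simps)
  have affeq: "aff M (s ^ e) (g' s) = aff M0 (s ^ e) (g s)" for s
    unfolding aff_columns by (simp add: M_def b'_def g'_def a_def[symmetric] b_def[symmetric] c_def[symmetric] vec_eq_iff algebra_simps)
  have img: "pimg M0 e g r = pimg M e g' r" unfolding affine_pt_def affeq ..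
  have nconst: "\<not> (\<lambda>s. h s - \<kappa>) constant_on ball 0 r"
  proof
    assume "(\<lambda>s. h s - \<kappa>) constant_on ball 0 r"
    then obtain y where y: "\<And>s. s \<in> ball 0 r \<Longrightarrow> h s - \<kappa> = y" unfolding constant_on_def by blast
    from y[of 0] r have "y = 0" by (simp add: \<kappa>_def)
    then have g'0: "g' s = 0" if "s \<in> ball 0 r" for s using g'h[OF that] y[OF that] by simp
    \<comment> \<open>The cross product of a and b', so that its linear form is
      \<open>det3 a b'\<close> and vanishes on the tangent line.\<close>
    define n where "n = (vector [a $ 2 * b' $ 3 - a $ 3 * b' $ 2, a $ 3 * b' $ 1 - a $ 1 * b' $ 3, a $ 1 * b' $ 2 - a $ 2 * b' $ 1] :: complex^3)"
    have n: "eval3 (lform n) x = det3 a b' x" for x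
      by (simp add: eval3_lform n_def vector_3 det3_def algebra_simps)
    have "\<not> F dvd lform n"
    proof
      assume "F dvd lform n"
      then have "lform n = 0"
        by (rule dvd_lower_degree[OF F(2) _ , of "lform n" 1, rotated 2]) (use F(3) eval3_scale[OF homogeneous_lform] in auto)
      then show False using n[of c] det' by simp
    qed
    then have fin: "finite {pt v | v. v \<noteq> 0 \<and> eval3 F v = 0 \<and> eval3 (lform n) v = 0}"
      using finite_common_zeros[OF F(1,2), of "lform n" 1] eval3_scale[OF homogeneous_lform] by auto
    have "(\<lambda>s. affine_pt M (s ^ e) (g' s)) ` ball 0 r \<subseteq> {pt v | v. v \<noteq> 0 \<and> eval3 F v = 0 \<and> eval3 (lform n) v = 0}"
    proof (rule image_subsetI)
      fix s :: complex assume s: "s \<in> ball 0 r"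
      have "aff M (s ^ e) (g' s) = a + (s ^ e) *s b'" using g'0[OF s] by (simp add: aff_columns M_def)
      then have "eval3 (lform n) (aff M (s ^ e) (g' s)) = 0" by (simp add: n)
      moreover have "eval3 F (aff M (s ^ e) (g' s)) = 0" unfolding affeq by (rule on[OF s])
      ultimately show "affine_pt M (s ^ e) (g' s) \<in> {pt v | v. v \<noteq> 0 \<and> eval3 F v = 0 \<and> eval3 (lform n) v = 0}"
        unfolding affine_pt_def using aff_nz[OF Mi] by blast
    qed
    then have fimg: "finite ((\<lambda>s. affine_pt M (s ^ e) (g' s)) ` ball 0 r)" using fin finite_subset by blast
    \<comment> \<open>On positive real parameters s ^ e is injective, which provides infinitely many
      points of the curve on the line.\<close>
    define S where "S = (\<lambda>x::real. complex_of_real x) ` {0<..<r}"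
    have "inj_on (\<lambda>s. affine_pt M (s ^ e) (g' s)) S"
    proof (rule inj_onI)
      fix s t assume s: "s \<in> S" "t \<in> S" "affine_pt M (s ^ e) (g' s) = affine_pt M (t ^ e) (g' t)"
      then obtain x y where xy: "s = of_real x" "t = of_real y" "0 < x" "0 < y" by (auto simp: S_def)
      have "s ^ e = t ^ e" using affine_pt_inj[OF Mi s(3)] by blast
      then have "x ^ e = y ^ e" unfolding xy by (metis of_real_eq_iff of_real_power)
      then show "s = t" using xy e power_eq_imp_eq_base[of x e y] by simp
    qed
    moreover have "S \<subseteq> ball 0 r" by (auto simp: S_def)
    then have "finite ((\<lambda>s. affine_pt M (s ^ e) (g' s)) ` S)" using fimg by (meson finite_subset image_mono)
    ultimately have "finite S" using finite_imageD by blast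
    moreover have "infinite S" using r by (simp add: S_def finite_image_iff inj_on_def)
    ultimately show False by simp
  qed
  have hk: "(\<lambda>s. h s - \<kappa>) holomorphic_on ball 0 r" using h(1) by (auto intro!: holomorphic_intros)
  have z0: "0 \<in> ball (0::complex) r" using r by simp
  have hz: "h 0 - \<kappa> = 0" by (simp add: \<kappa>_def)
  have "\<exists>k \<rho>' m. (0::nat) < m \<and> 0 < \<rho>' \<and> ball 0 \<rho>' \<subseteq> ball (0::complex) r \<and> k holomorphic_on ball 0 \<rho>' \<and>
    (\<forall>s\<in>ball 0 \<rho>'. h s - \<kappa> = (s - 0) ^ m * k s \<and> k s \<noteq> 0)"
  proof (rule holomorphic_factor_zero_nonconstant[OF hk open_ball connected_ball z0 hz nconst])
    fix g ra n
    assume a: "(0::nat) < n" "0 < ra" "ball 0 ra \<subseteq> ball (0::complex) r" "g holomorphic_on ball 0 ra"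
      "\<And>w. w \<in> ball 0 ra \<Longrightarrow> h w - \<kappa> = (w - 0) ^ n * g w" "\<And>w. w \<in> ball 0 ra \<Longrightarrow> g w \<noteq> 0"
    show ?thesis by (rule exI[of _ g], rule exI[of _ ra], rule exI[of _ n], intro conjI ballI a)
  qed
  then obtain k \<rho>' m where k0: "(0::nat) < m" "0 < \<rho>'" "ball 0 \<rho>' \<subseteq> ball (0::complex) r" "k holomorphic_on ball 0 \<rho>'"
    "\<forall>s\<in>ball 0 \<rho>'. h s - \<kappa> = (s - 0) ^ m * k s \<and> k s \<noteq> 0" by blast
  then have k: "0 < m" "0 < \<rho>'" "ball 0 \<rho>' \<subseteq> ball (0::complex) r" "k holomorphic_on ball 0 \<rho>'"
    "\<And>s. s \<in> ball 0 \<rho>' \<Longrightarrow> h s - \<kappa> = (s - 0) ^ m * k s" "\<And>s. s \<in> ball 0 \<rho>' \<Longrightarrow> k s \<noteq> 0" by blast+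
  define p where "p = e + m"
  have kc: "(k \<longlongrightarrow> k 0) (at 0)"
    using continuous_on_interior[OF holomorphic_on_imp_continuous_on[OF k(4)], of 0] k(2) by (simp add: isCont_def)
  have lim: "((\<lambda>t. g' t / t ^ p) \<longlongrightarrow> k 0) (at 0)"
  proof (rule Lim_transform_eventually[OF kc])
    have "\<forall>\<^sub>F s in at 0. s \<in> ball 0 \<rho>' - {0}" using k(2) by (intro eventually_at_in_open) auto
    then show "\<forall>\<^sub>F s in at 0. k s = g' s / s ^ p"
    proof eventually_elim
      case (elim s)
      then have "g' s = s ^ e * (s ^ m * k s)" using g'h[of s] k(3) k(5)[of s] by auto
      then show ?case using elim by (simp add: p_def power_add)
    qed
  qed
  have adapted: "adapted_coords (pt a) (pimg M0 e g r) M"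
    unfolding adapted_coords_def
  proof
    show "centered_coords (pt a) M" unfolding centered_coords_def using Mi by (simp add: affine_pt_0 M_def)
    show "snd \<in> o[at (0, 0) within {(z, w). affine_pt M z w \<in> pimg M0 e g r}](fst)"
    proof (rule landau_o.smallI)
      fix \<epsilon> :: real assume \<epsilon>: "\<epsilon> > 0"
      have "isCont h 0" by (rule continuous_on_interior[OF holomorphic_on_imp_continuous_on[OF h(1)]]) (use r in simp)
      then have "(h \<longlongrightarrow> \<kappa>) (nhds 0)" unfolding \<kappa>_def by (rule isCont_tendsto_nhds)
      then have "\<forall>\<^sub>F s in nhds 0. dist (h s) \<kappa> < \<epsilon>" using \<epsilon> by (rule tendstoD)
      then obtain \<delta> where \<delta>: "\<delta> > 0" "\<And>s. norm s < \<delta> \<Longrightarrow> dist (h s) \<kappa> < \<epsilon>" unfolding eventually_nhds_metric by auto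
      have "\<forall>\<^sub>F p in nhds (0, 0). p \<in> ball (0::complex) (\<delta> ^ e) \<times> (UNIV :: complex set)"
        using \<delta>(1) by (intro eventually_nhds_in_open) (auto intro: open_Times)
      then show "\<forall>\<^sub>F p in at (0, 0) within {(z, w). affine_pt M z w \<in> pimg M0 e g r}. norm (snd p) \<le> \<epsilon> * norm (fst p)"
        unfolding eventually_at_filter
      proof eventually_elim
        case (elim p)
        show ?case
        proof (intro impI)
          assume "p \<in> {(z, w). affine_pt M z w \<in> pimg M0 e g r}"
          then have "affine_pt M (fst p) (snd p) \<in> pimg M e g' r" unfolding img by (simp add: case_prod_unfold)
          then obtain s where s: "s \<in> ball 0 r" "affine_pt M (fst p) (snd p) = affine_pt M (s ^ e) (g' s)" by blast
          then have eq: "fst p = s ^ e" "snd p = g' s" using affine_pt_inj[OF Mi] by auto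
          then have "norm s ^ e < \<delta> ^ e" using elim by (auto simp: norm_power mem_Times_iff)
          then have "norm s < \<delta>" using \<delta>(1) power_less_imp_less_base[of "norm s" e \<delta>] by auto
          then have "norm (h s - \<kappa>) \<le> \<epsilon>" using \<delta>(2)[of s] by (simp add: dist_norm)
          then have "norm (s ^ e) * norm (h s - \<kappa>) \<le> norm (s ^ e) * \<epsilon>" by (intro mult_left_mono) auto
          then show "norm (snd p) \<le> \<epsilon> * norm (fst p)" unfolding eq g'h[OF s(1)] norm_mult by (simp add: mult.commute)
        qed
      qed
    qed
  qed
  have g'hol: "g' holomorphic_on ball 0 r" unfolding g'_def using g(1) by (auto intro!: holomorphic_intros)
  have "bparam a (pimg M0 e g r) M e p g' r"
    unfolding bparam_def
  proof (intro conjI)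
    show "\<exists>c. c \<noteq> 0 \<and> ((\<lambda>t. g' t / t ^ p) \<longlongrightarrow> c) (at 0)" using lim k(6)[of 0] k(2) by (intro exI[of _ "k 0"]) auto
    show "germ_eq (pt a) (pimg M0 e g r) (pimg M e g' r)" unfolding img by (simp add: germ_eq_def)
    show "g' 0 = 0" using g(2) e by (simp add: g'_def zero_power)
  qed (use Mi e r g'hol adapted k(1) in \<open>simp_all add: M_def p_def\<close>)
  then show ?thesis unfolding a_def by (rule that)
qed

text \<open>The projection is taken along a good direction. Of the Puiseux branches over a small
  disc around z = 0, those with g 0 = 0 pass through v and the others keep a positive distance in w;
  the estimate for small roots then supplies adapted coordinates on each branch through v.\<close>

theorem branch_decomposition:
  assumes F: "irreducible F" "homogeneous d F" "d \<ge> 2" and v: "v \<noteq> 0" "eval3 F v = 0"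
  obtains \<T> where "finite \<T>" "\<And>b. b \<in> \<T> \<Longrightarrow> local_branch (zero_locus F) (pt v) b \<and> (\<exists>M q p g r. bparam v b M q p g r)"
    "\<forall>\<^sub>F X in nhds (pt v). X \<in> zero_locus F \<longrightarrow> (\<exists>b\<in>\<T>. X \<in> b)"
proof -
  have "\<exists>u0. eval3 F u0 \<noteq> 0"
  proof (rule ccontr)
    assume "\<not> ?thesis"
    then have "F = 0" by (intro eval3_eq_0_imp) blast
    then show False using F(1) by simp
  qed
  then obtain u0 where u0: "eval3 F u0 \<noteq> 0" by blast
  obtain c \<mu> where c: "eval3 F c \<noteq> 0" "coeff (lp d F v c) \<mu> \<noteq> 0" "\<And>u j. j < \<mu> \<Longrightarrow> coeff (lp d F v u) j = 0"
    by (rule good_direction[OF F(2) u0, of v]) blast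
  have "c \<noteq> l *s v" for l using c(1) v(2) eval3_scale[OF F(2), of l v] by auto
  from det3_complement[OF v(1) this] obtain b where b: "det3 v b c \<noteq> 0" by blast
  define M where "M = cols v b c"
  have M: "invertible M" using b by (simp add: invertible_columns M_def)
  have C: "affine_pt M 0 0 = pt v" by (simp add: affine_pt_0 M_def)
  define P where "P z = lp d F (v + z *s b) c" for z
  have colM: "column 1 M = v" "column 2 M = b" "column 3 M = c" by (simp_all add: M_def)
  have PK: "affine_pt M z w \<in> zero_locus F \<longleftrightarrow> poly (P z) w = 0" for z w
    using affine_pt_zero_locus[OF F(2) M, of z w] by (simp add: colM P_def)
  have fin: "finite {z. \<exists>w. poly (P z) w = 0 \<and> poly (pderiv (P z)) w = 0}"
    using finite_multiple_roots[OF F(1,2) _ M] F(3) c(1) by (simp add: colM P_def)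
  \<comment> \<open>The disc separates 0 from all other values of z over which roots
    collide.\<close>
  then obtain \<rho> where \<rho>: "\<rho> > 0" "\<And>z. z \<in> {z. \<exists>w. poly (P z) w = 0 \<and> poly (pderiv (P z)) w = 0} \<Longrightarrow> z \<noteq> 0 \<Longrightarrow> \<rho> \<le> dist 0 z"
    using finite_set_avoid[OF fin, of 0] by blast
  interpret mf: monic_family P UNIV d "eval3 F c" unfolding P_def by (rule monic_family_lp[OF F(2) c(1)])
  interpret pu: puiseux P UNIV d "eval3 F c" \<rho>
  proof
    show "\<rho> > 0" "cball 0 \<rho> \<subseteq> UNIV" "d > 0" using \<rho>(1) F(3) by auto
    show "poly (pderiv (P z)) w \<noteq> 0" if "z \<in> ball 0 \<rho> - {0}" "poly (P z) w = 0" for z w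
      using \<rho>(2)[of z] that by fastforce
  qed
  obtain \<B> where B: "finite \<B>" "\<And>e g A. (e, g, A) \<in> \<B> \<Longrightarrow> pbranch \<rho> e g A"
    and cov: "\<And>z w. z \<in> ball 0 \<rho> - {0} \<Longrightarrow> poly (P z) w = 0 \<longleftrightarrow> (\<exists>(e, g, A)\<in>\<B>. \<exists>s\<in>ball 0 (root e \<rho>). z = s ^ e \<and> w = g s)"
    and disj: "\<And>e g A e' g' A' s s' z w. (e, g, A) \<in> \<B> \<Longrightarrow> (e', g', A') \<in> \<B> \<Longrightarrow> s \<in> ball 0 (root e \<rho>) \<Longrightarrow> s' \<in> ball 0 (root e' \<rho>) \<Longrightarrow>
      s ^ e = s' ^ e' \<Longrightarrow> g s = g' s' \<Longrightarrow> s \<noteq> 0 \<Longrightarrow> z \<noteq> 0 \<Longrightarrow>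
      (\<exists>s\<in>ball 0 (root e \<rho>). z = s ^ e \<and> w = g s) \<longleftrightarrow> (\<exists>s\<in>ball 0 (root e' \<rho>). z = s ^ e' \<and> w = g' s)"
    by (rule pu.puiseux_branches) blast
  define \<B>0 where "\<B>0 = {x \<in> \<B>. fst (snd x) 0 = 0}"
  have B0: "finite \<B>0" "\<And>e g A. (e, g, A) \<in> \<B>0 \<Longrightarrow> (e, g, A) \<in> \<B> \<and> pbranch \<rho> e g A \<and> g 0 = 0"
    using B by (auto simp: \<B>0_def)
  have rpos: "root e \<rho> > 0" "root e \<rho> ^ e = \<rho>" if "pbranch \<rho> e g A" for e g A using that \<rho>(1) by (auto simp: pbranch_def)
  have zb: "norm (s ^ e) < \<rho>" if "pbranch \<rho> e g A" "s \<in> ball 0 (root e \<rho>)" for e g A and s :: complex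
    using power_strict_mono[of "norm s" "root e \<rho>" e] rpos[OF that(1)] that by (auto simp: norm_power pbranch_def)
  have "\<exists>\<eta>>0. \<forall>e g A s. x = (e, g, A) \<longrightarrow> g 0 \<noteq> 0 \<longrightarrow> s \<in> ball 0 (root e \<rho>) \<longrightarrow> norm (s ^ e) < \<eta> \<longrightarrow> \<eta> \<le> norm (g s)" if "x \<in> \<B>" for x
  proof -
    obtain e g A where x: "x = (e, g, A)" by (cases x) auto
    then have pb: "pbranch \<rho> e g A" using B(2) that by blast
    show ?thesis
    proof (cases "g 0 = 0")
      case True
      then show ?thesis using x by (intro exI[of _ 1]) auto
    next
      case False
      have gh: "g holomorphic_on ball 0 (root e \<rho>)" using pb by (simp add: pbranch_def)
      have "isCont g 0" by (rule continuous_on_interior[OF holomorphic_on_imp_continuous_on[OF gh]]) (use rpos[OF pb] in simp)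
      then have "(g \<longlongrightarrow> g 0) (nhds 0)" by (rule isCont_tendsto_nhds)
      then have "\<forall>\<^sub>F s in nhds 0. dist (g s) (g 0) < norm (g 0) / 2" by (rule tendstoD) (use False in simp)
      then obtain \<delta> where \<delta>: "\<delta> > 0" "\<And>s. norm s < \<delta> \<Longrightarrow> dist (g s) (g 0) < norm (g 0) / 2" unfolding eventually_nhds_metric by auto
      define \<eta> where "\<eta> = min (\<delta> ^ e) (norm (g 0) / 2)"
      have "\<eta> \<le> norm (g s)" if "norm (s ^ e) < \<eta>" for s
      proof -
        have "norm s ^ e < \<delta> ^ e" using that by (simp add: \<eta>_def norm_power)
        then have "norm s < \<delta>" using \<delta>(1) power_less_imp_less_base[of "norm s" e \<delta>] by auto
        then have "dist (g s) (g 0) < norm (g 0) / 2" by (rule \<delta>(2))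
        moreover have "norm (g 0) \<le> norm (g s) + dist (g s) (g 0)" unfolding dist_norm by norm
        ultimately show ?thesis by (simp add: \<eta>_def)
      qed
      moreover have "\<eta> > 0" using \<delta>(1) False by (simp add: \<eta>_def)
      ultimately show ?thesis using x by (intro exI[of _ \<eta>]) auto
    qed
  qed
  then obtain \<eta>f where \<eta>f: "\<And>x. x \<in> \<B> \<Longrightarrow> \<eta>f x > 0 \<and> (\<forall>e g A s. x = (e, g, A) \<longrightarrow> g 0 \<noteq> 0 \<longrightarrow> s \<in> ball 0 (root e \<rho>) \<longrightarrow> norm (s ^ e) < \<eta>f x \<longrightarrow> \<eta>f x \<le> norm (g s))"
    by metis
  \<comment> \<open>A common distance for the finitely many branches that miss v; inserting \<rho>
    keeps the minimum defined and z inside the disc.\<close>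
  define \<eta>1 where "\<eta>1 = Min (insert \<rho> (\<eta>f ` \<B>))"
  have \<eta>1: "\<eta>1 > 0" unfolding \<eta>1_def using B(1) \<rho>(1) \<eta>f by (subst Min_gr_iff) auto
  have \<eta>1le: "\<eta>1 \<le> \<rho>" "\<And>x. x \<in> \<B> \<Longrightarrow> \<eta>1 \<le> \<eta>f x" unfolding \<eta>1_def using B(1) by (auto intro: Min_le)
  have big: "\<eta>1 \<le> norm (g s)" if "(e, g, A) \<in> \<B>" "g 0 \<noteq> 0" "s \<in> ball 0 (root e \<rho>)" "norm (s ^ e) < \<eta>1" for e g A s
    using \<eta>f[OF that(1)] \<eta>1le(2)[OF that(1)] that by fastforce
  have small: "\<exists>(e, g, A)\<in>\<B>0. \<exists>s\<in>ball 0 (root e \<rho>). z = s ^ e \<and> w = g s" if "z \<noteq> 0" "norm z < \<eta>1" "norm w < \<eta>1" "poly (P z) w = 0" for z w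
  proof -
    have "z \<in> ball 0 \<rho> - {0}" using that \<eta>1le(1) by auto
    then have "\<exists>(e, g, A)\<in>\<B>. \<exists>s\<in>ball 0 (root e \<rho>). z = s ^ e \<and> w = g s" using cov that(4) by blast
    then obtain e g A s where x: "(e, g, A) \<in> \<B>" "s \<in> ball 0 (root e \<rho>)" "z = s ^ e" "w = g s" by blast
    then have "g 0 = 0" using big[OF x(1) _ x(2)] that by force
    then show ?thesis using x by (intro bexI[of _ "(e, g, A)"]) (auto simp: \<B>0_def)
  qed
  have P0: "poly (P 0) 0 = 0" using v(2) by (simp add: P_def poly_lp[OF F(2)])
  \<comment> \<open>By \<open>root_near\<close> the root 0 over z = 0 persists as a small root over
    small z, and such roots lie on branches through v. With at least one such branch the centre
    itself is covered.\<close>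
  have ne: "\<B>0 \<noteq> {}"
  proof -
    have "isCont (\<lambda>z. poly (P z) 0) 0"
      using holomorphic_on_imp_continuous_on[OF mf.holo_poly[of 0]] continuous_on_interior by fastforce
    then have "((\<lambda>z. poly (P z) 0) \<longlongrightarrow> 0) (nhds 0)" using isCont_tendsto_nhds[of 0 "\<lambda>z. poly (P z) 0"] P0 by simp
    moreover have "norm (eval3 F c) * \<eta>1 ^ d > 0" using c(1) \<eta>1 by simp
    ultimately have "\<forall>\<^sub>F z in nhds 0. dist (poly (P z) 0) 0 < norm (eval3 F c) * \<eta>1 ^ d" by (rule tendstoD)
    then obtain \<delta> where \<delta>: "\<delta> > 0" "\<And>z. norm z < \<delta> \<Longrightarrow> norm (poly (P z) 0) < norm (eval3 F c) * \<eta>1 ^ d" unfolding eventually_nhds_metric by auto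
    define z :: complex where "z = of_real (min \<delta> \<eta>1 / 2)"
    have nz: "norm z = min \<delta> \<eta>1 / 2" unfolding z_def norm_of_real using \<delta>(1) \<eta>1 by simp
    have z: "z \<noteq> 0" "norm z < \<delta>" "norm z < \<eta>1" using \<delta>(1) \<eta>1 nz by (auto simp: min_def split: if_splits)
    have "norm (poly (P z) 0) < norm (lead_coeff (P z)) * \<eta>1 ^ d" using \<delta>(2)[OF z(2)] mf.lc[of z] by simp
    then obtain w where w: "poly (P z) w = 0" "dist 0 w < \<eta>1" using root_near[OF mf.P_nz mf.deg \<eta>1] by (metis UNIV_I)
    then show ?thesis using small[OF z(1,3), of w] by auto
  qed
  have "finite {w. poly (P 0) w = 0}" using mf.P_nz[of 0] poly_roots_finite by auto
  then obtain \<eta>2 where \<eta>2: "\<eta>2 > 0" "\<And>w. poly (P 0) w = 0 \<Longrightarrow> w \<noteq> 0 \<Longrightarrow> \<eta>2 \<le> dist 0 w"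
    using finite_set_avoid[of "{w. poly (P 0) w = 0}" 0] by auto
  \<comment> \<open>The Puiseux description excludes z = 0, so w is also kept away from the nonzero
    roots of \<open>P 0\<close>.\<close>
  define \<eta>3 where "\<eta>3 = min \<eta>1 \<eta>2"
  have \<eta>3: "\<eta>3 > 0" using \<eta>1 \<eta>2 by (simp add: \<eta>3_def)
  have onb: "poly (P (s ^ e)) (g s) = 0" if "(e, g, A) \<in> \<B>0" "s \<in> ball 0 (root e \<rho>)" for e g A s
  proof (cases "s = 0")
    case True
    have "e \<ge> 1" "g 0 = 0" using B0(2)[OF that(1)] by (auto simp: pbranch_def)
    then show ?thesis using True P0 by (simp add: zero_power)
  next
    case False
    have "s ^ e \<in> ball 0 \<rho> - {0}" using False zb[of e g A s] B0(2)[OF that(1)] that(2) by auto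
    then show ?thesis using cov[of "s ^ e" "g s"] B0(2)[OF that(1)] that(2) by blast
  qed
  have cover: "\<forall>\<^sub>F X in nhds (affine_pt M 0 0). X \<in> zero_locus F \<longleftrightarrow> (\<exists>(e, g, A)\<in>\<B>0. X \<in> pimg M e g (root e \<rho>))"
    unfolding eventually_nhds_chart[OF M]
  proof -
    have "\<forall>\<^sub>F p in nhds (0, 0). p \<in> ball (0::complex) \<eta>3 \<times> ball (0::complex) \<eta>3"
      using \<eta>3 by (intro eventually_nhds_in_open) (auto intro: open_Times)
    then show "\<forall>\<^sub>F p in nhds (0, 0). affine_pt M (fst p) (snd p) \<in> zero_locus F \<longleftrightarrow>
       (\<exists>(e, g, A)\<in>\<B>0. affine_pt M (fst p) (snd p) \<in> pimg M e g (root e \<rho>))"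
    proof eventually_elim
      case (elim p)
      define z where "z = fst p"
      define w where "w = snd p"
      have zw: "norm z < \<eta>3" "norm w < \<eta>3" using elim by (auto simp: z_def w_def mem_Times_iff)
      have "poly (P z) w = 0 \<longleftrightarrow> (\<exists>(e, g, A)\<in>\<B>0. \<exists>s\<in>ball 0 (root e \<rho>). z = s ^ e \<and> w = g s)"
      proof
        assume root: "poly (P z) w = 0"
        show "\<exists>(e, g, A)\<in>\<B>0. \<exists>s\<in>ball 0 (root e \<rho>). z = s ^ e \<and> w = g s"
        proof (cases "z = 0")
          case False
          then show ?thesis using small[OF False _ _ root] zw by (auto simp: \<eta>3_def)
        next
          case True
          then have "w = 0" using \<eta>2(2)[of w] root zw by (force simp: \<eta>3_def)
          moreover obtain e g A where m: "(e, g, A) \<in> \<B>0" using ne by auto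
          ultimately show ?thesis using True B0(2)[OF m] rpos(1)[of e g A]
            by (intro bexI[OF _ m]) (auto simp: pbranch_def zero_power intro!: bexI[of _ 0])
        qed
      next
        assume "\<exists>(e, g, A)\<in>\<B>0. \<exists>s\<in>ball 0 (root e \<rho>). z = s ^ e \<and> w = g s"
        then show "poly (P z) w = 0" using onb by blast
      qed
      moreover have "(\<exists>(e, g, A)\<in>\<B>0. affine_pt M z w \<in> pimg M e g (root e \<rho>)) \<longleftrightarrow> (\<exists>(e, g, A)\<in>\<B>0. \<exists>s\<in>ball 0 (root e \<rho>). z = s ^ e \<and> w = g s)"
      proof -
        have "affine_pt M z w \<in> pimg M e g r \<longleftrightarrow> (\<exists>s\<in>ball 0 r. z = s ^ e \<and> w = g s)" for e g r
          using affine_pt_inj[OF M] by blast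
        then show ?thesis by simp
      qed
      ultimately show ?case unfolding PK z_def[symmetric] w_def[symmetric] by blast
    qed
  qed
  have "\<exists>\<eta>>0. \<forall>z w. norm w < \<eta> \<longrightarrow> eval3 F (v + z *s b + w *s c) = 0 \<longrightarrow> \<eta> * norm w \<le> norm z"
    by (rule small_root_estimate[OF F(2) c(3) c(2), of b]) blast+
  then obtain \<eta> where \<eta>: "\<eta> > 0" "\<And>z w. norm w < \<eta> \<Longrightarrow> eval3 F (v + z *s b + w *s c) = 0 \<Longrightarrow> \<eta> * norm w \<le> norm z"
    by blast
  define \<T> where "\<T> = (\<lambda>(e, g, A). pimg M e g (root e \<rho>)) ` \<B>0"
  show ?thesis
  proof (rule that[of \<T>])
    show "finite \<T>" using B0(1) by (simp add: \<T>_def)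
    show "\<forall>\<^sub>F X in nhds (pt v). X \<in> zero_locus F \<longrightarrow> (\<exists>b\<in>\<T>. X \<in> b)"
      using cover unfolding C by eventually_elim (auto simp: \<T>_def)
    fix b0 assume "b0 \<in> \<T>"
    then obtain e g A where m: "(e, g, A) \<in> \<B>0" "b0 = pimg M e g (root e \<rho>)" by (auto simp: \<T>_def)
    have pb: "pbranch \<rho> e g A" "g 0 = 0" using B0(2)[OF m(1)] by auto
    have lb: "local_branch (zero_locus F) (affine_pt M 0 0) (pimg M e g (root e \<rho>))"
    proof (rule pbranch_local_branch[OF M \<rho>(1) B0(1) _ cover _ m(1)])
      show "pbranch \<rho> e g A \<and> g 0 = 0" if "(e, g, A) \<in> \<B>0" for e g A using B0(2)[OF that] by blast
    qed (use disj B0(2) in blast)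
    have on: "eval3 F (aff M (s ^ e) (g s)) = 0" if "s \<in> ball 0 (root e \<rho>)" for s
      using onb[OF m(1) that] by (simp add: P_def poly_lp[OF F(2)] aff_columns colM)
    have "e \<ge> 1" "g holomorphic_on ball 0 (root e \<rho>)" using pb(1) by (auto simp: pbranch_def)
    from bparam_of_pbranch[OF F M this(1) rpos(1)[OF pb(1)] this(2) pb(2) on \<eta>(1)]
    obtain M' p g' where "bparam (column 1 M) (pimg M e g (root e \<rho>)) M' e p g' (root e \<rho>)"
      using \<eta>(2) on by (metis aff_columns colM)
    then have "bparam v b0 M' e p g' (root e \<rho>)" using m(2) colM(1) by simp
    then show "local_branch (zero_locus F) (pt v) b0 \<and> (\<exists>M q p g r. bparam v b0 M q p g r)" using lb unfolding C m(2) by blast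
  qed
qed

section \<open>Derivatives of forms and values of the invariant at points of the curve\<close>

lemma cdiff_eval3:
  assumes "homogeneous d F" shows "cdiff (eval3 F) v"
proof -
  have "cdiff (\<lambda>v. \<Sum>k\<le>d. \<Sum>j\<le>d. \<Sum>i\<le>d. coeff (coeff (coeff F k) j) i * (v$1) ^ i * (v$2) ^ j * (v$3) ^ k) v"
    by (intro cdiff_sum cdiff_mult cdiff_power cdiff_const cdiff_component finite_atMost)
  then show ?thesis by (simp add: eval3_sum[OF assms, abs_def])
qed

lemma cderiv_vhd:
  assumes "(f has_derivative D) (at v)" "\<And>c x. D (c *s x) = c * D x" "vhd \<phi> \<phi>' t" "\<phi> t = v"
  shows "((\<lambda>s. f (\<phi> s)) has_field_derivative D \<phi>') (at t)"
proof -
  have "((\<lambda>s. f (\<phi> s)) has_derivative (\<lambda>h. D (h *s \<phi>'))) (at t)"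
    by (rule has_derivative_compose[OF vhd_has_derivative[OF assms(3)]]) (simp add: assms(1,4))
  then show ?thesis
    unfolding has_field_derivative_def assms(2) by (simp add: mult_commute_abs)
qed

lemma vhd_line: "vhd (\<lambda>s. v + s *s u) u t"
  unfolding vhd_def by (auto intro!: derivative_eq_intros)

lemma eval3_cderiv:
  assumes "homogeneous d F"
  obtains D where "(eval3 F has_derivative D) (at v)" "\<And>c x. D (c *s x) = c * D x" "\<And>u. D u = poly (pderiv (lp d F v u)) 0"
proof -
  obtain D where D: "(eval3 F has_derivative D) (at v)" "\<And>c x. D (c *s x) = c * D x"
    using cdiff_eval3[OF assms, of v] unfolding cdiff_def by blast
  have "D u = poly (pderiv (lp d F v u)) 0" for u
  proof -
    have "((\<lambda>s. eval3 F (v + s *s u)) has_field_derivative D u) (at 0)"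
      by (rule cderiv_vhd[OF D vhd_line]) simp
    then have "((\<lambda>s. poly (lp d F v u) s) has_field_derivative D u) (at 0)" by (simp add: poly_lp[OF assms])
    then show ?thesis using poly_DERIV DERIV_unique by blast
  qed
  then show ?thesis using D that by blast
qed

text \<open>This estimate detects inflection points and, later, branches whose second exponent
  exceeds 2.\<close>

lemma taylor_cubic:
  assumes Y: "Y holomorphic_on ball 0 \<delta>" and d: "\<delta> > 0" and Y0: "Y 0 = 0" and Y2: "(deriv ^^ 2) Y 0 = 0"
  shows "(\<lambda>t. Y t - deriv Y 0 * t) \<in> O[at 0](\<lambda>t. t ^ 3)"
proof -
  define S where "S = cball (0::complex) (\<delta> / 2)"
  have S: "S \<subseteq> ball 0 \<delta>" "convex S" "compact S" using d by (auto simp: S_def)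
  have h: "(deriv ^^ n) Y holomorphic_on ball 0 \<delta>" for n by (rule holomorphic_higher_deriv[OF Y open_ball])
  have "compact ((deriv ^^ 3) Y ` S)"
    using holomorphic_on_imp_continuous_on[OF h[of 3]] S continuous_on_subset by (blast intro: compact_continuous_image)
  then have "bounded ((deriv ^^ 3) Y ` S)" by (rule compact_imp_bounded)
  then obtain B where B: "\<And>t. t \<in> S \<Longrightarrow> norm ((deriv ^^ 3) Y t) \<le> B" unfolding bounded_iff by auto
  have est: "norm (Y t - deriv Y 0 * t) \<le> B * norm t ^ 3 / 2" if t: "t \<in> S" for t
  proof -
    have dd: "((deriv ^^ i) Y has_field_derivative (deriv ^^ Suc i) Y x) (at x within S)" if "x \<in> S" for i x
      using holomorphic_derivI[OF h[of i] open_ball, of x] that S has_field_derivative_at_within by auto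
    have "norm ((deriv ^^ 0) Y t - (\<Sum>i\<le>2. (deriv ^^ i) Y 0 * (t - 0) ^ i / fact i)) \<le> B * norm (t - 0) ^ Suc 2 / fact 2"
    proof (rule complex_Taylor[OF S(2)])
      show "norm ((deriv ^^ Suc 2) Y x) \<le> B" if "x \<in> S" for x using B[OF that] by (simp add: eval_nat_numeral)
    qed (use dd t d in \<open>auto simp: S_def\<close>)
    then show ?thesis using Y0 Y2 by (simp add: eval_nat_numeral)
  qed
  have "\<forall>\<^sub>F t in at 0. t \<in> ball 0 (\<delta> / 2) - {0}" using d by (intro eventually_at_in_open) auto
  then have "\<forall>\<^sub>F t in at 0. norm (Y t - deriv Y 0 * t) \<le> (max B 1 / 2) * norm (t ^ 3)"
  proof eventually_elim
    case (elim t)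
    then have "norm (Y t - deriv Y 0 * t) \<le> B * norm t ^ 3 / 2" by (intro est) (auto simp: S_def)
    also have "\<dots> \<le> (max B 1 / 2) * norm (t ^ 3)" by (simp add: norm_power mult_right_mono)
    finally show ?case .
  qed
  then show ?thesis by (intro landau_o.bigI[where c = "max B 1 / 2"]) auto
qed

context symform
begin

text \<open>The value is read off any holomorphic curve in the cone over F that passes through X
  with nonzero Wronskian. It is a relation, because a point with several branches may have several
  values; \<open>hrel_unique\<close> shows that there is only one where the curve is locally a
  graph.\<close>

definition hrel :: "poly3 \<Rightarrow> cp2 \<Rightarrow> complex \<Rightarrow> bool" where
  "hrel F X h \<longleftrightarrow> (\<exists>\<phi> t0 U. open U \<and> t0 \<in> U \<and> vholo \<phi> U \<and> (\<forall>t\<in>U. \<phi> t \<noteq> 0 \<and> eval3 F (\<phi> t) = 0) \<and>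
     X = pt (\<phi> t0) \<and> wr \<phi> t0 \<noteq> 0 \<and> h = hval \<phi> t0)"

lemma hrel_param:
  assumes F: "homogeneous d F" and M: "invertible M" "column 1 M = v" and q: "q \<ge> 1" and r: "r > 0"
    and g: "g holomorphic_on ball 0 r" "g 0 = 0" and b: "germ_eq (pt v) b (pimg M q g r)" "germ_le (pt v) b (zero_locus F)"
    and bd: "\<forall>\<^sub>F s in at 0. wr (\<lambda>t. column 1 M + (t ^ q) *s column 2 M + g t *s column 3 M) s \<noteq> 0 \<and>
       norm (hval (\<lambda>t. column 1 M + (t ^ q) *s column 2 M + g t *s column 3 M) s) \<le> K"
  shows "\<forall>\<^sub>F X in nhds (pt v). X \<in> b \<longrightarrow> X = pt v \<or> (\<exists>h. hrel F X h \<and> norm h \<le> K)"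
proof -
  define \<psi> where "\<psi> t = column 1 M + (t ^ q) *s column 2 M + g t *s column 3 M" for t
  have \<psi>: "\<psi> t = aff M (t ^ q) (g t)" for t by (simp add: \<psi>_def aff_columns)
  have C: "pt v = affine_pt M 0 0" using M by (simp add: affine_pt_def aff_columns)
  have gc: "isCont g 0" by (rule continuous_on_interior[OF holomorphic_on_imp_continuous_on[OF g(1)]]) (use r in simp)
  note par = eventually_param[OF M(1) q r gc g(2) b(1)[unfolded C], folded C]
  have "\<forall>\<^sub>F s in nhds 0. affine_pt M (s ^ q) (g s) \<in> zero_locus F"
    using b(2) unfolding germ_le_def par .
  moreover have "\<forall>\<^sub>F s in nhds 0. s \<in> ball (0::complex) r" using r by (intro eventually_nhds_in_open) auto
  ultimately have "\<forall>\<^sub>F s in nhds 0. eval3 F (\<psi> s) = 0 \<and> s \<in> ball 0 r"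
    by eventually_elim (use in_zero_locus[OF F aff_nz[OF M(1)]] in \<open>simp add: affine_pt_def \<psi>\<close>)
  then obtain U where U: "open U" "0 \<in> U" "\<And>s. s \<in> U \<Longrightarrow> eval3 F (\<psi> s) = 0 \<and> s \<in> ball 0 r" unfolding eventually_nhds by blast
  have vh: "vholo \<psi> U" unfolding \<psi>_def[abs_def]
    by (rule vholo_lin) (auto intro!: holomorphic_intros holomorphic_on_subset[OF g(1)] simp del: mem_ball dest: U(3))
  have "\<forall>\<^sub>F s in nhds 0. s \<in> U" using U by (intro eventually_nhds_in_open)
  moreover have "\<forall>\<^sub>F s in nhds 0. s \<noteq> 0 \<longrightarrow> wr \<psi> s \<noteq> 0 \<and> norm (hval \<psi> s) \<le> K"
    using bd unfolding eventually_at_filter \<psi>_def by eventually_elim auto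
  ultimately have "\<forall>\<^sub>F s in nhds 0. affine_pt M (s ^ q) (g s) = pt v \<or> (\<exists>h. hrel F (affine_pt M (s ^ q) (g s)) h \<and> norm h \<le> K)"
  proof eventually_elim
    case (elim s)
    show ?case
    proof (cases "s = 0")
      case True
      then show ?thesis using q g(2) C by (simp add: zero_power)
    next
      case False
      then have "hrel F (affine_pt M (s ^ q) (g s)) (hval \<psi> s)"
        unfolding hrel_def using elim U vh aff_nz[OF M(1)]
        by (intro exI[of _ \<psi>] exI[of _ s] exI[of _ U]) (auto simp: affine_pt_def \<psi>)
      then show ?thesis using elim False by blast
    qed
  qed
  then show ?thesis unfolding par .
qed

text \<open>At a smooth point the curve is the graph of Y over a chart whose vertical direction is
  not tangent. The Wronskian at 0 is a nonzero multiple of the second derivative of Y; if that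
  vanished, the tangent line would stay within O (t ^ 3) of the graph, which makes the point an
  inflection point.\<close>

lemma hrel_smooth_point:
  assumes F: "homogeneous d F" "curve_equation K F" and nz: "\<exists>u. eval3 F u \<noteq> 0" and v: "v \<noteq> 0" "eval3 F v = 0"
    and ns: "\<not> singular_point K (pt v)" "\<not> inflection_point K (pt v)"
  obtains Kb where "\<forall>\<^sub>F X in nhds (pt v). X \<in> K \<longrightarrow> (\<exists>h. hrel F X h \<and> norm h \<le> Kb)"
proof -
  have K: "K = zero_locus F" using F(2) by (simp add: curve_equation_def)
  obtain D where D: "(eval3 F has_derivative D) (at v)" "\<And>c x. D (c *s x) = c * D x" "\<And>u. D u = poly (pderiv (lp d F v u)) 0"
    by (rule eval3_cderiv[OF F(1), of v]) blast
  have Dnz: "D \<noteq> (\<lambda>_. 0)" using ns(1) F(2) v D(1) unfolding singular_point_def by blast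
  from Dnz obtain u1 where u1: "D u1 \<noteq> 0" by auto
  obtain u0 where u0: "eval3 F u0 \<noteq> 0" using nz by blast
  have Dlin: "D (x + y) = D x + D y" for x y using has_derivative_linear[OF D(1)] by (simp add: linear_add)
  \<comment> \<open>The vertical direction has to be off the curve and off the tangent line; along
    u1 + s u0 each condition fails for finitely many s only.\<close>
  obtain s where s: "eval3 F (u1 + s *s u0) \<noteq> 0" "D (u1 + s *s u0) \<noteq> 0"
  proof -
    have "lp d F u1 u0 \<noteq> 0" using coeff_lp_deg(2)[OF F(1), of u1 u0] u0 by auto
    then have "finite {s. poly (lp d F u1 u0) s = 0}" by (rule poly_roots_finite)
    moreover have "[: D u1, D u0 :] \<noteq> 0" using u1 by simp
    then have "finite {s. poly [: D u1, D u0 :] s = 0}" by (rule poly_roots_finite)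
    ultimately have "finite ({s. poly (lp d F u1 u0) s = 0} \<union> {s. poly [: D u1, D u0 :] s = 0})" by simp
    then have "{s. poly (lp d F u1 u0) s = 0} \<union> {s. poly [: D u1, D u0 :] s = 0} \<noteq> UNIV" using infinite_UNIV_char_0 by metis
    then obtain s where "poly (lp d F u1 u0) s \<noteq> 0" "poly [: D u1, D u0 :] s \<noteq> 0" by blast
    then show ?thesis using that[of s] by (simp add: poly_lp[OF F(1)] Dlin D(2))
  qed
  define c where "c = u1 + s *s u0"
  have c: "eval3 F c \<noteq> 0" "D c \<noteq> 0" using s by (auto simp: c_def)
  have "c \<noteq> l *s v" for l using c(1) v(2) eval3_scale[OF F(1), of l v] by auto
  from det3_complement[OF v(1) this] obtain b where b: "det3 v b c \<noteq> 0" by blast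
  define M where "M = cols v b c"
  have M: "invertible M" using b by (simp add: invertible_columns M_def)
  have colM: "column 1 M = v" "column 2 M = b" "column 3 M = c" by (simp_all add: M_def)
  define P where "P z = lp d F (v + z *s b) c" for z
  interpret mf: monic_family P UNIV d "eval3 F c" unfolding P_def by (rule monic_family_lp[OF F(1) c(1)])
  have PK: "affine_pt M z w \<in> K \<longleftrightarrow> poly (P z) w = 0" for z w
    unfolding K using affine_pt_zero_locus[OF F(1) M, of z w] by (simp add: colM P_def)
  have P0: "poly (P 0) 0 = 0" using v(2) by (simp add: P_def poly_lp[OF F(1)])
  have dP: "poly (pderiv (P 0)) 0 \<noteq> 0" using c(2) D(3)[of c] by (simp add: P_def)
  obtain \<delta> \<epsilon> Y where Y: "\<delta> > 0" "\<epsilon> > 0" "Y holomorphic_on ball 0 \<delta>" "Y 0 = 0"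
    "\<And>z. z \<in> ball 0 \<delta> \<Longrightarrow> Y z \<in> ball 0 \<epsilon> \<and> poly (P z) (Y z) = 0"
    "\<And>z w. z \<in> ball 0 \<delta> \<Longrightarrow> w \<in> ball 0 \<epsilon> \<Longrightarrow> poly (P z) w = 0 \<Longrightarrow> w = Y z"
    by (rule mf.simple_root[OF UNIV_I P0 dP zero_less_one]) blast
  define \<phi> where "\<phi> = (\<lambda>z. v + z *s b + Y z *s c)"
  have \<phi>a: "\<phi> z = aff M z (Y z)" for z by (simp add: \<phi>_def aff_columns colM)
  have idh: "(\<lambda>z. z) holomorphic_on ball 0 \<delta>" by (intro holomorphic_intros)
  have vh: "vholo \<phi> (ball 0 \<delta>)" unfolding \<phi>_def by (rule vholo_lin[OF idh Y(3)])
  have zero: "eval3 F (\<phi> z) = 0" "\<phi> z \<noteq> 0" if "z \<in> ball 0 \<delta>" for z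
    using Y(5)[OF that] aff_nz[OF M] by (simp_all add: P_def poly_lp[OF F(1)] \<phi>_def \<phi>a[unfolded \<phi>_def])
  have z0: "0 \<in> ball (0::complex) \<delta>" using Y(1) by simp
  have wr0: "wr \<phi> 0 \<noteq> 0"
  proof
    assume "wr \<phi> 0 = 0"
    moreover have "deriv (\<lambda>z. z) 0 = (1::complex)" "(deriv ^^ 2) (\<lambda>z. z) 0 = (0::complex)" by (simp_all add: eval_nat_numeral)
    ultimately have Y2: "(deriv ^^ 2) Y 0 = 0"
      using wr_lin[OF open_ball idh Y(3) z0, of v b c] b by (simp add: \<phi>_def)
    define u where "u = b + deriv Y 0 *s c"
    have "vD \<phi> 0 = u" using vD_lin[OF open_ball idh Y(3) z0, of v b c] by (simp add: \<phi>_def u_def)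
    then have vh0: "vhd \<phi> u 0" using vholo_vhd[OF vh open_ball z0] by simp
    have "((\<lambda>s. eval3 F (\<phi> s)) has_field_derivative D u) (at 0)"
      by (rule cderiv_vhd[OF D(1,2) vh0]) (simp add: \<phi>_def Y(4))
    moreover have "((\<lambda>s. eval3 F (\<phi> s)) has_field_derivative 0) (at 0)"
      by (rule has_field_derivative_transform_within_open[OF DERIV_const[of 0] open_ball z0]) (simp add: zero)
    ultimately have Du: "D u = 0" by (rule DERIV_unique)
    have det: "det3 v u c \<noteq> 0" using b by (simp add: u_def)
    then have u0: "u \<noteq> 0" by auto
    have une: "pt u \<noteq> pt v"
    proof
      assume "pt u = pt v"
      then obtain l where "v = l *s u" using pt_eq_iff[OF u0 v(1)] by blast
      then show False using det by simp
    qed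
    have "(\<lambda>t. eval3 F (v + t *s u)) \<in> O[at 0](\<lambda>t. t ^ 3)"
    proof -
      \<comment> \<open>F on the tangent line is the difference of the values of \<open>P t\<close>
        at the line and at the graph, hence the gap between them times a divided difference, which
        stays bounded.\<close>
      have eq: "eval3 F (v + t *s u) = - ((Y t - deriv Y 0 * t) * dquot d (P t) (deriv Y 0 * t) (Y t))" if t: "t \<in> ball 0 \<delta>" for t
      proof -
        have "v + t *s u = v + t *s b + (deriv Y 0 * t) *s c" by (simp add: u_def vec_eq_iff algebra_simps)
        then have "eval3 F (v + t *s u) = poly (P t) (deriv Y 0 * t) - poly (P t) (Y t)"
          using Y(5)[OF t] by (simp only: P_def poly_lp[OF F(1)]) simp
        also have "\<dots> = (deriv Y 0 * t - Y t) * dquot d (P t) (deriv Y 0 * t) (Y t)"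
          by (rule poly_diff_dquot) (use mf.deg in simp)
        finally show ?thesis by (simp add: algebra_simps)
      qed
      have "(\<lambda>t. dquot d (P t) (deriv Y 0 * t) (Y t)) \<in> O[at 0](\<lambda>_. 1)"
      proof -
        have Yc: "isCont Y 0" by (rule continuous_on_interior[OF holomorphic_on_imp_continuous_on[OF Y(3)]]) (use Y(1) in simp)
        have "isCont (\<lambda>(z, x, y). dquot d (P z) x y) (0, 0, 0)"
          using mf.cont_dquot continuous_on_interior[of UNIV "\<lambda>(z, x, y). dquot d (P z) x y" "(0,0,0)"] by simp
        moreover have "isCont (\<lambda>t. (t, deriv Y 0 * t, Y t)) 0" by (intro continuous_intros Yc)
        ultimately have "isCont (\<lambda>t. dquot d (P t) (deriv Y 0 * t) (Y t)) 0"
          using isCont_o2[where f = "\<lambda>t. (t, deriv Y 0 * t, Y t)" and a = 0 and g = "\<lambda>(z, x, y). dquot d (P z) x y"] Y(4) by simp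
        then have "((\<lambda>t. dquot d (P t) (deriv Y 0 * t) (Y t)) \<longlongrightarrow> dquot d (P 0) (deriv Y 0 * 0) (Y 0)) (at 0)" unfolding isCont_def .
        then show ?thesis by (intro bigoI_tendsto[where c = "dquot d (P 0) (deriv Y 0 * 0) (Y 0)"]) simp_all
      qed
      from landau_o.big.mult[OF taylor_cubic[OF Y(3,1,4) Y2] this]
      have "(\<lambda>t. - ((Y t - deriv Y 0 * t) * dquot d (P t) (deriv Y 0 * t) (Y t))) \<in> O[at 0](\<lambda>t. t ^ 3)" by simp
      moreover have "\<forall>\<^sub>F t in at 0. t \<in> ball 0 \<delta> - {0}" using Y(1) by (intro eventually_at_in_open) auto
      then have "\<forall>\<^sub>F t in at 0. eval3 F (v + t *s u) = - ((Y t - deriv Y 0 * t) * dquot d (P t) (deriv Y 0 * t) (Y t))"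
        by (rule eventually_mono) (rule eq, simp)
      from landau_o.big.in_cong[OF this] have "(\<lambda>t. eval3 F (v + t *s u)) \<in> O[at 0](\<lambda>t. t ^ 3) \<longleftrightarrow>
        (\<lambda>t. - ((Y t - deriv Y 0 * t) * dquot d (P t) (deriv Y 0 * t) (Y t))) \<in> O[at 0](\<lambda>t. t ^ 3)" .
      ultimately show ?thesis by (simp only:)
    qed
    moreover have "curve_tangent K (pt v) {pt u |u. u \<noteq> 0 \<and> D u = 0}"
      unfolding curve_tangent_def by (intro exI[of _ F] exI[of _ v] exI[of _ D] conjI refl F(2) v D(1) Dnz)
    moreover have "pt u \<in> {pt u |u. u \<noteq> 0 \<and> D u = 0}" using u0 Du by blast
    ultimately have "inflection_point K (pt v)"
      unfolding inflection_point_def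
      by (intro exI[of _ F] exI[of _ "{pt u |u. u \<noteq> 0 \<and> D u = 0}"] exI[of _ v] exI[of _ u] conjI refl F(2) v(1) u0 une)
    then show False using ns(2) by simp
  qed
  obtain Kb where Kb: "\<forall>\<^sub>F t in nhds 0. wr \<phi> t \<noteq> 0 \<and> norm (hval \<phi> t) \<le> Kb"
    by (rule hval_bounded_if_wr_nonzero[OF vh open_ball z0 wr0])
  then obtain \<delta>1 where \<delta>1: "\<delta>1 > 0" "\<And>t. norm t < \<delta>1 \<Longrightarrow> wr \<phi> t \<noteq> 0 \<and> norm (hval \<phi> t) \<le> Kb" unfolding eventually_nhds_metric by auto
  have C: "pt v = affine_pt M 0 0" by (simp add: affine_pt_def aff_columns colM)
  have "\<forall>\<^sub>F p in nhds (0, 0). p \<in> ball (0::complex) (min \<delta> \<delta>1) \<times> ball (0::complex) \<epsilon>"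
    using Y(1,2) \<delta>1(1) by (intro eventually_nhds_in_open) (auto intro: open_Times)
  then have "\<forall>\<^sub>F p in nhds (0, 0). affine_pt M (fst p) (snd p) \<in> K \<longrightarrow> (\<exists>h. hrel F (affine_pt M (fst p) (snd p)) h \<and> norm h \<le> Kb)"
  proof eventually_elim
    case (elim p)
    show ?case
    proof
      assume "affine_pt M (fst p) (snd p) \<in> K"
      then have "poly (P (fst p)) (snd p) = 0" by (simp only: PK)
      then have "snd p = Y (fst p)" using Y(6)[of "fst p" "snd p"] elim by (auto simp: mem_Times_iff)
      then have X: "affine_pt M (fst p) (snd p) = pt (\<phi> (fst p))" by (simp add: affine_pt_def \<phi>a)
      have "fst p \<in> ball 0 \<delta>" "norm (fst p) < \<delta>1" using elim by (auto simp: mem_Times_iff)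
      then have "hrel F (affine_pt M (fst p) (snd p)) (hval \<phi> (fst p))"
        unfolding hrel_def X using vh zero \<delta>1(2)[of "fst p"] by (intro exI[of _ \<phi>] exI[of _ "fst p"] exI[of _ "ball 0 \<delta>"]) auto
      then show "\<exists>h. hrel F (affine_pt M (fst p) (snd p)) h \<and> norm h \<le> Kb" using \<delta>1(2) \<open>norm (fst p) < \<delta>1\<close> by blast
    qed
  qed
  then have "\<forall>\<^sub>F X in nhds (pt v). X \<in> K \<longrightarrow> (\<exists>h. hrel F X h \<and> norm h \<le> Kb)" unfolding C eventually_nhds_chart[OF M] .
  then show ?thesis by (rule that)
qed

text \<open>In the coordinates \<xi> with respect to M any lift through the point is
  \<open>\<xi> 1\<close> times the graph lift, reparametrized by x =
  \<open>\<xi> 2 / \<xi> 1\<close>; uniqueness of the root determines the third coordinate. The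
  invariance of \<open>hval\<close> under such changes then fixes the value.\<close>

lemma hrel_unique:
  assumes F: "homogeneous d F" and M: "invertible M"
    and Y: "\<delta> > 0" "\<epsilon> > 0" "Y holomorphic_on ball x0 \<delta>" "Y x0 = y0"
      "\<And>x y. x \<in> ball x0 \<delta> \<Longrightarrow> y \<in> ball y0 \<epsilon> \<Longrightarrow> eval3 F (aff M x y) = 0 \<Longrightarrow> y = Y x"
    and h: "hrel F (affine_pt M x0 y0) h"
  shows "h = hval (\<lambda>x. column 1 M + x *s column 2 M + Y x *s column 3 M) x0 \<and>
    wr (\<lambda>x. column 1 M + x *s column 2 M + Y x *s column 3 M) x0 \<noteq> 0"
proof -
  define f where "f = (\<lambda>x. column 1 M + x *s column 2 M + Y x *s column 3 M)"
  have fa: "f x = aff M x (Y x)" for x by (simp add: f_def aff_columns)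
  obtain \<phi> t0 U where U: "open U" "t0 \<in> U" "vholo \<phi> U" "\<And>t. t \<in> U \<Longrightarrow> \<phi> t \<noteq> 0 \<and> eval3 F (\<phi> t) = 0"
    "affine_pt M x0 y0 = pt (\<phi> t0)" "wr \<phi> t0 \<noteq> 0" "h = hval \<phi> t0"
    using h unfolding hrel_def by blast
  define \<xi> where "\<xi> i t = (matrix_inv M *v \<phi> t) $ i" for i t
  have \<xi>h: "\<xi> i holomorphic_on U" for i
    using U(3) unfolding \<xi>_def[abs_def] matrix_vector_mult_def vholo_def by (simp, intro holomorphic_intros) auto
  have \<phi>\<xi>: "\<phi> t = \<xi> 1 t *s column 1 M + \<xi> 2 t *s column 2 M + \<xi> 3 t *s column 3 M" for t
    using matrix_vector_3[of M "matrix_inv M *v \<phi> t"] inv_mult(2)[OF M, of "\<phi> t"] by (simp add: \<xi>_def)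
  obtain l0 where l0: "l0 \<noteq> 0" "\<phi> t0 = l0 *s aff M x0 y0"
    using U(5) pt_eq_iff[OF aff_nz[OF M], of "\<phi> t0"] U(4)[OF U(2)] unfolding affine_pt_def by blast
  have "matrix_inv M *v \<phi> t0 = l0 *s vector [1, x0, y0]"
    unfolding l0(2) using inv_mult(1)[OF M, of "vector [1, x0, y0]"] by (simp add: vector_scalar_commute)
  then have \<xi>0: "\<xi> 1 t0 = l0" "\<xi> 2 t0 = l0 * x0" "\<xi> 3 t0 = l0 * y0" by (simp_all add: \<xi>_def vector_3)
  have cont: "(\<xi> i \<longlongrightarrow> \<xi> i t0) (nhds t0)" for i
    by (rule isCont_tendsto_nhds, rule continuous_on_interior[OF holomorphic_on_imp_continuous_on[OF \<xi>h]]) (use U in \<open>simp add: interior_open\<close>)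
  have nz: "\<forall>\<^sub>F t in nhds t0. \<xi> 1 t \<noteq> 0" by (rule tendsto_imp_eventually_ne[OF cont]) (use \<xi>0 l0 in simp)
  have "((\<lambda>t. \<xi> 2 t / \<xi> 1 t) \<longlongrightarrow> \<xi> 2 t0 / \<xi> 1 t0) (nhds t0)" "((\<lambda>t. \<xi> 3 t / \<xi> 1 t) \<longlongrightarrow> \<xi> 3 t0 / \<xi> 1 t0) (nhds t0)"
    by (intro tendsto_intros cont; use \<xi>0 l0 in simp)+
  then have "((\<lambda>t. \<xi> 2 t / \<xi> 1 t) \<longlongrightarrow> x0) (nhds t0)" "((\<lambda>t. \<xi> 3 t / \<xi> 1 t) \<longlongrightarrow> y0) (nhds t0)" using \<xi>0 l0 by simp_all
  then have "\<forall>\<^sub>F t in nhds t0. dist (\<xi> 2 t / \<xi> 1 t) x0 < \<delta>" "\<forall>\<^sub>F t in nhds t0. dist (\<xi> 3 t / \<xi> 1 t) y0 < \<epsilon>"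
    using Y(1,2) tendstoD by blast+
  moreover have "\<forall>\<^sub>F t in nhds t0. t \<in> U" using U by (intro eventually_nhds_in_open)
  ultimately have "\<forall>\<^sub>F t in nhds t0. t \<in> U \<and> \<xi> 1 t \<noteq> 0 \<and> \<xi> 2 t / \<xi> 1 t \<in> ball x0 \<delta> \<and> \<xi> 3 t / \<xi> 1 t \<in> ball y0 \<epsilon>"
    using nz by eventually_elim (auto simp: dist_commute)
  then obtain V where V: "open V" "t0 \<in> V" "\<And>t. t \<in> V \<Longrightarrow> t \<in> U \<and> \<xi> 1 t \<noteq> 0 \<and> \<xi> 2 t / \<xi> 1 t \<in> ball x0 \<delta> \<and> \<xi> 3 t / \<xi> 1 t \<in> ball y0 \<epsilon>"
    unfolding eventually_nhds by blast
  have eq: "\<phi> t = \<xi> 1 t *s f (\<xi> 2 t / \<xi> 1 t)" if t: "t \<in> V" for t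
  proof -
    have a: "\<phi> t = \<xi> 1 t *s aff M (\<xi> 2 t / \<xi> 1 t) (\<xi> 3 t / \<xi> 1 t)"
      unfolding \<phi>\<xi>[of t] aff_columns using V(3)[OF t] by (simp add: vec_eq_iff algebra_simps)
    then have "eval3 F (aff M (\<xi> 2 t / \<xi> 1 t) (\<xi> 3 t / \<xi> 1 t)) = 0"
      using U(4)[of t] V(3)[OF t] eval3_scale[OF F] by auto
    then have "\<xi> 3 t / \<xi> 1 t = Y (\<xi> 2 t / \<xi> 1 t)" using Y(5) V(3)[OF t] by blast
    then show ?thesis using a by (simp add: fa)
  qed
  have vf: "vholo f (ball x0 \<delta>)" unfolding f_def by (rule vholo_lin) (auto intro!: holomorphic_intros Y(3))
  have hx: "(\<lambda>t. \<xi> 2 t / \<xi> 1 t) holomorphic_on V" using V(3) by (intro holomorphic_intros holomorphic_on_subset[OF \<xi>h]) auto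
  have hl: "\<xi> 1 holomorphic_on V" using V(3) by (intro holomorphic_on_subset[OF \<xi>h]) auto
  have im: "(\<lambda>t. \<xi> 2 t / \<xi> 1 t) ` V \<subseteq> ball x0 \<delta>" using V(3) by blast
  have x0: "\<xi> 2 t0 / \<xi> 1 t0 = x0" using \<xi>0 l0 by simp
  from hval_scale_compose[where f=f and g=\<phi>, OF V(1) open_ball vf hx im hl eq V(2) U(6)]
  show ?thesis unfolding x0 U(7) f_def by simp
qed

end

subsection \<open>Exponents of branches\<close>

lemma bparam_of_branch_exponents:
  assumes "branch_exponents C b q p"
  obtains M g r where "bparam (column 1 M) b M q p g r" "pt (column 1 M) = C"
proof -
  obtain M r g c where e: "1 \<le> q" "q < p" "adapted_coords C b M" "0 < r" "g holomorphic_on ball 0 r" "c \<noteq> 0"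
      "((\<lambda>t. g t / t ^ p) \<longlongrightarrow> c) (at 0)" "g 0 = 0" "germ_eq C b (pimg M q g r)"
    using assms unfolding branch_exponents_def by blast
  have M: "invertible M" and C: "pt (column 1 M) = C"
    using e(3) by (simp_all add: adapted_coords_def centered_coords_def affine_pt_0)
  have "bparam (column 1 M) b M q p g r"
    unfolding bparam_def C by (intro conjI exI[of _ c] refl M e)
  then show ?thesis using C by (rule that)
qed

text \<open>For comparing two parametrizations of one branch: a relation R between the affine
  coordinates for M' that holds along b is rewritten in the parameter belonging to M, where the
  \<xi> are homogeneous coordinates with respect to M'.\<close>

lemma bparam_chart:
  assumes b: "bparam v b M q p g r" and M': "invertible M'" "pt (column 1 M') = pt v"
    and R: "\<forall>\<^sub>F X in nhds (pt v). X \<in> b \<longrightarrow> (\<forall>z w. X = affine_pt M' z w \<longrightarrow> R z w)"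
  defines "\<xi> \<equiv> \<lambda>i s. (matrix_inv M' *v v) $ i + s ^ q * (matrix_inv M' *v column 2 M) $ i + g s * (matrix_inv M' *v column 3 M) $ i"
  shows "\<forall>\<^sub>F s in nhds 0. \<xi> 1 s \<noteq> 0 \<and> R (\<xi> 2 s / \<xi> 1 s) (\<xi> 3 s / \<xi> 1 s)"
    "(matrix_inv M' *v v) $ 1 \<noteq> 0" "(matrix_inv M' *v v) $ 2 = 0" "(matrix_inv M' *v v) $ 3 = 0"
    "(g \<longlongrightarrow> 0) (nhds 0)" "\<And>k. k < p \<Longrightarrow> ((\<lambda>s. g s / s ^ k) \<longlongrightarrow> 0) (at 0)"
proof -
  have M: "invertible M" "column 1 M = v" and q: "1 \<le> q" "q < p" and r: "r > 0" and g: "g holomorphic_on ball 0 r" "g 0 = 0"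
    and ge: "germ_eq (pt v) b (pimg M q g r)" using b by (auto simp: bparam_def)
  obtain c where c: "((\<lambda>t. g t / t ^ p) \<longlongrightarrow> c) (at 0)" using b by (auto simp: bparam_def)
  have C: "affine_pt M 0 0 = pt v" by (simp add: affine_pt_0 M)
  have v0: "v \<noteq> 0" using aff_nz[OF M(1), of 0 0] M(2) by (simp add: aff_columns)
  have c10: "column 1 M' \<noteq> 0" using aff_nz[OF M'(1), of 0 0] by (simp add: aff_columns)
  obtain l where l: "l \<noteq> 0" "v = l *s column 1 M'" using M'(2) pt_eq_iff[OF c10 v0] by blast
  have "matrix_inv M' *v v = l *s vector [1, 0, 0]"
    using inv_mult(1)[OF M'(1), of "vector [1, 0, 0]"] unfolding l(2) by (simp add: matrix_vector_3[of M'] vector_3 vector_scalar_commute)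
  then show N: "(matrix_inv M' *v v) $ 1 \<noteq> 0" "(matrix_inv M' *v v) $ 2 = 0" "(matrix_inv M' *v v) $ 3 = 0"
    using l(1) by (simp_all add: vector_3)
  have gc: "isCont g 0" by (rule continuous_on_interior[OF holomorphic_on_imp_continuous_on[OF g(1)]]) (use r in simp)
  show g0: "(g \<longlongrightarrow> 0) (nhds 0)" using isCont_tendsto_nhds[OF gc] g(2) by simp
  show "((\<lambda>s. g s / s ^ k) \<longlongrightarrow> 0) (at 0)" if "k < p" for k
  proof -
    have "((\<lambda>s. g s / s ^ p * s ^ (p - k)) \<longlongrightarrow> c * 0 ^ (p - k)) (at 0)" by (intro tendsto_intros c)
    moreover have "\<forall>\<^sub>F s in at 0. g s / s ^ p * s ^ (p - k) = g s / s ^ k"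
      unfolding eventually_at_filter using that by (intro always_eventually) (auto simp: power_diff)
    ultimately show ?thesis using that by (simp add: tendsto_cong zero_power)
  qed
  have par: "\<forall>\<^sub>F s in nhds 0. \<forall>z w. affine_pt M (s ^ q) (g s) = affine_pt M' z w \<longrightarrow> R z w"
    using R eventually_param[OF M(1) q(1) r gc g(2) ge[folded C]] unfolding C by simp
  have \<xi>: "\<xi> i s = (matrix_inv M' *v aff M (s ^ q) (g s)) $ i" for i s
    unfolding aff_columns by (simp add: \<xi>_def M(2) matrix_vector_right_distrib vector_scalar_commute)
  have "((\<lambda>s. s ^ q) \<longlongrightarrow> 0 ^ q) (nhds (0::complex))" by (intro tendsto_power filterlim_ident)
  then have sq: "((\<lambda>s. s ^ q) \<longlongrightarrow> 0) (nhds (0::complex))" using q by (simp add: zero_power)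
  have "(\<xi> 1 \<longlongrightarrow> (matrix_inv M' *v v) $ 1 + 0 * (matrix_inv M' *v column 2 M) $ 1 + 0 * (matrix_inv M' *v column 3 M) $ 1) (nhds 0)"
    unfolding \<xi>_def by (intro tendsto_intros g0 sq)
  then have "\<forall>\<^sub>F s in nhds 0. \<xi> 1 s \<noteq> 0" by (rule tendsto_imp_eventually_ne) (use N in simp)
  with par show "\<forall>\<^sub>F s in nhds 0. \<xi> 1 s \<noteq> 0 \<and> R (\<xi> 2 s / \<xi> 1 s) (\<xi> 3 s / \<xi> 1 s)"
  proof eventually_elim
    case (elim s)
    define y where "y = matrix_inv M' *v aff M (s ^ q) (g s)"
    have "aff M (s ^ q) (g s) = M' *v y" unfolding y_def by (rule inv_mult(2)[OF M'(1), symmetric])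
    also have "\<dots> = \<xi> 1 s *s column 1 M' + \<xi> 2 s *s column 2 M' + \<xi> 3 s *s column 3 M'"
      unfolding \<xi> y_def[symmetric] by (rule matrix_vector_3)
    also have "\<dots> = \<xi> 1 s *s aff M' (\<xi> 2 s / \<xi> 1 s) (\<xi> 3 s / \<xi> 1 s)"
      unfolding aff_columns[of M'] using elim(2) by (simp add: vec_eq_iff algebra_simps)
    finally have "affine_pt M (s ^ q) (g s) = affine_pt M' (\<xi> 2 s / \<xi> 1 s) (\<xi> 3 s / \<xi> 1 s)"
      unfolding affine_pt_def using pt_scale[OF aff_nz[OF M'(1)] elim(2)] by simp
    then show ?case using elim by blast
  qed
qed

text \<open>In the second chart the branch satisfies w = o(z). Over a common denominator both
  coordinates are s ^ q times convergent factors, whose limits are the second and third coordinates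
  of the tangent vector; letting \<epsilon> tend to 0 leaves third coordinate 0. So all adapted
  charts share the tangent line.\<close>

lemma adapted_axis:
  assumes b: "bparam v b M q p g r" and ad: "adapted_coords (pt v) b M'"
  shows "(matrix_inv M' *v column 2 M) $ 3 = 0"
proof -
  have M': "invertible M'" "pt (column 1 M') = pt v" using ad by (simp_all add: adapted_coords_def centered_coords_def affine_pt_0)
  define N where "N i x = (matrix_inv M' *v x) $ i" for i x
  have q: "1 \<le> q" "q < p" using b by (auto simp: bparam_def)
  have le: "norm (N 3 (column 2 M)) \<le> \<epsilon> * norm (N 2 (column 2 M))" if \<epsilon>: "\<epsilon> > 0" for \<epsilon>
  proof -
    have "snd \<in> o[at (0, 0) within {(z, w). affine_pt M' z w \<in> b}](fst)" using ad by (simp add: adapted_coords_def)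
    from landau_o.smallD[OF this \<epsilon>]
    have "\<forall>\<^sub>F p in at (0, 0) within {(z, w). affine_pt M' z w \<in> b}. norm (snd p) \<le> \<epsilon> * norm (fst p)" .
    then have "\<forall>\<^sub>F p in nhds (0, 0). affine_pt M' (fst p) (snd p) \<in> b \<longrightarrow> norm (snd p) \<le> \<epsilon> * norm (fst p)"
      unfolding eventually_at_filter by eventually_elim (auto simp: case_prod_unfold)
    then have "\<forall>\<^sub>F p in nhds (0, 0). affine_pt M' (fst p) (snd p) \<in> b \<longrightarrow>
        (\<forall>z w. affine_pt M' (fst p) (snd p) = affine_pt M' z w \<longrightarrow> norm w \<le> \<epsilon> * norm z)"
      by eventually_elim (use affine_pt_inj[OF M'(1)] in blast)
    then have R: "\<forall>\<^sub>F X in nhds (pt v). X \<in> b \<longrightarrow> (\<forall>z w. X = affine_pt M' z w \<longrightarrow> norm w \<le> \<epsilon> * norm z)"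
      using eventually_nhds_chart[OF M'(1), of _ 0 0] M'(2) by (simp add: affine_pt_0)
    note ch = bparam_chart[OF b M' R, folded N_def]
    have lim: "((\<lambda>s. N i (column 2 M) + g s / s ^ q * N i (column 3 M)) \<longlongrightarrow> N i (column 2 M) + 0 * N i (column 3 M)) (at 0)" for i
      by (intro tendsto_add tendsto_mult tendsto_const ch(6)[OF q(2)])
    have "\<forall>\<^sub>F s in at 0. norm (N 3 (column 2 M) + g s / s ^ q * N 3 (column 3 M)) \<le> \<epsilon> * norm (N 2 (column 2 M) + g s / s ^ q * N 2 (column 3 M))"
      using ch(1) unfolding eventually_at_filter
    proof eventually_elim
      case (elim s)
      show ?case
      proof (intro impI)
        assume s: "s \<noteq> 0" "s \<in> UNIV"
        have e: "N i v + s ^ q * N i (column 2 M) + g s * N i (column 3 M) = s ^ q * (N i (column 2 M) + g s / s ^ q * N i (column 3 M))"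
          if "N i v = 0" for i
        proof -
          have "s ^ q * (g s / s ^ q) = g s" using s by simp
          then show ?thesis using that by (simp only: distrib_left mult.assoc[symmetric] add_0)
        qed
        define x where "x = N 1 v + s ^ q * N 1 (column 2 M) + g s * N 1 (column 3 M)"
        define y3 where "y3 = N 3 (column 2 M) + g s / s ^ q * N 3 (column 3 M)"
        define y2 where "y2 = N 2 (column 2 M) + g s / s ^ q * N 2 (column 3 M)"
        from elim have x: "x \<noteq> 0" and "norm (s ^ q * y3 / x) \<le> \<epsilon> * norm (s ^ q * y2 / x)"
          unfolding x_def[symmetric] e[OF ch(3)] e[OF ch(4)] y3_def y2_def by blast+
        then have "norm (s ^ q / x) * norm y3 \<le> norm (s ^ q / x) * (\<epsilon> * norm y2)" by (simp add: norm_mult norm_divide mult_ac)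
        moreover have "0 < norm (s ^ q / x)" using s x by simp
        ultimately have "norm y3 \<le> \<epsilon> * norm y2" by (simp only: mult_le_cancel_left_pos)
        then show "norm (N 3 (column 2 M) + g s / s ^ q * N 3 (column 3 M)) \<le> \<epsilon> * norm (N 2 (column 2 M) + g s / s ^ q * N 2 (column 3 M))"
          unfolding y3_def y2_def .
      qed
    qed
    then have "norm (N 3 (column 2 M) + 0 * N 3 (column 3 M)) \<le> \<epsilon> * norm (N 2 (column 2 M) + 0 * N 2 (column 3 M))"
      by (intro tendsto_le[OF _ tendsto_mult_left[OF tendsto_norm[OF lim]] tendsto_norm[OF lim]]) auto
    then show ?thesis by simp
  qed
  have "norm (N 3 (column 2 M)) \<le> 0"
  proof (rule field_le_epsilon)
    fix e :: real assume e: "e > 0"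
    have "norm (N 3 (column 2 M)) \<le> e / (norm (N 2 (column 2 M)) + 1) * norm (N 2 (column 2 M))"
      by (rule le) (use e norm_ge_zero[of "N 2 (column 2 M)"] in \<open>auto intro!: divide_pos_pos add_nonneg_pos\<close>)
    also have "\<dots> \<le> e"
    proof -
      have "norm (N 2 (column 2 M)) + 1 > 0" by (intro add_nonneg_pos) auto
      then show ?thesis using e by (simp add: field_simps)
    qed
    finally show "norm (N 3 (column 2 M)) \<le> 0 + e" by simp
  qed
  then show ?thesis by (simp add: N_def)
qed

text \<open>Since the tangent line is common to all adapted charts, \<open>column 2\<close> changes
  only within the plane of v and the old \<open>column 2\<close>. Conditions on B at the centre and
  at the tangent vector can thus be moved between charts.\<close>

lemma bparam_axis:
  assumes b: "bparam v b M q p g r" and b': "bparam v' b M' q' p' g' r'" and eq: "pt v = pt v'"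
  obtains l \<alpha> \<beta> where "v' = l *s v" "l \<noteq> 0" "column 2 M' = \<alpha> *s v + \<beta> *s column 2 M" "\<beta> \<noteq> 0"
    "(matrix_inv M' *v column 2 M) $ 2 \<noteq> 0"
proof -
  have M: "invertible M" "column 1 M = v" "invertible M'" "column 1 M' = v'" and ad: "adapted_coords (pt v) b M'"
    using b b' eq by (simp_all add: bparam_def)
  have v0: "v \<noteq> 0" "v' \<noteq> 0" using aff_nz[OF M(1), of 0 0] aff_nz[OF M(3), of 0 0] M by (simp_all add: aff_columns)
  obtain l where l: "l \<noteq> 0" "v' = l *s v" using eq pt_eq_iff[OF v0] by blast
  define x where "x = matrix_inv M' *v column 2 M"
  have x3: "x $ 3 = 0" unfolding x_def by (rule adapted_axis[OF b ad])
  have E: "column 2 M = x $ 1 *s v' + x $ 2 *s column 2 M'"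
    using inv_mult(2)[OF M(3), of "column 2 M"] unfolding x_def[symmetric] matrix_vector_3[of M' x] x3 M(4) by simp
  have x2: "x $ 2 \<noteq> 0"
  proof
    assume "x $ 2 = 0"
    then have "det3 v (column 2 M) (column 3 M) = 0" using E l by (simp add: det3_def algebra_simps)
    then show False using M by (simp add: invertible_columns)
  qed
  have "column 2 M' = (- x $ 1 * l / x $ 2) *s v + (1 / x $ 2) *s column 2 M"
    unfolding E l(2) using x2 by (simp add: vec_eq_iff field_simps)
  then show ?thesis using x2 l that[of l "- x $ 1 * l / x $ 2" "1 / x $ 2"] by (simp add: x_def)
qed

text \<open>\<open>regular_branch\<close> and \<open>quadratic_branch\<close> assert their
  properties of separate pairs of exponents, and this joins them. The quadratic pair yields \<kappa>
  |z| ^ 2 \<le> |w| for the points of b near the centre; transported to the regular parametrization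
  this contradicts p > 2, where w = o(z ^ 2).\<close>

lemma regular_quadratic_exponents:
  assumes b: "bparam v b M 1 p g r" and b': "bparam v' b M' q (2 * q) g' r'" and eq: "pt v = pt v'"
  shows "p = 2"
proof (rule ccontr)
  assume p: "p \<noteq> 2"
  have p3: "2 < p" using b p by (auto simp: bparam_def)
  have M': "invertible M'" "column 1 M' = v'" and q: "1 \<le> q" and r: "r' > 0" and g: "g' holomorphic_on ball 0 r'" "g' 0 = 0"
    and ge: "germ_eq (pt v) b (pimg M' q g' r')" and ad: "adapted_coords (pt v) b M'" using b' eq by (auto simp: bparam_def)
  obtain c where c: "c \<noteq> 0" "((\<lambda>t. g' t / t ^ (2 * q)) \<longlongrightarrow> c) (at 0)" using b' by (auto simp: bparam_def)
  have C: "affine_pt M' 0 0 = pt v" by (simp add: affine_pt_0 M' eq)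
  have gc: "isCont g' 0" by (rule continuous_on_interior[OF holomorphic_on_imp_continuous_on[OF g(1)]]) (use r in simp)
  \<comment> \<open>Anything strictly between 0 and the modulus of the limit c serves as a lower
    bound near 0.\<close>
  define \<kappa> where "\<kappa> = norm c / 2"
  have \<kappa>: "\<kappa> > 0" "\<kappa> < norm c" using c(1) by (simp_all add: \<kappa>_def)
  have "\<forall>\<^sub>F s in at 0. norm (g' s / s ^ (2 * q)) > \<kappa>" using tendsto_norm[OF c(2)] \<kappa>(2) by (rule order_tendstoD)
  then have "\<forall>\<^sub>F s in nhds 0. \<kappa> * norm (s ^ q) ^ 2 \<le> norm (g' s)"
    unfolding eventually_at_filter
  proof eventually_elim
    case (elim s)
    show ?case
    proof (cases "s = 0")
      case True
      then show ?thesis using q by (simp add: zero_power)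
    next
      case False
      then have "\<kappa> < norm (g' s) / norm s ^ (2 * q)" using elim by (simp add: norm_divide norm_power)
      moreover have "norm (s ^ q) ^ 2 = norm s ^ (2 * q)" by (simp add: norm_power power_mult[symmetric] mult.commute)
      moreover have "norm s ^ (2 * q) > 0" using False by simp
      ultimately show ?thesis by (simp add: pos_less_divide_eq less_imp_le)
    qed
  qed
  then have "\<forall>\<^sub>F s in nhds 0. \<forall>z w. affine_pt M' (s ^ q) (g' s) = affine_pt M' z w \<longrightarrow> \<kappa> * norm z ^ 2 \<le> norm w"
    by eventually_elim (use affine_pt_inj[OF M'(1)] in blast)
  then have R: "\<forall>\<^sub>F X in nhds (pt v). X \<in> b \<longrightarrow> (\<forall>z w. X = affine_pt M' z w \<longrightarrow> \<kappa> * norm z ^ 2 \<le> norm w)"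
    using eventually_param[OF M'(1) q r gc g(2) ge[folded C]] unfolding C by simp
  define N where "N i x = (matrix_inv M' *v x) $ i" for i x
  note ch = bparam_chart[OF b M'(1) _ R, folded N_def, unfolded M'(2), OF eq[symmetric], unfolded power_one_right]
  have E3: "N 3 (column 2 M) = 0" unfolding N_def by (rule adapted_axis[OF b ad])
  have g0: "(g \<longlongrightarrow> 0) (at 0)" using ch(5) by (rule filterlim_mono) (simp_all add: at_within_le_nhds)
  have l1: "((\<lambda>s. \<kappa> * norm (N 2 (column 2 M) + g s / s ^ 1 * N 2 (column 3 M)) ^ 2) \<longlongrightarrow> \<kappa> * norm (N 2 (column 2 M) + 0 * N 2 (column 3 M)) ^ 2) (at 0)"
    by (intro tendsto_add tendsto_mult tendsto_const tendsto_norm tendsto_power ch(6)) (use p3 in simp)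
  have l2: "((\<lambda>s. norm (g s / s ^ 2 * N 3 (column 3 M)) * norm (N 1 v + s * N 1 (column 2 M) + g s * N 1 (column 3 M))) \<longlongrightarrow>
     norm (0 * N 3 (column 3 M)) * norm (N 1 v + 0 * N 1 (column 2 M) + 0 * N 1 (column 3 M))) (at 0)"
    by (intro tendsto_add tendsto_mult tendsto_const tendsto_norm tendsto_ident_at ch(6)[OF p3] g0)
  have "\<forall>\<^sub>F s in at 0. \<kappa> * norm (N 2 (column 2 M) + g s / s ^ 1 * N 2 (column 3 M)) ^ 2 \<le>
     norm (g s / s ^ 2 * N 3 (column 3 M)) * norm (N 1 v + s * N 1 (column 2 M) + g s * N 1 (column 3 M))"
    using ch(1) unfolding eventually_at_filter
  proof eventually_elim
    case (elim s)
    show ?case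
    proof (intro impI)
      assume s: "s \<noteq> 0" "s \<in> UNIV"
      define x where "x = N 1 v + s * N 1 (column 2 M) + g s * N 1 (column 3 M)"
      define y where "y = N 2 (column 2 M) + g s / s ^ 1 * N 2 (column 3 M)"
      have e2: "N 2 v + s * N 2 (column 2 M) + g s * N 2 (column 3 M) = s * y"
      proof -
        have "s * (g s / s ^ 1) = g s" using s by simp
        then show ?thesis unfolding y_def ch(3) by (simp only: distrib_left mult.assoc[symmetric] add_0)
      qed
      define w where "w = g s / s ^ 2 * N 3 (column 3 M)"
      have e3: "N 3 v + s * N 3 (column 2 M) + g s * N 3 (column 3 M) = s ^ 2 * w"
      proof -
        have "s ^ 2 * (g s / s ^ 2) = g s" using s by simp
        then show ?thesis unfolding w_def ch(4) E3 by (simp only: mult.assoc[symmetric] mult_zero_right add_0)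
      qed
      from elim have x: "x \<noteq> 0" and le: "\<kappa> * norm (s * y / x) ^ 2 \<le> norm (s ^ 2 * w / x)"
        unfolding x_def[symmetric] e2 e3 by blast+
      have "norm s ^ 2 * (\<kappa> * norm y ^ 2) = norm x ^ 2 * (\<kappa> * norm (s * y / x) ^ 2)"
        using x by (simp add: norm_mult norm_divide power_mult_distrib power_divide)
      also have "\<dots> \<le> norm x ^ 2 * norm (s ^ 2 * w / x)" by (intro mult_left_mono le) simp
      also have "\<dots> = norm s ^ 2 * (norm w * norm x)" using x by (simp add: norm_mult norm_divide norm_power power2_eq_square[of "norm x"])
      finally have le': "norm s ^ 2 * (\<kappa> * norm y ^ 2) \<le> norm s ^ 2 * (norm w * norm x)" .
      have "norm s ^ 2 > 0" using s by simp
      with le' have "\<kappa> * norm y ^ 2 \<le> norm w * norm x" by (simp only: mult_le_cancel_left_pos)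
      then show "\<kappa> * norm (N 2 (column 2 M) + g s / s ^ 1 * N 2 (column 3 M)) ^ 2 \<le>
         norm (g s / s ^ 2 * N 3 (column 3 M)) * norm (N 1 v + s * N 1 (column 2 M) + g s * N 1 (column 3 M))"
        unfolding y_def w_def x_def .
    qed
  qed
  then have "\<kappa> * norm (N 2 (column 2 M) + 0 * N 2 (column 3 M)) ^ 2 \<le>
      norm (0 * N 3 (column 3 M)) * norm (N 1 v + 0 * N 1 (column 2 M) + 0 * N 1 (column 3 M))"
    by (intro tendsto_le[OF _ l2 l1]) auto
  then have "N 2 (column 2 M) = 0" using \<kappa>(1) by (simp add: mult_le_0_iff)
  moreover have "N 2 (column 2 M) \<noteq> 0" unfolding N_def by (rule bparam_axis[OF b b' eq]) blast
  ultimately show False by simp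
qed

subsection \<open>Boundedness of the invariant\<close>

context symform
begin

lemma bparam_bounded:
  assumes F: "homogeneous d F" and lb: "local_branch (zero_locus F) C b" and b: "bparam v b M q p g r" and C: "pt v = C"
    and bd: "\<forall>\<^sub>F s in at 0. wr (\<lambda>t. column 1 M + (t ^ q) *s column 2 M + g t *s column 3 M) s \<noteq> 0 \<and>
       norm (hval (\<lambda>t. column 1 M + (t ^ q) *s column 2 M + g t *s column 3 M) s) \<le> K"
  shows "\<forall>\<^sub>F X in nhds C. X \<in> b \<longrightarrow> X = C \<or> (\<exists>h. hrel F X h \<and> norm h \<le> K)"
proof -
  have "germ_le (pt v) b (zero_locus F)" using lb by (simp add: local_branch_def C)
  then show ?thesis
    unfolding C[symmetric] using b unfolding bparam_def by (intro hrel_param[OF F _ _ _ _ _ _ _ _ bd]) blast+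
qed

text \<open>The choice k = 2 q' serves two situations: tangency at a regular point of the conic,
  where p' = 2 q' gives B A C a sufficient order, and the node of a line pair, where B v = 0 and p'
  \<le> 2 q' is enough. The exponents refer to some adapted chart M', to which
  \<open>bparam_axis\<close> carries the tangent condition known for M.\<close>

lemma subquadratic_bounded:
  assumes F: "homogeneous d F" and lb: "local_branch (zero_locus F) (pt v) b" and b: "bparam v b M q p g r"
    and B: "B v v = 0" "B v (column 2 M) = 0" and e: "branch_exponents (pt v) b q' p'" "p' \<le> 2 * q'"
    and alt: "p' = 2 * q' \<or> (\<forall>u. B v u = 0)"
  shows "\<exists>K. \<forall>\<^sub>F X in nhds (pt v). X \<in> b \<longrightarrow> X = pt v \<or> (\<exists>h. hrel F X h \<and> norm h \<le> K)"
proof -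
  obtain M' g' r' where b': "bparam (column 1 M') b M' q' p' g' r'" and C: "pt (column 1 M') = pt v"
    by (rule bparam_of_branch_exponents[OF e(1)])
  obtain l \<alpha> \<beta> where l: "column 1 M' = l *s v" "column 2 M' = \<alpha> *s v + \<beta> *s column 2 M"
    by (rule bparam_axis[OF b b' C[symmetric]]) blast
  have qp: "1 \<le> q'" "q' < p'" and r: "r' > 0" and g: "g' holomorphic_on ball 0 r'" "g' 0 = 0" and M': "invertible M'"
    using b' by (auto simp: bparam_def)
  obtain c where c: "c \<noteq> 0" "((\<lambda>t. g' t / t ^ p') \<longlongrightarrow> c) (at 0)" using b' by (auto simp: bparam_def)
  have det: "det3 (column 1 M') (column 2 M') (column 3 M') \<noteq> 0" using M' by (simp add: invertible_columns)
  have B0: "B (column 1 M') (column 1 M') = 0" "B (column 1 M') (column 2 M') = 0"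
    unfolding l by (simp_all add: B_scale B_scale' B_add' B)
  have alt': "B (column 1 M') (column 3 M') = 0 \<or> 2 * q' \<le> p'" using alt unfolding l(1) by (auto simp: B_scale)
  obtain K where K: "\<forall>\<^sub>F s in at 0. wr (\<lambda>t. column 1 M' + (t ^ q') *s column 2 M' + g' t *s column 3 M') s \<noteq> 0 \<and>
       norm (hval (\<lambda>t. column 1 M' + (t ^ q') *s column 2 M' + g' t *s column 3 M') s) \<le> K"
    by (rule hval_bounded_on_branch[OF r g(1) c(2,1) g(2) qp det B0 _ _ alt']) (use e(2) qp in auto)
  show ?thesis using bparam_bounded[OF F lb b' C K] by blast
qed

text \<open>A branch at the node tangent to one of the two lines: with B v = 0 and B E E = 0 only
  terms of order at least p + q remain, so k = p + q meets the requirement 2 (p + q) \<le> 3 k for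
  all exponents.\<close>

lemma axis_bounded:
  assumes F: "homogeneous d F" and lb: "local_branch (zero_locus F) (pt v) b" and b: "bparam v b M q p g r"
    and B: "\<And>u. B v u = 0" "B (column 2 M) (column 2 M) = 0"
  shows "\<exists>K. \<forall>\<^sub>F X in nhds (pt v). X \<in> b \<longrightarrow> X = pt v \<or> (\<exists>h. hrel F X h \<and> norm h \<le> K)"
proof -
  have qp: "1 \<le> q" "q < p" and r: "r > 0" and g: "g holomorphic_on ball 0 r" "g 0 = 0" and M: "invertible M" "column 1 M = v"
    using b by (auto simp: bparam_def)
  obtain c where c: "c \<noteq> 0" "((\<lambda>t. g t / t ^ p) \<longlongrightarrow> c) (at 0)" using b by (auto simp: bparam_def)
  have det: "det3 (column 1 M) (column 2 M) (column 3 M) \<noteq> 0" using M by (simp add: invertible_columns)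
  have B0: "B (column 1 M) (column 1 M) = 0" "B (column 1 M) (column 2 M) = 0" "B (column 1 M) (column 3 M) = 0 \<or> p + q \<le> p"
      "B (column 2 M) (column 2 M) = 0 \<or> p + q \<le> 2 * q"
    using B M(2) by simp_all
  obtain K where K: "\<forall>\<^sub>F s in at 0. wr (\<lambda>t. column 1 M + (t ^ q) *s column 2 M + g t *s column 3 M) s \<noteq> 0 \<and>
       norm (hval (\<lambda>t. column 1 M + (t ^ q) *s column 2 M + g t *s column 3 M) s) \<le> K"
    by (rule hval_bounded_on_branch[OF r g(1) c(2,1) g(2) qp det B0(1,2) _ _ B0(3,4)]) auto
  show ?thesis using bparam_bounded[OF F lb b refl K] by blast
qed

text \<open>On a transversal branch B v E may be nonzero and counting orders of B is of no use.
  Instead p = 2 with q = 1 makes the second derivative of g nonzero, so that the Wronskian does not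
  vanish at the centre and \<open>hval\<close> is continuous there.\<close>

lemma regular_quadratic_bounded:
  assumes F: "homogeneous d F" and lb: "local_branch (zero_locus F) C b" and e: "regular_branch C b" "quadratic_branch C b"
  shows "\<exists>K. \<forall>\<^sub>F X in nhds C. X \<in> b \<longrightarrow> X = C \<or> (\<exists>h. hrel F X h \<and> norm h \<le> K)"
proof -
  obtain p where ex1: "branch_exponents C b 1 p" using e(1) unfolding regular_branch_def by blast
  obtain q' where ex2: "branch_exponents C b q' (2 * q')" using e(2) unfolding quadratic_branch_def by blast
  obtain M g r where b: "bparam (column 1 M) b M 1 p g r" and C: "pt (column 1 M) = C"
    by (rule bparam_of_branch_exponents[OF ex1])
  obtain M' g' r' where b': "bparam (column 1 M') b M' q' (2 * q') g' r'" and C': "pt (column 1 M') = C"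
    by (rule bparam_of_branch_exponents[OF ex2])
  have p: "p = 2" by (rule regular_quadratic_exponents[OF b b']) (simp add: C C')
  have r: "r > 0" and g: "g holomorphic_on ball 0 r" "g 0 = 0" and M: "invertible M" using b by (auto simp: bparam_def)
  obtain c where c: "c \<noteq> 0" "((\<lambda>t. g t / t ^ 2) \<longlongrightarrow> c) (at 0)" using b unfolding p by (auto simp: bparam_def)
  have z0: "0 \<in> ball (0::complex) r" using r by simp
  have "((\<lambda>t. g t / t ^ 2 * t) \<longlongrightarrow> c * 0) (at 0)" by (intro tendsto_mult c tendsto_ident_at)
  moreover have "\<forall>\<^sub>F t in at 0. g t / t ^ 2 * t = (g (0 + t) - g 0) / t"
    unfolding eventually_at_filter by (intro always_eventually) (simp add: g(2) power2_eq_square)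
  ultimately have "((\<lambda>t. (g (0 + t) - g 0) / t) \<longlongrightarrow> 0) (at 0)" by (simp add: tendsto_cong)
  then have "(g has_field_derivative 0) (at 0)" unfolding DERIV_def .
  then have g1: "deriv g 0 = 0" by (rule DERIV_imp_deriv)
  \<comment> \<open>Otherwise g would be O (t ^ 3) by Taylor's formula, and the limit c of g / t ^ 2
    would be 0.\<close>
  have g2: "(deriv ^^ 2) g 0 \<noteq> 0"
  proof
    assume "(deriv ^^ 2) g 0 = 0"
    from taylor_cubic[OF g(1) r g(2) this] have "g \<in> O[at 0](\<lambda>t. t ^ 3)" by (simp add: g1)
    then obtain k where "\<forall>\<^sub>F t in at 0. norm (g t) \<le> k * norm (t ^ 3)" by (elim landau_o.bigE)
    then have "\<forall>\<^sub>F t in at 0. norm (g t / t ^ 2) \<le> k * norm t"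
      unfolding eventually_at_filter
    proof eventually_elim
      case (elim t)
      show ?case
      proof (intro impI)
        assume t: "t \<noteq> 0" "t \<in> UNIV"
        have "norm (g t) \<le> (k * norm t) * norm t ^ 2"
          using elim t by (simp add: norm_power norm_mult eval_nat_numeral mult.assoc)
        moreover have "norm t ^ 2 > 0" using t by simp
        ultimately show "norm (g t / t ^ 2) \<le> k * norm t" unfolding norm_divide norm_power by (simp only: pos_divide_le_eq)
      qed
    qed
    moreover have "((\<lambda>t::complex. k * norm t) \<longlongrightarrow> 0) (at 0)"
      by (rule tendsto_mult_right_zero[OF tendsto_norm_zero[OF tendsto_ident_at]])
    ultimately have "((\<lambda>t. g t / t ^ 2) \<longlongrightarrow> 0) (at 0)" by (rule Lim_null_comparison)
    then have "c = 0" using tendsto_unique[OF _ c(2)] by simp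
    then show False using c(1) by simp
  qed
  have idh: "(\<lambda>t. t) holomorphic_on ball 0 r" by (intro holomorphic_intros)
  have vh: "vholo (\<lambda>t. column 1 M + t *s column 2 M + g t *s column 3 M) (ball 0 r)" by (rule vholo_lin[OF idh g(1)])
  have "deriv (\<lambda>z. z) 0 = (1::complex)" "(deriv ^^ 2) (\<lambda>z. z) 0 = (0::complex)" by (simp_all add: eval_nat_numeral)
  then have w: "wr (\<lambda>t. column 1 M + t *s column 2 M + g t *s column 3 M) 0 \<noteq> 0"
    using wr_lin[OF open_ball idh g(1) z0, of "column 1 M" "column 2 M" "column 3 M"] g2 M by (simp add: invertible_columns)
  obtain K where K: "\<forall>\<^sub>F s in nhds 0. wr (\<lambda>t. column 1 M + t *s column 2 M + g t *s column 3 M) s \<noteq> 0 \<and>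
     norm (hval (\<lambda>t. column 1 M + t *s column 2 M + g t *s column 3 M) s) \<le> K"
    by (rule hval_bounded_if_wr_nonzero[OF vh open_ball z0 w])
  then have "\<forall>\<^sub>F s in at 0. wr (\<lambda>t. column 1 M + (t ^ 1) *s column 2 M + g t *s column 3 M) s \<noteq> 0 \<and>
     norm (hval (\<lambda>t. column 1 M + (t ^ 1) *s column 2 M + g t *s column 3 M) s) \<le> K"
    unfolding eventually_at_filter power_one_right by (rule eventually_mono) blast
  from bparam_bounded[OF F lb b C this] show ?thesis by blast
qed

end

subsection \<open>The global argument\<close>

lemma holomorphic_on_if_locally:
  assumes "\<And>x. x \<in> S \<Longrightarrow> \<exists>D. open D \<and> x \<in> D \<and> f holomorphic_on D"
  shows "f holomorphic_on S"
  unfolding holomorphic_on_def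
proof
  fix x assume "x \<in> S"
  then obtain D where "open D" "x \<in> D" "f holomorphic_on D" using assms by blast
  then have "f field_differentiable at x" by (simp add: holomorphic_on_imp_differentiable_at)
  then show "f field_differentiable at x within S" by (rule field_differentiable_at_within)
qed

context symform
begin

text \<open>Near a simple root the given sheet is the only solution, as it coincides with the
  implicit function; a value of \<open>hrel\<close> obtained from any other lift must therefore be
  \<open>hval\<close> of this sheet.\<close>

lemma hrel_sheet:
  assumes F: "homogeneous d F" and M: "invertible M" and c: "eval3 F (column 3 M) \<noteq> 0"
    and D: "open D" and y: "y holomorphic_on D" and yF: "\<And>x. x \<in> D \<Longrightarrow> eval3 F (aff M x (y x)) = 0" and x0: "x0 \<in> D"
    and simple: "poly (pderiv (lp d F (column 1 M + x0 *s column 2 M) (column 3 M))) (y x0) \<noteq> 0"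
    and h: "hrel F (affine_pt M x0 (y x0)) h"
  shows "h = hval (\<lambda>x. column 1 M + x *s column 2 M + y x *s column 3 M) x0 \<and>
    wr (\<lambda>x. column 1 M + x *s column 2 M + y x *s column 3 M) x0 \<noteq> 0"
proof -
  define P where "P x = lp d F (column 1 M + x *s column 2 M) (column 3 M)" for x
  have PF: "poly (P x) w = eval3 F (aff M x w)" for x w by (simp add: P_def poly_lp[OF F] aff_columns)
  interpret mf: monic_family P UNIV d "eval3 F (column 3 M)" unfolding P_def by (rule monic_family_lp[OF F c])
  have root: "poly (P x0) (y x0) = 0" using yF[OF x0] by (simp add: PF)
  obtain \<delta> \<epsilon> Y where Y: "\<delta> > 0" "\<epsilon> > 0" "\<And>z w. z \<in> ball x0 \<delta> \<Longrightarrow> w \<in> ball (y x0) \<epsilon> \<Longrightarrow> poly (P z) w = 0 \<Longrightarrow> w = Y z"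
    by (rule mf.simple_root[OF UNIV_I root _ zero_less_one]) (use simple in \<open>auto simp: P_def\<close>)
  have "isCont y x0" by (rule continuous_on_interior[OF holomorphic_on_imp_continuous_on[OF y]]) (use D x0 in \<open>simp add: interior_open\<close>)
  then have "\<forall>\<^sub>F x in nhds x0. dist (y x) (y x0) < \<epsilon>" using isCont_tendsto_nhds tendstoD Y(2) by blast
  moreover have "\<forall>\<^sub>F x in nhds x0. x \<in> D" using D x0 by (rule eventually_nhds_in_open)
  ultimately have "\<forall>\<^sub>F x in nhds x0. dist (y x) (y x0) < \<epsilon> \<and> x \<in> D" by eventually_elim simp
  then obtain \<delta>1 where \<delta>1: "\<delta>1 > 0" "\<And>x. dist x x0 < \<delta>1 \<Longrightarrow> dist (y x) (y x0) < \<epsilon> \<and> x \<in> D"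
    unfolding eventually_nhds_metric by blast
  define \<delta>2 where "\<delta>2 = min \<delta> \<delta>1"
  have \<delta>2: "\<delta>2 > 0" using Y(1) \<delta>1(1) by (simp add: \<delta>2_def)
  show ?thesis
  proof (rule hrel_unique[where Y = y, OF F M \<delta>2 Y(2) _ refl _ h])
    show "y holomorphic_on ball x0 \<delta>2" by (rule holomorphic_on_subset[OF y]) (use \<delta>1(2) in \<open>auto simp: \<delta>2_def dist_commute\<close>)
    fix x w assume x: "x \<in> ball x0 \<delta>2" and w: "w \<in> ball (y x0) \<epsilon>" and Fz: "eval3 F (aff M x w) = 0"
    have xd: "x \<in> ball x0 \<delta>" "dist x x0 < \<delta>1" using x by (auto simp: \<delta>2_def dist_commute)
    have "w = Y x" using Y(3)[OF xd(1) w] Fz by (simp only: PF)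
    moreover have "y x = Y x" using Y(3)[OF xd(1), of "y x"] \<delta>1(2)[OF xd(2)] yF[of x] by (simp add: PF dist_commute)
    ultimately show "w = y x" by simp
  qed
qed

text \<open>The relation satisfied by y is homogenized to a nonzero quadratic form G that vanishes
  at infinitely many points of the curve. Hence F divides G, which bounds the degree of F.\<close>

lemma hval_constant_sheet_degree:
  assumes F: "irreducible F" "homogeneous d F" and M: "invertible M" and D: "open D" "convex D" "D \<noteq> {}"
    and y: "y holomorphic_on D" and yF: "\<And>x. x \<in> D \<Longrightarrow> eval3 F (aff M x (y x)) = 0"
    and Bnz: "\<And>x. x \<in> D \<Longrightarrow> B (aff M x (y x)) (aff M x (y x)) \<noteq> 0"
    and w: "\<And>x. x \<in> D \<Longrightarrow> wr (\<lambda>x. column 1 M + x *s column 2 M + y x *s column 3 M) x \<noteq> 0"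
    and const: "\<And>x. x \<in> D \<Longrightarrow> hval (\<lambda>x. column 1 M + x *s column 2 M + y x *s column 3 M) x = c"
  shows "d \<le> 2"
proof -
  have det: "det3 (column 1 M) (column 2 M) (column 3 M) \<noteq> 0" using M by (simp add: invertible_columns)
  have idh: "(\<lambda>t. t) holomorphic_on D" by (intro holomorphic_intros)
  have Y2: "(deriv ^^ 2) y x \<noteq> 0" if "x \<in> D" for x
  proof
    assume "(deriv ^^ 2) y x = 0"
    moreover have "(deriv ^^ 2) (\<lambda>z. z) x = (0::complex)" by (simp add: eval_nat_numeral)
    ultimately show False using w[OF that] wr_lin[OF D(1) idh y that, of "column 1 M" "column 2 M" "column 3 M"] by simp
  qed
  obtain r1 r2 r3 r4 r5 r6 where r: "(r3, r5, r6) \<noteq> (0, 0, 0)"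
    "\<And>t. t \<in> D \<Longrightarrow> r1 + r2 * t + r3 * y t + r4 * t ^ 2 + r5 * t * y t + r6 * y t ^ 2 = 0"
  proof (rule conic_if_hval_constant[OF D(2,1,3) y Y2 det refl _ const])
    show "B (column 1 M + t *s column 2 M + y t *s column 3 M) (column 1 M + t *s column 2 M + y t *s column 3 M) \<noteq> 0" if "t \<in> D" for t
      using Bnz[OF that] by (simp only: aff_columns not_False_eq_True)
  qed blast+
  define \<xi> where "\<xi> i u = (matrix_inv M *v u) $ i" for i u
  define R where "R u = r1 * (\<xi> 1 u * \<xi> 1 u) + r2 * (\<xi> 1 u * \<xi> 2 u) + r3 * (\<xi> 1 u * \<xi> 3 u) + r4 * (\<xi> 2 u * \<xi> 2 u) +
     r5 * (\<xi> 2 u * \<xi> 3 u) + r6 * (\<xi> 3 u * \<xi> 3 u)" for u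
  have "polyfun (\<xi> i)" for i unfolding \<xi>_def[abs_def] matrix_vector_mult_def
    by simp (intro polyfun_sum polyfun_mult polyfun_const polyfun_component)
  then have "polyfun R" unfolding R_def[abs_def] by (intro polyfun_add polyfun_mult polyfun_const)
  then obtain G where G: "\<And>u. eval3 G u = R u" unfolding polyfun_def by blast
  have \<xi>M: "\<xi> i (l *s aff M s t) = l * (vector [1, s, t] :: complex^3) $ i" for i l s t
    using inv_mult(1)[OF M, of "vector [1, s, t]"] by (simp add: \<xi>_def vector_scalar_commute)
  have Raff: "R (l *s aff M s t) = l ^ 2 * (r1 + r2 * s + r3 * t + r4 * s ^ 2 + r5 * s * t + r6 * t ^ 2)" for l s t
    unfolding R_def \<xi>M by (simp add: vector_3 power2_eq_square algebra_simps)
  have \<xi>s: "\<xi> i (l *s u) = l * \<xi> i u" for i l u by (simp add: \<xi>_def vector_scalar_commute)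
  have Rsc: "eval3 G (l *s u) = l ^ 2 * eval3 G u" for l u
    unfolding G R_def by (simp add: \<xi>s power2_eq_square algebra_simps)
  have Gnz: "G \<noteq> 0"
  proof
    assume "G = 0"
    then have z: "r1 + r2 * s + r3 * t + r4 * s ^ 2 + r5 * s * t + r6 * t ^ 2 = 0" for s t
      using G[of "1 *s aff M s t"] Raff[of 1 s t] by simp
    have 1: "r1 = 0" using z[of 0 0] by simp
    have 2: "r3 + r6 = 0" "r6 - r3 = 0" using z[of 0 1] z[of 0 "-1"] 1 by (simp_all add: algebra_simps)
    have "2 * r6 = (r3 + r6) + (r6 - r3)" by simp
    then have 3: "r6 = 0" "r3 = 0" using 2 by simp_all
    have 4: "r2 + r4 = 0" using z[of 1 0] 1 by simp
    have "r2 + r4 + r5 = 0" using z[of 1 1] 1 3 by (simp add: algebra_simps)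
    then have "r5 = 0" using 4 by simp
    then show False using r(1) 3 by simp
  qed
  define X where "X = (\<lambda>x. affine_pt M x (y x)) ` D"
  have "infinite D" using D(1,3) finite_imp_not_open by blast
  moreover have "inj_on (\<lambda>x. affine_pt M x (y x)) D" by (rule inj_onI) (use affine_pt_inj[OF M] in blast)
  ultimately have inf: "infinite X" unfolding X_def using finite_image_iff by blast
  have "F dvd G"
  proof (rule dvd_if_infinite_common_zeros[OF F(1) inf])
    fix v :: "complex^3" and a :: complex assume v: "v \<noteq> 0" "pt v \<in> X" "a \<noteq> 0"
    then obtain x where x: "x \<in> D" "pt (aff M x (y x)) = pt v" unfolding X_def affine_pt_def by force
    then obtain l where l: "v = l *s aff M x (y x)" using pt_eq_iff[OF aff_nz[OF M] v(1)] by blast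
    have "eval3 F (a *s v) = 0" unfolding l eval3_scale[OF F(2)] using yF[OF x(1)] by simp
    moreover have "eval3 G (a *s v) = 0" unfolding Rsc unfolding l G Raff using r(2)[OF x(1)] by simp
    ultimately show "eval3 F (a *s v) = 0 \<and> eval3 G (a *s v) = 0" by simp
  qed
  show ?thesis
  proof (rule ccontr)
    assume "\<not> d \<le> 2"
    then have "G = 0" by (intro dvd_lower_degree[OF F(2) Rsc _ \<open>F dvd G\<close>]) simp
    then show False using Gnz by simp
  qed
qed

text \<open>At every point of a compact disc some factor vanishes. One of the finitely many factors
  vanishes infinitely often there, and the identity theorem extends this to D.\<close>

lemma holomorphic_prod_eq_0:
  assumes D: "open D" "connected D" "x0 \<in> D" and "finite W" and f: "\<And>w. w \<in> W \<Longrightarrow> f w holomorphic_on D"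
    and z: "\<And>x. x \<in> D \<Longrightarrow> (\<Prod>w\<in>W. f w x) = (0::complex)"
  shows "\<exists>w\<in>W. \<forall>x\<in>D. f w x = 0"
proof -
  obtain e where e: "e > 0" "cball x0 e \<subseteq> D" using open_contains_cball_eq[OF D(1)] D(3) by blast
  have "cball x0 e \<subseteq> (\<Union>w\<in>W. {x \<in> cball x0 e. f w x = 0})"
    using z e(2) \<open>finite W\<close> by (force simp: prod_zero_iff)
  moreover have "infinite (cball x0 e)"
  proof -
    have "infinite (ball x0 e)" using finite_imp_not_open[OF _ open_ball] e(1) by force
    then show ?thesis using ball_subset_cball finite_subset by blast
  qed
  ultimately have "\<not> finite (\<Union>w\<in>W. {x \<in> cball x0 e. f w x = 0})" using finite_subset by blast
  then obtain w where w: "w \<in> W" "infinite {x \<in> cball x0 e. f w x = 0}" using \<open>finite W\<close> by blast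
  then obtain l where l: "l \<in> cball x0 e" "l islimpt {x \<in> cball x0 e. f w x = 0}"
    using compact_cball[of x0 e] unfolding compact_eq_Bolzano_Weierstrass by (metis (no_types, lifting) mem_Collect_eq subsetI)
  have "f w x = 0" if "x \<in> D" for x
    by (rule analytic_continuation[OF f[OF w(1)] D(1,2) _ _ l(2) _ that]) (use e l in auto)
  then show ?thesis using w(1) by blast
qed

theorem degree_2_if_hval_bounded:
  assumes F: "irreducible F" "homogeneous d F" "d \<ge> 1"
    and bd: "\<And>X0. \<exists>K. \<forall>\<^sub>F X in nhds X0. X \<in> zero_locus F \<longrightarrow> X \<in> Z \<or> (\<exists>h. hrel F X h \<and> norm h \<le> K)"
    and Z: "Z = {pt v | v. v \<noteq> 0 \<and> B v v = 0}" and fin: "finite (zero_locus F \<inter> Z)"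
  shows "d \<le> 2"
proof -
  \<comment> \<open>Local bounds are made uniform on the whole projective plane, so that the bound
    also holds over neighbourhoods of infinity in the affine coordinate x.\<close>
  define Q where "Q U \<longleftrightarrow> (\<exists>K. \<forall>X\<in>U. X \<in> zero_locus F \<longrightarrow> X \<in> Z \<or> (\<exists>h. hrel F X h \<and> norm h \<le> K))" for U
  have "Q UNIV"
  proof (rule eventually_nhds_cp2_sphere)
    fix X0 :: cp2
    obtain K where "\<forall>\<^sub>F X in nhds X0. X \<in> zero_locus F \<longrightarrow> X \<in> Z \<or> (\<exists>h. hrel F X h \<and> norm h \<le> K)" using bd by blast
    then show "\<exists>U. open U \<and> X0 \<in> U \<and> Q U" unfolding eventually_nhds Q_def by blast
  next
    fix \<U> :: "cp2 set set" assume "finite \<U>" and Q: "\<And>U. U \<in> \<U> \<Longrightarrow> Q U"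
    have "\<forall>U\<in>\<U>. \<exists>K. \<forall>X\<in>U. X \<in> zero_locus F \<longrightarrow> X \<in> Z \<or> (\<exists>h. hrel F X h \<and> norm h \<le> K)" using Q unfolding Q_def by blast
    from bchoice[OF this] obtain K where K: "\<forall>U\<in>\<U>. \<forall>X\<in>U. X \<in> zero_locus F \<longrightarrow> X \<in> Z \<or> (\<exists>h. hrel F X h \<and> norm h \<le> K U)" by blast
    have "norm h \<le> Max (insert 0 (K ` \<U>))" if "U \<in> \<U>" "norm h \<le> K U" for U and h :: complex
      using that \<open>finite \<U>\<close> by (intro order_trans[OF that(2)] Max_ge) auto
    then show "Q (\<Union> \<U>)" unfolding Q_def using K by (intro exI[of _ "Max (insert 0 (K ` \<U>))"]) blast
  next
    show "Q V \<Longrightarrow> U \<subseteq> V \<Longrightarrow> Q U" for U V unfolding Q_def by blast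
  qed
  then obtain K where K: "\<And>X. X \<in> zero_locus F \<Longrightarrow> X \<notin> Z \<Longrightarrow> \<exists>h. hrel F X h \<and> norm h \<le> K" unfolding Q_def by blast
  have "\<exists>c. eval3 F c \<noteq> 0"
  proof (rule ccontr)
    assume "\<not> ?thesis"
    then have "F = 0" by (intro eval3_eq_0_imp) blast
    then show False using F(1) by simp
  qed
  then obtain c where c: "eval3 F c \<noteq> 0" by blast
  have c0: "c \<noteq> 0"
  proof
    assume "c = 0"
    then show False using c eval3_scale[OF F(2), of 0 0] F(3) by (simp add: zero_power)
  qed
  have "\<exists>v. v \<noteq> 0 \<and> (\<forall>l. c \<noteq> l *s v)"
  proof (cases "c $ 1 = 0")
    case False
    then show ?thesis by (intro exI[of _ "vector [0, 1, 0]"]) (auto simp: vec3_eq_iff vector_3)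
  next
    case True
    then show ?thesis using c0 by (intro exI[of _ "vector [1, 0, 0]"]) (auto simp: vec3_eq_iff vector_3)
  qed
  then obtain v where v: "v \<noteq> 0" "\<And>l. c \<noteq> l *s v" by blast
  obtain b where b: "det3 v b c \<noteq> 0" by (rule det3_complement[OF v])
  define M where "M = cols v b c"
  have M: "invertible M" using b by (simp add: invertible_columns M_def)
  have colM: "column 1 M = v" "column 2 M = b" "column 3 M = c" by (simp_all add: M_def)
  define P where "P x = lp d F (v + x *s b) c" for x
  have PF: "poly (P x) w = eval3 F (aff M x w)" for x w by (simp add: P_def poly_lp[OF F(2)] aff_columns colM)
  have PK: "affine_pt M x w \<in> zero_locus F \<longleftrightarrow> poly (P x) w = 0" for x w
    using affine_pt_zero_locus[OF F(2) M, of x w] by (simp add: colM P_def)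
  interpret mf: monic_family P UNIV d "eval3 F c" unfolding P_def by (rule monic_family_lp[OF F(2) c])
  \<comment> \<open>The finitely many x over which roots collide or the curve meets the conic. Over
    the complement the sheets are locally holomorphic and the bound applies to them.\<close>
  define S where "S = {x. \<exists>w. poly (P x) w = 0 \<and> poly (pderiv (P x)) w = 0} \<union>
     fst ` ((\<lambda>p. affine_pt M (fst p) (snd p)) -` (zero_locus F \<inter> Z))"
  have "inj (\<lambda>p. affine_pt M (fst p) (snd p))" by (rule injI) (use affine_pt_inj[OF M] in \<open>auto simp: prod_eq_iff\<close>)
  then have "finite ((\<lambda>p. affine_pt M (fst p) (snd p)) -` (zero_locus F \<inter> Z))" by (rule finite_vimageI[OF fin])
  then have S: "finite S" unfolding S_def
    using finite_multiple_roots[OF F M] c by (intro finite_UnI finite_imageI) (simp_all add: colM P_def)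
  have So: "open (- S)" using S by (simp add: finite_imp_closed open_Compl)
  have simple: "poly (pderiv (P x)) w \<noteq> 0" if "x \<notin> S" "poly (P x) w = 0" for x w using that unfolding S_def by blast
  have notZ: "affine_pt M x w \<notin> Z" if "x \<notin> S" "poly (P x) w = 0" for x w
  proof
    assume "affine_pt M x w \<in> Z"
    then have "(x, w) \<in> (\<lambda>p. affine_pt M (fst p) (snd p)) -` (zero_locus F \<inter> Z)" using that PK by simp
    then have "x \<in> fst ` ((\<lambda>p. affine_pt M (fst p) (snd p)) -` (zero_locus F \<inter> Z))" by (rule image_eqI[rotated]) simp
    then have "x \<in> S" unfolding S_def by (rule UnI2)
    then show False using that by simp
  qed
  \<comment> \<open>A chosen value that obeys the bound; \<open>hrel_sheet\<close> identifies it
    with \<open>hval\<close> of the sheet through the point.\<close>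
  define hh where "hh x w = (SOME h. hrel F (affine_pt M x w) h \<and> norm h \<le> K)" for x w
  have hh: "hrel F (affine_pt M x w) (hh x w) \<and> norm (hh x w) \<le> K" if "x \<notin> S" "poly (P x) w = 0" for x w
    unfolding hh_def by (rule someI_ex, rule K) (use that PK notZ in blast)+
  have fin_roots: "finite {w. poly (P x) w = 0}" for x using mf.P_nz[of x] poly_roots_finite by blast
  have local: "\<exists>y. (\<forall>w\<in>{w. poly (P x0) w = 0}. y w holomorphic_on D \<and> (\<forall>x\<in>D. poly (P x) (y w x) = 0 \<and>
       wr (\<lambda>x. v + x *s b + y w x *s c) x \<noteq> 0 \<and> hval (\<lambda>x. v + x *s b + y w x *s c) x = hh x (y w x))) \<and>
     (\<forall>x\<in>D. bij_betw (\<lambda>w. y w x) {w. poly (P x0) w = 0} {w. poly (P x) w = 0})"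
    if D: "open D" "convex D" "x0 \<in> D" "D \<subseteq> - S" for D x0
  proof -
    interpret sm: simple_monic_family P D d "eval3 F c"
    proof
      show "poly (pderiv (P z)) w \<noteq> 0" if "z \<in> D" "poly (P z) w = 0" for z w using simple[of z w] that D(4) by blast
    qed (use D F(3) c mf.deg mf.lc holomorphic_on_subset[OF mf.holo] in auto)
    have "\<forall>w\<in>{w. poly (P x0) w = 0}. \<exists>y. y holomorphic_on D \<and> y x0 = w \<and> (\<forall>x\<in>D. poly (P x) (y x) = 0)"
    proof
      fix w assume "w \<in> {w. poly (P x0) w = 0}"
      then have "poly (P x0) w = 0" by simp
      show "\<exists>y. y holomorphic_on D \<and> y x0 = w \<and> (\<forall>x\<in>D. poly (P x) (y x) = 0)"
        by (rule sm.global_sheet[OF D(2,3) \<open>poly (P x0) w = 0\<close>]) blast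
    qed
    from bchoice[OF this] obtain y where
      "\<forall>w\<in>{w. poly (P x0) w = 0}. y w holomorphic_on D \<and> y w x0 = w \<and> (\<forall>x\<in>D. poly (P x) (y w x) = 0)" ..
    then have y: "y w holomorphic_on D \<and> y w x0 = w \<and> (\<forall>x\<in>D. poly (P x) (y w x) = 0)" if "poly (P x0) w = 0" for w
      using that by simp
    have hv: "hh x (y w x) = hval (\<lambda>x. v + x *s b + y w x *s c) x \<and> wr (\<lambda>x. v + x *s b + y w x *s c) x \<noteq> 0"
      if w: "poly (P x0) w = 0" and x: "x \<in> D" for w x
    proof (rule hrel_sheet[OF F(2) M _ D(1), of "y w" x "hh x (y w x)", unfolded colM])
      have xS: "x \<notin> S" and rt: "poly (P x) (y w x) = 0" using x D(4) y[OF w] by auto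
      show "poly (pderiv (lp d F (v + x *s b) c)) (y w x) \<noteq> 0" using simple[OF xS rt] by (simp add: P_def)
      show "hrel F (affine_pt M x (y w x)) (hh x (y w x))" using hh[OF xS rt] by blast
    qed (use c y[OF w] x PF in auto)
    \<comment> \<open>Sheets that meet over x agree over x0, where they are labelled by their
      values; both fibres have d elements.\<close>
    have bij: "bij_betw (\<lambda>w. y w x) {w. poly (P x0) w = 0} {w. poly (P x) w = 0}" if x: "x \<in> D" for x
    proof -
      have inj: "inj_on (\<lambda>w. y w x) {w. poly (P x0) w = 0}"
      proof (rule inj_onI)
        fix w w' assume w: "w \<in> {w. poly (P x0) w = 0}" "w' \<in> {w. poly (P x0) w = 0}" "y w x = y w' x"
        have "y w x0 = y w' x0"
          by (rule sm.sheet_unique[where y = "y w" and y' = "y w'", OF D(2) _ _ _ _ x w(3) D(3)]) (use y w in auto)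
        then show "w = w'" using y w by auto
      qed
      have "(\<lambda>w. y w x) ` {w. poly (P x0) w = 0} = {w. poly (P x) w = 0}"
      proof (rule card_subset_eq)
        show "finite {w. poly (P x) w = 0}" by (rule fin_roots)
        show "(\<lambda>w. y w x) ` {w. poly (P x0) w = 0} \<subseteq> {w. poly (P x) w = 0}" using y x by blast
        show "card ((\<lambda>w. y w x) ` {w. poly (P x0) w = 0}) = card {w. poly (P x) w = 0}"
          unfolding card_image[OF inj] sm.card_roots[OF D(3)] sm.card_roots[OF x] ..
      qed
      with inj show ?thesis unfolding bij_betw_def by blast
    qed
    show ?thesis
    proof (intro exI[of _ y] conjI ballI)
      fix w x assume w: "w \<in> {w. poly (P x0) w = 0}" and x: "x \<in> D"
      then have "poly (P x0) w = 0" by simp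
      note yw = y[OF this] hv[OF this x]
      show "poly (P x) (y w x) = 0" using yw(1) x by blast
      show "wr (\<lambda>x. v + x *s b + y w x *s c) x \<noteq> 0" using yw(2) by blast
      show "hval (\<lambda>x. v + x *s b + y w x *s c) x = hh x (y w x)" using yw(2) by simp
    qed (use y bij in simp_all)
  qed
  have locD: "\<exists>D. open D \<and> convex D \<and> x0 \<in> D \<and> D \<subseteq> - S" if "x0 \<notin> S" for x0
  proof -
    have "x0 \<in> - S" using that by simp
    then obtain e where "e > 0" "ball x0 e \<subseteq> - S" by (rule openE[OF So])
    then show ?thesis by (intro exI[of _ "ball x0 e"]) simp
  qed
  have "infinite (UNIV - S)" by (rule Diff_infinite_finite[OF S infinite_UNIV_char_0])
  then have "UNIV - S \<noteq> {}" by (rule infinite_imp_nonempty)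
  then obtain x1 where x1: "x1 \<notin> S" by blast
  have "\<not> constant (poly (P x1))" using mf.deg[of x1] F(3) by (simp add: constant_degree)
  then obtain w1 where w1: "poly (P x1) w1 = 0" using fundamental_theorem_of_algebra by blast
  \<comment> \<open>The value at one point of the curve, so that one factor of the product vanishes
    at x1.\<close>
  define c1 where "c1 = hh x1 w1"
  \<comment> \<open>The labelling of sheets is only local because of monodromy. The product over the
    whole fibre does not depend on it and is defined globally.\<close>
  define N where "N x = (\<Prod>w\<in>{w. poly (P x) w = 0}. hh x w - c1)" for x
  have Nloc: "N x = (\<Prod>w\<in>{w. poly (P x0) w = 0}. hh x (y w x) - c1)"
    if "bij_betw (\<lambda>w. y w x) {w. poly (P x0) w = 0} {w. poly (P x) w = 0}" for x x0 y
    unfolding N_def by (rule prod.reindex_bij_betw[OF that, symmetric])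
  have hol: "(hval (\<lambda>x. v + x *s b + y x *s c)) holomorphic_on D"
    if "open D" "y holomorphic_on D" "\<And>x. x \<in> D \<Longrightarrow> wr (\<lambda>x. v + x *s b + y x *s c) x \<noteq> 0" for D y
    by (rule holomorphic_hval[OF vholo_lin[OF _ that(2)] that(1,3)]) (auto intro: holomorphic_intros)
  have "N holomorphic_on (- S)"
  proof (rule holomorphic_on_if_locally)
    fix x0 assume "x0 \<in> - S"
    then obtain D where D: "open D" "convex D" "x0 \<in> D" "D \<subseteq> - S" using locD by blast
    obtain y where y: "\<forall>w\<in>{w. poly (P x0) w = 0}. y w holomorphic_on D \<and> (\<forall>x\<in>D. poly (P x) (y w x) = 0 \<and>
       wr (\<lambda>x. v + x *s b + y w x *s c) x \<noteq> 0 \<and> hval (\<lambda>x. v + x *s b + y w x *s c) x = hh x (y w x))"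
      "\<forall>x\<in>D. bij_betw (\<lambda>w. y w x) {w. poly (P x0) w = 0} {w. poly (P x) w = 0}" using local[OF D] by (elim exE conjE) (rule that)
    have h1: "(\<lambda>x. \<Prod>w\<in>{w. poly (P x0) w = 0}. hval (\<lambda>x. v + x *s b + y w x *s c) x - c1) holomorphic_on D"
      using y(1) by (intro holomorphic_intros hol D) auto
    have h2: "N x = (\<Prod>w\<in>{w. poly (P x0) w = 0}. hval (\<lambda>x. v + x *s b + y w x *s c) x - c1)" if "x \<in> D" for x
      using Nloc[where y = y, OF y(2)[rule_format, OF that]] y(1) that by (auto intro!: prod.cong)
    have "N holomorphic_on D" by (rule holomorphic_transform[OF h1]) (simp only: h2)
    then show "\<exists>D. open D \<and> x0 \<in> D \<and> N holomorphic_on D" using D by blast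
  qed
  \<comment> \<open>The summand 1 makes the base at least 1, so that the number of roots in the
    exponent may be replaced by d.\<close>
  have Nbd: "norm (N x) \<le> (K + norm c1 + 1) ^ d" if x: "x \<notin> S" for x
  proof -
    obtain D where D: "open D" "convex D" "x \<in> D" "D \<subseteq> - S" using locD[OF x] by blast
    have le: "norm (hh x w - c1) \<le> K + norm c1 + 1" if "poly (P x) w = 0" for w
      using hh[OF x that] norm_triangle_ineq4[of "hh x w" c1] by linarith
    have K0: "0 \<le> K" using hh[OF x1 w1] norm_ge_zero[of "hh x1 w1"] by linarith
    have "norm (N x) \<le> (\<Prod>w\<in>{w. poly (P x) w = 0}. K + norm c1 + 1)"
      unfolding N_def prod_norm[symmetric] by (intro prod_mono) (use le in auto)
    also have "\<dots> = (K + norm c1 + 1) ^ card {w. poly (P x) w = 0}" by simp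
    also have "\<dots> \<le> (K + norm c1 + 1) ^ d"
      by (rule power_increasing) (use K0 card_poly_roots_bound[OF mf.P_nz[of x]] mf.deg[of x] in auto)
    finally show ?thesis .
  qed
  \<comment> \<open>N is bounded near the points of S, which are therefore removable
    singularities.\<close>
  obtain G where G: "G holomorphic_on UNIV" "\<And>x. x \<notin> S \<Longrightarrow> G x = N x"
  proof -
    have "\<exists>g. g holomorphic_on UNIV \<and> (\<forall>z\<in>UNIV - S. g z = N z)"
    proof (rule removable_singularities[OF S])
      show "N holomorphic_on UNIV - S" using \<open>N holomorphic_on (- S)\<close> by (simp add: Compl_eq_Diff_UNIV)
      fix z assume "z \<in> S"
      have "open (- (S - {z}))" by (intro open_Compl finite_imp_closed finite_Diff S)
      then have "\<forall>\<^sub>F x in at z. x \<in> - (S - {z}) - {z}" by (intro eventually_at_in_open) auto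
      then have "\<forall>\<^sub>F x in at z. norm (N x) \<le> (K + norm c1 + 1) ^ d * norm (1::complex)"
        by eventually_elim (use Nbd in auto)
      then show "N \<in> O[at z](\<lambda>_. 1)" by (rule landau_o.bigI[rotated]) (use hh[OF x1 w1] norm_ge_zero[of c1] norm_ge_zero[of "hh x1 w1"] in \<open>intro zero_less_power, linarith\<close>)
    qed simp
    then show ?thesis using that by blast
  qed
  have "bounded (G ` (- S))" unfolding bounded_iff using Nbd G(2) by (intro exI[of _ "(K + norm c1 + 1) ^ d"]) auto
  then have "bounded (G ` (- S) \<union> G ` S)" using S by (simp add: finite_imp_bounded)
  then have "bounded (range G)" by (rule bounded_subset) auto
  from Liouville_theorem[OF G(1) this] obtain k where k: "\<And>x. G x = k" unfolding constant_on_def by blast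
  have "N x1 = 0" unfolding N_def using w1 fin_roots[of x1] by (auto simp: prod_zero_iff c1_def)
  then have N0: "N x = 0" if "x \<notin> S" for x using G(2)[OF that] G(2)[OF x1] k[of x] k[of x1] by simp
  obtain D where D: "open D" "convex D" "x1 \<in> D" "D \<subseteq> - S" using locD[OF x1] by blast
  obtain y where y: "\<forall>w\<in>{w. poly (P x1) w = 0}. y w holomorphic_on D \<and> (\<forall>x\<in>D. poly (P x) (y w x) = 0 \<and>
     wr (\<lambda>x. v + x *s b + y w x *s c) x \<noteq> 0 \<and> hval (\<lambda>x. v + x *s b + y w x *s c) x = hh x (y w x))"
    "\<forall>x\<in>D. bij_betw (\<lambda>w. y w x) {w. poly (P x1) w = 0} {w. poly (P x) w = 0}" using local[OF D] by (elim exE conjE) (rule that)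
  have pz: "(\<Prod>w\<in>{w. poly (P x1) w = 0}. hval (\<lambda>x. v + x *s b + y w x *s c) x - c1) = 0" if "x \<in> D" for x
  proof -
    have "(\<Prod>w\<in>{w. poly (P x1) w = 0}. hval (\<lambda>x. v + x *s b + y w x *s c) x - c1) = N x"
      unfolding Nloc[where y = y, OF y(2)[rule_format, OF that]] using y(1) that by (auto intro!: prod.cong)
    then show ?thesis using N0 that D(4) by auto
  qed
  have "\<exists>w\<in>{w. poly (P x1) w = 0}. \<forall>x\<in>D. hval (\<lambda>x. v + x *s b + y w x *s c) x - c1 = 0"
  proof (rule holomorphic_prod_eq_0[OF D(1) convex_connected[OF D(2)] D(3) fin_roots[of x1] _ pz])
    show "(\<lambda>x. hval (\<lambda>x. v + x *s b + y w x *s c) x - c1) holomorphic_on D" if "w \<in> {w. poly (P x1) w = 0}" for w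
      using y(1) that by (intro holomorphic_intros hol D) auto
  qed
  then obtain w where w: "w \<in> {w. poly (P x1) w = 0}" "\<forall>x\<in>D. hval (\<lambda>x. v + x *s b + y w x *s c) x - c1 = 0" ..
  have yw: "y w holomorphic_on D" "\<And>x. x \<in> D \<Longrightarrow> poly (P x) (y w x) = 0" "\<And>x. x \<in> D \<Longrightarrow> wr (\<lambda>x. v + x *s b + y w x *s c) x \<noteq> 0"
    using y(1) w(1) by auto
  show ?thesis
  proof (rule hval_constant_sheet_degree[OF F(1,2) M D(1,2) _ yw(1), unfolded colM])
    show "D \<noteq> {}" using D(3) by blast
    show "eval3 F (aff M x (y w x)) = 0" if "x \<in> D" for x using yw(2)[OF that] by (simp only: PF)
    show "B (aff M x (y w x)) (aff M x (y w x)) \<noteq> 0" if "x \<in> D" for x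
    proof
      assume "B (aff M x (y w x)) (aff M x (y w x)) = 0"
      then have "affine_pt M x (y w x) \<in> Z" unfolding Z affine_pt_def using aff_nz[OF M] by blast
      then show False using notZ[of x "y w x"] that D(4) yw(2)[OF that] by blast
    qed
    show "hval (\<lambda>x. v + x *s b + y w x *s c) x = c1" if "x \<in> D" for x using bspec[OF w(2) that] by simp
  qed (use yw in auto)
qed

end

subsection \<open>Equations of conics\<close>

lemma quadratic_form_polarization:
  assumes Q: "homogeneous 2 Q"
  obtains B where "symform B" "\<And>v. B v v = eval3 Q v"
proof -
  define q where "q i j k = coeff (coeff (coeff Q k) j) i" for i j k
  have z: "q i j k = 0" if "i + j + k \<noteq> 2" for i j k using Q that unfolding homogeneous_def q_def by blast
  have e: "eval3 Q v = q 2 0 0 * (v$1 * v$1) + q 0 2 0 * (v$2 * v$2) + q 0 0 2 * (v$3 * v$3) +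
      q 1 1 0 * (v$1 * v$2) + q 1 0 1 * (v$1 * v$3) + q 0 1 1 * (v$2 * v$3)" for v
    unfolding eval3_sum[OF Q] q_def[symmetric] by (simp add: numeral_2_eq_2 z)
  define B where "B u v = q 2 0 0 * (u$1 * v$1) + q 0 2 0 * (u$2 * v$2) + q 0 0 2 * (u$3 * v$3) +
      q 1 1 0 / 2 * (u$1 * v$2 + u$2 * v$1) + q 1 0 1 / 2 * (u$1 * v$3 + u$3 * v$1) + q 0 1 1 / 2 * (u$2 * v$3 + u$3 * v$2)"
    for u v :: "complex^3"
  have "symform B" by unfold_locales (simp_all add: B_def algebra_simps)
  moreover have "B v v = eval3 Q v" for v unfolding e B_def by (simp add: algebra_simps)
  ultimately show ?thesis by (rule that)
qed

context symform
begin

lemma form_derivative: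
  assumes Q: "homogeneous 2 Q" "\<And>v. B v v = eval3 Q v"
  shows "(eval3 Q has_derivative (\<lambda>u. 2 * B v u)) (at v)"
proof -
  obtain D where D: "(eval3 Q has_derivative D) (at v)" "\<And>c x. D (c *s x) = c * D x" "\<And>u. D u = poly (pderiv (lp 2 Q v u)) 0"
    by (rule eval3_cderiv[OF Q(1), of v]) blast
  have "D u = 2 * B v u" for u
  proof -
    have "poly (lp 2 Q v u) t = poly [:B v v, 2 * B v u, B u u:] t" for t
      unfolding poly_lp[OF Q(1)] Q(2)[symmetric] by (simp add: B_add B_add' B_scale B_scale' B_sym[of u v] algebra_simps)
    then have "lp 2 Q v u = [:B v v, 2 * B v u, B u u:]" using poly_eq_poly_eq_iff by blast
    then show ?thesis unfolding D(3) by (simp add: pderiv_pCons)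
  qed
  then have "D = (\<lambda>u. 2 * B v u)" by blast
  then show ?thesis using D(1) by simp
qed

end

lemma zero_locus_mono_dvd:
  assumes "F dvd G" shows "zero_locus F \<subseteq> zero_locus G"
  using assms unfolding zero_locus_def dvd_def by auto

lemma lform_derivative: "(eval3 (lform n) has_derivative eval3 (lform n)) (at v)"
proof (rule bounded_linear_imp_has_derivative)
  have "linear (eval3 (lform n))" by (rule linearI) (simp_all add: eval3_lform algebra_simps)
  then show "bounded_linear (eval3 (lform n))" by (simp add: linear_conv_bounded_linear)
qed

lemma curve_equation_lform:
  assumes "n \<noteq> 0" shows "curve_equation (zero_locus (lform n)) (lform n)"
  unfolding curve_equation_def
  using homogeneous_lform[of n] irreducible_lform[OF assms] irreducible_not_unit[OF irreducible_lform[OF assms]]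
  by (auto intro!: squarefree_prime_elem irreducible_imp_prime_elem)

lemma projective_line_lform:
  assumes "n \<noteq> 0" shows "projective_line (zero_locus (lform n))"
  unfolding projective_line_def using curve_equation_lform[OF assms] homogeneous_lform by blast

lemma projective_lineE:
  assumes "projective_line L"
  obtains n where "n \<noteq> 0" "L = zero_locus (lform n)"
proof -
  obtain F where F: "curve_equation L F" "homogeneous 1 F" using assms unfolding projective_line_def by blast
  obtain n where n: "F = lform n" using homogeneous_1_lform[OF F(2)] by blast
  have "n \<noteq> 0" using F(1) n lform_eq_0_iff[of n] by (auto simp: curve_equation_def)
  then show ?thesis using that F(1) n by (simp add: curve_equation_def)
qed

lemma curve_tangent_lform:
  assumes "n \<noteq> 0" "v \<noteq> 0" "eval3 (lform n) v = 0"
  shows "curve_tangent (zero_locus (lform n)) (pt v) (zero_locus (lform n))"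
proof -
  have "eval3 (lform n) \<noteq> (\<lambda>_. 0)"
  proof
    assume "eval3 (lform n) = (\<lambda>_. 0)"
    then have "lform n = 0" by (intro eval3_eq_0_imp) simp
    then show False using assms(1) by (simp add: lform_eq_0_iff)
  qed
  then show ?thesis unfolding curve_tangent_def
    by (intro exI[of _ "lform n"] exI[of _ v] exI[of _ "eval3 (lform n)"] conjI curve_equation_lform assms refl lform_derivative)
      (simp_all add: zero_locus_def)
qed

lemma lform_scale: "eval3 (lform n) (l *s v) = l * eval3 (lform n) v"
  using eval3_scale[OF homogeneous_lform, of n l v] by simp

lemma lform_not_dvd:
  assumes "n1 \<noteq> 0" "n2 \<noteq> 0" "zero_locus (lform n1) \<noteq> zero_locus (lform n2)"
  shows "\<not> lform n1 dvd lform n2"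
proof
  assume "lform n1 dvd lform n2"
  then have "lform n2 dvd lform n1"
    using irreducible_lform[OF assms(2)] irreducible_not_unit[OF irreducible_lform[OF assms(1)]] irreducibleD' by blast
  then show False using zero_locus_mono_dvd[OF \<open>lform n1 dvd lform n2\<close>] zero_locus_mono_dvd assms(3) by blast
qed

lemma line_pair_equation:
  assumes n: "n1 \<noteq> 0" "n2 \<noteq> 0" "zero_locus (lform n1) \<noteq> zero_locus (lform n2)"
  shows "curve_equation (zero_locus (lform n1) \<union> zero_locus (lform n2)) (lform n1 * lform n2)"
    "homogeneous 2 (lform n1 * lform n2)"
proof -
  show h: "homogeneous 2 (lform n1 * lform n2)" using homogeneous_mult[OF homogeneous_lform[of n1] homogeneous_lform[of n2]] unfolding one_add_one .
  have pr: "prime_elem (lform n1)" "prime_elem (lform n2)" using n irreducible_lform irreducible_imp_prime_elem by blast+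
  have "coprime (lform n1) (lform n2)" by (rule prime_elem_imp_coprime[OF pr(1) lform_not_dvd[OF n]])
  then have "squarefree (lform n1 * lform n2)"
    using pr squarefree_prime_elem by (intro squarefree_mult_coprime) blast+
  moreover have "\<not> is_unit (lform n1 * lform n2)" using pr(1) by (auto simp: is_unit_mult_iff)
  moreover have "zero_locus (lform n1) \<union> zero_locus (lform n2) = zero_locus (lform n1 * lform n2)"
    unfolding zero_locus_def by auto
  ultimately show "curve_equation (zero_locus (lform n1) \<union> zero_locus (lform n2)) (lform n1 * lform n2)"
    unfolding curve_equation_def using h by blast
qed

section \<open>Zeros of cofactors of forms and regular points of line pairs\<close>

lemma eval3_line: "\<exists>p. \<forall>t. eval3 K (x + t *s c) = poly p t"
proof -
  have 1: "\<exists>p. \<forall>t. poly a (x $ 1 + t * c $ 1) = poly p t" for a :: "complex poly"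
    by (intro exI[of _ "pcompose a [:x $ 1, c $ 1:]"]) (simp add: poly_pcompose)
  have 2: "\<exists>p. \<forall>t. poly (poly a [:x $ 2 + t * c $ 2:]) (x $ 1 + t * c $ 1) = poly p t" for a :: "complex poly poly"
  proof (induction a)
    case 0
    show ?case by (intro exI[of _ 0]) simp
  next
    case (pCons a f)
    obtain p where p: "\<forall>t. poly (poly f [:x $ 2 + t * c $ 2:]) (x $ 1 + t * c $ 1) = poly p t" using pCons.IH by blast
    obtain p' where "\<forall>t. poly a (x $ 1 + t * c $ 1) = poly p' t" using 1 by blast
    then show ?case using p by (intro exI[of _ "p' + [:x $ 2, c $ 2:] * p"]) (simp add: algebra_simps)
  qed
  have "\<exists>p. \<forall>t. poly (poly (poly K [:[:x $ 3 + t * c $ 3:]:]) [:x $ 2 + t * c $ 2:]) (x $ 1 + t * c $ 1) = poly p t"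
  proof (induction K)
    case 0
    show ?case by (intro exI[of _ 0]) simp
  next
    case (pCons a f)
    obtain p where p: "\<forall>t. poly (poly (poly f [:[:x $ 3 + t * c $ 3:]:]) [:x $ 2 + t * c $ 2:]) (x $ 1 + t * c $ 1) = poly p t" using pCons.IH by blast
    obtain p' where "\<forall>t. poly (poly a [:x $ 2 + t * c $ 2:]) (x $ 1 + t * c $ 1) = poly p' t" using 2 by blast
    then show ?case using p by (intro exI[of _ "p' + [:x $ 3, c $ 3:] * p"]) (simp add: algebra_simps)
  qed
  then show ?thesis by (simp add: eval3_def)
qed

lemma isCont_eval3_line: "isCont (\<lambda>t. eval3 K (x + t *s c)) t0"
proof -
  obtain p where "\<And>t. eval3 K (x + t *s c) = poly p t" using eval3_line by blast
  then show ?thesis by simp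
qed

lemma punctured_zero_imp_zero:
  fixes f :: "complex \<Rightarrow> complex"
  assumes "isCont f 0" "\<And>t. t \<noteq> 0 \<Longrightarrow> f t = 0"
  shows "f 0 = 0"
proof -
  have "\<forall>\<^sub>F t in at 0. f t = 0" unfolding eventually_at_filter using assms(2) by simp
  then have "(f \<longlongrightarrow> 0) (at 0)" by (rule tendsto_eventually)
  then show ?thesis using assms(1) tendsto_unique[of "at 0" f] unfolding isCont_def by fastforce
qed

text \<open>K is known only as a quotient of forms. Its scaling follows by cancelling G where G does
  not vanish and extends to v along a line v + t u, which meets the zeros of G finitely often.
  Keeping both powers of l avoids the difference of the degrees, a truncated one in the natural
  numbers.\<close>

lemma cofactor_scale:
  assumes F: "homogeneous d (G * K)" and G: "homogeneous e G" "G \<noteq> 0" and l: "l \<noteq> 0"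
  shows "l ^ e * eval3 K (l *s v) = l ^ d * eval3 K v"
proof -
  obtain u where u: "eval3 G u \<noteq> 0" using G(2) eval3_eq_0_imp by blast
  obtain p where p: "\<And>t. eval3 G (v + t *s u) = poly p t" using eval3_line by blast
  have ident: "l ^ e * eval3 K (l *s w) = l ^ d * eval3 K w" if "eval3 G w \<noteq> 0" for w
    using eval3_scale[OF F, of l w] that by (simp add: eval3_scale[OF G(1)])
  have "lp e G v u \<noteq> 0" using coeff_lp_deg(2)[OF G(1), of v u] u by auto
  then have "finite {t. poly (lp e G v u) t = 0}" by (rule poly_roots_finite)
  then have fin: "finite {t. eval3 G (v + t *s u) = 0}" by (simp add: poly_lp[OF G(1)])
  obtain p1 where p1: "\<And>t. eval3 K (l *s v + t *s (l *s u)) = poly p1 t" using eval3_line by blast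
  obtain p2 where p2: "\<And>t. eval3 K (v + t *s u) = poly p2 t" using eval3_line by blast
  have "smult (l ^ e) p1 - smult (l ^ d) p2 = 0"
  proof (rule ccontr)
    assume "smult (l ^ e) p1 - smult (l ^ d) p2 \<noteq> 0"
    then have "finite {t. poly (smult (l ^ e) p1 - smult (l ^ d) p2) t = 0}" by (rule poly_roots_finite)
    moreover have "UNIV \<subseteq> {t. poly (smult (l ^ e) p1 - smult (l ^ d) p2) t = 0} \<union> {t. eval3 G (v + t *s u) = 0}"
    proof (intro subsetI)
      fix t
      have "l *s (v + t *s u) = l *s v + t *s (l *s u)" by (simp add: vec_eq_iff algebra_simps)
      then show "t \<in> {t. poly (smult (l ^ e) p1 - smult (l ^ d) p2) t = 0} \<union> {t. eval3 G (v + t *s u) = 0}"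
        using ident[of "v + t *s u"] by (simp only: p1 p2) auto
    qed
    ultimately have "finite (UNIV :: complex set)" using fin finite_subset by blast
    then show False using infinite_UNIV_char_0 by blast
  qed
  then have "poly (smult (l ^ e) p1 - smult (l ^ d) p2) 0 = 0" by simp
  then show ?thesis using p1[of 0] p2[of 0] by simp
qed

text \<open>If K (c) is nonzero, every line of direction c contains a zero of K, and the zeros on
  the parallel lines through w + x b are different points for different x.\<close>

lemma infinite_zeros:
  assumes K: "K \<noteq> 0" and sc: "\<And>l v. l \<noteq> 0 \<Longrightarrow> l ^ e * eval3 K (l *s v) = l ^ d * eval3 K v" and w: "w \<noteq> 0" "eval3 K w = 0"
  shows "infinite {pt v | v. v \<noteq> 0 \<and> eval3 K v = 0}"
proof
  assume fin: "finite {pt v | v. v \<noteq> 0 \<and> eval3 K v = 0}"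
  obtain c where c: "eval3 K c \<noteq> 0" using K eval3_eq_0_imp by blast
  have root: "\<exists>t. eval3 K (x + t *s c) = 0" for x
  proof (rule ccontr)
    assume no: "\<not> ?thesis"
    obtain p where p: "\<And>t. eval3 K (x + t *s c) = poly p t" using eval3_line by blast
    \<comment> \<open>Without a zero, K would be constant on the line by the fundamental theorem of
      algebra. For d \<le> e scaling makes K constant altogether, contradicting K (w) = 0; for e < d
      the expression K (c + s x) = s ^ (d - e) K (x) tends both to K (c) and to 0.\<close>
    have "constant (poly p)" using no fundamental_theorem_of_algebra[of p] by (auto simp: p)
    then have eq: "eval3 K (x + t *s c) = eval3 K x" for t using p[of t] p[of 0] unfolding constant_def by simp
    show False
    proof (cases "d \<le> e")
      case True
      have ker: "s ^ (e - d) * eval3 K (s *s w') = eval3 K w'" if "s \<noteq> 0" for s w'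
      proof -
        have "s ^ d * (s ^ (e - d) * eval3 K (s *s w')) = s ^ d * eval3 K w'"
          using sc[OF that, of w'] True by (simp add: mult.assoc[symmetric] power_add[symmetric])
        then show ?thesis using that by simp
      qed
      have cont: "isCont (\<lambda>s. s ^ (e - d) * eval3 K (s *s w') - eval3 K w') 0" for w'
        using isCont_eval3_line[where K = K and x = 0 and c = w' and ?t0.0 = 0] by (intro continuous_intros) simp
      have z: "0 ^ (e - d) * eval3 K 0 = eval3 K w'" for w'
        using punctured_zero_imp_zero[OF cont[of w']] ker[of _ w'] by simp
      show False using z[of w] z[of c] w(2) c by simp
    next
      case False
      have ker: "eval3 K (s *s w') = s ^ (d - e) * eval3 K w'" if "s \<noteq> 0" for s w'
      proof -
        have "s ^ e * eval3 K (s *s w') = s ^ e * (s ^ (d - e) * eval3 K w')"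
          using sc[OF that, of w'] False by (simp add: mult.assoc[symmetric] power_add[symmetric])
        then show ?thesis using that by simp
      qed
      have "isCont (\<lambda>s. eval3 K (c + s *s x) - s ^ (d - e) * eval3 K x) 0" using isCont_eval3_line[where K = K and x = c and c = x and ?t0.0 = 0] by (intro continuous_intros)
      moreover have "eval3 K (c + s *s x) - s ^ (d - e) * eval3 K x = 0" if s: "s \<noteq> 0" for s
      proof -
        have "c + s *s x = s *s (x + (1 / s) *s c)" using s by (simp add: vec_eq_iff field_simps)
        then have "eval3 K (c + s *s x) = eval3 K (s *s (x + (1 / s) *s c))" by (simp only:)
        also have "\<dots> = s ^ (d - e) * eval3 K x" unfolding ker[OF s] eq ..
        finally show ?thesis by simp
      qed
      ultimately have "eval3 K (c + 0 *s x) - 0 ^ (d - e) * eval3 K x = 0" by (rule punctured_zero_imp_zero)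
      then show False using c False by (simp add: zero_power)
    qed
  qed
  \<comment> \<open>A nonzero multiple of w is again a zero of K. For c = 0, scaling at the origin
    forces d = e, and scaling along w then gives K (0) = K (w) = 0.\<close>
  have "c \<noteq> l *s w" for l
  proof
    assume l: "c = l *s w"
    show False
    proof (cases "l = 0")
      case False
      then have "l ^ e * eval3 K (l *s w) = 0" using sc[OF False, of w] w(2) by simp
      then show False using c l False by simp
    next
      case True
      have nz: "eval3 K 0 \<noteq> 0" using c l True by simp
      have "2 ^ e * eval3 K 0 = 2 ^ d * eval3 K 0" using sc[of 2 0] by simp
      then have "(2::complex) ^ e = 2 ^ d" using nz by simp
      then have "(of_nat (2 ^ e) :: complex) = of_nat (2 ^ d)" by simp
      then have "(2::nat) ^ e = 2 ^ d" by (simp only: of_nat_eq_iff)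
      then have ed: "e = d" by simp
      have "isCont (\<lambda>s. eval3 K (0 + s *s w) - eval3 K w) 0" by (intro continuous_intros isCont_eval3_line)
      moreover have "eval3 K (0 + s *s w) - eval3 K w = 0" if "s \<noteq> 0" for s using sc[OF that, of w] ed that by simp
      ultimately have "eval3 K (0 + 0 *s w) - eval3 K w = 0" by (rule punctured_zero_imp_zero)
      then show False using nz w(2) by simp
    qed
  qed
  from det3_complement[OF w(1) this] obtain b where b: "det3 w b c \<noteq> 0" by blast
  define M where "M = cols w b c"
  have M: "invertible M" using b by (simp add: invertible_columns M_def)
  have aff: "aff M x t = (w + x *s b) + t *s c" for x t by (simp add: aff_columns M_def)
  have "\<forall>x. \<exists>t. eval3 K (aff M x t) = 0" unfolding aff using root by blast
  from choice[OF this] obtain \<tau> where \<tau>: "\<And>x. eval3 K (aff M x (\<tau> x)) = 0" by blast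
  have "inj (\<lambda>x. affine_pt M x (\<tau> x))" by (rule injI) (use affine_pt_inj[OF M] in blast)
  then have "infinite (range (\<lambda>x. affine_pt M x (\<tau> x)))" using infinite_UNIV_char_0 finite_imageD by blast
  moreover have "range (\<lambda>x. affine_pt M x (\<tau> x)) \<subseteq> {pt v | v. v \<noteq> 0 \<and> eval3 K v = 0}"
    unfolding affine_pt_def using aff_nz[OF M] \<tau> by blast
  ultimately show False using fin finite_subset by blast
qed

lemma infinite_zero_locus_lform:
  assumes "n \<noteq> 0" shows "infinite (zero_locus (lform n))"
proof -
  have "\<exists>w. w \<noteq> 0 \<and> eval3 (lform n) w = 0"
  proof (cases "n $ 1 = 0 \<and> n $ 2 = 0")
    case True
    then show ?thesis by (intro exI[of _ "vector [1, 0, 0]"]) (auto simp: eval3_lform vector_3 vec3_eq_iff)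
  next
    case False
    then show ?thesis by (intro exI[of _ "vector [n $ 2, - n $ 1, 0]"]) (auto simp: eval3_lform vector_3 vec3_eq_iff)
  qed
  then obtain w where w: "w \<noteq> 0" "eval3 (lform n) w = 0" by blast
  have "infinite {pt v | v. v \<noteq> 0 \<and> eval3 (lform n) v = 0}"
    by (rule infinite_zeros[where e = 0 and d = 1, OF _ _ w]) (use assms in \<open>simp_all add: lform_eq_0_iff lform_scale\<close>)
  then show ?thesis by (simp add: zero_locus_def)
qed

text \<open>\<open>singular_point\<close> ranges over all reduced equations of the line pair, so an
  arbitrary one has to be treated; it is the product of both linear forms and some K. If its
  derivative vanishes at a point on the first line only, then K vanishes there. K then has
  infinitely many zeros, all on the two lines, so one of the linear forms divides K, which
  contradicts squarefreeness.\<close>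

lemma line_pair_regular_point:
  assumes n: "n1 \<noteq> 0" "n2 \<noteq> 0" "zero_locus (lform n1) \<noteq> zero_locus (lform n2)"
    and v: "v \<noteq> 0" "eval3 (lform n1) v = 0" "eval3 (lform n2) v \<noteq> 0"
  shows "regular_point (zero_locus (lform n1) \<union> zero_locus (lform n2)) (pt v)"
  unfolding regular_point_def
proof
  show "pt v \<in> zero_locus (lform n1) \<union> zero_locus (lform n2)" using v unfolding zero_locus_def by blast
  show "\<not> singular_point (zero_locus (lform n1) \<union> zero_locus (lform n2)) (pt v)"
  proof
    assume "singular_point (zero_locus (lform n1) \<union> zero_locus (lform n2)) (pt v)"
    then obtain F v' where F: "curve_equation (zero_locus (lform n1) \<union> zero_locus (lform n2)) F" and v': "v' \<noteq> 0" "pt v = pt v'" "eval3 F v' = 0"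
      and D: "(eval3 F has_derivative (\<lambda>_. 0)) (at v')" unfolding singular_point_def by blast
    obtain d where h: "homogeneous d F" and sq: "squarefree F" and zl: "zero_locus (lform n1) \<union> zero_locus (lform n2) = zero_locus F"
      using F unfolding curve_equation_def by blast
    have pr: "prime_elem (lform n1)" "prime_elem (lform n2)" using n irreducible_lform irreducible_imp_prime_elem by blast+
    have dv: "lform n dvd G" if n0: "n \<noteq> 0" and X: "infinite X" "X \<subseteq> zero_locus (lform n)"
        "\<And>w a. w \<noteq> 0 \<Longrightarrow> pt w \<in> X \<Longrightarrow> a \<noteq> 0 \<Longrightarrow> eval3 G (a *s w) = 0" for n G X
    proof (rule dvd_if_infinite_common_zeros[OF irreducible_lform[OF n0] X(1)])
      fix w :: "complex^3" and a :: complex assume w: "w \<noteq> 0" "pt w \<in> X" "a \<noteq> 0"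
      have "eval3 (lform n) w = 0" using in_zero_locus[OF homogeneous_lform w(1)] w(2) X(2) by blast
      then show "eval3 (lform n) (a *s w) = 0 \<and> eval3 G (a *s w) = 0" using X(3)[OF w] by (simp add: lform_scale)
    qed
    have Fz: "eval3 F (a *s w) = 0" if "w \<noteq> 0" "pt w \<in> zero_locus F" for a w
      using in_zero_locus[OF h that(1)] that(2) by (simp add: eval3_scale[OF h])
    have d1: "lform n1 dvd F" by (rule dv[OF n(1) infinite_zero_locus_lform[OF n(1)]]) (use Fz zl in auto)
    have d2: "lform n2 dvd F" by (rule dv[OF n(2) infinite_zero_locus_lform[OF n(2)]]) (use Fz zl in auto)
    have "coprime (lform n1) (lform n2)" by (rule prime_elem_imp_coprime[OF pr(1) lform_not_dvd[OF n]])
    then have "lform n1 * lform n2 dvd F" using d1 d2 by (intro divides_mult)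
    then obtain K where K: "F = lform n1 * lform n2 * K" by (elim dvdE)
    have Qnz: "lform n1 * lform n2 \<noteq> 0" using n by (simp add: lform_eq_0_iff)
    have Knz: "K \<noteq> 0" using sq K by auto
    note sc = cofactor_scale[OF h[unfolded K] line_pair_equation(2)[OF n] Qnz]
    obtain l where l: "l \<noteq> 0" "v' = l *s v" using pt_eq_iff[OF v(1) v'(1)] v'(2) by blast
    have lv: "eval3 (lform n1) v' = 0" "eval3 (lform n2) v' \<noteq> 0" using v l by (simp_all add: lform_scale)
    have "lform n1 \<noteq> 0" using n by (simp add: lform_eq_0_iff)
    then obtain u where u: "eval3 (lform n1) u \<noteq> 0" using eval3_eq_0_imp by blast
    \<comment> \<open>In a direction u off the first line, F (v' + t u) is t times a function whose
      value at t = 0 is a nonzero multiple of K (v'); this value is the derivative, which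
      vanishes.\<close>
    have "K \<noteq> 0 \<and> eval3 K v' = 0"
    proof
      have vh: "((\<lambda>t::complex. v' + t *s u) has_derivative (\<lambda>t. t *s u)) (at 0)"
        by (rule vhd_has_derivative) (rule vhd_line)
      have "((\<lambda>t. eval3 F (v' + t *s u)) has_derivative (\<lambda>t. 0)) (at 0)"
        using has_derivative_compose[OF vh, of "eval3 F" "\<lambda>_. 0"] D by simp
      then have "((\<lambda>t. eval3 F (v' + t *s u)) has_field_derivative 0) (at 0)" unfolding has_field_derivative_def by (rule has_derivative_eq_rhs) auto
      then have "((\<lambda>t. (eval3 F (v' + t *s u) - eval3 F (v' + 0 *s u)) / (t - 0)) \<longlongrightarrow> 0) (at 0)"
        unfolding has_field_derivative_iff .
      moreover have "\<forall>\<^sub>F t in at 0. (eval3 F (v' + t *s u) - eval3 F (v' + 0 *s u)) / (t - 0) =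
          eval3 (lform n1) u * eval3 (lform n2 * K) (v' + t *s u)"
      proof -
        have "eval3 F x = eval3 (lform n1) x * eval3 (lform n2 * K) x" for x by (simp add: K mult.assoc)
        moreover have "eval3 (lform n1) (v' + t *s u) = eval3 (lform n1) v' + t * eval3 (lform n1) u" for t
          by (simp add: eval3_lform algebra_simps)
        ultimately have "eval3 F (v' + t *s u) = t * (eval3 (lform n1) u * eval3 (lform n2 * K) (v' + t *s u))" for t
          using lv(1) by (simp only: add_0 mult.assoc)
        then show ?thesis unfolding eventually_at_filter by (intro always_eventually) (simp add: v'(3))
      qed
      ultimately have t0: "((\<lambda>t. eval3 (lform n1) u * eval3 (lform n2 * K) (v' + t *s u)) \<longlongrightarrow> 0) (at 0)" by (simp add: tendsto_cong)
      have "((\<lambda>t. eval3 (lform n1) u * eval3 (lform n2 * K) (v' + t *s u)) \<longlongrightarrow> eval3 (lform n1) u * eval3 (lform n2 * K) (v' + 0 *s u)) (at 0)"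
        using isCont_eval3_line[where K = "lform n2 * K" and x = v' and c = u and ?t0.0 = 0] unfolding isCont_def by (intro tendsto_mult tendsto_const)
      then have "eval3 (lform n1) u * eval3 (lform n2 * K) (v' + 0 *s u) = 0" using t0 tendsto_unique[OF at_neq_bot] by blast
      then show "eval3 K v' = 0" using u lv(2) by simp
    qed (rule Knz)
    then have v0: "eval3 K v' = 0" ..
    define X where "X = {pt v | v. v \<noteq> 0 \<and> eval3 K v = 0}"
    have inf: "infinite X" unfolding X_def by (rule infinite_zeros[OF Knz sc v'(1) v0])
    have "X \<subseteq> zero_locus F" unfolding X_def zero_locus_def K by auto
    then have Xeq: "X = (X \<inter> zero_locus (lform n1)) \<union> (X \<inter> zero_locus (lform n2))" unfolding zl[symmetric] by blast
    have alt: "infinite (X \<inter> zero_locus (lform n1)) \<or> infinite (X \<inter> zero_locus (lform n2))"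
    proof (rule ccontr)
      assume "\<not> ?thesis"
      then have "finite ((X \<inter> zero_locus (lform n1)) \<union> (X \<inter> zero_locus (lform n2)))" by (intro finite_UnI) auto
      then have "finite X" by (subst Xeq)
      then show False using inf by simp
    qed
    have Kz: "eval3 K (a *s w) = 0" if w: "w \<noteq> 0" "pt w \<in> X" "a \<noteq> 0" for w a
    proof -
      obtain w' where w': "pt w = pt w'" "w' \<noteq> 0" "eval3 K w' = 0" using w(2) unfolding X_def by blast
      have "pt w' = pt w" using w'(1) by simp
      then obtain l where l: "l \<noteq> 0" "w = l *s w'" unfolding pt_eq_iff[OF w'(2) w(1)] by blast
      have "(a * l) ^ 2 * eval3 K ((a * l) *s w') = 0" using sc[of "a * l" w'] w'(3) w(3) l(1) by simp
      then show ?thesis using l w(3) by (simp add: vector_smult_assoc)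
    qed
    from alt have "lform n1 dvd K \<or> lform n2 dvd K"
    proof
      assume "infinite (X \<inter> zero_locus (lform n1))"
      then have "lform n1 dvd K" by (rule dv[OF n(1)]) (use Kz in auto)
      then show ?thesis ..
    next
      assume "infinite (X \<inter> zero_locus (lform n2))"
      then have "lform n2 dvd K" by (rule dv[OF n(2)]) (use Kz in auto)
      then show ?thesis ..
    qed
    then have "lform n1 ^ 2 dvd F \<or> lform n2 ^ 2 dvd F" unfolding K by (auto simp: power2_eq_square elim!: dvdE)
    then have "is_unit (lform n1) \<or> is_unit (lform n2)" using sq unfolding squarefree_def by blast
    then show False using pr by (auto simp: prime_elem_def)
  qed
qed

text \<open>Divisibility forces d = 2, and the cofactor then takes one and the same nonzero value
  wherever F does not vanish. So F and Q have the same zeros, although their loci are assumed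
  different.\<close>

lemma not_dvd_other_conic:
  assumes Q: "homogeneous 2 Q" "Q \<noteq> 0" and F: "homogeneous d F" "d \<ge> 2" and ne: "zero_locus F \<noteq> zero_locus Q"
  shows "\<not> F dvd Q"
proof
  assume dvd: "F dvd Q"
  have Qs: "eval3 Q (l *s v) = l ^ 2 * eval3 Q v" for l v by (rule eval3_scale[OF Q(1)])
  have "d = 2" using dvd_lower_degree[OF F(1) Qs _ dvd] Q(2) F(2) by (cases "2 < d") auto
  obtain K where K: "Q = F * K" using dvd by (elim dvdE)
  have Knz: "eval3 K v = eval3 K 0" if v: "eval3 F v \<noteq> 0" for v
  proof -
    have "isCont (\<lambda>s. eval3 K (0 + s *s v) - eval3 K v) 0" by (intro continuous_intros isCont_eval3_line)
    moreover have "eval3 K (0 + s *s v) - eval3 K v = 0" if "s \<noteq> 0" for s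
    proof -
      have "s ^ 2 * eval3 F v * eval3 K (s *s v) = s ^ 2 * (eval3 F v * eval3 K v)"
        using Qs[of s v] eval3_scale[OF F(1), of s v] \<open>d = 2\<close> by (simp add: K)
      then show ?thesis using v that by simp
    qed
    ultimately have "eval3 K (0 + 0 *s v) - eval3 K v = 0" by (rule punctured_zero_imp_zero)
    then show ?thesis by simp
  qed
  have K0: "eval3 K 0 \<noteq> 0"
  proof
    assume "eval3 K 0 = 0"
    then have "eval3 Q v = 0" for v using Knz[of v] by (cases "eval3 F v = 0") (simp_all add: K)
    then show False using Q(2) eval3_eq_0_imp by blast
  qed
  have "eval3 Q v = 0 \<longleftrightarrow> eval3 F v = 0" for v using Knz[of v] K0 by (cases "eval3 F v = 0") (simp_all add: K)
  then show False using ne by (simp add: zero_locus_def)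
qed

lemma irreducible_curve_degree:
  assumes "curve_equation K F" "homogeneous d F" "irreducible F" "\<not> projective_line K"
  shows "d \<ge> 2"
proof -
  have "d \<noteq> 1" using assms unfolding projective_line_def by blast
  moreover have "d \<noteq> 0"
  proof
    assume "d = 0"
    then have "eval3 F v = eval3 F 0" for v using eval3_scale[OF assms(2), of 0 v] by simp
    then have "eval3 F v = eval3 [:[:[:eval3 F 0:]:]:] v" for v by (simp add: eval3_def)
    then have F: "F = [:[:[:eval3 F 0:]:]:]" by (rule eval3_eq_imp)
    have "eval3 F 0 \<noteq> 0"
    proof
      assume "eval3 F 0 = 0"
      then have "F = 0" using F by simp
      then show False using assms(3) by simp
    qed
    then have "is_unit [:[:[:eval3 F 0:]:]:]" by (simp add: is_unit_const_poly_iff dvd_field_iff)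
    then show False using F irreducible_not_unit[OF assms(3)] by simp
  qed
  ultimately show ?thesis by simp
qed

context symform
begin

text \<open>Off the curve there is nothing to bound, and a point of the curve outside Z is smooth
  and no inflection point. At a point of Z finitely many branches cover the curve, and the largest
  of their bounds works for all.\<close>

lemma hrel_bounded_at_point:
  assumes F: "irreducible F" "homogeneous d F" "curve_equation K F" "d \<ge> 2" and K: "K = zero_locus F"
    and Z: "Z = {pt v | v. v \<noteq> 0 \<and> B v v = 0}"
    and sing: "\<And>C. singular_point K C \<or> inflection_point K C \<Longrightarrow> C \<in> Z"
    and branch: "\<And>v b M q p g r. v \<noteq> 0 \<Longrightarrow> pt v \<in> K \<inter> Z \<Longrightarrow> local_branch K (pt v) b \<Longrightarrow> bparam v b M q p g r \<Longrightarrow>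
      \<exists>k. \<forall>\<^sub>F X in nhds (pt v). X \<in> b \<longrightarrow> X = pt v \<or> (\<exists>h. hrel F X h \<and> norm h \<le> k)"
  shows "\<exists>k. \<forall>\<^sub>F X in nhds X0. X \<in> zero_locus F \<longrightarrow> X \<in> Z \<or> (\<exists>h. hrel F X h \<and> norm h \<le> k)"
proof -
  obtain v where v: "v \<noteq> 0" "X0 = pt v" by (rule cp2_cases)
  consider "eval3 F v \<noteq> 0" | "eval3 F v = 0" "pt v \<notin> Z" | "eval3 F v = 0" "pt v \<in> Z" by blast
  then show ?thesis
  proof cases
    case 1
    have "isCont (eval3 F) v" using continuous_on_eval3[of UNIV F] by (simp add: continuous_on_eq_continuous_at)
    then have "\<forall>\<^sub>F u in nhds v. eval3 F u \<noteq> 0" using isCont_tendsto_nhds tendsto_imp_eventually_ne 1 by blast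
    moreover have "\<forall>\<^sub>F u in nhds v. u \<in> - {0}" by (rule eventually_nhds_in_open) (use v in auto)
    ultimately have "\<forall>\<^sub>F u in nhds v. pt u \<in> zero_locus F \<longrightarrow> pt u \<in> Z \<or> (\<exists>h. hrel F (pt u) h \<and> norm h \<le> 0)"
      by eventually_elim (use in_zero_locus[OF F(2)] in auto)
    then have "\<forall>\<^sub>F X in nhds (pt v). X \<in> zero_locus F \<longrightarrow> X \<in> Z \<or> (\<exists>h. hrel F X h \<and> norm h \<le> 0)"
      unfolding eventually_nhds_pt[OF v(1)] .
    then show ?thesis unfolding v(2) by blast
  next
    case 2
    have "\<exists>u. eval3 F u \<noteq> 0"
    proof (rule ccontr)
      assume "\<not> ?thesis"
      then have "F = 0" by (intro eval3_eq_0_imp) blast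
      then show False using F(1) by simp
    qed
    moreover have "\<not> singular_point K (pt v)" "\<not> inflection_point K (pt v)" using sing 2(2) by blast+
    ultimately obtain k where "\<forall>\<^sub>F X in nhds (pt v). X \<in> K \<longrightarrow> (\<exists>h. hrel F X h \<and> norm h \<le> k)"
      by (rule hrel_smooth_point[OF F(2,3) _ v(1) 2(1)])
    then have "\<forall>\<^sub>F X in nhds (pt v). X \<in> zero_locus F \<longrightarrow> X \<in> Z \<or> (\<exists>h. hrel F X h \<and> norm h \<le> k)"
      unfolding K by (rule eventually_mono) blast
    then show ?thesis unfolding v(2) by blast
  next
    case 3
    have C: "pt v \<in> K \<inter> Z" using 3 v(1) unfolding K zero_locus_def by blast
    have "\<exists>\<T>. finite \<T> \<and> (\<forall>b\<in>\<T>. local_branch (zero_locus F) (pt v) b \<and> (\<exists>M q p g r. bparam v b M q p g r)) \<and>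
      (\<forall>\<^sub>F X in nhds (pt v). X \<in> zero_locus F \<longrightarrow> (\<exists>b\<in>\<T>. X \<in> b))"
    proof (rule branch_decomposition[OF F(1,2,4) v(1) 3(1)])
      fix \<T> assume a: "finite \<T>" "\<And>b. b \<in> \<T> \<Longrightarrow> local_branch (zero_locus F) (pt v) b \<and> (\<exists>M q p g r. bparam v b M q p g r)"
        "\<forall>\<^sub>F X in nhds (pt v). X \<in> zero_locus F \<longrightarrow> (\<exists>b\<in>\<T>. X \<in> b)"
      have "\<forall>b\<in>\<T>. local_branch (zero_locus F) (pt v) b \<and> (\<exists>M q p g r. bparam v b M q p g r)" using a(2) by (rule ballI)
      then show ?thesis using a(1,3) by (intro exI[of _ \<T>]) (rule conjI, assumption, rule conjI)
    qed
    then obtain \<T> where T: "finite \<T>" "\<forall>b\<in>\<T>. local_branch (zero_locus F) (pt v) b \<and> (\<exists>M q p g r. bparam v b M q p g r)"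
      "\<forall>\<^sub>F X in nhds (pt v). X \<in> zero_locus F \<longrightarrow> (\<exists>b\<in>\<T>. X \<in> b)" by (elim exE conjE) (rule that)
    have "\<forall>b\<in>\<T>. \<exists>k. \<forall>\<^sub>F X in nhds (pt v). X \<in> b \<longrightarrow> X = pt v \<or> (\<exists>h. hrel F X h \<and> norm h \<le> k)"
    proof
      fix b assume "b \<in> \<T>"
      from bspec[OF T(2) this] obtain M q p g r where b: "local_branch K (pt v) b" "bparam v b M q p g r" unfolding K by blast
      show "\<exists>k. \<forall>\<^sub>F X in nhds (pt v). X \<in> b \<longrightarrow> X = pt v \<or> (\<exists>h. hrel F X h \<and> norm h \<le> k)" by (rule branch[OF v(1) C b])
    qed
    from bchoice[OF this] obtain k where
      k: "\<forall>b\<in>\<T>. \<forall>\<^sub>F X in nhds (pt v). X \<in> b \<longrightarrow> X = pt v \<or> (\<exists>h. hrel F X h \<and> norm h \<le> k b)" ..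
    define m where "m = Max (insert 0 (k ` \<T>))"
    have m: "k b \<le> m" if "b \<in> \<T>" for b using that T(1) by (simp add: m_def)
    from k have "\<forall>\<^sub>F X in nhds (pt v). \<forall>b\<in>\<T>. X \<in> b \<longrightarrow> X = pt v \<or> (\<exists>h. hrel F X h \<and> norm h \<le> k b)"
      using T(1) by (simp add: eventually_ball_finite_distrib)
    with T(3) have "\<forall>\<^sub>F X in nhds (pt v). X \<in> zero_locus F \<longrightarrow> X \<in> Z \<or> (\<exists>h. hrel F X h \<and> norm h \<le> m)"
    proof eventually_elim
      case (elim X)
      show ?case
      proof
        assume "X \<in> zero_locus F"
        then obtain b where b: "b \<in> \<T>" "X \<in> b" using elim by blast
        then have "X = pt v \<or> (\<exists>h. hrel F X h \<and> norm h \<le> k b)" using elim by blast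
        then show "X \<in> Z \<or> (\<exists>h. hrel F X h \<and> norm h \<le> m)" using 3(2) m[OF b(1)] order_trans by blast
      qed
    qed
    then show ?thesis unfolding v(2) by blast
  qed
qed

end

lemma bparam_tangent_line:
  assumes b: "bparam v b M q p g r"
  obtains n where "n \<noteq> 0" "\<And>u. eval3 (lform n) u = det3 v (column 2 M) u" "branch_tangent (pt v) b (zero_locus (lform n))"
    "pt (column 2 M) \<in> zero_locus (lform n)" "column 2 M \<noteq> 0"
proof -
  have M: "invertible M" "column 1 M = v" and ad: "adapted_coords (pt v) b M" using b by (auto simp: bparam_def)
  define E where "E = column 2 M"
  \<comment> \<open>The cross product of v and E: its linear form is \<open>det3 v E\<close>, the
    equation of the tangent line.\<close>
  define n where "n = (vector [v $ 2 * E $ 3 - v $ 3 * E $ 2, v $ 3 * E $ 1 - v $ 1 * E $ 3, v $ 1 * E $ 2 - v $ 2 * E $ 1] :: complex^3)"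
  have n: "eval3 (lform n) x = det3 v E x" for x by (simp add: eval3_lform n_def vector_3 det3_def algebra_simps)
  have det: "det3 v E (column 3 M) \<noteq> 0" using M by (simp add: invertible_columns E_def)
  have n0: "n \<noteq> 0"
  proof
    assume "n = 0"
    then have "eval3 (lform n) (column 3 M) = 0" by (simp add: eval3_lform)
    then show False using n det by simp
  qed
  have E0: "E \<noteq> 0" using det by (auto simp: det3_def)
  have "affine_pt M z 0 \<in> zero_locus (lform n)" for z
  proof -
    have "eval3 (lform n) (aff M z 0) = 0" unfolding n aff_columns M(2) E_def[symmetric] by (simp add: det3_def algebra_simps)
    then show ?thesis unfolding affine_pt_def zero_locus_def using aff_nz[OF M(1)] by blast
  qed
  then have "branch_tangent (pt v) b (zero_locus (lform n))"
    unfolding branch_tangent_def using projective_line_lform[OF n0] ad by blast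
  moreover have "pt E \<in> zero_locus (lform n)"
    using in_zero_locus[OF homogeneous_lform E0] by (simp add: n)
  ultimately show ?thesis using that[OF n0] n E0 by (simp add: E_def)
qed

theorem theorem1p26:
  fixes I \<gamma> :: "cp2 set"
  assumes I: "regular_conic I \<or>
      (\<exists>L1 L2. projective_line L1 \<and> projective_line L2 \<and> L1 \<noteq> L2 \<and> I = L1 \<union> L2)"
    and curve: "irreducible_curve \<gamma>" "\<not> projective_line \<gamma>" "\<gamma> \<noteq> I"
    and sing: "\<And>C. singular_point \<gamma> C \<or> inflection_point \<gamma> C \<Longrightarrow> C \<in> I"
    and case1_tangent: "\<And>C b. C \<in> \<gamma> \<inter> I \<Longrightarrow> local_branch \<gamma> C b \<Longrightarrow> regular_point I C \<Longrightarrow>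
      tangent_to C b I \<Longrightarrow> quadratic_branch C b"
    and case1_transversal: "\<And>C b. C \<in> \<gamma> \<inter> I \<Longrightarrow> local_branch \<gamma> C b \<Longrightarrow> regular_point I C \<Longrightarrow>
      transversal_to C b I \<Longrightarrow> regular_branch C b \<and> quadratic_branch C b"
    and case2: "\<And>C b L1 L2. C \<in> \<gamma> \<inter> I \<Longrightarrow> local_branch \<gamma> C b \<Longrightarrow>
      projective_line L1 \<Longrightarrow> projective_line L2 \<Longrightarrow> L1 \<noteq> L2 \<Longrightarrow> I = L1 \<union> L2 \<Longrightarrow> C \<in> L1 \<inter> L2 \<Longrightarrow>
      transversal_to C b L1 \<Longrightarrow> transversal_to C b L2 \<Longrightarrow> subquadratic_branch C b"
  shows "conic_curve \<gamma>"
proof -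
  obtain F where F: "curve_equation \<gamma> F" "irreducible F" using curve(1) unfolding irreducible_curve_def by blast
  obtain d where d: "homogeneous d F" and \<gamma>: "\<gamma> = zero_locus F" using F(1) unfolding curve_equation_def by blast
  have d2: "d \<ge> 2" by (rule irreducible_curve_degree[OF F(1) d F(2) curve(2)])
  \<comment> \<open>Both kinds of conic receive one quadratic equation. For a line pair the
    factorization into linear forms is kept, since it is needed at the node.\<close>
  have "\<exists>Q. curve_equation I Q \<and> homogeneous 2 Q \<and> (regular_conic I \<or>
      (\<exists>n1 n2. n1 \<noteq> 0 \<and> n2 \<noteq> 0 \<and> zero_locus (lform n1) \<noteq> zero_locus (lform n2) \<and>
        I = zero_locus (lform n1) \<union> zero_locus (lform n2) \<and> Q = lform n1 * lform n2))"
    using I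
  proof
    assume "regular_conic I"
    then show ?thesis unfolding regular_conic_def conic_curve_def by blast
  next
    assume "\<exists>L1 L2. projective_line L1 \<and> projective_line L2 \<and> L1 \<noteq> L2 \<and> I = L1 \<union> L2"
    then obtain L1 L2 where L: "projective_line L1" "projective_line L2" "L1 \<noteq> L2" "I = L1 \<union> L2" by blast
    obtain n1 where n1: "n1 \<noteq> 0" "L1 = zero_locus (lform n1)" by (rule projective_lineE[OF L(1)])
    obtain n2 where n2: "n2 \<noteq> 0" "L2 = zero_locus (lform n2)" by (rule projective_lineE[OF L(2)])
    note ne = L(3)[unfolded n1(2) n2(2)]
    show ?thesis unfolding L(4) n1(2) n2(2)
      by (intro exI[of _ "lform n1 * lform n2"] conjI disjI2 exI[of _ n1] exI[of _ n2] line_pair_equation n1(1) n2(1) ne refl)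
  qed
  then obtain Q where Q: "curve_equation I Q" "homogeneous 2 Q" and alt: "regular_conic I \<or>
      (\<exists>n1 n2. n1 \<noteq> 0 \<and> n2 \<noteq> 0 \<and> zero_locus (lform n1) \<noteq> zero_locus (lform n2) \<and>
        I = zero_locus (lform n1) \<union> zero_locus (lform n2) \<and> Q = lform n1 * lform n2)" by blast
  have IQ: "I = zero_locus Q" and Q0: "Q \<noteq> 0" using Q(1) by (auto simp: curve_equation_def)
  obtain B where B: "symform B" "\<And>v. B v v = eval3 Q v" by (rule quadratic_form_polarization[OF Q(2)]) blast
  interpret symform B by (rule B(1))
  have Z: "I = {pt v | v. v \<noteq> 0 \<and> B v v = 0}" unfolding IQ zero_locus_def B(2) ..
  \<comment> \<open>It follows that the curve meets the conic in finitely many points, as the global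
    argument requires.\<close>
  have ndvd: "\<not> F dvd Q" by (rule not_dvd_other_conic[OF Q(2) Q0 d d2]) (use curve(3) \<gamma> IQ in simp)
  have "finite {pt v | v. v \<noteq> 0 \<and> eval3 F v = 0 \<and> eval3 Q v = 0}"
    by (rule finite_common_zeros[OF F(2) d _ ndvd]) (rule eval3_scale[OF Q(2)])
  moreover have "zero_locus F \<inter> I \<subseteq> {pt v | v. v \<noteq> 0 \<and> eval3 F v = 0 \<and> eval3 Q v = 0}"
  proof
    fix X assume X: "X \<in> zero_locus F \<inter> I"
    then obtain v where v: "v \<noteq> 0" "X = pt v" "eval3 F v = 0" unfolding zero_locus_def by blast
    then have "eval3 Q v = 0" using X in_zero_locus[OF Q(2) v(1)] by (simp add: IQ)
    then show "X \<in> {pt v | v. v \<noteq> 0 \<and> eval3 F v = 0 \<and> eval3 Q v = 0}" using v by blast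
  qed
  ultimately have fin: "finite (zero_locus F \<inter> I)" by (rule finite_subset[rotated])
  have bdd: "\<exists>k. \<forall>\<^sub>F X in nhds (pt v). X \<in> b \<longrightarrow> X = pt v \<or> (\<exists>h. hrel F X h \<and> norm h \<le> k)"
    if v: "v \<noteq> 0" "pt v \<in> \<gamma> \<inter> I" and lb: "local_branch \<gamma> (pt v) b" and b: "bparam v b M q p g r" for v b M q p g r
  proof -
    define E where "E = column 2 M"
    have lb': "local_branch (zero_locus F) (pt v) b" using lb by (simp add: \<gamma>)
    obtain n where n: "n \<noteq> 0" "\<And>u. eval3 (lform n) u = det3 v E u" "branch_tangent (pt v) b (zero_locus (lform n))"
      "pt E \<in> zero_locus (lform n)" "E \<noteq> 0" unfolding E_def by (rule bparam_tangent_line[OF b]) blast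
    have Qv: "eval3 Q v = 0" using v(2) in_zero_locus[OF Q(2) v(1)] by (simp add: IQ)
    have Bv: "B v v = 0" by (simp add: B(2) Qv)
    note der = form_derivative[OF Q(2) B(2), of v]
    show ?thesis
    proof (cases "regular_point I (pt v)")
      case True
      have nz: "(\<lambda>u. 2 * B v u) \<noteq> (\<lambda>_. 0)"
      proof
        assume "(\<lambda>u. 2 * B v u) = (\<lambda>_. 0)"
        then have "singular_point I (pt v)" unfolding singular_point_def using Q(1) v(1) Qv der by auto
        then show False using True by (simp add: regular_point_def)
      qed
      \<comment> \<open>The derivative of Q at v is 2 B v, so tangency of the branch to the conic
        amounts to B v E = 0, the condition on which the order count rests.\<close>
      define L where "L = {pt u | u. u \<noteq> 0 \<and> 2 * B v u = 0}"
      have ct: "curve_tangent I (pt v) L" unfolding curve_tangent_def L_def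
        by (intro exI[of _ Q] exI[of _ v] exI[of _ "\<lambda>u. 2 * B v u"] conjI Q(1) v(1) refl Qv der nz)
      show ?thesis
      proof (cases "L = zero_locus (lform n)")
        case True
        then have "tangent_to (pt v) b I" unfolding tangent_to_def using ct n(3) by blast
        then have "quadratic_branch (pt v) b" by (rule case1_tangent[OF v(2) lb \<open>regular_point I (pt v)\<close>])
        then obtain q' where e: "branch_exponents (pt v) b q' (2 * q')" unfolding quadratic_branch_def by blast
        obtain u where u: "u \<noteq> 0" "B v u = 0" "pt E = pt u" using n(4) unfolding True[symmetric] L_def by auto
        have "\<exists>l. E = l *s u" using pt_eq_iff[OF u(1) n(5)] u(3) by metis
        then have "B v (column 2 M) = 0" using u(2) unfolding E_def by (auto simp: B_scale')
        then show ?thesis by (intro subquadratic_bounded[OF d lb' b Bv _ e]) auto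
      next
        case False
        then have "transversal_to (pt v) b I" unfolding transversal_to_def using ct n(3) by blast
        then have "regular_branch (pt v) b \<and> quadratic_branch (pt v) b"
          by (rule case1_transversal[OF v(2) lb \<open>regular_point I (pt v)\<close>])
        then show ?thesis by (intro regular_quadratic_bounded[OF d lb']) auto
      qed
    next
      case False
      \<comment> \<open>A conic with a point that is not regular must be a line pair, and the point
        lies on both lines, since a point on only one of them is regular by
        \<open>line_pair_regular_point\<close>.\<close>
      have "\<not> regular_conic I" using False v(2) unfolding regular_conic_def by blast
      then obtain n1 n2 where l: "n1 \<noteq> 0" "n2 \<noteq> 0" "zero_locus (lform n1) \<noteq> zero_locus (lform n2)"
        "I = zero_locus (lform n1) \<union> zero_locus (lform n2)" "Q = lform n1 * lform n2" using alt by blast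
      have prod: "eval3 (lform n1) v * eval3 (lform n2) v = 0" using Qv by (simp add: l(5))
      have l1: "eval3 (lform n1) v = 0"
      proof (rule ccontr)
        assume nz: "eval3 (lform n1) v \<noteq> 0"
        then have "eval3 (lform n2) v = 0" using prod by simp
        then have "regular_point (zero_locus (lform n2) \<union> zero_locus (lform n1)) (pt v)"
          by (intro line_pair_regular_point l(1,2) l(3)[symmetric] v(1) nz)
        then show False using False by (simp add: l(4) Un_commute)
      qed
      have l2: "eval3 (lform n2) v = 0"
      proof (rule ccontr)
        assume nz: "eval3 (lform n2) v \<noteq> 0"
        have "regular_point I (pt v)" unfolding l(4) by (rule line_pair_regular_point[OF l(1-3) v(1) l1 nz])
        then show False using False by simp
      qed
      \<comment> \<open>Both linear forms vanish at v, so Q (v + u) = Q (u): the node lies in the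
        radical of B.\<close>
      have Bz: "B v u = 0" for u
      proof -
        have "eval3 Q (v + u) = B v v + 2 * B v u + B u u"
          unfolding B(2)[symmetric] by (simp add: B_add B_add' B_sym[of u v])
        moreover have "eval3 (lform m) (v + u) = eval3 (lform m) v + eval3 (lform m) u" for m by (simp add: eval3_lform algebra_simps)
        then have "eval3 Q (v + u) = eval3 Q u" by (simp add: l(5) l1 l2)
        ultimately show ?thesis using Bv by (simp add: B(2))
      qed
      \<comment> \<open>If the tangent of the branch is one of the lines, then Q (E) = 0 and the
        order count succeeds for all exponents. Otherwise the branch is transversal to both lines
        and the subquadratic hypothesis applies.\<close>
      show ?thesis
      proof (cases "eval3 (lform n1) E = 0 \<or> eval3 (lform n2) E = 0")
        case True
        then have "B (column 2 M) (column 2 M) = 0" unfolding B(2) E_def[symmetric] l(5) by auto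
        then show ?thesis by (rule axis_bounded[OF d lb' b Bz])
      next
        case False
        have tr: "transversal_to (pt v) b (zero_locus (lform m))"
          if m: "m \<noteq> 0" "eval3 (lform m) v = 0" "eval3 (lform m) E \<noteq> 0" for m
        proof -
          have "pt E \<notin> zero_locus (lform m)" using in_zero_locus[OF homogeneous_lform n(5)] m(3) by simp
          then have "zero_locus (lform m) \<noteq> zero_locus (lform n)" using n(4) by blast
          then show ?thesis unfolding transversal_to_def using curve_tangent_lform[OF m(1) v(1) m(2)] n(3) by blast
        qed
        have "pt v \<in> zero_locus (lform n1) \<inter> zero_locus (lform n2)" unfolding zero_locus_def using v(1) l1 l2 by blast
        then have "subquadratic_branch (pt v) b"
          using False by (intro case2[OF v(2) lb projective_line_lform[OF l(1)] projective_line_lform[OF l(2)] l(3,4)] tr l(1,2) l1 l2) auto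
        then obtain q' p' where e: "branch_exponents (pt v) b q' p'" "p' \<le> 2 * q'" unfolding subquadratic_branch_def by blast
        then show ?thesis by (intro subquadratic_bounded[OF d lb' b Bv Bz e]) (simp add: Bz)
      qed
    qed
  qed
  have "d \<le> 2"
  proof (rule degree_2_if_hval_bounded[OF F(2) d _ _ Z fin])
    show "\<exists>k. \<forall>\<^sub>F X in nhds X0. X \<in> zero_locus F \<longrightarrow> X \<in> I \<or> (\<exists>h. hrel F X h \<and> norm h \<le> k)" for X0
      by (rule hrel_bounded_at_point[OF F(2) d F(1) d2 \<gamma> Z sing bdd])
  qed (use d2 in simp)
  then have "d = 2" using d2 by simp
  then show ?thesis unfolding conic_curve_def using F(1) d by blast
qed

end
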